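(* Let $G=\mathbb{Z}/r_1\mathbb{Z}\times\dots\times\mathbb{Z}/r_n\mathbb{Z}$ be a (nontrivial, finite) abelian group with $r_j\mid r_{j+1}$, and let $q$ be a prime power with $q\equiv 1 \pmod{\exp(G)}$. Let $1=s_0<s_1<\dots<s_\eta=r_n$ be the divisors of $r_n=\exp(G)$. Let $\vec k=(k_1,\dots,k_n)\in\mathbb Z^n$, let $0\le\ell\le q$, and let $E=(\epsilon_{i,j})$ be an $\ell\times n$ matrix with $\epsilon_{i,j}\in\mu_{r_j}$. Then there are quasi-polynomials $P_{j;\vec k,E}$, $1\le j\le\eta$, with $P_{j;\vec k,E}$ of degree at most $\phi_G(s_j)-1$, such that the following holds. If $g$ is such that there exist non-negative integers $(d(\vec\alpha))_{\vec\alpha\in\mathcal R}$ with $$2g+2|G|-2=\sum_{\vec\alpha\in\mathcal R}\Big(|G|-\frac{|G|}{e(\vec\alpha)}\Big)d(\vec\alpha)+|G|-\frac{|G|}{e(\vec k)}\quad\text{and}\quad \sum_{\vec\alpha\in\mathcal R}\alpha_jd(\vec\alpha)\equiv k_j\pmod{r_j},\ j=1,\dots,n,$$ then for every $\epsilon>0$, as $g\to\infty$ through such values, $$|\mathcal H_{G,g}(\vec k,E)|=\sum_{j=1}^\eta P_{j;\vec k,E}(2g)\,q^{\frac{2g+2|G|-2}{|G|-|G|/s_j}}+O\Big(q^{\frac{(1+\epsilon)g}{|G|-|G|/s_1}}\Big).$$ If no such $(d(\vec\alpha))$ exists, then $|\mathcal H_{G,g}(\vec k,E)|=0$.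
   Context: Let $K=\mathbb F_q(X)$. $\phi_G(s)$ is the number of elements of $G$ of order $s$. $\mu_r$ is the group of complex $r$-th roots of unity; $\chi_{r_j}:\mathbb F_q\to\mu_{r_j}\cup\{0\}$ is a fixed multiplicative character of order $r_j$ (with $\chi_{r_j}(0)=0$). $x_1,\dots,x_q$ is a fixed ordering of the elements of $\mathbb F_q$. $\mathcal R=\{0,\dots,r_1-1\}\times\dots\times\{0,\dots,r_n-1\}\setminus\{(0,\dots,0)\}$, with elements $\vec\alpha=(\alpha_1,\dots,\alpha_n)$. For an integer vector $\vec v$, $e(\vec v)=\operatorname{lcm}_{j}\big(r_j/\gcd(r_j,v_j)\big)$. Curves: $C$ is a smooth projective geometrically connected curve over $\mathbb F_q$ with function field $K(C)\supset K$ finite over $K$, and $g(C)$ is its genus. "$\mathrm{Gal}(C)=G$" means that $K(C)/K$ is Galois and equipped with an identification $\mathrm{Gal}(K(C)/K)\cong G$; extensions are considered up to $K$-isomorphism compatible with the identification. Equivalently (Kummer theory, with a fixed primitive $r_n$-th root of unity $\zeta\in\mathbb F_q$), such a $C$ is given by nonzero polynomials $F_1,\dots,F_n\in\mathbb F_q[X]$, $F_j$ being $r_j$-th power free and determined up to multiplication by $(\mathbb F_q^* )^{r_j}$, with $K(C)=K(\sqrt[r_1]{F_1},\dots,\sqrt[r_n]{F_n})$, where $(\sigma_1,\dots,\sigma_n)\in G$ acts by $\sqrt[r_j]{F_j}\mapsto \zeta^{\sigma_j r_n/r_j}\sqrt[r_j]{F_j}$. Different Kummer data $(F_j)$ count as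 different curves. $\mathcal H_{G,g}=\{C:\mathrm{Gal}(C)=G,\ g(C)=g\}$ and $$\mathcal H_{G,g}(\vec k,E)=\{C\in\mathcal H_{G,g}:\deg F_j\equiv k_j\ (\mathrm{mod}\ r_j),\ \chi_{r_j}(F_j(x_i))=\epsilon_{i,j},\ 1\le i\le\ell,\ 1\le j\le n\}.$$ A quasi-polynomial is a function $p(x)=c_m(x)x^m+\dots+c_0(x)$ where each $c_i$ is a periodic function with integer period; it has degree $m$ if $c_m$ is not identically zero. *)

theory Defs
  imports
    "HOL-Algebra.Algebra"
    "HOL-Algebra.Algebraic_Closure_Type"
    "HOL-Computational_Algebra.Computational_Algebra"
    "HOL-Number_Theory.Number_Theory"
    "HOL-Library.Landau_Symbols"
    "HOL-Library.Cardinality"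
    Complex_Main
begin

section \<open>The group, characters and quasi-polynomials\<close>

text \<open>Elements are functions \<open>\<sigma>\<close> in \<open>PiE {1..n} (\<lambda>j. {0..<r j})\<close>, provided all \<open>r j > 0\<close>.\<close>

definition abelian_grp :: "nat \<Rightarrow> (nat \<Rightarrow> nat) \<Rightarrow> (nat \<Rightarrow> int) monoid" where
  "abelian_grp n r = product_group {1..n} (\<lambda>j. integer_mod_group (r j))"

definition num_of_order :: "('b, 'c) monoid_scheme \<Rightarrow> nat \<Rightarrow> nat" where
  "num_of_order G s = card {x \<in> carrier G. group.ord G x = s}"

definition nonzero_residues :: "nat \<Rightarrow> (nat \<Rightarrow> nat) \<Rightarrow> (nat \<Rightarrow> int) set" where
  "nonzero_residues n r = (\<Pi>\<^sub>E j\<in>{1..n}. {0..<int (r j)}) - {\<lambda>j\<in>{1..n}. 0}"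

definition ram_index :: "nat \<Rightarrow> (nat \<Rightarrow> nat) \<Rightarrow> (nat \<Rightarrow> int) \<Rightarrow> int" where
  "ram_index n r v = Lcm ((\<lambda>j. int (r j) div gcd (int (r j)) (v j)) ` {1..n})"

definition mult_character_of_order :: "nat \<Rightarrow> ('a :: field \<Rightarrow> complex) \<Rightarrow> bool" where
  "mult_character_of_order m \<chi> \<longleftrightarrow>
     \<chi> 0 = 0 \<and> \<chi> 1 = 1 \<and> (\<forall>a b. \<chi> (a * b) = \<chi> a * \<chi> b) \<and>
     m > 0 \<and> (\<forall>a. a \<noteq> 0 \<longrightarrow> \<chi> a ^ m = 1) \<and>
     (\<forall>i. 0 < i \<and> i < m \<longrightarrow> (\<exists>a. a \<noteq> 0 \<and> \<chi> a ^ i \<noteq> 1))"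

definition primitive_root_of_unity :: "nat \<Rightarrow> 'a :: field \<Rightarrow> bool" where
  "primitive_root_of_unity m z \<longleftrightarrow>
     m > 0 \<and> z ^ m = 1 \<and> (\<forall>i. 0 < i \<and> i < m \<longrightarrow> z ^ i \<noteq> 1)"

text \<open>The zero quasi-polynomial has degree at most \<open>m\<close> for every \<open>m\<close>.\<close>

definition quasi_polynomial_le :: "nat \<Rightarrow> (int \<Rightarrow> real) \<Rightarrow> bool" where
  "quasi_polynomial_le m p \<longleftrightarrow>
     (\<exists>c :: nat \<Rightarrow> int \<Rightarrow> real.
        (\<forall>i\<le>m. \<exists>T>0. \<forall>x. c i (x + T) = c i x) \<and>
        (\<forall>x. p x = (\<Sum>i\<le>m. c i x * of_int x ^ i)))"


section \<open>Function fields over \<open>K = F\<^sub>q(X)\<close>\<close>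

text \<open>
  All finite extensions of \<open>K\<close> are realised inside one fixed algebraic closure of \<open>K\<close>;
  the finite field is the type \<^typ>\<open>'a\<close>.
\<close>

type_synonym 'a Kbar = "'a poly fract alg_closure"

definition poly_emb :: "'a :: {field,finite} poly \<Rightarrow> 'a Kbar" where
  "poly_emb p = to_ac (to_fract p)"

definition const_emb :: "'a :: {field,finite} \<Rightarrow> 'a Kbar" where
  "const_emb c = poly_emb [:c:]"

definition X_elem :: "'a :: {field,finite} Kbar" where
  "X_elem = poly_emb [:0, 1:]"

definition intermediate_field :: "'a :: {field,finite} Kbar set \<Rightarrow> bool" where
  "intermediate_field L \<longleftrightarrow> subfield L ring_of_type_algebra \<and> range to_ac \<subseteq> L"

definition finite_over_K :: "'a :: {field,finite} Kbar set \<Rightarrow> bool" where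
  "finite_over_K L \<longleftrightarrow>
     (\<exists>B. finite B \<and> L = module.span (\<lambda>(c :: 'a poly fract) v. to_ac c * v) B)"

definition Gal :: "'a :: {field,finite} Kbar set \<Rightarrow> ('a Kbar \<Rightarrow> 'a Kbar) monoid" where
  "Gal L = BijGroup L \<lparr>carrier :=
     {\<sigma> \<in> Bij L. (\<forall>x\<in>L. \<forall>y\<in>L. \<sigma> (x + y) = \<sigma> x + \<sigma> y \<and> \<sigma> (x * y) = \<sigma> x * \<sigma> y) \<and>
                 (\<forall>c. \<sigma> (to_ac c) = to_ac c)}\<rparr>"

definition galois_over_K :: "'a :: {field,finite} Kbar set \<Rightarrow> bool" where
  "galois_over_K L \<longleftrightarrow>
     intermediate_field L \<and> finite_over_K L \<and>
     {x \<in> L. \<forall>\<sigma> \<in> carrier (Gal L). \<sigma> x = x} = range to_ac"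

text \<open>
  \<open>F\<^sub>q\<close> is algebraically closed in \<open>L\<close>. For the function field \<open>L\<close> of a smooth projective curve
  over the perfect field \<open>F\<^sub>q\<close> this says that the curve is geometrically connected.
\<close>

definition geom_connected :: "'a :: {field,finite} Kbar set \<Rightarrow> bool" where
  "geom_connected L \<longleftrightarrow>
     (\<forall>y\<in>L. \<forall>p :: 'a poly. p \<noteq> 0 \<and> poly (map_poly const_emb p) y = 0 \<longrightarrow> y \<in> range const_emb)"

definition integral_closure_in :: "'a :: {field,finite} Kbar set \<Rightarrow> 'a Kbar set \<Rightarrow> 'a Kbar set" where
  "integral_closure_in A L =
     {y \<in> L. \<exists>p. lead_coeff p = 1 \<and> (\<forall>i. coeff p i \<in> A) \<and> poly p y = 0}"

text \<open>
  The smooth projective curve \<open>C\<close> with function field \<open>L\<close> is the normalization of \<open>P\<^sup>1\<close> in \<open>L\<close>. It is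
  covered by the affine open sets \<open>U\<^sub>0\<close> and \<open>U\<^sub>1\<close> lying over \<open>X \<noteq> \<infinity>\<close> and \<open>X \<noteq> 0\<close>; the coordinate rings
  of \<open>U\<^sub>0\<close>, \<open>U\<^sub>1\<close>, \<open>U\<^sub>0 \<inter> U\<^sub>1\<close> are the integral closures in \<open>L\<close> of \<open>F\<^sub>q[X]\<close>, \<open>F\<^sub>q[1/X]\<close>, \<open>F\<^sub>q[X,1/X]\<close>.
\<close>

definition ring_U0 :: "'a :: {field,finite} Kbar set \<Rightarrow> 'a Kbar set" where
  "ring_U0 L = integral_closure_in (range poly_emb) L"

definition ring_U1 :: "'a :: {field,finite} Kbar set \<Rightarrow> 'a Kbar set" where
  "ring_U1 L =
     integral_closure_in (range (\<lambda>p :: 'a poly. poly (map_poly const_emb p) (inverse X_elem))) L"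

definition ring_U01 :: "'a :: {field,finite} Kbar set \<Rightarrow> 'a Kbar set" where
  "ring_U01 L = integral_closure_in {poly_emb p / X_elem ^ m | p m. True} L"

text \<open>For \<open>F\<^sub>q\<close>-subspaces \<open>W \<subseteq> V\<close>: the quotient \<open>V / W\<close> has dimension \<open>d\<close> (and a basis represented by \<open>B\<close>).\<close>

definition has_quotient_dim ::
    "'a :: {field,finite} Kbar set \<Rightarrow> 'a Kbar set \<Rightarrow> nat \<Rightarrow> bool" where
  "has_quotient_dim V W d \<longleftrightarrow>
     (\<exists>B. finite B \<and> card B = d \<and> B \<subseteq> V \<and>
          V = module.span (\<lambda>(c :: 'a) v. const_emb c * v) (B \<union> W) \<and>
          (\<forall>c :: 'a Kbar \<Rightarrow> 'a. (\<Sum>b\<in>B. const_emb (c b) * b) \<in> W \<longrightarrow> (\<forall>b\<in>B. c b = 0)))"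

text \<open>
  The genus of a smooth projective geometrically connected curve is the dimension of \<open>H\<^sup>1(C, O\<^sub>C)\<close>,
  here the first cohomology of the Cech complex of the affine cover \<open>{U\<^sub>0, U\<^sub>1}\<close>, that is,
  \<open>O(U\<^sub>0 \<inter> U\<^sub>1) / (O(U\<^sub>0) + O(U\<^sub>1))\<close>.
\<close>

definition has_genus :: "'a :: {field,finite} Kbar set \<Rightarrow> nat \<Rightarrow> bool" where
  "has_genus L g \<longleftrightarrow>
     has_quotient_dim (ring_U01 L) {a + b | a b. a \<in> ring_U0 L \<and> b \<in> ring_U1 L} g"


section \<open>The families of curves\<close>

text \<open>
  A curve with Galois group identified with the abelian group \<open>G\<close> is a pair \<open>(L, \<phi>)\<close>, where \<open>L\<close> is
  the function field and \<open>\<phi>\<close> is an isomorphism from \<open>G\<close> to \<open>Gal(L/K)\<close>. Each class of pairs up to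
  \<open>K\<close>-isomorphism compatible with the identification contains exactly one such pair: a Galois
  extension has only one copy in the algebraic closure, and the \<open>K\<close>-automorphisms of \<open>L\<close> act
  on the identifications by conjugation, hence trivially, since \<open>G\<close> is abelian.
\<close>

type_synonym 'a Gcurve = "'a Kbar set \<times> ((nat \<Rightarrow> int) \<Rightarrow> 'a Kbar \<Rightarrow> 'a Kbar)"

definition curves_Gg :: "nat \<Rightarrow> (nat \<Rightarrow> nat) \<Rightarrow> nat \<Rightarrow> ('a :: {field,finite}) Gcurve set" where
  "curves_Gg n r g =
     {(L, \<phi>). galois_over_K L \<and> geom_connected L \<and>
              \<phi> \<in> iso (abelian_grp n r) (Gal L) \<and> \<phi> \<in> extensional (carrier (abelian_grp n r)) \<and>
              has_genus L g}"

definition power_free :: "nat \<Rightarrow> 'a :: field poly \<Rightarrow> bool" where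
  "power_free m F \<longleftrightarrow> F \<noteq> 0 \<and> (\<forall>p. p ^ m dvd F \<longrightarrow> is_unit p)"

definition kummer_data ::
    "nat \<Rightarrow> (nat \<Rightarrow> nat) \<Rightarrow> 'a \<Rightarrow> ('a :: {field,finite}) Gcurve \<Rightarrow> (nat \<Rightarrow> 'a poly) \<Rightarrow> bool" where
  "kummer_data n r \<zeta> C F \<longleftrightarrow>
     (\<forall>j\<in>{1..n}. power_free (r j) (F j)) \<and>
     (\<exists>y. (\<forall>j\<in>{1..n}. y j ^ r j = poly_emb (F j)) \<and>
          fst C = intermediate_field hull (y ` {1..n}) \<and>
          (\<forall>\<sigma> \<in> carrier (abelian_grp n r). \<forall>j\<in>{1..n}.
              snd C \<sigma> (y j) = const_emb \<zeta> ^ (nat (\<sigma> j) * (r n div r j)) * y j))"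

definition curves_GgkE ::
    "nat \<Rightarrow> (nat \<Rightarrow> nat) \<Rightarrow> 'a \<Rightarrow> (nat \<Rightarrow> 'a \<Rightarrow> complex) \<Rightarrow> (nat \<Rightarrow> 'a) \<Rightarrow> (nat \<Rightarrow> int) \<Rightarrow> nat \<Rightarrow>
       (nat \<Rightarrow> nat \<Rightarrow> complex) \<Rightarrow> nat \<Rightarrow> ('a :: {field,finite}) Gcurve set" where
  "curves_GgkE n r \<zeta> \<chi> x k l E g =
     {C \<in> curves_Gg n r g. \<exists>F. kummer_data n r \<zeta> C F \<and>
        (\<forall>j\<in>{1..n}. [int (Polynomial.degree (F j)) = k j] (mod int (r j))) \<and>
        (\<forall>i\<in>{1..l}. \<forall>j\<in>{1..n}. \<chi> (r j) (poly (F j) (x i)) = E i j)}"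

definition admissible_genus :: "nat \<Rightarrow> (nat \<Rightarrow> nat) \<Rightarrow> (nat \<Rightarrow> int) \<Rightarrow> nat \<Rightarrow> bool" where
  "admissible_genus n r k g \<longleftrightarrow>
     (let N = real (Coset.order (abelian_grp n r)) in
      \<exists>d :: (nat \<Rightarrow> int) \<Rightarrow> nat.
        2 * real g + 2 * N - 2 =
          (\<Sum>\<alpha>\<in>nonzero_residues n r. (N - N / of_int (ram_index n r \<alpha>)) * real (d \<alpha>))
            + N - N / of_int (ram_index n r k) \<and>
        (\<forall>j\<in>{1..n}. [(\<Sum>\<alpha>\<in>nonzero_residues n r. \<alpha> j * int (d \<alpha>)) = k j] (mod int (r j))))"

end

theory Submission
  imports Defs
begin

text \<open>
  By Kummer theory a curve is a tuple \<open>(F\<^sub>1, \<dots>, F\<^sub>n)\<close> of power-free polynomials modulo powers of units. The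
  monomials in the \<open>r\<^sub>j\<close>-th roots of the \<open>F\<^sub>j\<close> are linearly independent over \<open>K\<close>. They diagonalise the Galois
  action and, after division by polynomials, the integral closures of \<open>F\<^sub>q[X]\<close>, \<open>F\<^sub>q[1/X]\<close> and
  \<open>F\<^sub>q[X, 1/X]\<close>, so that a basis of \<open>H\<^sup>1\<close> can be written down; this yields the Riemann-Hurwitz formula, by
  which fixing the genus means fixing a weighted sum of the degrees of the primes dividing the \<open>F\<^sub>j\<close>.

  The conditions on the degrees and values of the \<open>F\<^sub>j\<close> are combinations of multiplicative functions, so the number
  of tuples is a combination of coefficients of Euler products over the monic irreducible polynomials. Each
  is a product of zeta functions, which are rational with a single pole radius, and a power series that
  converges in a larger disc. The zeta functions of weight \<open>|G| - |G|/s\<close> are indexed by elements of order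
  \<open>s\<close>; the recurrences satisfied by the coefficients of their product give the quasi-polynomials, and the
  series converging in the larger disc gives the error term.
\<close>

section \<open>Residue vectors\<close>

text \<open>No place of \<open>L\<close> is ever considered. The Galois group acts diagonally on
  monomials whose \<open>R\<close>-th powers lie in \<open>K\<close>, so integrality in
  \<open>L\<close> is tested by valuations of \<open>K\<close>. The exponent of the error term has
  two sources. Let cm = |G| - |G|/s_1 be the least weight. After division by the local factors of
  the zeta functions, the local factor at P is 1 plus terms of order at least 2*cm*deg P, so the
  quotient converges up to radius q^(-1/(2cm)). And cm is at least |G|/2, so every weight i lies in
  [cm, 2cm) and the poles, of radius q^(-1/i), lie inside that disc. The coefficient index is 2g
  plus a constant, which turns q^(1/(2cm)) into q^(g/cm). That the Galois group is all of G is not a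
  multiplicative condition. It depends only on the set of multiplicity vectors that occur, and is
  reached by inclusion-exclusion over subsets of G. All Euler products are truncated to primes of
  degree at most the coefficient index, so that only finite products of formal power series
  occur.\<close>

definition residue_box :: "nat \<Rightarrow> (nat \<Rightarrow> nat) \<Rightarrow> (nat \<Rightarrow> int) set" where
  "residue_box n r = (\<Pi>\<^sub>E j\<in>{1..n}. {0..<int (r j)})"

definition residue_vec :: "nat \<Rightarrow> (nat \<Rightarrow> nat) \<Rightarrow> (nat \<Rightarrow> int) \<Rightarrow> nat \<Rightarrow> int" where
  "residue_vec n r v = (\<lambda>j\<in>{1..n}. v j mod int (r j))"

definition zero_vec :: "nat \<Rightarrow> nat \<Rightarrow> int" where
  "zero_vec n = (\<lambda>j\<in>{1..n}. 0)"

text \<open>Modulo \<open>R\<close> this is the perfect pairing of G with itself: for a primitive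
  \<open>R\<close>-th root of unity \<open>z\<close>, \<open>z powi pairing n r R g v\<close> is the
  value at \<open>g\<close> of the character with index \<open>v\<close>. It stays integer valued
  because the same form also gives multiplicities of primes in \<open>R\<close>-th powers of
  monomials, see \<open>pmult_mon\<close>.\<close>

definition pairing :: "nat \<Rightarrow> (nat \<Rightarrow> nat) \<Rightarrow> nat \<Rightarrow> (nat \<Rightarrow> int) \<Rightarrow> (nat \<Rightarrow> int) \<Rightarrow> int" where
  "pairing n r R v w = (\<Sum>j\<in>{1..n}. v j * w j * int (R div r j))"

lemma pairing_commute: "pairing n r R v w = pairing n r R w v"
  by (simp add: pairing_def mult.commute mult.left_commute)

lemma pairing_add_right: "pairing n r R v (\<lambda>j. w j + u j) = pairing n r R v w + pairing n r R v u"
  by (simp add: pairing_def algebra_simps sum.distrib)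

lemma pairing_add_left: "pairing n r R (\<lambda>j. w j + u j) v = pairing n r R w v + pairing n r R u v"
  by (simp add: pairing_def algebra_simps sum.distrib)

lemma pairing_uminus_right: "pairing n r R v (\<lambda>j. - w j) = - pairing n r R v w"
  by (simp add: pairing_def sum_negf)

lemma pairing_cong:
  "(\<And>j. j \<in> {1..n} \<Longrightarrow> v j = v' j) \<Longrightarrow> (\<And>j. j \<in> {1..n} \<Longrightarrow> w j = w' j) \<Longrightarrow>
   pairing n r R v w = pairing n r R v' w'"
  by (simp add: pairing_def)

lemma pairing_zero_vec [simp]: "pairing n r R (zero_vec n) v = 0" "pairing n r R v (zero_vec n) = 0"
  by (simp_all add: pairing_def zero_vec_def)

lemma powi_prim_root_eq_iff:
  fixes z :: "'b :: field"
  assumes "primitive_root_of_unity m z"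
  shows "z powi a = z powi b \<longleftrightarrow> [a = b] (mod int m)"
proof -
  have z: "z ^ m = 1" "m > 0" "\<And>i. 0 < i \<Longrightarrow> i < m \<Longrightarrow> z ^ i \<noteq> 1"
    using assms by (auto simp: primitive_root_of_unity_def)
  have [simp]: "z \<noteq> 0" using z by (metis power_0_left zero_neq_one not_gr0)
  have 1: "z powi c = z powi (c mod int m)" for c
  proof -
    have "z powi c = z powi (int m * (c div int m) + c mod int m)" by simp
    also have "\<dots> = z powi (int m * (c div int m)) * z powi (c mod int m)"
      by (rule power_int_add) simp
    also have "z powi (int m * (c div int m)) = 1"
      by (simp add: power_int_mult z)
    finally show ?thesis by simp
  qed
  have 2: "z powi c = 1 \<longleftrightarrow> int m dvd c" for c
  proof
    assume "z powi c = 1"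
    then have "z powi (c mod int m) = 1" using 1 by simp
    then have "z ^ nat (c mod int m) = 1" using z(2) by (simp add: power_int_def)
    moreover have "nat (c mod int m) < m" using z(2) by (simp add: nat_less_iff)
    ultimately have "nat (c mod int m) = 0" using z(3) by (meson not_gr0)
    then have "c mod int m = 0" using z(2)
      by (metis nat_eq_iff2 of_nat_0 pos_mod_sign of_nat_0_less_iff nat_0_iff order_antisym)
    then show "int m dvd c" by auto
  next
    assume "int m dvd c" then show "z powi c = 1" using 1[of c] by (simp add: mod_eq_0_iff_dvd)
  qed
  have "z powi a = z powi b \<longleftrightarrow> z powi (a - b) = 1"
    by (simp add: power_int_diff)
  then show ?thesis by (simp add: 2 cong_iff_dvd_diff)
qed

lemma powi_prim_root_eq_1_iff:
  fixes z :: "'b :: field"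
  assumes "primitive_root_of_unity m z"
  shows "z powi a = 1 \<longleftrightarrow> int m dvd a"
  using powi_prim_root_eq_iff[OF assms, of a 0] by (simp add: cong_0_iff)

lemma prim_root_nonzero: "primitive_root_of_unity m (z :: 'b :: field) \<Longrightarrow> z \<noteq> 0"
  by (metis primitive_root_of_unity_def power_0_left zero_neq_one not_gr0)

locale residue_system =
  fixes n :: nat and r :: "nat \<Rightarrow> nat" and R :: nat
  assumes r_pos: "\<And>j. j \<in> {1..n} \<Longrightarrow> r j > 0"
    and r_dvd: "\<And>j. j \<in> {1..n} \<Longrightarrow> r j dvd R"
    and R_pos: "R > 0"
begin

abbreviation "B \<equiv> residue_box n r"
abbreviation "pr \<equiv> pairing n r R"
abbreviation "red \<equiv> residue_vec n r"
abbreviation "z0 \<equiv> zero_vec n"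

lemma finite_B [simp]: "finite B"
  by (auto simp: residue_box_def intro!: finite_PiE)

lemma red_in_B [simp]: "red v \<in> B"
  using r_pos by (auto simp: residue_box_def residue_vec_def)

lemma z0_in_B [simp]: "z0 \<in> B"
  using r_pos by (auto simp: residue_box_def zero_vec_def)

lemma red_id: "v \<in> B \<Longrightarrow> red v = v"
  by (rule ext) (auto simp: residue_box_def residue_vec_def PiE_iff extensional_def)

lemma R_split: "j \<in> {1..n} \<Longrightarrow> int R = int (r j) * int (R div r j)"
  using r_dvd by (metis dvd_mult_div_cancel of_nat_mult)

lemma pr_cong_dvd:
  assumes "\<And>j. j \<in> {1..n} \<Longrightarrow> [w j = w' j] (mod int (r j))"
  shows "[pr v w = pr v w'] (mod int R)"
  unfolding pairing_def
proof (rule cong_sum)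
  fix j assume j: "j \<in> {1..n}"
  then obtain t where "w j = w' j + int (r j) * t"
    using assms[OF j] by (metis cong_iff_lin cong_sym mult.commute)
  then have "v j * w j * int (R div r j) = v j * w' j * int (R div r j) + int R * (v j * t)"
    by (simp add: R_split[OF j] algebra_simps)
  then show "[v j * w j * int (R div r j) = v j * w' j * int (R div r j)] (mod int R)"
    by (simp add: cong_def)
qed

lemma pr_red_right: "[pr v (red w) = pr v w] (mod int R)"
  by (rule pr_cong_dvd) (auto simp: residue_vec_def cong_def)

lemma pr_red_left: "[pr (red w) v = pr w v] (mod int R)"
  using pr_red_right[of v w] by (simp add: pairing_commute)

lemma pr_nondegenerate:
  assumes v: "v \<in> B" and d: "\<And>w. w \<in> B \<Longrightarrow> int R dvd pr w v"
  shows "v = z0"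
proof (rule ext)
  fix j show "v j = z0 j"
  proof (cases "j \<in> {1..n}")
    case True
    define e where "e = (\<lambda>i. if i = j then 1 else 0 :: int)"
    \<comment> \<open>\<open>e\<close> itself need not lie in \<open>B\<close>: it is 0 outside the
      index range, and \<open>r j\<close> may be 1.\<close>
    have "int R dvd pr (red e) v" using d by simp
    then have "int R dvd pr e v"
      using pr_red_left cong_dvd_iff by blast
    also have "pr e v = (\<Sum>i\<in>{1..n}. if i = j then v i * int (R div r i) else 0)"
      unfolding pairing_def e_def by (intro sum.cong refl) (simp only: if_distrib if_False if_True mult_1 mult_zero_left split: if_split, simp)
    also have "\<dots> = v j * int (R div r j)" using True by (simp add: sum.delta)
    finally have "int (r j) * int (R div r j) dvd v j * int (R div r j)"
      by (simp only: R_split[OF True, symmetric])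
    moreover have "R div r j \<noteq> 0" using r_dvd[OF True] R_pos by (simp add: dvd_div_eq_0_iff)
    ultimately have "int (r j) dvd v j" by simp
    moreover have "0 \<le> v j" "v j < int (r j)" using v True by (auto simp: residue_box_def)
    ultimately have "v j = 0" using zdvd_not_zless[of "v j" "int (r j)"] by linarith
    then show ?thesis using True by (simp add: zero_vec_def)
  next
    case False then show ?thesis using v by (auto simp: residue_box_def zero_vec_def)
  qed
qed

lemma red_add_bij: "bij_betw (\<lambda>v. red (\<lambda>j. v j + w j)) B B"
proof (rule bij_betw_byWitness[where f' = "\<lambda>v. red (\<lambda>j. v j - w j)"])
  show "\<forall>a\<in>B. red (\<lambda>j. red (\<lambda>j. a j + w j) j - w j) = a"
  proof
    fix a assume "a \<in> B"
    then have "red a = a" by (rule red_id)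
    moreover have "red (\<lambda>j. red (\<lambda>j. a j + w j) j - w j) = red a"
      by (rule ext) (auto simp: residue_vec_def mod_simps)
    ultimately show "red (\<lambda>j. red (\<lambda>j. a j + w j) j - w j) = a" by simp
  qed
  show "\<forall>a\<in>B. red (\<lambda>j. red (\<lambda>j. a j - w j) j + w j) = a"
  proof
    fix a assume "a \<in> B"
    then have "red a = a" by (rule red_id)
    moreover have "red (\<lambda>j. red (\<lambda>j. a j - w j) j + w j) = red a"
      by (rule ext) (auto simp: residue_vec_def mod_simps)
    ultimately show "red (\<lambda>j. red (\<lambda>j. a j - w j) j + w j) = a" by simp
  qed
qed auto

lemma red_uminus_bij: "bij_betw (\<lambda>v. red (\<lambda>j. - v j)) B B"
proof (rule bij_betw_byWitness[where f' = "\<lambda>v. red (\<lambda>j. - v j)"])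
  have "red (\<lambda>j. - red (\<lambda>j. - a j) j) = a" if "a \<in> B" for a
  proof -
    have "red (\<lambda>j. - red (\<lambda>j. - a j) j) = red a"
      by (rule ext) (auto simp: residue_vec_def mod_simps)
    with red_id[OF that] show ?thesis by simp
  qed
  then show "\<forall>a\<in>B. red (\<lambda>j. - red (\<lambda>j. - a j) j) = a" by simp
  then show "\<forall>a\<in>B. red (\<lambda>j. - red (\<lambda>j. - a j) j) = a" .
qed auto

text \<open>Orthogonality of characters: replacing \<open>g\<close> by \<open>g + h\<close> permutes
  the summands and multiplies the sum by \<open>z powi pr h u\<close>, which differs from 1 for some
  \<open>h\<close> unless the character is trivial. The field is arbitrary because \<open>K\<close>
  is needed for the projections and the complex numbers for counting.\<close>

lemma sum_powi_pr:
  fixes z :: "'b :: field"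
  assumes z: "primitive_root_of_unity R z"
  shows "(\<Sum>g\<in>B. z powi pr g u) = (if \<forall>h. int R dvd pr h u then of_nat (card B) else 0)"
proof (cases "\<forall>h. int R dvd pr h u")
  case True
  then have "z powi pr g u = 1" for g using powi_prim_root_eq_1_iff[OF z] by blast
  then show ?thesis using True by simp
next
  case False
  then obtain h where h: "\<not> int R dvd pr h u" by blast
  have "(\<Sum>g\<in>B. z powi pr g u) = (\<Sum>g\<in>B. z powi pr (red (\<lambda>j. g j + h j)) u)"
    by (rule sum.reindex_bij_betw[OF red_add_bij, symmetric])
  also have "\<dots> = (\<Sum>g\<in>B. z powi pr g u * z powi pr h u)"
  proof (rule sum.cong[OF refl])
    fix g
    have "z powi pr (red (\<lambda>j. g j + h j)) u = z powi pr (\<lambda>j. g j + h j) u"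
      using powi_prim_root_eq_iff[OF z] pr_red_left by blast
    then show "z powi pr (red (\<lambda>j. g j + h j)) u = z powi pr g u * z powi pr h u"
      using prim_root_nonzero[OF z] by (simp add: pairing_add_left power_int_add)
  qed
  also have "\<dots> = (\<Sum>g\<in>B. z powi pr g u) * z powi pr h u" by (rule sum_distrib_right[symmetric])
  finally have "(\<Sum>g\<in>B. z powi pr g u) * (1 - z powi pr h u) = 0" by (simp add: right_diff_distrib)
  moreover have "z powi pr h u \<noteq> 1" using h powi_prim_root_eq_1_iff[OF z] by blast
  ultimately show ?thesis using False by auto
qed

lemma carrier_abelian_grp: "carrier (abelian_grp n r) = B"
  unfolding abelian_grp_def residue_box_def carrier_product_group
  by (rule PiE_cong) (use r_pos in \<open>force simp: carrier_integer_mod_group\<close>)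

end

section \<open>Radical extensions\<close>

text \<open>Linear independence of the monomials is kept out of this locale: it is proved by
  induction on \<open>n\<close>, and \<open>frame_nondeg\<close> works with radicals before it is
  known.\<close>

locale radical_box = residue_system n r R for n r R +
  fixes \<zeta> :: "'b :: field" and y :: "nat \<Rightarrow> 'b alg_closure"
  assumes prim: "primitive_root_of_unity R \<zeta>"
    and R_nz: "of_nat R \<noteq> (0 :: 'b)"
    and y_nz: "\<And>j. j \<in> {1..n} \<Longrightarrow> y j \<noteq> 0"
    and y_pow: "\<And>j. j \<in> {1..n} \<Longrightarrow> y j ^ r j \<in> range to_ac"
begin

definition Y :: "(nat \<Rightarrow> int) \<Rightarrow> 'b alg_closure" where
  "Y v = (\<Prod>j\<in>{1..n}. y j powi v j)"

abbreviation ch :: "(nat \<Rightarrow> int) \<Rightarrow> (nat \<Rightarrow> int) \<Rightarrow> 'b" where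
  "ch w v \<equiv> \<zeta> powi pr w v"

definition comb :: "((nat \<Rightarrow> int) \<Rightarrow> 'b) \<Rightarrow> 'b alg_closure" where
  "comb c = (\<Sum>v\<in>B. to_ac (c v) * Y v)"

text \<open>Only a span at first. Closure under products is formal, since \<open>Y_red\<close>
  brings exponents back into \<open>B\<close> at the cost of a factor from \<open>K\<close>; closure
  under inverses is \<open>L_inverse\<close>.\<close>

definition L :: "'b alg_closure set" where "L = range comb"

lemma zeta_nz [simp]: "\<zeta> \<noteq> 0" using prim_root_nonzero[OF prim] .

lemma Y_nz [simp]: "Y v \<noteq> 0"
  using y_nz by (auto simp: Y_def)

lemma Y_add: "Y (\<lambda>j. v j + w j) = Y v * Y w"
  using y_nz by (auto simp: Y_def prod.distrib[symmetric] power_int_add intro!: prod.cong)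

lemma Y_uminus: "Y (\<lambda>j. - v j) = inverse (Y v)"
  using y_nz by (auto simp: Y_def prod_inversef[symmetric] power_int_minus o_def)

lemma Y_cong: "(\<And>j. j \<in> {1..n} \<Longrightarrow> v j = w j) \<Longrightarrow> Y v = Y w"
  by (auto simp: Y_def intro!: prod.cong)

lemma Y_z0 [simp]: "Y z0 = 1"
  by (auto simp: Y_def zero_vec_def)

lemma Y_power: "Y v ^ m = Y (\<lambda>j. int m * v j)"
proof -
  have "(y j powi v j) ^ m = y j powi (int m * v j)" for j
    by (simp add: power_int_mult mult.commute[of "int m"])
  then show ?thesis by (simp add: Y_def prod_power_distrib)
qed

lemma range_to_ac_powi: "x \<in> range to_ac \<Longrightarrow> x powi i \<in> range (to_ac :: 'b \<Rightarrow> _)"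
  by (auto simp: power_int_def simp flip: to_ac_power to_ac_inverse)

lemma Y_K:
  assumes "\<And>j. j \<in> {1..n} \<Longrightarrow> int (r j) dvd v j"
  obtains k where "k \<noteq> 0" "Y v = to_ac k"
proof -
  have "\<exists>k. y j powi v j = to_ac k" if j: "j \<in> {1..n}" for j
  proof -
    obtain t where "v j = int (r j) * t" using assms[OF j] by auto
    then have "y j powi v j = (y j ^ r j) powi t" by (simp add: power_int_mult)
    also have "\<dots> \<in> range to_ac" using y_pow[OF j] by (rule range_to_ac_powi)
    finally show ?thesis by auto
  qed
  then obtain k where "\<And>j. j \<in> {1..n} \<Longrightarrow> y j powi v j = to_ac (k j)" by metis
  then have eq: "Y v = to_ac (\<Prod>j\<in>{1..n}. k j)" by (simp add: Y_def to_ac_prod)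
  then have "(\<Prod>j\<in>{1..n}. k j) \<noteq> 0" by (metis Y_nz to_ac_eq_0_iff)
  then show ?thesis using eq that by blast
qed

lemma Y_red:
  obtains k where "k \<noteq> 0" "Y v = to_ac k * Y (red v)"
proof -
  have "int (r j) dvd v j - red v j" if "j \<in> {1..n}" for j
    using that by (simp add: residue_vec_def minus_mod_eq_mult_div)
  from Y_K[OF this] obtain k where k: "k \<noteq> 0" "Y (\<lambda>j. v j - red v j) = to_ac k" .
  have "Y v = Y (\<lambda>j. (v j - red v j) + red v j)" by simp
  also have "\<dots> = to_ac k * Y (red v)" by (simp only: Y_add k)
  finally show ?thesis using k that by blast
qed

lemma Y_pow_R:
  obtains k where "k \<noteq> 0" "Y v ^ R = to_ac k"
proof -
  have "int (r j) dvd int R * v j" if "j \<in> {1..n}" for j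
    using r_dvd[OF that] by simp
  from Y_K[OF this] show ?thesis using that by (metis Y_power)
qed

lemma comb_add: "comb c + comb d = comb (\<lambda>v. c v + d v)"
  by (simp add: comb_def sum.distrib algebra_simps)

lemma comb_diff: "comb c - comb d = comb (\<lambda>v. c v - d v)"
  by (simp add: comb_def sum_subtractf algebra_simps)

lemma comb_scale: "to_ac k * comb c = comb (\<lambda>v. k * c v)"
  by (simp add: comb_def sum_distrib_left algebra_simps)

lemma comb_in_L [simp]: "comb c \<in> L" by (simp add: L_def)

lemma comb_single:
  assumes "v \<in> B" shows "comb (\<lambda>w. if w = v then k else 0) = to_ac k * Y v"
proof -
  have "comb (\<lambda>w. if w = v then k else 0) = (\<Sum>w\<in>B. if w = v then to_ac k * Y w else 0)"
    unfolding comb_def by (rule sum.cong) auto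
  also have "\<dots> = to_ac k * Y v" using assms by simp
  finally show ?thesis .
qed

lemma mono_in_L [simp]: "to_ac k * Y v \<in> L"
proof -
  obtain k' where "Y v = to_ac k' * Y (red v)" using Y_red by metis
  then have "to_ac k * Y v = comb (\<lambda>w. if w = red v then k * k' else 0)"
    by (simp add: comb_single mult.assoc)
  then show ?thesis by simp
qed

lemma Y_in_L [simp]: "Y v \<in> L" using mono_in_L[of 1 v] by simp

lemma K_in_L [simp]: "to_ac k \<in> L" using mono_in_L[of k z0] by simp

lemma zero_in_L [simp]: "0 \<in> L" and one_in_L [simp]: "1 \<in> L"
  using K_in_L[of 0] K_in_L[of 1] by simp_all

lemma L_add: "a \<in> L \<Longrightarrow> b \<in> L \<Longrightarrow> a + b \<in> L"
  by (auto simp: L_def comb_add)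

lemma L_diff: "a \<in> L \<Longrightarrow> b \<in> L \<Longrightarrow> a - b \<in> L"
  by (auto simp: L_def comb_diff)

lemma L_sum: "(\<And>i. i \<in> I \<Longrightarrow> f i \<in> L) \<Longrightarrow> sum f I \<in> L"
  by (induction I rule: infinite_finite_induct) (auto intro: L_add)

lemma comb_mult: "comb c * comb d = (\<Sum>v\<in>B. \<Sum>w\<in>B. to_ac (c v * d w) * Y (\<lambda>j. v j + w j))"
  by (simp add: comb_def sum_product Y_add algebra_simps)

lemma L_mult: "a \<in> L \<Longrightarrow> b \<in> L \<Longrightarrow> a * b \<in> L"
  by (auto simp: L_def[symmetric] comb_mult elim!: L_def[THEN equalityD1, THEN subsetD, THEN rangeE] intro!: L_sum simp del: to_ac_mult)

lemma L_prod: "(\<And>i. i \<in> I \<Longrightarrow> f i \<in> L) \<Longrightarrow> prod f I \<in> L"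
  by (induction I rule: infinite_finite_induct) (auto intro: L_mult)

lemma L_power: "a \<in> L \<Longrightarrow> a ^ m \<in> L"
  by (induction m) (auto intro: L_mult)

end

locale radical_indep = radical_box n r R \<zeta> y
  for n r R and \<zeta> :: "'b :: field" and y +
  assumes indep: "\<And>c v. comb c = 0 \<Longrightarrow> v \<in> B \<Longrightarrow> c v = 0"
begin

lemma comb_eqD: "comb c = comb d \<Longrightarrow> v \<in> B \<Longrightarrow> c v = d v"
  using indep[of "\<lambda>v. c v - d v" v] by (simp add: comb_diff[symmetric])

text \<open>Outside \<open>B\<close> the chosen coefficients are arbitrary, so facts about
  \<open>coord\<close> are restricted to indices in \<open>B\<close>.\<close>

definition coord :: "'b alg_closure \<Rightarrow> (nat \<Rightarrow> int) \<Rightarrow> 'b" where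
  "coord z = (SOME c. comb c = z)"

lemma comb_coord: "z \<in> L \<Longrightarrow> comb (coord z) = z"
  unfolding coord_def L_def by (metis (mono_tags, lifting) rangeE someI)

lemma coord_comb: "v \<in> B \<Longrightarrow> coord (comb c) v = c v"
  by (rule comb_eqD) (auto simp: comb_coord)

lemma comb_cong: "(\<And>v. v \<in> B \<Longrightarrow> c v = d v) \<Longrightarrow> comb c = comb d"
  by (simp add: comb_def)

lemma coord_add: "a \<in> L \<Longrightarrow> b \<in> L \<Longrightarrow> v \<in> B \<Longrightarrow> coord (a + b) v = coord a v + coord b v"
  by (auto simp: L_def comb_add coord_comb)

lemma coord_scale: "a \<in> L \<Longrightarrow> v \<in> B \<Longrightarrow> coord (to_ac k * a) v = k * coord a v"
  by (auto simp: L_def comb_scale coord_comb)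

lemma coord_mono: "v \<in> B \<Longrightarrow> w \<in> B \<Longrightarrow> coord (to_ac k * Y w) v = (if v = w then k else 0)"
  by (simp only: comb_single[symmetric] coord_comb)

text \<open>The Galois group is constructed and not extracted: \<open>g\<close> scales each basis
  monomial by a character value. That every automorphism arises in this way is
  \<open>Gal_eq_aut\<close>.\<close>

definition aut :: "(nat \<Rightarrow> int) \<Rightarrow> 'b alg_closure \<Rightarrow> 'b alg_closure" where
  "aut g z = comb (\<lambda>v. ch g v * coord z v)"

lemma aut_in_L [simp]: "aut g z \<in> L" by (simp add: aut_def)

lemma aut_comb: "aut g (comb c) = comb (\<lambda>v. ch g v * c v)"
  unfolding aut_def by (rule comb_cong) (simp add: coord_comb)

lemma coord_aut: "z \<in> L \<Longrightarrow> v \<in> B \<Longrightarrow> coord (aut g z) v = ch g v * coord z v"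
  by (simp add: aut_def coord_comb)

lemma ch_cong: "[pr g v = pr g' v'] (mod int R) \<Longrightarrow> ch g v = ch g' v'"
  using powi_prim_root_eq_iff[OF prim] by blast

lemma aut_mono: "aut g (to_ac k * Y v) = to_ac (ch g v * k) * Y v"
proof -
  obtain k' where k': "Y v = to_ac k' * Y (red v)" using Y_red by metis
  have "aut g (to_ac k * Y v) = aut g (comb (\<lambda>w. if w = red v then k * k' else 0))"
    by (simp add: k' comb_single mult.assoc)
  also have "\<dots> = comb (\<lambda>w. if w = red v then ch g (red v) * (k * k') else 0)"
    unfolding aut_comb by (rule comb_cong) auto
  also have "\<dots> = to_ac (ch g (red v) * k) * Y v"
    by (subst comb_single) (auto simp: k' algebra_simps)
  also have "ch g (red v) = ch g v" by (rule ch_cong) (rule pr_red_right)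
  finally show ?thesis .
qed

lemma aut_Y: "aut g (Y v) = to_ac (ch g v) * Y v"
  using aut_mono[of g 1 v] by simp

lemma aut_K [simp]: "aut g (to_ac k) = to_ac k"
  using aut_mono[of g k z0] by simp

lemma aut_0 [simp]: "aut g 0 = 0" and aut_1 [simp]: "aut g 1 = 1"
  using aut_K[of g 0] aut_K[of g 1] by simp_all

lemma aut_add: "a \<in> L \<Longrightarrow> b \<in> L \<Longrightarrow> aut g (a + b) = aut g a + aut g b"
  by (auto simp: L_def comb_add aut_comb intro!: comb_cong) (simp add: algebra_simps)

lemma aut_sum: "(\<And>i. i \<in> I \<Longrightarrow> f i \<in> L) \<Longrightarrow> aut g (sum f I) = (\<Sum>i\<in>I. aut g (f i))"
  by (induction I rule: infinite_finite_induct) (auto simp: aut_add L_sum)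

text \<open>The sum of two exponent vectors may leave \<open>B\<close>, but \<open>aut_mono\<close>
  holds for all integer vectors: reduction changes a monomial by a factor from \<open>K\<close> and
  leaves its character alone. Additivity of the exponent then gives multiplicativity.\<close>

lemma aut_mult:
  assumes "a \<in> L" "b \<in> L" shows "aut g (a * b) = aut g a * aut g b"
proof -
  obtain c d where a: "a = comb c" and b: "b = comb d" using assms by (auto simp: L_def)
  have "aut g (a * b) = (\<Sum>v\<in>B. \<Sum>w\<in>B. aut g (to_ac (c v * d w) * Y (\<lambda>j. v j + w j)))"
    unfolding a b comb_mult by (subst aut_sum; (intro L_sum mono_in_L)?)+ (auto simp: aut_sum simp del: to_ac_mult)
  also have "\<dots> = (\<Sum>v\<in>B. \<Sum>w\<in>B. to_ac ((ch g v * c v) * (ch g w * d w)) * Y (\<lambda>j. v j + w j))"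
    by (simp only: aut_mono pairing_add_right power_int_add[OF disjI1[OF zeta_nz]]) (simp add: algebra_simps)
  also have "\<dots> = aut g a * aut g b"
    by (simp only: a b aut_comb comb_mult)
  finally show ?thesis .
qed

lemma aut_prod: "(\<And>i. i \<in> I \<Longrightarrow> f i \<in> L) \<Longrightarrow> aut g (prod f I) = (\<Prod>i\<in>I. aut g (f i))"
  by (induction I rule: infinite_finite_induct) (auto simp: aut_mult L_prod)

lemma aut_power: "a \<in> L \<Longrightarrow> aut g (a ^ m) = aut g a ^ m"
  by (induction m) (auto simp: aut_mult L_power)

lemma aut_aut: "z \<in> L \<Longrightarrow> aut g (aut h z) = aut (\<lambda>j. g j + h j) z"
  by (auto simp: L_def aut_comb pairing_add_left power_int_add intro!: comb_cong)

lemma aut_cong: "(\<And>v. [pr g v = pr h v] (mod int R)) \<Longrightarrow> aut g = aut h"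
  unfolding aut_def using ch_cong by (intro ext comb_cong) (metis)

lemma aut_red: "aut (red g) = aut g"
  by (rule aut_cong) (rule pr_red_left)

lemma aut_z0: "z \<in> L \<Longrightarrow> aut z0 z = z"
  by (auto simp: L_def aut_comb)

lemma aut_inverse: "z \<in> L \<Longrightarrow> aut (\<lambda>j. - g j) (aut g z) = z"
proof -
  assume z: "z \<in> L"
  have "aut (\<lambda>j. - g j) (aut g z) = aut (\<lambda>j. - g j + g j) z" using z by (rule aut_aut)
  also have "\<dots> = aut z0 z" by (rule fun_cong[OF aut_cong]) (simp add: pairing_def zero_vec_def)
  finally show ?thesis using aut_z0[OF z] by simp
qed

lemma aut_nz: "z \<in> L \<Longrightarrow> z \<noteq> 0 \<Longrightarrow> aut g z \<noteq> 0"
  by (metis aut_inverse aut_0)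

text \<open>A nonzero coordinate at \<open>v\<close> forces the character of \<open>v\<close> to be
  trivial, and the pairing is nondegenerate.\<close>

lemma fixed_in_K:
  assumes z: "z \<in> L" and fx: "\<And>g. g \<in> B \<Longrightarrow> aut g z = z"
  shows "z = to_ac (coord z z0)"
proof -
  have "coord z v = 0" if v: "v \<in> B" "v \<noteq> z0" for v
  proof (rule ccontr)
    assume nz: "coord z v \<noteq> 0"
    have "int R dvd pr g v" if "g \<in> B" for g
    proof -
      have "ch g v * coord z v = coord z v" using coord_aut[OF z v(1), of g] fx[OF that] by simp
      then have "ch g v = 1" using nz by simp
      then show ?thesis using powi_prim_root_eq_1_iff[OF prim] by blast
    qed
    then show False using pr_nondegenerate v by blast
  qed
  then have "comb (coord z) = comb (\<lambda>v. if v = z0 then coord z z0 else 0)"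
    by (intro comb_cong) auto
  then show ?thesis using z by (simp add: comb_single comb_coord)
qed

lemma norm_in_K:
  assumes z: "z \<in> L"
  shows "(\<Prod>g\<in>B. aut g z) \<in> range to_ac"
proof -
  have "aut h (\<Prod>g\<in>B. aut g z) = (\<Prod>g\<in>B. aut g z)" for h
  proof -
    have "aut h (\<Prod>g\<in>B. aut g z) = (\<Prod>g\<in>B. aut (red (\<lambda>j. g j + h j)) z)"
      by (simp add: aut_prod aut_aut z aut_red add.commute)
    also have "\<dots> = (\<Prod>g\<in>B. aut g z)"
      by (rule prod.reindex_bij_betw[OF red_add_bij])
    finally show ?thesis .
  qed
  then show ?thesis using fixed_in_K by (metis aut_in_L L_prod rangeI)
qed

text \<open>The inverse is the product of the other conjugates divided by the norm, which lies in
  \<open>K\<close>.\<close>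

lemma L_inverse:
  assumes z: "z \<in> L" shows "inverse z \<in> L"
proof (cases "z = 0")
  case False
  obtain k where k: "(\<Prod>g\<in>B. aut g z) = to_ac k" using norm_in_K[OF z] by auto
  have nz: "to_ac k \<noteq> 0" using aut_nz[OF z False] k by (metis finite_B prod_zero_iff)
  have "(\<Prod>g\<in>B. aut g z) = aut z0 z * (\<Prod>g\<in>B-{z0}. aut g z)"
    by (rule prod.remove) auto
  then have "z * (\<Prod>g\<in>B-{z0}. aut g z) = to_ac k" using k aut_z0[OF z] by simp
  then have "inverse z = to_ac (inverse k) * (\<Prod>g\<in>B-{z0}. aut g z)"
    using False nz by (simp add: field_simps)
  also have "\<dots> \<in> L" by (intro L_mult L_prod K_in_L aut_in_L)
  finally show ?thesis .
qed auto

lemma L_divide: "a \<in> L \<Longrightarrow> b \<in> L \<Longrightarrow> a / b \<in> L"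
  by (simp add: divide_inverse L_mult L_inverse)

end

section \<open>Linear independence of radicals\<close>

text \<open>Division with remainder by a monic polynomial, done by hand since \<open>M\<close>
  (later \<open>L\<close>) is a set inside a larger field: subtracting a multiple of
  \<open>p\<close> keeps the coefficients in \<open>M\<close>, and minimality of
  \<open>degree p\<close> among polynomials over \<open>M\<close> with root \<open>x\<close> ends
  the descent at 0.\<close>

lemma dvd_of_root_minimal:
  fixes p f :: "'k :: field poly" and M :: "'k set"
  assumes sub: "\<And>a b. a \<in> M \<Longrightarrow> b \<in> M \<Longrightarrow> a - b \<in> M" "\<And>a b. a \<in> M \<Longrightarrow> b \<in> M \<Longrightarrow> a * b \<in> M" "0 \<in> M"
    and p: "lead_coeff p = 1" "\<And>i. coeff p i \<in> M" "poly p x = 0"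
    and min: "\<And>g. g \<noteq> 0 \<Longrightarrow> (\<And>i. coeff g i \<in> M) \<Longrightarrow> poly g x = 0 \<Longrightarrow> degree p \<le> degree g"
    and f: "\<And>i. coeff f i \<in> M" "poly f x = 0"
  shows "p dvd f"
  using f
proof (induction "degree f" arbitrary: f rule: less_induct)
  case less
  show ?case
  proof (cases "f = 0")
    case False
    have le: "degree p \<le> degree f" using min[OF False] less.prems by blast
    define c where "c = lead_coeff f"
    define d where "d = degree f - degree p"
    define g where "g = f - monom c d * p"
    have p0: "p \<noteq> 0" using p(1) by auto
    have cM: "c \<in> M" using less.prems unfolding c_def by blast
    have gM: "coeff g i \<in> M" for i
      unfolding g_def coeff_diff by (auto simp: coeff_monom_mult intro!: sub less.prems p(2) cM)
    have g0: "poly g x = 0" using less.prems p(3) by (simp add: g_def)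
    have "p dvd g"
    proof (cases "g = 0")
      case False
      have deg: "degree (monom c d * p) = degree f"
        using \<open>f \<noteq> 0\<close> p0 le by (simp add: degree_mult_eq c_def d_def degree_monom_eq)
      have "degree g \<le> degree f" unfolding g_def by (intro degree_diff_le) (auto simp: deg)
      moreover have "coeff g (degree f) = 0"
        using le p(1) by (simp add: g_def coeff_monom_mult d_def c_def)
      ultimately have "degree g < degree f"
        using False by (metis leading_coeff_0_iff le_neq_implies_less)
      then show ?thesis using less.hyps gM g0 by blast
    qed auto
    then have "p dvd g + monom c d * p" by simp
    then show ?thesis by (simp add: g_def)
  qed auto
qed

text \<open>Up to sign the constant coefficient is the product of the roots, and each root is an
  admissible multiple of \<open>x\<close>. In the application \<open>P\<close> singles out the
  \<open>R\<close>-th roots of unity.\<close>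

lemma alg_closed_splits_const_coeff:
  fixes p :: "'k :: alg_closed_field poly"
  assumes "lead_coeff p = 1" and roots: "\<And>z. poly p z = 0 \<Longrightarrow> \<exists>w. P w \<and> z = w * x"
    and one: "P 1" and mult: "\<And>a b. P a \<Longrightarrow> P b \<Longrightarrow> P (a * b)"
  shows "\<exists>w. P w \<and> poly p 0 = (-1) ^ degree p * w * x ^ degree p"
  using assms(1,2)
proof (induction "degree p" arbitrary: p)
  case 0
  then have "p = 1" by (metis degree_eq_zeroE lead_coeff_pCons(2) one_pCons)
  then show ?case using one by auto
next
  case (Suc m)
  have "degree p > 0" using Suc by simp
  then obtain z where z: "poly p z = 0" using alg_closed_imp_poly_has_root by blast
  then obtain s where s: "p = [:-z, 1:] * s" by (metis dvdE poly_eq_0_iff_dvd)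
  have s0: "s \<noteq> 0" using Suc.prems s by auto
  have ds: "degree p = Suc (degree s)" unfolding s by (subst degree_mult_eq) (use s0 in auto)
  have ls: "lead_coeff s = 1" using Suc.prems(1) unfolding s lead_coeff_mult by simp
  have "\<exists>w. P w \<and> u = w * x" if "poly s u = 0" for u
    using Suc.prems(2) that s by simp
  then obtain w where w: "P w" "poly s 0 = (-1) ^ degree s * w * x ^ degree s"
    using Suc.hyps(1)[of s] Suc.hyps(2) ds ls by auto
  obtain w' where w': "P w'" "z = w' * x" using Suc.prems(2) z by blast
  have "poly p 0 = - z * poly s 0" by (simp add: s)
  also have "\<dots> = (-1) ^ degree p * (w' * w) * x ^ degree p"
    by (simp add: w w' ds)
  finally show ?case using w w' mult by blast
qed

context radical_indep
begin

text \<open>The powers of \<open>\<zeta>\<close> with exponents below \<open>R\<close> are already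
  \<open>R\<close> distinct roots of the polynomial \<open>T ^ R - 1\<close>, which has no
  more.\<close>

lemma root_of_unity_powi:
  fixes w :: "'b alg_closure"
  assumes "w ^ R = 1" shows "\<exists>i. w = to_ac (\<zeta> powi i)"
proof -
  let ?S = "(\<lambda>i. to_ac (\<zeta> ^ i)) ` {..<R}"
  have inj: "inj_on (\<lambda>i. to_ac (\<zeta> ^ i)) {..<R}"
  proof (rule inj_onI)
    fix i j assume ij: "i \<in> {..<R}" "j \<in> {..<R}" "to_ac (\<zeta> ^ i) = to_ac (\<zeta> ^ j)"
    then have "\<zeta> powi int i = \<zeta> powi int j" by (simp only: to_ac_eq_iff power_int_of_nat)
    then have "[int i = int j] (mod int R)" using powi_prim_root_eq_iff[OF prim] by blast
    then show "i = j" using ij by (simp add: cong_int_iff cong_def)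
  qed
  define p where "p = monom 1 R - (1 :: 'b alg_closure poly)"
  have p0: "p \<noteq> 0"
  proof
    assume "p = 0"
    then have "coeff p R = 0" by simp
    then show False using R_pos by (simp add: p_def)
  qed
  have dp: "degree p \<le> R" unfolding p_def by (intro degree_diff_le) (auto simp: degree_monom_eq)
  have fin: "finite {z. poly p z = 0}" using p0 poly_roots_finite by blast
  have "?S \<subseteq> {z. poly p z = 0}"
  proof (clarsimp simp: p_def poly_monom)
    fix i
    have "(to_ac \<zeta> ^ i) ^ R = (to_ac (\<zeta> ^ R)) ^ i"
      by (simp add: power_mult[symmetric] mult.commute)
    then show "(to_ac \<zeta> ^ i) ^ R = 1" using prim by (simp add: primitive_root_of_unity_def del: to_ac_power)
  qed
  moreover have "card {z. poly p z = 0} \<le> card ?S"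
    using card_poly_roots_bound[OF p0] dp inj by (simp add: card_image)
  ultimately have "?S = {z. poly p z = 0}" using fin by (intro card_seteq) auto
  moreover have "poly p w = 0" using assms by (simp add: p_def poly_monom)
  ultimately obtain i where "w = to_ac (\<zeta> ^ i)" by blast
  then have "w = to_ac (\<zeta> powi int i)" by simp
  then show ?thesis by blast
qed

text \<open>Since \<open>z ^ R\<close> is fixed by every automorphism, each one multiplies
  \<open>z\<close> by a root of unity from \<open>K\<close>. All nonzero coordinates of
  \<open>z\<close> therefore belong to one character, and distinct indices in \<open>B\<close> have
  distinct characters, so only one coordinate survives.\<close>

lemma eigenvector_mono:
  assumes z: "z \<in> L" "z \<noteq> 0" and zR: "z ^ R \<in> range to_ac"
  obtains v k where "v \<in> B" "z = to_ac k * Y v" "k \<noteq> 0"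
proof -
  have ev: "\<exists>k. aut g z = to_ac k * z" for g
  proof -
    obtain k where k: "z ^ R = to_ac k" using zR by auto
    have "aut g z ^ R = aut g (z ^ R)" using z by (simp add: aut_power)
    also have "\<dots> = z ^ R" by (simp only: k aut_K)
    finally have "(aut g z / z) ^ R = 1" using z by (simp add: power_divide)
    then obtain i where "aut g z / z = to_ac (\<zeta> powi i)" using root_of_unity_powi by blast
    then have "aut g z = to_ac (\<zeta> powi i) * z" using z by (simp add: field_simps)
    then show ?thesis by blast
  qed
  have ex: "\<exists>v\<in>B. coord z v \<noteq> 0"
  proof (rule ccontr)
    assume "\<not> ?thesis"
    then have "comb (coord z) = 0" by (simp add: comb_def)
    then show False using z comb_coord by simp
  qed
  then obtain v where v: "v \<in> B" "coord z v \<noteq> 0" by blast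
  have uniq: "w = v" if w: "w \<in> B" "coord z w \<noteq> 0" for w
  proof -
    have d: "int R dvd pr g (\<lambda>j. w j - v j)" for g
    proof -
      obtain k where k: "aut g z = to_ac k * z" using ev by blast
      have "ch g u * coord z u = k * coord z u" if "u \<in> B" for u
        using coord_aut[OF z(1) that, of g] coord_scale[OF z(1) that, of k] k by metis
      then have "ch g v = k" "ch g w = k" using v w by auto
      then have "ch g w = ch g v" by simp
      then have "[pr g w = pr g v] (mod int R)" using powi_prim_root_eq_iff[OF prim] by blast
      then have "int R dvd pr g w - pr g v" by (simp add: cong_iff_dvd_diff)
      also have "pr g w - pr g v = pr g (\<lambda>j. w j - v j)"
        by (simp add: pairing_def algebra_simps sum_subtractf)
      finally show ?thesis .
    qed
    have "int R dvd pr g (red (\<lambda>j. w j - v j))" for g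
      using d[of g] pr_red_right cong_dvd_iff by blast
    then have r0: "red (\<lambda>j. w j - v j) = z0" by (intro pr_nondegenerate) auto
    show ?thesis
    proof (rule ext)
      fix j show "w j = v j"
      proof (cases "j \<in> {1..n}")
        case True
        have "(w j - v j) mod int (r j) = 0"
          using fun_cong[OF r0, of j] True by (simp add: residue_vec_def zero_vec_def)
        then have "w j mod int (r j) = v j mod int (r j)"
          by (metis mod_eq_dvd_iff mod_0_imp_dvd)
        then show ?thesis using w(1) v(1) True by (auto simp: residue_box_def PiE_iff)
      next
        case False
        then show ?thesis using w(1) v(1) by (auto simp: residue_box_def PiE_iff extensional_def)
      qed
    qed
  qed
  have "comb (coord z) = comb (\<lambda>w. if w = v then coord z v else 0)"
    using uniq by (intro comb_cong) auto
  then have "z = to_ac (coord z v) * Y v" using z v by (simp add: comb_single comb_coord)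
  then show ?thesis using v that by blast
qed

text \<open>
  A polynomial of degree less than \<open>t\<close> over \<open>L\<close> with root \<open>x\<close>, where \<open>x ^ t\<close> lies in \<open>K\<close>, would give a
  monic divisor of \<open>T ^ t - x ^ t\<close> over \<open>L\<close>. Its constant coefficient is a root of unity times \<open>x ^ d\<close> with
  \<open>0 < d < t\<close>, so \<open>x ^ d\<close> is in \<open>L\<close> and hence, being an eigenvector of all automorphisms, a monomial.
\<close>

lemma radical_step:
  assumes ext: "radical_box (Suc n) r R \<zeta> y"
    and nK: "\<And>v. v \<in> residue_box (Suc n) r \<Longrightarrow> v \<noteq> zero_vec (Suc n) \<Longrightarrow>
      radical_box.Y (Suc n) y v \<notin> range to_ac"
  shows "radical_indep (Suc n) r R \<zeta> y"
proof -
  interpret S: radical_box "Suc n" r R \<zeta> y by (rule ext)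
  define t x where "t = r (Suc n)" and "x = y (Suc n)"
  have t: "t > 0" "t dvd R" using S.r_pos S.r_dvd by (auto simp: t_def)
  have x0: "x \<noteq> 0" using S.y_nz by (auto simp: x_def)
  obtain f where f: "x ^ t = to_ac f" using S.y_pow[of "Suc n"] by (auto simp: x_def t_def)
  have SY: "S.Y v = Y v * x powi v (Suc n)" for v
    by (simp add: S.Y_def Y_def x_def atLeastAtMostSuc_conv mult.commute)
  have no_pow: "x ^ d \<notin> L" if d: "0 < d" "d < t" for d
  proof
    assume xd: "x ^ d \<in> L"
    have "(x ^ d) ^ R = to_ac (f ^ (R div t * d))"
    proof -
      have "(x ^ d) ^ R = (x ^ t) ^ (R div t * d)"
        using t by (simp add: power_mult[symmetric] mult_ac)
      then show ?thesis by (simp add: f)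
    qed
    then have "(x ^ d) ^ R \<in> range to_ac" by (rule range_eqI)
    moreover have "x ^ d \<noteq> 0" using x0 by simp
    ultimately obtain v k where vk: "v \<in> B" "x ^ d = to_ac k * Y v" "k \<noteq> 0"
      using eigenvector_mono[OF xd] by metis
    \<comment> \<open>The vector of \<open>x ^ d / Y v\<close>, a monomial in all
      \<open>n + 1\<close> radicals that lies in \<open>K\<close>. Its reduction is nonzero because
      its last entry \<open>d\<close> satisfies \<open>0 < d < t\<close>.\<close>
    define w where "w = (\<lambda>j. if j = Suc n then int d else - v j)"
    have "S.Y w = Y (\<lambda>j. - v j) * x ^ d"
    proof -
      have "Y w = Y (\<lambda>j. - v j)" by (rule Y_cong) (auto simp: w_def)
      moreover have "w (Suc n) = int d" by (simp add: w_def)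
      ultimately show ?thesis by (simp add: SY)
    qed
    also have "\<dots> = to_ac k" using vk by (simp add: Y_uminus)
    finally have 1: "S.Y w = to_ac k" .
    obtain k' where k': "k' \<noteq> 0" "S.Y w = to_ac k' * S.Y (S.red w)" using S.Y_red by metis
    then have "S.Y (S.red w) = to_ac (k / k')" using 1 by (simp add: field_simps)
    moreover have "S.red w \<noteq> S.z0"
    proof
      assume "S.red w = S.z0"
      from fun_cong[OF this, of "Suc n"] show False
        using d by (simp add: residue_vec_def zero_vec_def w_def t_def)
    qed
    ultimately show False using nK[of "S.red w"] by (metis S.red_in_B rangeI)
  qed
  have main: "p = 0" if p: "\<And>i. coeff p i \<in> L" "poly p x = 0" "degree p < t" for p
  proof (rule ccontr)
    assume p0: "p \<noteq> 0"
    define Q where "Q = (\<lambda>g. g \<noteq> 0 \<and> (\<forall>i. coeff g i \<in> L) \<and> poly g x = 0)"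
    have "Q p" using p p0 by (auto simp: Q_def)
    \<comment> \<open>After division by its leading coefficient this is the minimal polynomial of
      \<open>x\<close> over \<open>L\<close>.\<close>
    define g0 where "g0 = arg_min degree Q"
    have g0: "Q g0" "\<And>g. Q g \<Longrightarrow> degree g0 \<le> degree g"
      unfolding g0_def using arg_min_nat_lemma[of Q, OF \<open>Q p\<close>] by auto
    define g where "g = smult (inverse (lead_coeff g0)) g0"
    have lg0: "lead_coeff g0 \<noteq> 0" using g0(1) by (auto simp: Q_def)
    have dg: "degree g = degree g0" using lg0 by (simp add: g_def)
    have Qg: "Q g" using g0(1) by (auto simp: Q_def g_def intro!: L_mult L_inverse)
    have lg: "lead_coeff g = 1" using lg0 by (simp add: g_def)
    have dt: "degree g < t" using g0(2)[OF \<open>Q p\<close>] p(3) dg by simp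
    define h where "h = monom 1 t - [:to_ac f:]"
    have dvd: "g dvd h"
    proof (rule dvd_of_root_minimal[where M = L and x = x])
      show "poly h x = 0" using f by (simp add: h_def poly_monom)
      show "coeff h i \<in> L" for i
        unfolding h_def coeff_diff by (intro L_diff) (auto simp: coeff_pCons split: nat.split)
      show "lead_coeff g = 1" by (rule lg)
      show "degree g \<le> degree g'" if "g' \<noteq> 0" "\<And>i. coeff g' i \<in> L" "poly g' x = 0" for g'
        using g0(2)[of g'] that by (simp add: dg Q_def)
    qed (use Qg in \<open>auto simp: Q_def intro: L_diff L_mult\<close>)
    have dg0: "degree g > 0"
    proof (rule ccontr)
      assume "\<not> degree g > 0"
      then have "g = 1" using lg by (metis degree_eq_zeroE lead_coeff_pCons(2) one_pCons not_gr0)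
      then show False using Qg by (simp add: Q_def)
    qed
    have "\<exists>w. w \<in> range (\<lambda>i. to_ac (\<zeta> powi i)) \<and> z = w * x" if "poly g z = 0" for z
    proof -
      have "poly h z = 0" using dvd that by (metis dvd_trans poly_eq_0_iff_dvd)
      then have "z ^ t = x ^ t" using f by (simp add: h_def poly_monom)
      then have "(z / x) ^ t = 1" using x0 by (simp add: power_divide)
      then have "(z / x) ^ R = 1" using t(2) by (metis dvdE power_mult power_one)
      then obtain i where "z / x = to_ac (\<zeta> powi i)" using root_of_unity_powi by blast
      then have "z = to_ac (\<zeta> powi i) * x" using x0 by (simp add: field_simps)
      then show ?thesis by blast
    qed
    moreover have "a * b \<in> range (\<lambda>i. to_ac (\<zeta> powi i))"
      if ab: "a \<in> range (\<lambda>i. to_ac (\<zeta> powi i))" "b \<in> range (\<lambda>i. to_ac (\<zeta> powi i))" for a b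
    proof -
      from ab obtain i j where "a = to_ac (\<zeta> powi i)" "b = to_ac (\<zeta> powi j)" by auto
      then have "a * b = to_ac (\<zeta> powi (i + j))" by (simp add: power_int_add)
      then show ?thesis by blast
    qed
    moreover have "1 \<in> range (\<lambda>i. to_ac (\<zeta> powi i))" by (rule range_eqI[of _ _ 0]) simp
    ultimately obtain w where w: "w \<in> range (\<lambda>i. to_ac (\<zeta> powi i))"
      "poly g 0 = (-1) ^ degree g * w * x ^ degree g"
      using alg_closed_splits_const_coeff[OF lg, of "\<lambda>w. w \<in> range (\<lambda>i. to_ac (\<zeta> powi i))" x] by blast
    then obtain i where wi: "w = to_ac (\<zeta> powi i)" by auto
    have g0L: "poly g 0 \<in> L" using Qg by (simp add: Q_def poly_0_coeff_0)
    have "x ^ degree g = (to_ac ((-1) ^ degree g * \<zeta> powi (-i))) * poly g 0"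
    proof -
      have "to_ac (\<zeta> powi (-i)) * to_ac (\<zeta> powi i) = 1"
        by (metis to_ac_mult to_ac_1 power_int_minus left_inverse power_int_eq_0_iff zeta_nz)
      moreover have "(-1) ^ degree g * (-1) ^ degree g = (1 :: 'b alg_closure)"
        by (simp flip: power_mult_distrib)
      moreover have "(to_ac ((-1) ^ degree g * \<zeta> powi (-i))) * poly g 0 =
          ((-1) ^ degree g * (-1) ^ degree g) * (to_ac (\<zeta> powi (-i)) * to_ac (\<zeta> powi i)) * x ^ degree g"
        unfolding w(2) wi to_ac_mult by (simp add: mult_ac)
      ultimately show ?thesis by simp
    qed
    also have "\<dots> \<in> L" using g0L by (intro L_mult K_in_L)
    finally show False using no_pow[OF dg0 dt] by simp
  qed
  show ?thesis
  proof (unfold_locales)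
    fix c v assume c: "S.comb c = 0" and v: "v \<in> S.B"
    \<comment> \<open>Collecting the combination by powers of the last radical makes it a polynomial
      in \<open>x\<close> of degree less than \<open>t\<close> with coefficients in
      \<open>L\<close>; \<open>main\<close> makes it vanish, and \<open>indep\<close> then kills the
      coefficients.\<close>
    define a where "a = (\<lambda>i. comb (\<lambda>w. c (w(Suc n := int i))))"
    define p where "p = (\<Sum>i<t. monom (a i) i)"
    have coeffp: "coeff p i = (if i < t then a i else 0)" for i
      by (simp add: p_def coeff_sum)
    have bij: "bij_betw (\<lambda>(w, i). w(Suc n := int i)) (B \<times> {..<t}) S.B"
    proof (rule bij_betw_byWitness[where f' = "\<lambda>v. (v(Suc n := undefined), nat (v (Suc n)))"])
      show "\<forall>wi\<in>B \<times> {..<t}. ((case wi of (w, i) \<Rightarrow> w(Suc n := int i))(Suc n := undefined),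
         nat ((case wi of (w, i) \<Rightarrow> w(Suc n := int i)) (Suc n))) = wi"
        by (auto simp: residue_box_def PiE_iff extensional_def)
      show "\<forall>v\<in>S.B. (case (v(Suc n := undefined), nat (v (Suc n))) of (w, i) \<Rightarrow> w(Suc n := int i)) = v"
        by (auto simp: residue_box_def PiE_iff)
      show "(\<lambda>(w, i). w(Suc n := int i)) ` (B \<times> {..<t}) \<subseteq> S.B"
        by (auto simp: residue_box_def PiE_iff extensional_def t_def le_Suc_eq)
      show "(\<lambda>v. (v(Suc n := undefined), nat (v (Suc n)))) ` S.B \<subseteq> B \<times> {..<t}"
        by (auto simp: residue_box_def PiE_iff extensional_def t_def nat_less_iff)
    qed
    have "S.comb c = (\<Sum>(w, i)\<in>B \<times> {..<t}. to_ac (c (w(Suc n := int i))) * S.Y (w(Suc n := int i)))"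
      unfolding S.comb_def by (subst sum.reindex_bij_betw[OF bij, symmetric]) (simp add: case_prod_unfold)
    also have "\<dots> = (\<Sum>(w, i)\<in>B \<times> {..<t}. to_ac (c (w(Suc n := int i))) * Y w * x ^ i)"
    proof -
      have "Y (w(Suc n := i)) = Y w" for w i by (rule Y_cong) auto
      then show ?thesis by (simp add: SY mult.assoc)
    qed
    also have "\<dots> = (\<Sum>i<t. a i * x ^ i)"
      unfolding a_def comb_def
      by (subst sum.cartesian_product[symmetric], subst sum.swap) (simp add: sum_distrib_right)
    also have "\<dots> = poly p x" by (simp add: p_def poly_sum poly_monom)
    finally have "poly p x = 0" using c by simp
    moreover have "degree p < t"
      by (rule degree_lessI) (use t coeffp in auto)
    ultimately have "p = 0" using main[of p] coeffp by (auto simp: a_def)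
    then have a0: "a i = 0" if "i < t" for i using coeffp[of i] that by simp
    have "v \<in> (\<lambda>(w, i). w(Suc n := int i)) ` (B \<times> {..<t})"
      using bij v by (simp add: bij_betw_def)
    then obtain w i where wi: "w \<in> B" "i < t" "v = w(Suc n := int i)" by auto
    show "c v = 0" using indep[of "\<lambda>w. c (w(Suc n := int i))" w] a0[OF wi(2)] wi by (simp add: a_def)
  qed
qed

end

text \<open>Kummer theory in the form used below: the only obstruction to independence is a
  nontrivial monomial lying in \<open>K\<close>. The induction adjoins one root at a time.\<close>

theorem radical_indepI:
  assumes "radical_box n r R \<zeta> y"
    and "\<And>v. v \<in> residue_box n r \<Longrightarrow> v \<noteq> zero_vec n \<Longrightarrow> radical_box.Y n y v \<notin> range to_ac"
  shows "radical_indep n r R \<zeta> y"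
  using assms
proof (induction n)
  case 0
  interpret radical_box 0 r R \<zeta> y by (rule 0)
  show ?case
  proof
    fix c v assume "comb c = 0" "v \<in> B"
    then show "c v = 0" by (simp add: comb_def residue_box_def Y_def)
  qed
next
  case (Suc n)
  interpret S: radical_box "Suc n" r R \<zeta> y by (rule Suc.prems)
  have rb: "radical_box n r R \<zeta> y"
    using S.r_pos S.r_dvd S.R_pos S.prim S.R_nz S.y_nz S.y_pow by unfold_locales auto
  interpret b: radical_box n r R \<zeta> y by (rule rb)
  have "b.Y v \<notin> range to_ac" if v: "v \<in> residue_box n r" "v \<noteq> zero_vec n" for v
  proof -
    let ?v = "v(Suc n := 0)"
    have "?v \<in> residue_box (Suc n) r"
      using v S.r_pos[of "Suc n"] by (auto simp: residue_box_def PiE_iff extensional_def le_Suc_eq)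
    moreover have "?v \<noteq> zero_vec (Suc n)"
    proof
      assume *: "?v = zero_vec (Suc n)"
      have "v j = zero_vec n j" for j
      proof (cases "j \<in> {1..n}")
        case True then show ?thesis using fun_cong[OF *, of j] by (auto simp: zero_vec_def)
      next
        case False then show ?thesis using v by (auto simp: zero_vec_def residue_box_def PiE_iff extensional_def)
      qed
      then show False using v by blast
    qed
    ultimately have "S.Y ?v \<notin> range to_ac" using Suc.prems(2) by blast
    moreover have "S.Y ?v = b.Y v"
      by (simp add: S.Y_def b.Y_def atLeastAtMostSuc_conv)
    ultimately show ?thesis by simp
  qed
  then interpret I: radical_indep n r R \<zeta> y using Suc.IH rb by blast
  show ?case using I.radical_step Suc.prems by blast
qed

section \<open>Galois groups of radical extensions\<close>

lemma type_algebra_simps [simp]: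
  "carrier (ring_of_type_algebra :: 'a :: field ring) = UNIV"
  "\<zero>\<^bsub>ring_of_type_algebra :: 'a ring\<^esub> = 0"
  "\<one>\<^bsub>ring_of_type_algebra :: 'a ring\<^esub> = 1"
  "a \<otimes>\<^bsub>ring_of_type_algebra :: 'a ring\<^esub> b = a * b"
  "a \<oplus>\<^bsub>ring_of_type_algebra :: 'a ring\<^esub> b = a + b"
  by (simp_all add: ring_of_type_algebra_def)

lemma type_algebra_uminus [simp]: "\<ominus>\<^bsub>ring_of_type_algebra :: 'a :: field ring\<^esub> a = - a"
proof -
  interpret ring "ring_of_type_algebra :: 'a ring" by (rule ring_from_type_algebra)
  show ?thesis by (rule minus_equality) auto
qed

lemma type_algebra_inv [simp]:
  "a \<noteq> 0 \<Longrightarrow> inv\<^bsub>ring_of_type_algebra :: 'a :: field ring\<^esub> a = inverse a"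
proof -
  assume a: "a \<noteq> 0"
  interpret field "ring_of_type_algebra :: 'a ring" by (rule field_from_type_algebra)
  show ?thesis by (rule comm_inv_char) (use a in auto)
qed

lemma subfield_type_algebra_iff:
  "subfield M (ring_of_type_algebra :: 'a :: field ring) \<longleftrightarrow>
     1 \<in> M \<and> (\<forall>a\<in>M. \<forall>b\<in>M. a + b \<in> M \<and> a * b \<in> M) \<and> (\<forall>a\<in>M. - a \<in> M \<and> inverse a \<in> M)"
    (is "?l \<longleftrightarrow> ?r")
proof
  interpret field "ring_of_type_algebra :: 'a ring" by (rule field_from_type_algebra)
  assume l: ?l
  note sr = subringE[OF subfieldE(1)[OF l], simplified]
  have "inverse a \<in> M" if a: "a \<in> M" for a
  proof (cases "a = 0")
    case False
    then show ?thesis using subfield_m_inv(1)[OF l, of a] a by simp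
  qed (use sr in simp)
  then show ?r using sr by auto
next
  interpret field "ring_of_type_algebra :: 'a ring" by (rule field_from_type_algebra)
  assume r: ?r
  show ?l
  proof (rule subfieldI')
    show "subring M (ring_of_type_algebra :: 'a ring)"
      by (rule subringI) (use r in auto)
  qed (use r in auto)
qed

lemma intermediate_field_iff:
  "intermediate_field (M :: ('a :: {field,finite}) Kbar set) \<longleftrightarrow>
     range to_ac \<subseteq> M \<and> (\<forall>a\<in>M. \<forall>b\<in>M. a + b \<in> M \<and> a * b \<in> M) \<and> (\<forall>a\<in>M. inverse a \<in> M)"
proof -
  have "- a \<in> M" if "a \<in> M" "range (to_ac :: 'a poly fract \<Rightarrow> _) \<subseteq> M"
    "\<forall>a\<in>M. \<forall>b\<in>M. a + b \<in> M \<and> a * b \<in> M" for a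
  proof -
    have "to_ac (-1) \<in> M" using that by blast
    then have "to_ac (-1) * a \<in> M" using that by blast
    then show ?thesis by simp
  qed
  moreover have "1 \<in> M" if "range (to_ac :: 'a poly fract \<Rightarrow> _) \<subseteq> M"
    using that to_ac_1 by (metis rangeI subsetD)
  ultimately show ?thesis unfolding intermediate_field_def subfield_type_algebra_iff by blast
qed

definition K_hom_on :: "('a :: {field,finite}) Kbar set \<Rightarrow> ('a Kbar \<Rightarrow> 'a Kbar) \<Rightarrow> bool" where
  "K_hom_on M f \<longleftrightarrow> (\<forall>x\<in>M. \<forall>y\<in>M. f (x + y) = f x + f y \<and> f (x * y) = f x * f y) \<and>
     (\<forall>c. f (to_ac c) = to_ac c)"

lemma carrier_Gal: "carrier (Gal M) = {f \<in> Bij M. K_hom_on M f}"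
  by (auto simp: Gal_def K_hom_on_def)

lemma mult_Gal: "f \<in> Bij M \<Longrightarrow> g \<in> Bij M \<Longrightarrow> f \<otimes>\<^bsub>Gal M\<^esub> g = compose M f g"
  by (simp add: Gal_def BijGroup_def)

locale radical_field = radical_indep n r R \<zeta> y
  for n r R and \<zeta> :: "('a :: {field,finite}) poly fract" and y
begin

lemma unit_vec_Y: "j \<in> {1..n} \<Longrightarrow> Y (\<lambda>i. if i = j then 1 else 0) = y j"
proof -
  assume j: "j \<in> {1..n}"
  have "Y (\<lambda>i. if i = j then 1 else 0) = (\<Prod>i\<in>{1..n}. if i = j then y i else 1)"
    unfolding Y_def by (rule prod.cong) auto
  then show ?thesis using j by simp
qed

lemma y_in_L: "j \<in> {1..n} \<Longrightarrow> y j \<in> L"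
  using unit_vec_Y Y_in_L by metis

lemma intermediate_field_L: "intermediate_field L"
  unfolding intermediate_field_iff by (auto intro: L_add L_mult L_inverse)

lemma intermediate_field_powi:
  "intermediate_field M \<Longrightarrow> a \<in> M \<Longrightarrow> a powi i \<in> M"
proof -
  assume M: "intermediate_field M" and a: "a \<in> M"
  have 1: "1 \<in> M" using M to_ac_1 by (metis intermediate_field_iff rangeI subsetD)
  have "b ^ m \<in> M" if "b \<in> M" for b m
    by (induction m) (use M that 1 in \<open>auto simp: intermediate_field_iff\<close>)
  then show ?thesis using M a by (auto simp: power_int_def intermediate_field_iff)
qed

lemma L_hull: "intermediate_field hull (y ` {1..n}) = L"
proof (rule hull_unique)
  show "y ` {1..n} \<subseteq> L" using y_in_L by auto
  show "intermediate_field L" by (rule intermediate_field_L)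
  fix M assume M: "y ` {1..n} \<subseteq> M" "intermediate_field M"
  have K: "to_ac k \<in> M" for k using M(2) by (auto simp: intermediate_field_iff)
  have sums: "sum f A \<in> M" if "\<And>i. i \<in> A \<Longrightarrow> f i \<in> M" for f :: "(nat \<Rightarrow> int) \<Rightarrow> _" and A
    using that K[of 0] M(2)
    by (induction A rule: infinite_finite_induct) (auto simp: intermediate_field_iff)
  have prods: "prod f A \<in> M" if "\<And>i. i \<in> A \<Longrightarrow> f i \<in> M" for f :: "nat \<Rightarrow> _" and A
    using that K[of 1] M(2)
    by (induction A rule: infinite_finite_induct) (auto simp: intermediate_field_iff)
  have "Y v \<in> M" for v
    unfolding Y_def by (intro prods intermediate_field_powi[OF M(2)]) (use M(1) in auto)
  then have "comb c \<in> M" for c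
    unfolding comb_def using K M(2) by (intro sums) (auto simp: intermediate_field_iff)
  then show "L \<subseteq> M" by (auto simp: L_def)
qed

lemma finite_over_K_L: "finite_over_K L"
proof -
  interpret V: vector_space "\<lambda>(c :: 'a poly fract) v. to_ac c * v"
    by unfold_locales (simp_all add: algebra_simps)
  have "L = V.span (Y ` B)"
  proof
    show "L \<subseteq> V.span (Y ` B)"
    proof
      fix z assume "z \<in> L"
      then obtain c where "z = comb c" by (auto simp: L_def)
      then show "z \<in> V.span (Y ` B)"
        unfolding comb_def by (simp only:) (intro V.span_sum V.span_scale V.span_base imageI)
    qed
    show "V.span (Y ` B) \<subseteq> L"
      by (rule V.span_minimal) (auto simp: V.subspace_def intro: L_add L_mult)
  qed
  then show ?thesis unfolding finite_over_K_def by (intro exI[of _ "Y ` B"]) auto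
qed

lemma K_hom_on_0: "K_hom_on L f \<Longrightarrow> f 0 = 0" and K_hom_on_1: "K_hom_on L f \<Longrightarrow> f 1 = 1"
  unfolding K_hom_on_def using to_ac_0 to_ac_1 by metis+

lemma K_hom_on_sum:
  "K_hom_on L f \<Longrightarrow> (\<And>i. i \<in> A \<Longrightarrow> h i \<in> L) \<Longrightarrow> f (sum h A) = (\<Sum>i\<in>A. f (h i))"
  by (induction A rule: infinite_finite_induct) (auto simp: K_hom_on_0 L_sum K_hom_on_def)

lemma K_hom_on_prod:
  "K_hom_on L f \<Longrightarrow> (\<And>i. i \<in> A \<Longrightarrow> h i \<in> L) \<Longrightarrow> f (prod h A) = (\<Prod>i\<in>A. f (h i))"
  by (induction A rule: infinite_finite_induct) (auto simp: K_hom_on_1 L_prod K_hom_on_def)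

lemma K_hom_on_power: "K_hom_on L f \<Longrightarrow> a \<in> L \<Longrightarrow> f (a ^ m) = f a ^ m"
  by (induction m) (auto simp: K_hom_on_1 L_power K_hom_on_def)

lemma Y_nat: "v \<in> B \<Longrightarrow> Y v = (\<Prod>j\<in>{1..n}. y j ^ nat (v j))"
  unfolding Y_def by (rule prod.cong) (auto simp: residue_box_def power_int_def PiE_iff)

lemma K_hom_on_Y:
  assumes f: "K_hom_on L f" and v: "v \<in> B"
  shows "f (Y v) = (\<Prod>j\<in>{1..n}. f (y j) ^ nat (v j))"
proof -
  have "f (Y v) = (\<Prod>j\<in>{1..n}. f (y j ^ nat (v j)))"
    unfolding Y_nat[OF v] by (intro K_hom_on_prod[OF f] L_power y_in_L)
  then show ?thesis using K_hom_on_power[OF f y_in_L] by simp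
qed

lemma K_hom_on_determined:
  assumes f: "K_hom_on L f" and g: "K_hom_on L g"
    and eq: "\<And>j. j \<in> {1..n} \<Longrightarrow> f (y j) = g (y j)" and z: "z \<in> L"
  shows "f z = g z"
proof -
  have Y: "f (Y v) = g (Y v)" if "v \<in> B" for v
    using that eq by (simp add: K_hom_on_Y[OF f] K_hom_on_Y[OF g])
  obtain c where c: "z = comb c" using z by (auto simp: L_def)
  have "f (to_ac (c v) * Y v) = g (to_ac (c v) * Y v)" if "v \<in> B" for v
    using Y[OF that] f g unfolding K_hom_on_def by simp
  then show ?thesis unfolding c comb_def
    by (simp add: K_hom_on_sum[OF f] K_hom_on_sum[OF g])
qed

lemma K_hom_on_aut: "K_hom_on L (restrict (aut g) L)"
  by (auto simp: K_hom_on_def aut_add aut_mult L_add L_mult)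

lemma aut_Bij: "restrict (aut g) L \<in> Bij L"
proof -
  have "bij_betw (restrict (aut g) L) L L"
  proof (rule bij_betw_byWitness[where f' = "aut (\<lambda>j. - g j)"])
    show "\<forall>a\<in>L. aut (\<lambda>j. - g j) (restrict (aut g) L a) = a"
      by (simp add: aut_inverse)
    show "\<forall>a\<in>L. restrict (aut g) L (aut (\<lambda>j. - g j) a) = a"
      using aut_inverse[of _ "\<lambda>j. - g j"] by simp
  qed auto
  then show ?thesis by (simp add: Bij_def)
qed

lemma aut_in_Gal: "restrict (aut g) L \<in> carrier (Gal L)"
  by (simp add: carrier_Gal aut_Bij K_hom_on_aut)

definition aut_map :: "(nat \<Rightarrow> int) \<Rightarrow> 'a Kbar \<Rightarrow> 'a Kbar" where
  "aut_map = (\<lambda>g\<in>B. restrict (aut g) L)"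

lemma mult_abelian_grp: "g \<otimes>\<^bsub>abelian_grp n r\<^esub> h = red (\<lambda>j. g j + h j)"
  unfolding abelian_grp_def by (simp add: residue_vec_def)

lemma aut_y: "j \<in> {1..n} \<Longrightarrow> aut g (y j) = to_ac (\<zeta> powi (g j * int (R div r j))) * y j"
proof -
  assume j: "j \<in> {1..n}"
  have "pr g (\<lambda>i. if i = j then 1 else 0) = (\<Sum>i\<in>{1..n}. if i = j then g i * int (R div r i) else 0)"
    unfolding pairing_def by (rule sum.cong) auto
  then have "pr g (\<lambda>i. if i = j then 1 else 0) = g j * int (R div r j)" using j by simp
  then show ?thesis using aut_Y[of g "\<lambda>i. if i = j then 1 else 0"] unit_vec_Y[OF j] by simp
qed

text \<open>An automorphism moves \<open>y j\<close> by an \<open>r j\<close>-th root of unity, that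
  is by a power of \<open>\<zeta>\<close> with exponent divisible by \<open>R div r j\<close>; the
  quotients give the entries of \<open>g\<close> up to reduction, and the \<open>y j\<close>
  generate \<open>L\<close>.\<close>

lemma Gal_eq_aut:
  assumes f: "f \<in> carrier (Gal L)"
  obtains g where "g \<in> B" "f = restrict (aut g) L"
proof -
  have fh: "K_hom_on L f" and fB: "f \<in> Bij L" using f by (auto simp: carrier_Gal)
  have "\<exists>m. f (y j) = to_ac (\<zeta> powi (m * int (R div r j))) * y j" if j: "j \<in> {1..n}" for j
  proof -
    have y0: "y j \<noteq> 0" using y_nz j by blast
    obtain k where k: "y j ^ r j = to_ac k" using y_pow[OF j] by auto
    have "f (y j) ^ r j = f (y j ^ r j)" using K_hom_on_power[OF fh y_in_L[OF j]] by simp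
    also have "\<dots> = y j ^ r j" using fh by (simp only: k K_hom_on_def)
    finally have 1: "(f (y j) / y j) ^ r j = 1" using y0 by (simp add: power_divide)
    then have "(f (y j) / y j) ^ R = 1" using r_dvd[OF j] by (metis dvdE power_mult power_one)
    then obtain i where i: "f (y j) / y j = to_ac (\<zeta> powi i)" using root_of_unity_powi by blast
    have "to_ac (\<zeta> powi (i * int (r j))) = (to_ac (\<zeta> powi i)) ^ r j"
      by (simp add: power_int_mult flip: to_ac_power)
    then have "\<zeta> powi (i * int (r j)) = 1" using 1 i by simp
    then have "int R dvd i * int (r j)" using powi_prim_root_eq_1_iff[OF prim] by blast
    then have "int (R div r j) * int (r j) dvd i * int (r j)"
      using r_dvd[OF j] by (metis dvd_div_mult_self of_nat_mult)
    then have "int (R div r j) dvd i" using r_pos[OF j] by simp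
    then obtain m where "i = m * int (R div r j)" by (metis dvdE mult.commute)
    then show ?thesis using i y0 by (auto simp: field_simps)
  qed
  then obtain m where m: "\<And>j. j \<in> {1..n} \<Longrightarrow> f (y j) = to_ac (\<zeta> powi (m j * int (R div r j))) * y j"
    by metis
  have "f z = restrict (aut (red m)) L z" for z
  proof (cases "z \<in> L")
    case True
    show ?thesis
    proof (rule K_hom_on_determined[OF fh K_hom_on_aut _ True])
      fix j assume j: "j \<in> {1..n}"
      then show "f (y j) = restrict (aut (red m)) L (y j)"
        using m[OF j] y_in_L[OF j] by (simp add: aut_red aut_y)
    qed
  next
    case False then show ?thesis using fB by (auto simp: Bij_def extensional_def)
  qed
  then have "f = restrict (aut (red m)) L" by (rule ext)
  then show ?thesis using that[OF red_in_B] by blast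
qed

lemma aut_eq_iff:
  assumes "g \<in> B" "h \<in> B" "\<And>z. z \<in> L \<Longrightarrow> aut g z = aut h z"
  shows "g = h"
proof (rule ext)
  fix j show "g j = h j"
  proof (cases "j \<in> {1..n}")
    case True
    have "to_ac (\<zeta> powi (g j * int (R div r j))) * y j = to_ac (\<zeta> powi (h j * int (R div r j))) * y j"
      using assms(3)[OF y_in_L[OF True]] by (simp add: aut_y[OF True])
    then have "[g j * int (R div r j) = h j * int (R div r j)] (mod int R)"
      using powi_prim_root_eq_iff[OF prim] y_nz[OF True] by simp
    then have "int (r j) * int (R div r j) dvd (g j - h j) * int (R div r j)"
      unfolding cong_iff_dvd_diff R_split[OF True, symmetric] by (simp add: algebra_simps)
    moreover have "R div r j \<noteq> 0" using r_dvd[OF True] R_pos by (simp add: dvd_div_eq_0_iff)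
    ultimately have "int (r j) dvd g j - h j" by simp
    then have "g j mod int (r j) = h j mod int (r j)" by (simp add: mod_eq_dvd_iff)
    then show ?thesis using assms(1,2) True by (auto simp: residue_box_def PiE_iff)
  next
    case False
    then show ?thesis using assms(1,2) by (auto simp: residue_box_def PiE_iff extensional_def)
  qed
qed

lemma aut_map_iso: "aut_map \<in> iso (abelian_grp n r) (Gal L)"
proof -
  have "aut_map \<in> hom (abelian_grp n r) (Gal L)"
  proof (rule homI)
    fix g assume "g \<in> carrier (abelian_grp n r)"
    then show "aut_map g \<in> carrier (Gal L)" by (simp add: aut_map_def carrier_abelian_grp aut_in_Gal)
  next
    fix g h assume gh: "g \<in> carrier (abelian_grp n r)" "h \<in> carrier (abelian_grp n r)"
    have "restrict (aut (\<lambda>j. g j + h j)) L = compose L (restrict (aut g) L) (restrict (aut h) L)"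
      by (auto simp: compose_def aut_aut)
    then show "aut_map (g \<otimes>\<^bsub>abelian_grp n r\<^esub> h) = aut_map g \<otimes>\<^bsub>Gal L\<^esub> aut_map h"
      using gh by (simp add: aut_map_def carrier_abelian_grp mult_abelian_grp aut_red mult_Gal aut_Bij)
  qed
  moreover have "bij_betw aut_map (carrier (abelian_grp n r)) (carrier (Gal L))"
    unfolding bij_betw_def carrier_abelian_grp
  proof
    show "inj_on aut_map B"
    proof (rule inj_onI)
      fix g h assume gh: "g \<in> B" "h \<in> B" "aut_map g = aut_map h"
      then have "restrict (aut g) L = restrict (aut h) L" by (simp add: aut_map_def)
      then have "aut g z = aut h z" if "z \<in> L" for z
        using that by (metis restrict_apply')
      then show "g = h" using aut_eq_iff gh by blast
    qed
    show "aut_map ` B = carrier (Gal L)"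
    proof
      show "aut_map ` B \<subseteq> carrier (Gal L)" by (auto simp: aut_map_def aut_in_Gal)
      show "carrier (Gal L) \<subseteq> aut_map ` B"
      proof
        fix f assume "f \<in> carrier (Gal L)"
        then obtain g where "g \<in> B" "f = restrict (aut g) L" using Gal_eq_aut by blast
        then show "f \<in> aut_map ` B" by (auto simp: aut_map_def)
      qed
    qed
  qed
  ultimately show ?thesis by (simp add: iso_def)
qed

lemma galois_over_K_L: "galois_over_K L"
proof -
  have "{x \<in> L. \<forall>\<sigma> \<in> carrier (Gal L). \<sigma> x = x} = range to_ac"
  proof
    show "{x \<in> L. \<forall>\<sigma> \<in> carrier (Gal L). \<sigma> x = x} \<subseteq> range to_ac"
    proof
      fix x assume "x \<in> {x \<in> L. \<forall>\<sigma> \<in> carrier (Gal L). \<sigma> x = x}"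
      then have x: "x \<in> L" and f: "\<And>f. f \<in> carrier (Gal L) \<Longrightarrow> f x = x" by auto
      then have "aut g x = x" for g using f[OF aut_in_Gal, of g] by simp
      then show "x \<in> range to_ac" using fixed_in_K[OF x] by blast
    qed
    show "range to_ac \<subseteq> {x \<in> L. \<forall>\<sigma> \<in> carrier (Gal L). \<sigma> x = x}"
      by (auto simp: carrier_Gal K_hom_on_def)
  qed
  then show ?thesis by (simp add: galois_over_K_def intermediate_field_L finite_over_K_L)
qed

end

section \<open>Integral closures\<close>

text \<open>The value at 0 is left unconstrained, which avoids an infinite value; the axioms exclude
  0 instead.\<close>

definition is_valuation :: "('b :: field \<Rightarrow> int) \<Rightarrow> bool" where
  "is_valuation v \<longleftrightarrow> (\<forall>a b. a \<noteq> 0 \<longrightarrow> b \<noteq> 0 \<longrightarrow> v (a * b) = v a + v b) \<and>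
     (\<forall>a b. a \<noteq> 0 \<longrightarrow> b \<noteq> 0 \<longrightarrow> a + b \<noteq> 0 \<longrightarrow> min (v a) (v b) \<le> v (a + b))"

definition valuation_ring :: "('b :: field \<Rightarrow> int) set \<Rightarrow> 'b set" where
  "valuation_ring V = {k. k \<noteq> 0 \<longrightarrow> (\<forall>v\<in>V. 0 \<le> v k)}"

lemma valuation_mult: "is_valuation v \<Longrightarrow> a \<noteq> 0 \<Longrightarrow> b \<noteq> 0 \<Longrightarrow> v (a * b) = v a + v b"
  by (simp add: is_valuation_def)

lemma valuation_one: "is_valuation v \<Longrightarrow> v 1 = 0"
  using valuation_mult[of v 1 1] by simp

lemma valuation_power: "is_valuation v \<Longrightarrow> a \<noteq> 0 \<Longrightarrow> v (a ^ m) = int m * v a"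
  by (induction m) (auto simp: valuation_one valuation_mult algebra_simps)

lemma valuation_root_of_unity: "is_valuation v \<Longrightarrow> a ^ m = 1 \<Longrightarrow> m > 0 \<Longrightarrow> v a = 0"
  using valuation_power[of v a m] valuation_one[of v]
  by (cases "a = 0") (auto simp: power_0_left)

lemma valuation_add: "is_valuation v \<Longrightarrow> a \<noteq> 0 \<Longrightarrow> b \<noteq> 0 \<Longrightarrow> a + b \<noteq> 0 \<Longrightarrow> min (v a) (v b) \<le> v (a + b)"
  by (simp add: is_valuation_def)

lemma prod_linear_coeff_closed:
  fixes f :: "'i \<Rightarrow> 'k :: field"
  assumes sub: "\<And>a b. a \<in> M \<Longrightarrow> b \<in> M \<Longrightarrow> a - b \<in> M" "\<And>a b. a \<in> M \<Longrightarrow> b \<in> M \<Longrightarrow> a * b \<in> M" "0 \<in> M" "1 \<in> M"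
    and f: "\<And>i. i \<in> I \<Longrightarrow> f i \<in> M"
  shows "coeff (\<Prod>i\<in>I. [:- f i, 1:]) k \<in> M"
  using f
proof (induction I arbitrary: k rule: infinite_finite_induct)
  case (insert x F)
  have "coeff (\<Prod>i\<in>insert x F. [:- f i, 1:]) k =
      coeff (pCons 0 (\<Prod>i\<in>F. [:- f i, 1:])) k - f x * coeff (\<Prod>i\<in>F. [:- f i, 1:]) k"
    using insert.hyps by (simp add: algebra_simps)
  also have "\<dots> \<in> M"
    using insert by (intro sub) (auto simp: coeff_pCons sub(3) split: nat.split)
  finally show ?case .
qed (auto simp: sub)

lemma prod_linear_coeff_hom:
  fixes f :: "'i \<Rightarrow> 'k :: field" and h :: "'k \<Rightarrow> 'k"
  assumes sub: "\<And>a b. a \<in> M \<Longrightarrow> b \<in> M \<Longrightarrow> a - b \<in> M" "\<And>a b. a \<in> M \<Longrightarrow> b \<in> M \<Longrightarrow> a * b \<in> M" "0 \<in> M" "1 \<in> M"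
    and hom: "\<And>a b. a \<in> M \<Longrightarrow> b \<in> M \<Longrightarrow> h (a - b) = h a - h b"
      "\<And>a b. a \<in> M \<Longrightarrow> b \<in> M \<Longrightarrow> h (a * b) = h a * h b" "h 0 = 0" "h 1 = 1"
    and f: "\<And>i. i \<in> I \<Longrightarrow> f i \<in> M"
  shows "h (coeff (\<Prod>i\<in>I. [:- f i, 1:]) k) = coeff (\<Prod>i\<in>I. [:- h (f i), 1:]) k"
  using f
proof (induction I arbitrary: k rule: infinite_finite_induct)
  case (insert x F)
  have cM: "coeff (\<Prod>i\<in>F. [:- f i, 1:]) k \<in> M" for k
    using insert.prems by (intro prod_linear_coeff_closed sub) auto
  have p: "coeff (\<Prod>i\<in>insert x F. [:- g i, 1:]) k =
      coeff (pCons 0 (\<Prod>i\<in>F. [:- g i, 1:])) k - g x * coeff (\<Prod>i\<in>F. [:- g i, 1:]) k" for g :: "'i \<Rightarrow> 'k"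
    using insert.hyps by (simp add: algebra_simps)
  have "h (coeff (\<Prod>i\<in>insert x F. [:- f i, 1:]) k) =
      h (coeff (pCons 0 (\<Prod>i\<in>F. [:- f i, 1:])) k) - h (f x) * h (coeff (\<Prod>i\<in>F. [:- f i, 1:]) k)"
    unfolding p using cM insert.prems
    by (subst hom; (intro sub)?) (auto simp: hom coeff_pCons sub split: nat.split)
  also have "\<dots> = coeff (\<Prod>i\<in>insert x F. [:- h (f i), 1:]) k"
    unfolding p[of "\<lambda>i. h (f i)"] using insert.IH insert.prems by (cases k) (auto simp: hom)
  finally show ?case .
qed (auto simp: hom)

text \<open>\<open>denom\<close> makes \<open>K\<close> the fraction field of the valuation ring of
  \<open>V\<close>. \<open>val_of_nat\<close> makes the order of G a unit of it, so that averaging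
  over the Galois group preserves integrality.\<close>

locale valued_radical_field = radical_field n r R \<zeta> y
  for n r R and \<zeta> :: "('a :: {field,finite}) poly fract" and y +
  fixes V :: "('a poly fract \<Rightarrow> int) set"
  assumes val: "\<And>v. v \<in> V \<Longrightarrow> is_valuation v"
    and val_of_nat: "\<And>v m. v \<in> V \<Longrightarrow> of_nat m \<noteq> (0 :: 'a poly fract) \<Longrightarrow> v (of_nat m) = 0"
    and denom: "\<And>k. \<exists>d. d \<noteq> 0 \<and> d \<in> valuation_ring V \<and> d * k \<in> valuation_ring V"

context radical_indep
begin

definition radicand :: "(nat \<Rightarrow> int) \<Rightarrow> 'b" where "radicand u = of_ac (Y u ^ R)"

lemma radicand: "to_ac (radicand u) = Y u ^ R"
proof -
  obtain k where "Y u ^ R = to_ac k" using Y_pow_R by metis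
  then show ?thesis by (simp add: radicand_def)
qed

lemma radicand_nz [simp]: "radicand u \<noteq> 0"
  by (metis radicand Y_nz power_not_zero to_ac_eq_0_iff)

lemma radicand_add: "radicand (\<lambda>j. u j + v j) = radicand u * radicand v"
proof -
  have "to_ac (radicand (\<lambda>j. u j + v j)) = to_ac (radicand u * radicand v)"
    by (simp add: radicand Y_add power_mult_distrib)
  then show ?thesis by (simp only: to_ac_eq_iff)
qed

lemma radicand_z0 [simp]: "radicand z0 = 1"
proof -
  have "to_ac (radicand z0) = to_ac 1" by (simp only: radicand) simp
  then show ?thesis by (simp only: to_ac_eq_iff)
qed

lemma sum_ch: "\<not> int R dvd pr h u \<Longrightarrow> (\<Sum>g\<in>B. ch g u) = 0"
  using sum_powi_pr[OF prim, of u] by auto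

text \<open>Fourier inversion on G: summing conjugates against the inverse character of
  \<open>w\<close> isolates the \<open>w\<close>-component. The factor \<open>card B\<close> stays
  on the left and is removed later as a unit.\<close>

lemma projection:
  assumes z: "z \<in> L" and w: "w \<in> B"
  shows "to_ac (of_nat (card B) * coord z w) * Y w = (\<Sum>g\<in>B. to_ac (inverse (ch g w)) * aut g z)"
proof -
  have "(\<Sum>g\<in>B. to_ac (inverse (ch g w)) * aut g z) =
        (\<Sum>g\<in>B. \<Sum>u\<in>B. to_ac (inverse (ch g w) * ch g u * coord z u) * Y u)"
    by (simp add: aut_def comb_def sum_distrib_left mult_ac)
  also have "\<dots> = (\<Sum>u\<in>B. to_ac ((\<Sum>g\<in>B. inverse (ch g w) * ch g u) * coord z u) * Y u)"
    by (subst sum.swap) (simp add: sum_distrib_right to_ac_sum)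
  also have "\<dots> = (\<Sum>u\<in>B. if u = w then to_ac (of_nat (card B) * coord z w) * Y w else 0)"
  proof (rule sum.cong[OF refl])
    fix u assume u: "u \<in> B"
    show "to_ac ((\<Sum>g\<in>B. inverse (ch g w) * ch g u) * coord z u) * Y u =
          (if u = w then to_ac (of_nat (card B) * coord z w) * Y w else 0)"
    proof (cases "u = w")
      case True
      have "inverse (ch g w) * ch g w = 1" for g by simp
      then show ?thesis using True by simp
    next
      case False
      let ?d = "\<lambda>j. u j + - w j"
      have "inverse (ch g w) * ch g u = ch g ?d" for g
        by (simp only: pairing_add_right pairing_uminus_right power_int_add[OF disjI1[OF zeta_nz]] power_int_minus) (simp add: mult_ac)
      moreover have "\<exists>h. \<not> int R dvd pr h ?d"
      proof (rule ccontr)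
        assume "\<not> ?thesis"
        then have "int R dvd pr h (red ?d)" for h using pr_red_right[of h ?d] cong_dvd_iff by blast
        then have r0: "red ?d = z0" by (intro pr_nondegenerate) auto
        have "u j = w j" for j
        proof (cases "j \<in> {1..n}")
          case True
          have "(u j - w j) mod int (r j) = 0"
            using fun_cong[OF r0, of j] True by (simp add: residue_vec_def zero_vec_def)
          then have "u j mod int (r j) = w j mod int (r j)" by (metis mod_eq_dvd_iff mod_0_imp_dvd)
          then show ?thesis using u w True by (auto simp: residue_box_def PiE_iff)
        next
          case False then show ?thesis using u w by (auto simp: residue_box_def PiE_iff extensional_def)
        qed
        then show False using \<open>u \<noteq> w\<close> by blast
      qed
      ultimately have "(\<Sum>g\<in>B. inverse (ch g w) * ch g u) = 0" using sum_ch by auto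
      then show ?thesis using False by simp
    qed
  qed
  finally show ?thesis using w by simp
qed

lemma card_B: "card B = (\<Prod>j\<in>{1..n}. r j)"
  by (simp add: residue_box_def card_PiE)

lemma card_B_nz: "of_nat (card B) \<noteq> (0 :: 'b)"
proof -
  have "of_nat (r j) \<noteq> (0 :: 'b)" if "j \<in> {1..n}" for j
  proof
    assume "of_nat (r j) = (0 :: 'b)"
    moreover obtain m where "R = r j * m" using r_dvd \<open>j \<in> {1..n}\<close> by auto
    ultimately show False using R_nz by simp
  qed
  then show ?thesis by (simp add: card_B)
qed

end

context valued_radical_field
begin

abbreviation "A \<equiv> valuation_ring V"

lemma A_0 [simp]: "0 \<in> A" and A_1 [simp]: "1 \<in> A"
  by (auto simp: valuation_ring_def valuation_one val)

lemma A_mult: "a \<in> A \<Longrightarrow> b \<in> A \<Longrightarrow> a * b \<in> A"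
  by (auto simp: valuation_ring_def valuation_mult val)

lemma A_power: "a \<in> A \<Longrightarrow> a ^ m \<in> A"
  by (induction m) (auto intro: A_mult)

lemma A_root_of_unity: "a ^ m = 1 \<Longrightarrow> m > 0 \<Longrightarrow> a \<in> A"
  by (auto simp: valuation_ring_def valuation_root_of_unity[OF val])

text \<open>Complete integral closedness: if \<open>v k\<close> were negative,
  \<open>v d + t * v k\<close> would be negative for large \<open>t\<close>. This turns a common
  denominator of all powers into integrality.\<close>

lemma A_cic:
  assumes "d \<noteq> 0" "\<And>t. d * k ^ t \<in> A"
  shows "k \<in> A"
proof -
  have "0 \<le> v k" if v: "v \<in> V" and k: "k \<noteq> 0" for v
  proof (rule ccontr)
    assume "\<not> 0 \<le> v k"
    then have neg: "v k \<le> -1" by simp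
    define t where "t = nat (\<bar>v d\<bar> + 1)"
    have "0 \<le> v (d * k ^ t)" using assms v k by (auto simp: valuation_ring_def)
    also have "\<dots> = v d + int t * v k"
      using assms(1) k by (simp add: valuation_mult valuation_power val[OF v])
    also have "int t * v k \<le> int t * (-1)" using neg by (intro mult_left_mono) auto
    finally show False by (simp add: t_def)
  qed
  then show ?thesis by (auto simp: valuation_ring_def)
qed

text \<open>
  The \<open>w\<close>-component of an integral element is integral by \<open>projection\<close>, since \<open>card B\<close> is a unit;
  so integrality can be tested on the \<open>R\<close>-th powers of the components, which lie in \<open>K\<close>.
\<close>

definition integral_elts :: "'a Kbar set" where
  "integral_elts = {z \<in> L. \<forall>w\<in>B. coord z w ^ R * radicand w \<in> A}"

text \<open>For each valuation the condition reads \<open>R * v a + v c \<ge> 0\<close>, which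
  passes to sums by the ultrametric inequality.\<close>

lemma cond_add:
  assumes "a ^ R * c \<in> A" "b ^ R * c \<in> A" "c \<noteq> 0"
  shows "(a + b) ^ R * c \<in> A"
proof (cases "a = 0 \<or> b = 0 \<or> a + b = 0")
  case True then show ?thesis using assms R_pos by (auto simp: power_0_left)
next
  case False
  have "0 \<le> v ((a + b) ^ R * c)" if v: "v \<in> V" for v
  proof -
    have "0 \<le> int R * v a + v c" "0 \<le> int R * v b + v c"
      using assms v False by (auto simp: valuation_ring_def valuation_mult valuation_power val)
    moreover have "int R * min (v a) (v b) \<le> int R * v (a + b)"
      using valuation_add[OF val[OF v], of a b] False by (intro mult_left_mono) auto
    ultimately have "0 \<le> int R * v (a + b) + v c" by (auto simp: min_def split: if_splits)
    then show ?thesis using False assms(3) v by (simp add: valuation_mult valuation_power val)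
  qed
  then show ?thesis by (auto simp: valuation_ring_def)
qed

lemma integral_elts_add: "a \<in> integral_elts \<Longrightarrow> b \<in> integral_elts \<Longrightarrow> a + b \<in> integral_elts"
  by (auto simp: integral_elts_def L_add coord_add intro: cond_add)

lemma integral_elts_0 [simp]: "0 \<in> integral_elts"
proof -
  have "coord 0 w = 0" if "w \<in> B" for w
    using coord_scale[of 0 w 0] that by simp
  then show ?thesis using R_pos by (simp add: integral_elts_def power_0_left)
qed

lemma integral_elts_sum: "(\<And>i. i \<in> I \<Longrightarrow> f i \<in> integral_elts) \<Longrightarrow> sum f I \<in> integral_elts"
  by (induction I rule: infinite_finite_induct) (auto intro: integral_elts_add)

lemma mono_integral_iff: "to_ac k * Y u \<in> integral_elts \<longleftrightarrow> k ^ R * radicand u \<in> A"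
proof -
  obtain k' where k': "k' \<noteq> 0" "Y u = to_ac k' * Y (red u)" using Y_red by metis
  have eq: "to_ac k * Y u = to_ac (k * k') * Y (red u)" by (simp add: k')
  have "to_ac (radicand u) = to_ac (k' ^ R * radicand (red u))"
    unfolding radicand by (simp add: k' radicand power_mult_distrib)
  then have ku: "radicand u = k' ^ R * radicand (red u)" by (simp only: to_ac_eq_iff)
  have cfe: "coord (to_ac k * Y u) w = (if w = red u then k * k' else 0)" if "w \<in> B" for w
    using that unfolding eq by (rule coord_mono) simp
  show ?thesis
    unfolding integral_elts_def using R_pos
    by (auto simp: cfe ku power_mult_distrib mult_ac power_0_left)
qed

lemma K_integral_iff: "to_ac k \<in> integral_elts \<longleftrightarrow> k \<in> A"
proof
  assume "to_ac k \<in> integral_elts"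
  then have kR: "k ^ R \<in> A" using mono_integral_iff[of k z0] by simp
  show "k \<in> A"
  proof (cases "k = 0")
    case False
    have "0 \<le> v k" if "v \<in> V" for v
      using kR that False R_pos by (auto simp: valuation_ring_def valuation_power val zero_le_mult_iff)
    then show ?thesis by (auto simp: valuation_ring_def)
  qed auto
next
  assume "k \<in> A" then show "to_ac k \<in> integral_elts" using mono_integral_iff[of k z0] A_power by simp
qed

lemma integral_elts_1 [simp]: "1 \<in> integral_elts"
  using K_integral_iff[of 1] by simp

lemma integral_elts_mult:
  assumes "a \<in> integral_elts" "b \<in> integral_elts" shows "a * b \<in> integral_elts"
proof -
  have aL: "a \<in> L" "b \<in> L" using assms by (auto simp: integral_elts_def)
  have "a * b = (\<Sum>v\<in>B. \<Sum>w\<in>B. to_ac (coord a v * coord b w) * Y (\<lambda>j. v j + w j))"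
    using comb_mult[of "coord a" "coord b"] aL by (simp add: comb_coord)
  also have "\<dots> \<in> integral_elts"
  proof (intro integral_elts_sum)
    fix v w assume "v \<in> B" "w \<in> B"
    then have "(coord a v ^ R * radicand v) * (coord b w ^ R * radicand w) \<in> A"
      using assms by (intro A_mult[of "_ * _" "_ * _"]) (auto simp: integral_elts_def)
    then show "to_ac (coord a v * coord b w) * Y (\<lambda>j. v j + w j) \<in> integral_elts"
      unfolding mono_integral_iff radicand_add by (simp add: power_mult_distrib mult_ac)
  qed
  finally show ?thesis .
qed

lemma integral_elts_uminus: "a \<in> integral_elts \<Longrightarrow> - a \<in> integral_elts"
proof -
  assume a: "a \<in> integral_elts"
  have "to_ac (-1) \<in> integral_elts" unfolding K_integral_iff by (rule A_root_of_unity[of _ 2]) auto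
  from integral_elts_mult[OF this a] show ?thesis by simp
qed

lemma integral_elts_diff: "a \<in> integral_elts \<Longrightarrow> b \<in> integral_elts \<Longrightarrow> a - b \<in> integral_elts"
  using integral_elts_add[OF _ integral_elts_uminus] by force

lemma zeta_powi_pow_R: "(\<zeta> powi i) ^ R = 1"
proof -
  have "(\<zeta> powi i) ^ R = \<zeta> powi (i * int R)" by (simp add: power_int_mult)
  then show ?thesis by (simp add: powi_prim_root_eq_1_iff[OF prim])
qed

lemma integral_elts_aut: "a \<in> integral_elts \<Longrightarrow> aut g a \<in> integral_elts"
  by (auto simp: integral_elts_def coord_aut power_mult_distrib zeta_powi_pow_R)

lemma aut_diff: "a \<in> L \<Longrightarrow> b \<in> L \<Longrightarrow> aut g (a - b) = aut g a - aut g b"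
  using aut_add[of "a - b" b g] L_diff[of a b] by simp

text \<open>The integral equation is the product of the \<open>T - aut g z\<close> over the group.
  Its coefficients are again in \<open>integral_elts\<close> and invariant, hence in
  \<open>K\<close>, where \<open>integral_elts\<close> and \<open>A\<close> agree.\<close>

lemma integral_elts_integral:
  assumes z: "z \<in> integral_elts"
  shows "z \<in> integral_closure_in (to_ac ` A) L"
proof -
  have zL: "z \<in> L" using z by (simp add: integral_elts_def)
  define p where "p = (\<Prod>g\<in>B. [:- aut g z, 1:])"
  have "lead_coeff p = 1" unfolding p_def lead_coeff_prod by simp
  moreover have "poly p z = 0"
  proof -
    have "poly p z = (\<Prod>g\<in>B. z - aut g z)" by (simp add: p_def poly_prod)
    moreover have "z - aut z0 z = 0" using aut_z0 zL by simp
    ultimately show ?thesis by (metis finite_B prod_zero z0_in_B)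
  qed
  moreover have "coeff p i \<in> to_ac ` A" for i
  proof -
    have cI: "coeff p i \<in> integral_elts" unfolding p_def
      by (rule prod_linear_coeff_closed) (auto intro: integral_elts_diff integral_elts_mult integral_elts_aut z)
    then have cL: "coeff p i \<in> L" by (simp add: integral_elts_def)
    have "aut h (coeff p i) = coeff p i" for h
    proof -
      have "aut h (coeff p i) = coeff (\<Prod>g\<in>B. [:- aut h (aut g z), 1:]) i"
        unfolding p_def by (rule prod_linear_coeff_hom[where M = L]) (auto intro: L_diff L_mult aut_diff aut_mult)
      also have "(\<Prod>g\<in>B. [:- aut h (aut g z), 1:]) = (\<Prod>g\<in>B. [:- aut (red (\<lambda>j. g j + h j)) z, 1:])"
        by (simp add: aut_aut zL aut_red add.commute)
      also have "\<dots> = p" unfolding p_def by (rule prod.reindex_bij_betw[OF red_add_bij])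
      finally show ?thesis .
    qed
    then have eq: "coeff p i = to_ac (coord (coeff p i) z0)" by (intro fixed_in_K cL)
    then have "coord (coeff p i) z0 \<in> A" using cI K_integral_iff by metis
    then show ?thesis using eq by blast
  qed
  ultimately show ?thesis using zL by (auto simp: integral_closure_in_def)
qed

lemma common_denominator:
  assumes "finite S" "S \<subseteq> L"
  shows "\<exists>d. d \<noteq> 0 \<and> d \<in> A \<and> (\<forall>z\<in>S. to_ac d * z \<in> integral_elts)"
proof -
  have mono: "\<exists>d. d \<noteq> 0 \<and> d \<in> A \<and> to_ac d * (to_ac c * Y w) \<in> integral_elts" for c w
  proof -
    obtain d1 where d1: "d1 \<noteq> 0" "d1 \<in> A" "d1 * c \<in> A" using denom by blast
    obtain d2 where d2: "d2 \<noteq> 0" "d2 \<in> A" "d2 * radicand w \<in> A" using denom by blast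
    \<comment> \<open>\<open>d1\<close> clears the coefficient and \<open>d2\<close> the radicand;
      of the \<open>R\<close> factors \<open>d2\<close> one is spent on the radicand.\<close>
    have "(d1 * c) ^ R * (d2 ^ (R - 1) * (d2 * radicand w)) \<in> A"
      by (rule A_mult[OF A_power[OF d1(3)] A_mult[OF A_power[OF d2(2)] d2(3)]])
    also have "(d1 * c) ^ R * (d2 ^ (R - 1) * (d2 * radicand w)) = (d1 * d2 * c) ^ R * radicand w"
      using R_pos by (cases R) (auto simp: power_mult_distrib mult_ac)
    finally have "to_ac (d1 * d2 * c) * Y w \<in> integral_elts" unfolding mono_integral_iff .
    then show ?thesis using d1 d2 by (intro exI[of _ "d1 * d2"]) (auto intro: A_mult simp: mult_ac)
  qed
  have fin: "\<exists>d. d \<noteq> 0 \<and> d \<in> A \<and> (\<forall>i\<in>I. to_ac d * f i \<in> integral_elts)"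
    if "finite I" "\<And>i. i \<in> I \<Longrightarrow> \<exists>d. d \<noteq> 0 \<and> d \<in> A \<and> to_ac d * f i \<in> integral_elts"
    for I :: "'i set" and f
    using that
  proof (induction I rule: finite_induct)
    case empty then show ?case by (intro exI[of _ 1]) auto
  next
    case (insert i I)
    obtain d1 where d1: "d1 \<noteq> 0" "d1 \<in> A" "\<forall>i\<in>I. to_ac d1 * f i \<in> integral_elts" using insert by blast
    obtain d2 where d2: "d2 \<noteq> 0" "d2 \<in> A" "to_ac d2 * f i \<in> integral_elts" using insert by blast
    have "to_ac (d1 * d2) * f j \<in> integral_elts" if "j \<in> insert i I" for j
    proof (cases "j = i")
      case True
      have "to_ac d1 * (to_ac d2 * f i) \<in> integral_elts"
        by (rule integral_elts_mult[OF _ d2(3)]) (simp add: K_integral_iff d1)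
      then show ?thesis using True by (simp add: mult_ac)
    next
      case False
      then have "to_ac d2 * (to_ac d1 * f j) \<in> integral_elts"
        using d1 that by (intro integral_elts_mult[OF iffD2[OF K_integral_iff d2(2)]]) auto
      then show ?thesis by (simp add: mult_ac)
    qed
    then show ?case using d1 d2 by (intro exI[of _ "d1 * d2"]) (auto intro: A_mult)
  qed
  show ?thesis
  proof (rule fin[OF assms(1), of "\<lambda>z. z", simplified])
    fix z assume "z \<in> S"
    then have z: "z \<in> L" using assms by blast
    obtain d where d: "d \<noteq> 0" "d \<in> A" "\<forall>w\<in>B. to_ac d * (to_ac (coord z w) * Y w) \<in> integral_elts"
      using fin[OF finite_B, of "\<lambda>w. to_ac (coord z w) * Y w"] mono by blast
    have "to_ac d * z = (\<Sum>w\<in>B. to_ac d * (to_ac (coord z w) * Y w))"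
      using comb_coord[OF z] by (simp add: comb_def sum_distrib_left[symmetric])
    also have "\<dots> \<in> integral_elts" using d by (intro integral_elts_sum) auto
    finally show "\<exists>d. d \<noteq> 0 \<and> d \<in> A \<and> to_ac d * z \<in> integral_elts" using d by blast
  qed
qed

text \<open>A common denominator for all powers of an element is a workable substitute for an
  integral equation: by the binomial formula it passes to sums at once, and for elements of
  \<open>K\<close> it yields integrality by \<open>A_cic\<close>.\<close>

lemma bounded_powers_add:
  assumes "\<And>i. to_ac d * a ^ i \<in> integral_elts" "\<And>i. to_ac e * b ^ i \<in> integral_elts"
  shows "to_ac (d * e) * (a + b) ^ i \<in> integral_elts"
proof -
  have "to_ac (d * e) * (a + b) ^ i =
      (\<Sum>k\<le>i. of_nat (i choose k) * ((to_ac d * a ^ k) * (to_ac e * b ^ (i - k))))"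
    by (simp add: binomial_ring sum_distrib_left mult_ac)
  also have "\<dots> \<in> integral_elts"
  proof (intro integral_elts_sum integral_elts_mult[OF _ integral_elts_mult[OF assms]])
    fix k
    have "of_nat m \<in> integral_elts" for m
      by (induction m) (auto intro: integral_elts_add)
    then show "of_nat (i choose k) \<in> integral_elts" .
  qed
  finally show ?thesis .
qed

lemma bounded_powers_sum:
  assumes "finite I" "\<And>g i. g \<in> I \<Longrightarrow> to_ac d * f g ^ i \<in> integral_elts"
  shows "to_ac (d ^ card I) * (\<Sum>g\<in>I. f g) ^ i \<in> integral_elts"
  using assms
proof (induction I arbitrary: i rule: finite_induct)
  case empty
  then show ?case by (cases i) auto
next
  case (insert x F)
  have "to_ac (d * d ^ card F) * (f x + (\<Sum>g\<in>F. f g)) ^ i \<in> integral_elts"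
    by (rule bounded_powers_add) (use insert in auto)
  then show ?case using insert.hyps by simp
qed

lemma integral_bounded_powers:
  assumes "z \<in> integral_closure_in (to_ac ` A) L"
  obtains d where "d \<noteq> 0" "d \<in> A" "\<And>i. to_ac d * z ^ i \<in> integral_elts"
proof -
  obtain p where p: "lead_coeff p = 1" "\<And>i. coeff p i \<in> to_ac ` A" "poly p z = 0" and z: "z \<in> L"
    using assms by (auto simp: integral_closure_in_def)
  define m where "m = degree p"
  obtain d where d: "d \<noteq> 0" "d \<in> A" "\<forall>x\<in>(\<lambda>i. z ^ i) ` {..<m}. to_ac d * x \<in> integral_elts"
    using common_denominator[of "(\<lambda>i. z ^ i) ` {..<m}"] z L_power by blast
  have "poly p z = (\<Sum>i\<le>m. coeff p i * z ^ i)" by (simp add: poly_altdef m_def)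
  also have "\<dots> = (\<Sum>i<m. coeff p i * z ^ i) + z ^ m"
    using p(1) by (simp add: m_def lessThan_Suc_atMost[symmetric])
  finally have zm: "z ^ m = - (\<Sum>i<m. coeff p i * z ^ i)" using p(3) by (simp add: eq_neg_iff_add_eq_0 add.commute)
  have "to_ac d * z ^ i \<in> integral_elts" for i
  proof (induction i rule: less_induct)
    case (less i)
    show ?case
    proof (cases "i < m")
      case True then show ?thesis using d by auto
    next
      case False
      then have "z ^ i = z ^ (i - m) * z ^ m" by (simp flip: power_add)
      also have "\<dots> = - (\<Sum>j<m. coeff p j * z ^ (i - m + j))"
        by (simp add: zm sum_distrib_left power_add mult_ac)
      finally have "to_ac d * z ^ i = - (\<Sum>j<m. coeff p j * (to_ac d * z ^ (i - m + j)))"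
        by (simp add: sum_distrib_left mult_ac)
      also have "\<dots> \<in> integral_elts"
      proof (intro integral_elts_uminus integral_elts_sum)
        fix j assume j: "j \<in> {..<m}"
        have "coeff p j \<in> integral_elts" using p(2)[of j] K_integral_iff by auto
        moreover have "to_ac d * z ^ (i - m + j) \<in> integral_elts" by (rule less) (use j False in auto)
        ultimately show "coeff p j * (to_ac d * z ^ (i - m + j)) \<in> integral_elts"
          by (rule integral_elts_mult)
      qed
      finally show ?thesis .
    qed
  qed
  then show ?thesis using d that by blast
qed

theorem integral_closure_eq: "integral_closure_in (to_ac ` A) L = integral_elts"
proof
  show "integral_elts \<subseteq> integral_closure_in (to_ac ` A) L"
    using integral_elts_integral by blast
  show "integral_closure_in (to_ac ` A) L \<subseteq> integral_elts"
  proof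
    fix z assume zi: "z \<in> integral_closure_in (to_ac ` A) L"
    then have z: "z \<in> L" by (simp add: integral_closure_in_def)
    obtain d where d: "d \<noteq> 0" "d \<in> A" "\<And>i. to_ac d * z ^ i \<in> integral_elts"
      using integral_bounded_powers[OF zi] by blast
    have "coord z w ^ R * radicand w \<in> A" if w: "w \<in> B" for w
    proof -
      let ?N = "of_nat (card B) :: 'a poly fract"
      define om where "om = (\<Sum>g\<in>B. to_ac (inverse (ch g w)) * aut g z)"
      have om: "om = to_ac (?N * coord z w) * Y w" unfolding om_def by (rule projection[OF z w, symmetric])
      have "to_ac d * (to_ac (inverse (ch g w)) * aut g z) ^ i \<in> integral_elts" for g i
      proof -
        have "aut g (to_ac d * z ^ i) \<in> integral_elts" by (intro integral_elts_aut d)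
        then have 1: "to_ac d * aut g z ^ i \<in> integral_elts"
          using z by (simp add: aut_mult aut_power L_power)
        have "to_ac (inverse (ch g w)) \<in> integral_elts"
          unfolding K_integral_iff
          by (rule A_root_of_unity[OF _ R_pos]) (simp add: power_inverse zeta_powi_pow_R)
        then have "to_ac (inverse (ch g w)) ^ i \<in> integral_elts"
          by (induction i) (auto intro: integral_elts_mult)
        from integral_elts_mult[OF this 1] show ?thesis by (simp add: power_mult_distrib mult_ac)
      qed
      then have 2: "to_ac (d ^ card B) * om ^ i \<in> integral_elts" for i
        unfolding om_def by (intro bounded_powers_sum) auto
      define k where "k = (?N * coord z w) ^ R * radicand w"
      \<comment> \<open>The \<open>R\<close>-th power of the component lies in \<open>K\<close>,
        where \<open>A_cic\<close> applies; so only the powers of \<open>om\<close> with exponents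
        \<open>R * t\<close> are used.\<close>
      have "om ^ R = to_ac k" unfolding om k_def by (simp add: power_mult_distrib radicand)
      then have "to_ac (d ^ card B) * om ^ (R * t) = to_ac (d ^ card B * k ^ t)" for t
        by (simp add: power_mult)
      then have "d ^ card B * k ^ t \<in> A" for t using 2[of "R * t"] K_integral_iff by metis
      then have kA: "k \<in> A" by (rule A_cic[rotated]) (simp add: d(1))
      show ?thesis
      proof (cases "coord z w = 0")
        case True then show ?thesis using R_pos by (simp add: power_0_left)
      next
        case False
        have "0 \<le> v (coord z w ^ R * radicand w)" if v: "v \<in> V" for v
        proof -
          have "0 \<le> v k" using kA v False card_B_nz by (auto simp: valuation_ring_def k_def)
          also have "v k = v (?N ^ R * (coord z w ^ R * radicand w))" by (simp add: k_def power_mult_distrib mult_ac)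
          also have "\<dots> = int R * v ?N + v (coord z w ^ R * radicand w)"
            using False card_B_nz by (simp add: valuation_mult[OF val[OF v]] valuation_power[OF val[OF v]])
          finally show ?thesis using val_of_nat[OF v card_B_nz] by simp
        qed
        then show ?thesis by (auto simp: valuation_ring_def)
      qed
    qed
    then show "z \<in> integral_elts" using z by (simp add: integral_elts_def)
  qed
qed

end

section \<open>Valuations of the rational function field\<close>

definition monic_irred :: "'a :: field poly \<Rightarrow> bool" where
  "monic_irred P \<longleftrightarrow> Factorial_Ring.irreducible P \<and> lead_coeff P = 1"

definition pmult :: "'a :: field poly \<Rightarrow> 'a poly \<Rightarrow> nat" where
  "pmult P f = Max {m. P ^ m dvd f}"

lemma monic_irred_props:
  assumes "monic_irred P"
  shows "P \<noteq> 0" "\<not> is_unit P" "prime_elem P" "degree P > 0" "lead_coeff P = 1"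
proof -
  show "P \<noteq> 0" "\<not> is_unit P" "lead_coeff P = 1" using assms by (auto simp: monic_irred_def Factorial_Ring.irreducible_def)
  show "prime_elem P" using assms by (auto simp: monic_irred_def intro: field_poly_irreducible_imp_prime)
  show "degree P > 0" using \<open>\<not> is_unit P\<close> \<open>P \<noteq> 0\<close> by (auto simp: is_unit_iff_degree)
qed

lemma degree_power_ge: "monic_irred P \<Longrightarrow> degree (P ^ m) \<ge> m"
  using monic_irred_props(4)[of P] by (simp add: degree_power_eq monic_irred_props(1))

lemma finite_power_dvd:
  assumes "monic_irred P" "f \<noteq> 0" shows "finite {m. P ^ m dvd f}"
proof (rule finite_subset)
  show "{m. P ^ m dvd f} \<subseteq> {..degree f}"
    using assms degree_power_ge dvd_imp_degree_le le_trans by blast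
qed simp

lemma power_dvd_iff_pmult:
  assumes "monic_irred P" "f \<noteq> 0" shows "P ^ m dvd f \<longleftrightarrow> m \<le> pmult P f"
proof
  assume "P ^ m dvd f" then show "m \<le> pmult P f"
    unfolding pmult_def using finite_power_dvd[OF assms] by (intro Max_ge) auto
next
  have "P ^ pmult P f dvd f"
    using Max_in[OF finite_power_dvd[OF assms]] unfolding pmult_def by (metis (mono_tags, lifting) empty_iff mem_Collect_eq one_dvd power_0)
  then show "m \<le> pmult P f \<Longrightarrow> P ^ m dvd f" using le_imp_power_dvd dvd_trans by blast
qed

lemma dvd_iff_pmult_pos: "monic_irred P \<Longrightarrow> f \<noteq> 0 \<Longrightarrow> P dvd f \<longleftrightarrow> pmult P f > 0"
  using power_dvd_iff_pmult[of P f 1] by auto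

lemma pmult_unique:
  assumes P: "monic_irred P" and f: "f = P ^ m * g" "\<not> P dvd g"
  shows "pmult P f = m"
proof -
  have g0: "g \<noteq> 0" using f by auto
  have f0: "f \<noteq> 0" using f g0 monic_irred_props(1)[OF P] by auto
  have "m \<le> pmult P f" using power_dvd_iff_pmult[OF P f0, of m] f by simp
  moreover have "\<not> Suc m \<le> pmult P f"
  proof
    assume "Suc m \<le> pmult P f"
    then have "P ^ Suc m dvd f" using power_dvd_iff_pmult[OF P f0] by blast
    then have "P ^ m * P dvd P ^ m * g" using f by (simp add: mult.commute)
    then show False using f(2) monic_irred_props(1)[OF P] by simp
  qed
  ultimately show ?thesis by simp
qed

lemma pmult_decomp:
  assumes P: "monic_irred P" and "f \<noteq> 0"
  obtains g where "f = P ^ pmult P f * g" "\<not> P dvd g" "g \<noteq> 0"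
proof -
  have "P ^ pmult P f dvd f" using power_dvd_iff_pmult[OF assms] by blast
  then obtain g where g: "f = P ^ pmult P f * g" by auto
  have "\<not> P dvd g"
  proof
    assume "P dvd g"
    then have "P ^ Suc (pmult P f) dvd f" by (subst (2) g) (simp add: mult.commute)
    then show False using power_dvd_iff_pmult[OF assms] by (metis Suc_n_not_le_n)
  qed
  moreover have "g \<noteq> 0" using g assms(2) by auto
  ultimately show ?thesis using g that by blast
qed

lemma pmult_mult:
  assumes P: "monic_irred P" and "f \<noteq> 0" "g \<noteq> 0"
  shows "pmult P (f * g) = pmult P f + pmult P g"
proof -
  obtain f' where f': "f = P ^ pmult P f * f'" "\<not> P dvd f'" using pmult_decomp[OF P assms(2)] by metis
  obtain g' where g': "g = P ^ pmult P g * g'" "\<not> P dvd g'" using pmult_decomp[OF P assms(3)] by metis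
  have "f * g = P ^ (pmult P f + pmult P g) * (f' * g')"
    by (subst f'(1), subst g'(1)) (simp add: power_add mult_ac)
  moreover have "\<not> P dvd f' * g'"
    using f'(2) g'(2) monic_irred_props(3)[OF P] prime_elem_dvd_mult_iff by blast
  ultimately show ?thesis by (rule pmult_unique[OF P])
qed

lemma pmult_add:
  assumes P: "monic_irred P" and "f \<noteq> 0" "g \<noteq> 0" "f + g \<noteq> 0"
  shows "min (pmult P f) (pmult P g) \<le> pmult P (f + g)"
proof -
  have "P ^ min (pmult P f) (pmult P g) dvd f + g"
    using power_dvd_iff_pmult[OF P] assms by (intro dvd_add) auto
  then show ?thesis using power_dvd_iff_pmult[OF P assms(4)] by blast
qed

lemma pmult_unit: "monic_irred P \<Longrightarrow> is_unit f \<Longrightarrow> pmult P f = 0"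
  by (rule pmult_unique[of P f 0 f]) (auto dest: monic_irred_props(2) dvd_trans)

lemma pmult_1 [simp]: "monic_irred P \<Longrightarrow> pmult P 1 = 0"
  by (rule pmult_unit) auto

lemma pmult_power: "monic_irred P \<Longrightarrow> f \<noteq> 0 \<Longrightarrow> pmult P (f ^ m) = m * pmult P f"
  by (induction m) (auto simp: pmult_mult)

lemma pmult_prod:
  "monic_irred P \<Longrightarrow> (\<And>i. i \<in> I \<Longrightarrow> f i \<noteq> 0) \<Longrightarrow> pmult P (\<Prod>i\<in>I. f i) = (\<Sum>i\<in>I. pmult P (f i))"
  by (induction I rule: infinite_finite_induct) (auto simp: pmult_mult)

lemma pmult_self: "monic_irred P \<Longrightarrow> pmult P P = 1"
  by (rule pmult_unique[of P P 1 1]) (auto dest: monic_irred_props(2))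

lemma monic_irred_dvd_iff: "monic_irred P \<Longrightarrow> monic_irred Q \<Longrightarrow> P dvd Q \<longleftrightarrow> P = Q"
proof
  assume P: "monic_irred P" and Q: "monic_irred Q" and "P dvd Q"
  then obtain c where c: "Q = P * c" by auto
  then have "is_unit c" using Q P monic_irred_props(2)[OF P] by (metis Factorial_Ring.irreducibleD monic_irred_def)
  then obtain a where "c = [:a:]" by (elim is_unit_polyE)
  moreover from this have "a = 1"
  proof -
    have "lead_coeff Q = lead_coeff P * lead_coeff c" unfolding c by (rule Polynomial.lead_coeff_mult)
    then show ?thesis using \<open>c = [:a:]\<close> monic_irred_props(5)[OF P] monic_irred_props(5)[OF Q]
      by (cases "a = 0") auto
  qed
  ultimately show "P = Q" using c by (simp add: one_pCons[symmetric])
qed auto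

lemma pmult_other: "monic_irred P \<Longrightarrow> monic_irred Q \<Longrightarrow> P \<noteq> Q \<Longrightarrow> pmult P Q = 0"
  by (rule pmult_unique[of P Q 0 Q]) (auto simp: monic_irred_dvd_iff)

lemma irreducible_factor_exists:
  fixes f :: "'a :: field poly"
  assumes "degree f > 0"
  shows "\<exists>P. monic_irred P \<and> P dvd f"
  using assms
proof (induction "degree f" arbitrary: f rule: less_induct)
  case less
  show ?case
  proof (cases "Factorial_Ring.irreducible f")
    case True
    let ?P = "smult (inverse (lead_coeff f)) f"
    have f0: "f \<noteq> 0" using less.prems by auto
    have "Factorial_Ring.irreducible ?P"
    proof -
      have "?P = [:inverse (lead_coeff f):] * f" by simp
      moreover have "is_unit [:inverse (lead_coeff f):]" using f0 by (simp add: is_unit_pCons_iff)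
      ultimately show ?thesis using True irreducible_mult_unit_left by metis
    qed
    then have "monic_irred ?P" using f0 by (simp add: monic_irred_def)
    moreover have "?P dvd f" using f0 by (simp add: smult_dvd_iff)
    ultimately show ?thesis by blast
  next
    case False
    have fn: "f \<noteq> 0" using less.prems by auto
    have "\<not> is_unit f" using less.prems is_unit_iff_degree[OF fn] by simp
    note f0 = fn this
    then obtain a b where ab: "f = a * b" "\<not> is_unit a" "\<not> is_unit b"
      using False by (auto simp: Factorial_Ring.irreducible_def)
    then have "a \<noteq> 0" "b \<noteq> 0" using f0 by auto
    then have "degree a > 0" "degree b > 0" using ab by (auto simp: is_unit_iff_degree)
    moreover from this have "degree a < degree f" using ab \<open>a \<noteq> 0\<close> \<open>b \<noteq> 0\<close> by (simp add: degree_mult_eq)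
    ultimately obtain P where "monic_irred P" "P dvd a" using less.hyps by blast
    then show ?thesis using ab by (metis dvd_mult2)
  qed
qed

lemma dvd_if_pmult_le:
  fixes f g :: "'a :: field poly"
  assumes "g \<noteq> 0" "f \<noteq> 0" "\<And>P. monic_irred P \<Longrightarrow> pmult P g \<le> pmult P f"
  shows "g dvd f"
  using assms
proof (induction "degree g" arbitrary: f g rule: less_induct)
  case less
  show ?case
  proof (cases "degree g = 0")
    case True
    then show ?thesis using less.prems by (meson is_unit_iff_degree unit_imp_dvd)
  next
    case False
    then obtain P where P: "monic_irred P" "P dvd g" using irreducible_factor_exists[of g] by auto
    then obtain g' where g': "g = P * g'" by auto
    have "pmult P f > 0" using less.prems(3)[OF P(1)] dvd_iff_pmult_pos[OF P(1) less.prems(1)] P(2) by simp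
    then obtain f' where f': "f = P * f'" using dvd_iff_pmult_pos[OF P(1) less.prems(2)] by auto
    have nz: "P \<noteq> 0" "g' \<noteq> 0" "f' \<noteq> 0" using less.prems g' f' by auto
    have "pmult Q g' \<le> pmult Q f'" if "monic_irred Q" for Q
      using less.prems(3)[OF that] nz that by (simp add: g' f' pmult_mult)
    moreover have "degree g' < degree g" using nz monic_irred_props(4)[OF P(1)] by (simp add: g' degree_mult_eq)
    ultimately have "g' dvd f'" using less.hyps nz by blast
    then show ?thesis by (simp add: g' f')
  qed
qed

lemma finite_prime_divisors:
  fixes f :: "'a :: {field,finite} poly"
  assumes "f \<noteq> 0" shows "finite {P. monic_irred P \<and> P dvd f}"
proof (rule finite_subset)
  show "{P. monic_irred P \<and> P dvd f} \<subseteq> {P. degree P \<le> degree f}"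
    using assms dvd_imp_degree_le by blast
  show "finite {P :: 'a poly. degree P \<le> degree f}"
  proof (rule finite_subset)
    show "{P :: 'a poly. degree P \<le> degree f} \<subseteq> Poly ` {xs. set xs \<subseteq> UNIV \<and> length xs \<le> Suc (degree f)}"
    proof
      fix P :: "'a poly" assume "P \<in> {P. degree P \<le> degree f}"
      then have "length (coeffs P) \<le> Suc (degree f)"
        by (cases "P = 0") (auto simp: length_coeffs_degree)
      then show "P \<in> Poly ` {xs. set xs \<subseteq> UNIV \<and> length xs \<le> Suc (degree f)}"
        by (intro image_eqI[of _ _ "coeffs P"]) auto
    qed
  qed (intro finite_imageI finite_lists_length_le, simp)
qed

text \<open>\<open>S\<close> may contain primes that do not divide \<open>f\<close>, so one set can
  serve several polynomials: the primes of a whole tuple, or all primes of bounded degree.\<close>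

lemma monic_factorization:
  fixes f :: "'a :: field poly"
  assumes S: "finite S" "\<And>P. P \<in> S \<Longrightarrow> monic_irred P" and f: "lead_coeff f = 1"
    and div: "\<And>P. monic_irred P \<Longrightarrow> P dvd f \<Longrightarrow> P \<in> S"
  shows "f = (\<Prod>P\<in>S. P ^ pmult P f)"
proof -
  let ?g = "\<Prod>P\<in>S. P ^ pmult P f"
  have f0: "f \<noteq> 0" using f by auto
  have S0: "P \<noteq> 0" if "P \<in> S" for P using S(2)[OF that] monic_irred_props(1) by blast
  have g0: "?g \<noteq> 0" using S S0 by auto
  have eq: "pmult Q ?g = pmult Q f" if Q: "monic_irred Q" for Q
  proof -
    have "pmult Q ?g = (\<Sum>P\<in>S. pmult P f * pmult Q P)"
      using S0 Q by (subst pmult_prod) (auto simp: pmult_power)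
    also have "\<dots> = (\<Sum>P\<in>S. if P = Q then pmult Q f else 0)"
      using S(2) Q by (intro sum.cong) (auto simp: pmult_self pmult_other)
    also have "\<dots> = pmult Q f"
      using S(1) div[OF Q] dvd_iff_pmult_pos[OF Q f0] by auto
    finally show ?thesis .
  qed
  have "?g dvd f" "f dvd ?g" by (intro dvd_if_pmult_le f0 g0; simp add: eq)+
  then obtain c where c: "f = ?g * c" by auto
  have "is_unit c" using \<open>f dvd ?g\<close> c g0 f0 by (metis dvd_mult_cancel_left mult.right_neutral)
  then obtain a where a: "c = [:a:]" by (elim is_unit_polyE)
  have "lead_coeff ?g = (\<Prod>P\<in>S. lead_coeff (P ^ pmult P f))" by (rule Polynomial.lead_coeff_prod)
  also have "\<dots> = 1"
    by (intro prod.neutral ballI) (simp only: Polynomial.lead_coeff_power monic_irred_props(5)[OF S(2)] power_one)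
  finally have "lead_coeff ?g = 1" .
  then have "a = 1" using f c a by (metis Polynomial.lead_coeff_mult lead_coeff_pCons(2) mult_1)
  then show ?thesis using c a by (simp add: one_pCons[symmetric])
qed

text \<open>Extends a function that is additive on products of polynomials to quotients; the
  description covers all representations at once. No representation of 0 qualifies, so the value
  there is unspecified.\<close>

definition fract_val :: "('a :: field poly \<Rightarrow> int) \<Rightarrow> 'a poly fract \<Rightarrow> int" where
  "fract_val w k = (THE i. \<forall>a b. a \<noteq> 0 \<longrightarrow> b \<noteq> 0 \<longrightarrow> k = to_fract a / to_fract b \<longrightarrow> i = w a - w b)"

lemma to_fract_power [simp]: "to_fract (p ^ m) = to_fract (p :: 'a :: idom) ^ m"
  by (induction m) auto

lemma fract_obtain:
  obtains a b where "b \<noteq> 0" "k = to_fract a / to_fract b"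
proof (cases k)
  case (Fract a b)
  then show ?thesis using that[of b a] by (simp add: Fract_conv_to_fract)
qed

lemma fract_val_eq:
  assumes w: "\<And>a b. a \<noteq> 0 \<Longrightarrow> b \<noteq> 0 \<Longrightarrow> w (a * b) = w a + w b" and "a \<noteq> 0" "b \<noteq> 0"
  shows "fract_val w (to_fract a / to_fract b) = w a - w b"
  unfolding fract_val_def
proof (rule the_equality)
  have "w a - w b = w a' - w b'"
    if "a' \<noteq> 0" "b' \<noteq> 0" "to_fract a / to_fract b = to_fract a' / to_fract b'" for a' b'
  proof -
    have "to_fract (a * b') = to_fract (a' * b)" using that assms by (simp add: field_simps)
    then have "a * b' = a' * b" by (simp only: to_fract_eq_iff)
    then have "w a + w b' = w a' + w b" using w assms that by metis
    then show ?thesis by simp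
  qed
  then show "\<forall>a' b'. a' \<noteq> 0 \<longrightarrow> b' \<noteq> 0 \<longrightarrow> to_fract a / to_fract b = to_fract a' / to_fract b' \<longrightarrow> w a - w b = w a' - w b'"
    by blast
qed (use assms in blast)

lemma fract_val_poly:
  assumes w: "\<And>a b. a \<noteq> 0 \<Longrightarrow> b \<noteq> 0 \<Longrightarrow> w (a * b) = w a + w b" and "a \<noteq> 0"
  shows "fract_val w (to_fract a) = w a"
proof -
  have "w 1 = 0" using w[of 1 1] by simp
  then show ?thesis using fract_val_eq[OF w assms(2), of 1] by simp
qed

lemma is_valuation_fract_val:
  assumes w: "\<And>a b. a \<noteq> 0 \<Longrightarrow> b \<noteq> 0 \<Longrightarrow> w (a * b) = w a + w b"
    and w2: "\<And>a b. a \<noteq> 0 \<Longrightarrow> b \<noteq> 0 \<Longrightarrow> a + b \<noteq> 0 \<Longrightarrow> min (w a) (w b) \<le> w (a + b)"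
  shows "is_valuation (fract_val w)"
  unfolding is_valuation_def
proof (intro conjI allI impI)
  fix k l :: "'a poly fract" assume kl: "k \<noteq> 0" "l \<noteq> 0"
  obtain a b where k: "b \<noteq> 0" "k = to_fract a / to_fract b" using fract_obtain by blast
  obtain c d where l: "d \<noteq> 0" "l = to_fract c / to_fract d" using fract_obtain by blast
  have ac: "a \<noteq> 0" "c \<noteq> 0" using kl k l by auto
  have "k * l = to_fract (a * c) / to_fract (b * d)" by (simp add: k l)
  then have "fract_val w (k * l) = w (a * c) - w (b * d)"
    using fract_val_eq[of w "a * c" "b * d", OF w] ac k l by simp
  then show "fract_val w (k * l) = fract_val w k + fract_val w l"
    using ac k l by (simp add: fract_val_eq[OF w] w)
next
  fix k l :: "'a poly fract" assume kl: "k \<noteq> 0" "l \<noteq> 0" "k + l \<noteq> 0"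
  obtain a b where k: "b \<noteq> 0" "k = to_fract a / to_fract b" using fract_obtain by blast
  obtain c d where l: "d \<noteq> 0" "l = to_fract c / to_fract d" using fract_obtain by blast
  have ac: "a \<noteq> 0" "c \<noteq> 0" using kl k l by auto
  have eq: "k + l = to_fract (a * d + c * b) / to_fract (b * d)" using k l by (simp add: field_simps)
  have nz: "a * d + c * b \<noteq> 0"
  proof
    assume "a * d + c * b = 0"
    then have "k + l = 0" unfolding eq by (simp only: to_fract_0 div_0)
    then show False using kl by blast
  qed
  have "fract_val w (k + l) = w (a * d + c * b) - w (b * d)"
    unfolding eq by (rule fract_val_eq[OF w]) (use nz k l in auto)
  moreover have "min (w (a * d)) (w (c * b)) \<le> w (a * d + c * b)"
    by (rule w2) (use nz ac k l in auto)
  ultimately show "min (fract_val w k) (fract_val w l) \<le> fract_val w (k + l)"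
    using ac k l by (simp add: fract_val_eq[OF w] w min_def split: if_splits)
qed

abbreviation "val_at P \<equiv> fract_val (\<lambda>f. int (pmult P f))"
abbreviation "val_inf \<equiv> fract_val (\<lambda>f. - int (degree f))"

lemma val_at_poly: "monic_irred P \<Longrightarrow> f \<noteq> 0 \<Longrightarrow> val_at P (to_fract f) = int (pmult P f)"
  by (rule fract_val_poly) (auto simp: pmult_mult)

lemma val_at_quot:
  "monic_irred P \<Longrightarrow> f \<noteq> 0 \<Longrightarrow> g \<noteq> 0 \<Longrightarrow>
   val_at P (to_fract f / to_fract g) = int (pmult P f) - int (pmult P g)"
  by (rule fract_val_eq) (auto simp: pmult_mult)

lemma val_inf_poly: "f \<noteq> 0 \<Longrightarrow> val_inf (to_fract f) = - int (degree f)"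
  by (rule fract_val_poly) (auto simp: degree_mult_eq)

lemma val_inf_quot:
  "f \<noteq> 0 \<Longrightarrow> g \<noteq> 0 \<Longrightarrow> val_inf (to_fract f / to_fract g) = int (degree g) - int (degree f)"
  by (subst fract_val_eq) (auto simp: degree_mult_eq)

lemma is_valuation_at: "monic_irred (P :: 'a :: field poly) \<Longrightarrow> is_valuation (val_at P)"
proof (rule is_valuation_fract_val)
  fix a b :: "'a poly" assume P: "monic_irred P" and ab: "a \<noteq> 0" "b \<noteq> 0"
  show "int (pmult P (a * b)) = int (pmult P a) + int (pmult P b)"
    using pmult_mult[OF P ab] by simp
  assume "a + b \<noteq> 0"
  then show "min (int (pmult P a)) (int (pmult P b)) \<le> int (pmult P (a + b))"
    using pmult_add[OF P ab] by (simp flip: of_nat_min)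
qed

lemma is_valuation_inf: "is_valuation (val_inf :: 'a :: field poly fract \<Rightarrow> int)"
proof (rule is_valuation_fract_val)
  fix a b :: "'a poly"
  show "min (- int (degree a)) (- int (degree b)) \<le> - int (degree (a + b))"
    using degree_add_le_max[of a b] by (auto simp: min_def max_def split: if_splits)
qed (auto simp: degree_mult_eq)

text \<open>Places of the projective line: \<open>finite_vals\<close> are those other than infinity,
  \<open>torus_vals\<close> those other than 0 and infinity, and
  \<open>insert val_inf torus_vals\<close> those other than 0. They belong to
  \<open>ring_U0\<close>, \<open>ring_U01\<close> and \<open>ring_U1\<close>.\<close>

definition "finite_vals = (val_at ` Collect monic_irred :: ('a :: field poly fract \<Rightarrow> int) set)"
definition "torus_vals = (val_at ` {P. monic_irred P \<and> P \<noteq> [:0, 1:]} :: ('a :: field poly fract \<Rightarrow> int) set)"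

lemma valuation_ring_finite: "valuation_ring finite_vals = range (to_fract :: 'a :: field poly \<Rightarrow> _)"
proof
  show "range to_fract \<subseteq> valuation_ring (finite_vals :: ('a poly fract \<Rightarrow> int) set)"
    by (auto simp: valuation_ring_def finite_vals_def val_at_poly)
  show "valuation_ring (finite_vals :: ('a poly fract \<Rightarrow> int) set) \<subseteq> range to_fract"
  proof
    fix k :: "'a poly fract" assume k: "k \<in> valuation_ring finite_vals"
    show "k \<in> range to_fract"
    proof (cases "k = 0")
      case True then show ?thesis by (metis rangeI to_fract_0)
    next
      case False
      obtain a b where ab: "b \<noteq> 0" "k = to_fract a / to_fract b" using fract_obtain by blast
      have a0: "a \<noteq> 0" using ab False by auto
      have "b dvd a"
      proof (rule dvd_if_pmult_le[OF ab(1) a0])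
        fix P :: "'a poly" assume P: "monic_irred P"
        then have "0 \<le> val_at P k" using k False by (auto simp: valuation_ring_def finite_vals_def)
        then show "pmult P b \<le> pmult P a" using ab a0 P by (simp add: val_at_quot)
      qed
      then obtain c where "a = b * c" by auto
      then have "k = to_fract c" using ab by simp
      then show ?thesis by blast
    qed
  qed
qed

lemma monic_irred_X: "monic_irred [:0, 1 :: 'a :: field:]"
  unfolding monic_irred_def using irreducible_linear_field_poly[of 1 0] by simp

lemma valuation_ring_torus:
  "valuation_ring torus_vals = {to_fract p / to_fract [:0, 1:] ^ m | (p :: 'a :: field poly) m. True}"
proof
  let ?X = "[:0, 1 :: 'a:]"
  show "{to_fract p / to_fract ?X ^ m | p m. True} \<subseteq> valuation_ring torus_vals"
  proof
    fix k assume "k \<in> {to_fract p / to_fract ?X ^ m | p m. True}"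
    then obtain p m where k: "k = to_fract p / to_fract (?X ^ m)" by (auto simp del: to_fract_power simp flip: to_fract_power)
    show "k \<in> valuation_ring torus_vals"
    proof (cases "p = 0")
      case False
      have "val_at P k = int (pmult P p)" if P: "monic_irred P" "P \<noteq> ?X" for P
      proof -
        have "?X ^ m \<noteq> 0" by simp
        then have "val_at P k = int (pmult P p) - int (pmult P (?X ^ m))"
          unfolding k by (rule val_at_quot[OF P(1) False])
        also have "pmult P (?X ^ m) = 0"
          using pmult_power[OF P(1), of ?X m] pmult_other[OF P(1) monic_irred_X P(2)] by simp
        finally show ?thesis by simp
      qed
      then show ?thesis by (auto simp: valuation_ring_def torus_vals_def)
    qed (simp add: k valuation_ring_def)
  qed
  show "valuation_ring torus_vals \<subseteq> {to_fract p / to_fract ?X ^ m | p m. True}"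
  proof
    fix k :: "'a poly fract" assume k: "k \<in> valuation_ring torus_vals"
    show "k \<in> {to_fract p / to_fract ?X ^ m | p m. True}"
    proof (cases "k = 0")
      case True then show ?thesis by (auto intro!: exI[of _ 0])
    next
      case False
      obtain a b where ab: "b \<noteq> 0" "k = to_fract a / to_fract b" using fract_obtain by blast
      have a0: "a \<noteq> 0" using ab False by auto
      define m where "m = pmult ?X b"
      obtain b' where b': "b = ?X ^ m * b'" "\<not> ?X dvd b'" "b' \<noteq> 0"
        unfolding m_def using pmult_decomp[OF monic_irred_X ab(1)] by metis
      have "b' dvd a"
      proof (rule dvd_if_pmult_le[OF b'(3) a0])
        fix P :: "'a poly" assume P: "monic_irred P"
        show "pmult P b' \<le> pmult P a"
        proof (cases "P = ?X")
          case True then show ?thesis using dvd_iff_pmult_pos[OF P b'(3)] b'(2) by simp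
        next
          case False
          then have "0 \<le> val_at P k" using k P \<open>k \<noteq> 0\<close> by (auto simp: valuation_ring_def torus_vals_def)
          then have "pmult P b \<le> pmult P a" using ab a0 P by (simp add: val_at_quot)
          then show ?thesis unfolding b'(1) using P b'(3) monic_irred_props(1)[OF monic_irred_X] by (simp add: pmult_mult)
        qed
      qed
      then obtain c where c: "a = b' * c" by auto
      have "k = to_fract c / to_fract ?X ^ m"
        unfolding ab(2) b'(1) c using b'(3) by (simp add: field_simps)
      then show ?thesis by blast
    qed
  qed
qed

lemma valuation_ring_Un: "valuation_ring (V \<union> W) = valuation_ring V \<inter> valuation_ring W"
  by (auto simp: valuation_ring_def)

text \<open>The right-hand side is the ring of polynomials in 1/X: reversing coefficients turns
  \<open>p / X ^ m\<close> with \<open>degree p \<le> m\<close> into such a polynomial, see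
  \<open>range_poly_inverse_X\<close>.\<close>

lemma valuation_ring_at_infinity:
  "valuation_ring (insert val_inf torus_vals) =
     {to_fract p / to_fract [:0, 1:] ^ m | (p :: 'a :: field poly) m. degree p \<le> m}"
proof -
  let ?X = "[:0, 1 :: 'a:]"
  have val: "val_inf (to_fract p / to_fract ?X ^ m) = int m - int (degree p)" if "p \<noteq> 0" for p m
  proof -
    have "val_inf (to_fract p / to_fract (?X ^ m)) = int (degree (?X ^ m)) - int (degree p)"
      using that by (intro val_inf_quot) auto
    also have "degree (?X ^ m) = m" by (simp add: degree_power_eq)
    finally show ?thesis by simp
  qed
  have "valuation_ring (insert val_inf torus_vals) = valuation_ring {val_inf} \<inter> valuation_ring torus_vals"
    using valuation_ring_Un[of "{val_inf}" torus_vals] by simp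
  also have "\<dots> = {to_fract p / to_fract ?X ^ m | p m. degree p \<le> m}"
  proof
    show "{to_fract p / to_fract ?X ^ m | p m. degree p \<le> m} \<subseteq> valuation_ring {val_inf} \<inter> valuation_ring torus_vals"
    proof
      fix k assume "k \<in> {to_fract p / to_fract ?X ^ m | p m. degree p \<le> m}"
      then obtain p m where k: "k = to_fract p / to_fract ?X ^ m" "degree p \<le> m" by auto
      then have "k \<in> valuation_ring {val_inf}"
        using val[of p m] by (cases "p = 0") (auto simp: valuation_ring_def)
      then show "k \<in> valuation_ring {val_inf} \<inter> valuation_ring torus_vals"
        unfolding valuation_ring_torus using k by auto
    qed
    show "valuation_ring {val_inf} \<inter> valuation_ring torus_vals \<subseteq> {to_fract p / to_fract ?X ^ m | p m. degree p \<le> m}"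
    proof
      fix k :: "'a poly fract" assume k: "k \<in> valuation_ring {val_inf} \<inter> valuation_ring torus_vals"
      then obtain p m where pm: "k = to_fract p / to_fract ?X ^ m" unfolding valuation_ring_torus by auto
      have "degree p \<le> m"
        using k pm val[of p m] by (cases "p = 0") (auto simp: valuation_ring_def)
      then show "k \<in> {to_fract p / to_fract ?X ^ m | p m. degree p \<le> m}" using pm by blast
    qed
  qed
  finally show ?thesis .
qed

lemma pmult_smult: "monic_irred P \<Longrightarrow> c \<noteq> 0 \<Longrightarrow> f \<noteq> 0 \<Longrightarrow> pmult P (smult c f) = pmult P f"
  using pmult_mult[of P "[:c:]" f] pmult_unit[of P "[:c:]"] by (simp add: is_unit_pCons_iff)

lemma degree_eq_sum_pmult:
  fixes f :: "'a :: field poly"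
  assumes S: "finite S" "\<And>P. P \<in> S \<Longrightarrow> monic_irred P" and f: "f \<noteq> 0"
    and div: "\<And>P. monic_irred P \<Longrightarrow> P dvd f \<Longrightarrow> P \<in> S"
  shows "degree f = (\<Sum>P\<in>S. pmult P f * degree P)"
proof -
  let ?g = "smult (inverse (lead_coeff f)) f"
  have lc: "inverse (lead_coeff f) \<noteq> 0" using f by simp
  have "?g = (\<Prod>P\<in>S. P ^ pmult P ?g)"
  proof (rule monic_factorization[OF S])
    show "lead_coeff ?g = 1" using f by simp
    show "P \<in> S" if "monic_irred P" "P dvd ?g" for P
      using div[OF that(1)] that(2) lc by (simp add: dvd_smult_iff)
  qed
  also have "\<dots> = (\<Prod>P\<in>S. P ^ pmult P f)"
    using S(2) lc f by (intro prod.cong) (auto simp: pmult_smult)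
  finally have "degree ?g = degree (\<Prod>P\<in>S. P ^ pmult P f)" by simp
  also have "\<dots> = (\<Sum>P\<in>S. pmult P f * degree P)"
    using monic_irred_props(1)[OF S(2)] by (subst degree_prod_sum_eq) (auto simp: degree_power_eq)
  finally show ?thesis using lc by simp
qed

section \<open>Kummer extensions of the rational function field\<close>

lemma poly_emb_simps:
  "poly_emb (p + q) = poly_emb p + (poly_emb q :: ('a :: {field,finite}) Kbar)"
  "poly_emb (p - q) = poly_emb p - (poly_emb q :: 'a Kbar)"
  "poly_emb (p * q) = poly_emb p * (poly_emb q :: 'a Kbar)"
  "poly_emb 0 = (0 :: 'a Kbar)" "poly_emb 1 = (1 :: 'a Kbar)"
  "poly_emb (p ^ m) = (poly_emb p :: 'a Kbar) ^ m"
  "(poly_emb p :: 'a Kbar) = 0 \<longleftrightarrow> p = 0"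
  by (simp_all add: poly_emb_def)

lemma const_emb_simps:
  "const_emb (a + b) = const_emb a + (const_emb b :: ('a :: {field,finite}) Kbar)"
  "const_emb (a * b) = const_emb a * (const_emb b :: 'a Kbar)"
  "const_emb (a - b) = const_emb a - (const_emb b :: 'a Kbar)"
  "const_emb 1 = (1 :: 'a Kbar)" "const_emb 0 = (0 :: 'a Kbar)"
proof -
  have m: "[:a * b:] = [:a:] * [:b:]" and p: "[:a + b:] = [:a:] + [:b:]" and d: "[:a - b:] = [:a:] - [:b:]"
    by simp_all
  show "const_emb (a + b) = const_emb a + (const_emb b :: 'a Kbar)"
    unfolding const_emb_def p poly_emb_simps ..
  show "const_emb (a * b) = const_emb a * (const_emb b :: 'a Kbar)"
    unfolding const_emb_def m poly_emb_simps ..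
  show "const_emb (a - b) = const_emb a - (const_emb b :: 'a Kbar)"
    unfolding const_emb_def d poly_emb_simps ..
  show "const_emb 1 = (1 :: 'a Kbar)" "const_emb 0 = (0 :: 'a Kbar)"
    by (simp_all add: const_emb_def poly_emb_simps flip: one_pCons)
qed

lemma vector_space_const_emb: "vector_space (\<lambda>(c :: 'a :: {field,finite}) (v :: 'a Kbar). const_emb c * v)"
  by unfold_locales (simp_all add: algebra_simps const_emb_simps)

text \<open>\<open>has_quotient_dim\<close> only asserts that some basis modulo \<open>W\<close>
  exists, so uniqueness of the dimension has to be shown before the genus is a number. The scalars
  are finite: coefficient vectors over the first basis inject into those over the second, whence
  \<open>q ^ d \<le> q ^ e\<close>.\<close>

lemma quotient_dim_le:
  fixes U W :: "('a :: {field,finite}) Kbar set"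
  assumes 1: "has_quotient_dim U W d" and 2: "has_quotient_dim U W e"
    and W0: "0 \<in> W" and Wa: "\<And>a b. a \<in> W \<Longrightarrow> b \<in> W \<Longrightarrow> a + b \<in> W"
    and Ws: "\<And>c a. a \<in> W \<Longrightarrow> const_emb c * a \<in> W"
  shows "d \<le> e"
proof -
  interpret S: vector_space "\<lambda>(c :: 'a) (v :: 'a Kbar). const_emb c * v"
    by (rule vector_space_const_emb)
  have sub: "S.subspace W" using W0 Wa Ws by (simp add: S.subspace_def)
  obtain B where B: "finite B" "card B = d" "B \<subseteq> U"
    "\<And>c :: 'a Kbar \<Rightarrow> 'a. (\<Sum>b\<in>B. const_emb (c b) * b) \<in> W \<Longrightarrow> (\<forall>b\<in>B. c b = 0)"
    using 1 unfolding has_quotient_dim_def by blast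
  obtain B' where B': "finite B'" "card B' = e" "U = S.span (B' \<union> W)"
    using 2 unfolding has_quotient_dim_def by blast
  obtain B1 where B1: "U = S.span (B1 \<union> W)" using 1 unfolding has_quotient_dim_def by blast
  have subU: "S.subspace U" unfolding B1 by (rule S.subspace_span)
  define lin where "lin = (\<lambda>C (f :: 'a Kbar \<Rightarrow> 'a). \<Sum>b\<in>C. const_emb (f b) * b)"
  have ex: "\<exists>f'. f' \<in> (\<Pi>\<^sub>E b\<in>B'. UNIV) \<and> lin B f - lin B' f' \<in> W" for f
  proof -
    have "lin B f \<in> U" unfolding lin_def
      by (rule S.subspace_sum[OF subU], rule S.subspace_scale[OF subU]) (use B(3) in auto)
    then obtain a w where aw: "lin B f = a + w" "a \<in> S.span B'" "w \<in> S.span W"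
      unfolding B' S.span_Un by auto
    have w: "w \<in> W" using aw(3) S.span_minimal[OF subset_refl sub] by blast
    obtain g where g: "a = (\<Sum>b\<in>B'. const_emb (g b) * b)"
      using aw(2) unfolding S.span_finite[OF B'(1)] by auto
    have "lin B' (restrict g B') = a" unfolding g lin_def by (rule sum.cong) auto
    then show ?thesis using w aw(1) by (intro exI[of _ "restrict g B'"]) auto
  qed
  then obtain h where h: "\<And>f. h f \<in> (\<Pi>\<^sub>E b\<in>B'. UNIV)" "\<And>f. lin B f - lin B' (h f) \<in> W" by metis
  have inj: "inj_on h (\<Pi>\<^sub>E b\<in>B. UNIV)"
  proof (rule inj_onI)
    fix f g assume fg: "f \<in> (\<Pi>\<^sub>E b\<in>B. UNIV)" "g \<in> (\<Pi>\<^sub>E b\<in>B. UNIV)" "h f = h g"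
    have "lin B (\<lambda>b. f b - g b) = (lin B f - lin B' (h f)) - (lin B g - lin B' (h g))"
      by (simp add: lin_def const_emb_simps left_diff_distrib sum_subtractf fg(3))
    also have "\<dots> \<in> W" by (rule S.subspace_diff[OF sub]) (rule h)+
    finally have "\<forall>b\<in>B. f b - g b = 0" unfolding lin_def by (rule B(4))
    then show "f = g" using fg by (intro PiE_ext[of f B _ g]) auto
  qed
  have "card (\<Pi>\<^sub>E b\<in>B. (UNIV :: 'a set)) \<le> card (\<Pi>\<^sub>E b\<in>B'. (UNIV :: 'a set))"
    by (rule card_inj_on_le[OF inj]) (use h(1) B' in \<open>auto intro!: finite_PiE\<close>)
  then have "CARD('a) ^ d \<le> CARD('a) ^ e" using B B' by (simp add: card_PiE)
  moreover have "card {0, 1 :: 'a} \<le> CARD('a)" by (rule card_mono) auto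
  then have "1 < CARD('a)" by simp
  ultimately show ?thesis by simp
qed

lemma poly_emb_eq_sum:
  fixes p :: "'a :: {field,finite} poly"
  assumes "degree p \<le> m"
  shows "poly_emb p = (\<Sum>i\<le>m. const_emb (coeff p i) * X_elem ^ i)"
proof -
  have "p = (\<Sum>i\<le>m. monom (coeff p i) i)"
    using assms by (metis poly_as_sum_of_monoms')
  then have "poly_emb p = poly_emb (\<Sum>i\<le>m. monom (coeff p i) i)" by simp
  also have "\<dots> = (\<Sum>i\<le>m. poly_emb (monom (coeff p i) i))"
    by (simp add: poly_emb_def to_ac_sum)
  also have "\<dots> = (\<Sum>i\<le>m. const_emb (coeff p i) * X_elem ^ i)"
  proof (rule sum.cong[OF refl])
    fix i
    have "monom (coeff p i) i = [:coeff p i:] * [:0, 1:] ^ i" by (simp add: monom_altdef)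
    then show "poly_emb (monom (coeff p i) i) = const_emb (coeff p i) * X_elem ^ i"
      by (simp only: poly_emb_simps const_emb_def X_elem_def)
  qed
  finally show ?thesis .
qed

lemma poly_emb_prod: "poly_emb (\<Prod>i\<in>I. f i) = (\<Prod>i\<in>I. poly_emb (f i) :: ('a :: {field,finite}) Kbar)"
  by (induction I rule: infinite_finite_induct) (auto simp: poly_emb_simps)

lemma poly_map_const_emb:
  fixes p :: "'a :: {field,finite} poly"
  assumes "degree p \<le> m"
  shows "poly (map_poly const_emb p) x = (\<Sum>i\<le>m. const_emb (coeff p i) * x ^ i)"
proof -
  have 1: "degree (map_poly const_emb p) \<le> m"
    by (rule degree_le) (use assms in \<open>auto simp: coeff_map_poly const_emb_simps coeff_eq_0\<close>)
  have "poly (map_poly const_emb p) x = (\<Sum>i\<le>m. coeff (map_poly const_emb p) i * x ^ i)"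
    unfolding poly_altdef using 1 by (intro sum.mono_neutral_left) (auto simp: coeff_eq_0)
  then show ?thesis by (simp add: coeff_map_poly const_emb_simps)
qed

lemma X_elem_nz [simp]: "X_elem \<noteq> 0"
  by (simp add: X_elem_def poly_emb_simps)

lemma to_ac_Laurent: "to_ac (to_fract p / to_fract [:0, 1:] ^ m) = poly_emb p / X_elem ^ m"
  by (simp add: poly_emb_def X_elem_def)

lemma range_poly_inverse_X:
  "range (\<lambda>p :: 'a :: {field,finite} poly. poly (map_poly const_emb p) (inverse X_elem)) =
     to_ac ` {to_fract p / to_fract [:0, 1:] ^ m | p m. degree p \<le> m}"
proof
  let ?S = "{to_fract p / to_fract [:0, 1:] ^ m | (p :: 'a poly) m. degree p \<le> m}"
  have key: "poly (map_poly const_emb p) (inverse X_elem) = poly_emb q / X_elem ^ m"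
    if "degree p \<le> m" "degree q \<le> m" "\<And>i. i \<le> m \<Longrightarrow> coeff q i = coeff p (m - i)" for p q :: "'a poly" and m
  proof -
    have "poly_emb q / X_elem ^ m = (\<Sum>i\<le>m. const_emb (coeff p (m - i)) * (X_elem ^ i / X_elem ^ m))"
      unfolding poly_emb_eq_sum[OF that(2)] by (simp add: sum_divide_distrib that(3))
    also have "\<dots> = (\<Sum>i\<le>m. const_emb (coeff p (m - i)) * inverse X_elem ^ (m - i))"
    proof (rule sum.cong[OF refl])
      fix i assume "i \<in> {..m}"
      then have "X_elem ^ m = X_elem ^ i * (X_elem ^ (m - i) :: 'a Kbar)" by (simp flip: power_add)
      then have "X_elem ^ i / X_elem ^ m = inverse (X_elem :: 'a Kbar) ^ (m - i)"
        by (simp add: field_simps)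
      then show "const_emb (coeff p (m - i)) * (X_elem ^ i / X_elem ^ m) =
          const_emb (coeff p (m - i)) * inverse X_elem ^ (m - i)" by simp
    qed
    also have "\<dots> = (\<Sum>i\<le>m. const_emb (coeff p i) * inverse X_elem ^ i)"
      by (rule sum.reindex_bij_witness[of _ "\<lambda>i. m - i" "\<lambda>i. m - i"]) auto
    finally show ?thesis using poly_map_const_emb[OF that(1)] by simp
  qed
  have rev: "\<exists>q. degree q \<le> m \<and> (\<forall>i\<le>m. coeff q i = coeff p (m - i))" for p :: "'a poly" and m
  proof (intro exI[of _ "\<Sum>i\<le>m. monom (coeff p (m - i)) i"] conjI allI impI)
    show "degree (\<Sum>i\<le>m. monom (coeff p (m - i)) i) \<le> m"
      by (rule degree_sum_le) (auto intro: order_trans[OF degree_monom_le])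
    show "coeff (\<Sum>i\<le>m. monom (coeff p (m - i)) i) i = coeff p (m - i)" if "i \<le> m" for i
      using that by (simp add: coeff_sum)
  qed
  show "range (\<lambda>p :: 'a poly. poly (map_poly const_emb p) (inverse X_elem)) \<subseteq> to_ac ` ?S"
  proof
    fix x assume "x \<in> range (\<lambda>p :: 'a poly. poly (map_poly const_emb p) (inverse X_elem))"
    then obtain p :: "'a poly" where p: "x = poly (map_poly const_emb p) (inverse X_elem)" by auto
    obtain q where q: "degree q \<le> degree p" "\<forall>i\<le>degree p. coeff q i = coeff p (degree p - i)"
      using rev by blast
    have "x = to_ac (to_fract q / to_fract [:0, 1:] ^ degree p)"
      unfolding p to_ac_Laurent using key[of p "degree p" q] q by simp
    then show "x \<in> to_ac ` ?S" using q(1) by blast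
  qed
  show "to_ac ` ?S \<subseteq> range (\<lambda>p :: 'a poly. poly (map_poly const_emb p) (inverse X_elem))"
  proof
    fix x assume "x \<in> to_ac ` ?S"
    then obtain q :: "'a poly" and m where q: "x = to_ac (to_fract q / to_fract [:0, 1:] ^ m)" "degree q \<le> m" by auto
    obtain p where p: "degree p \<le> m" "\<forall>i\<le>m. coeff p i = coeff q (m - i)" using rev by blast
    have "poly (map_poly const_emb p) (inverse X_elem) = poly_emb q / X_elem ^ m"
      by (rule key) (use p q in auto)
    then show "x \<in> range (\<lambda>p :: 'a poly. poly (map_poly const_emb p) (inverse X_elem))"
      using q(1) unfolding to_ac_Laurent by (metis rangeI)
  qed
qed

lemma prim_root_to_fract:
  "primitive_root_of_unity R (z :: 'a :: {field,finite}) \<Longrightarrow> primitive_root_of_unity R (to_fract [:z:])"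
proof -
  have "to_fract [:z:] ^ i = to_fract [:z ^ i:]" for i
  proof -
    have "[:z:] ^ i = [:z ^ i:]" by (induction i) (auto simp: one_pCons)
    then show ?thesis by (simp flip: to_fract_power)
  qed
  moreover have "to_fract [:c:] = 1 \<longleftrightarrow> c = 1" for c :: 'a
    by (metis one_pCons pCons_eq_iff to_fract_1 to_fract_eq_iff)
  ultimately show "primitive_root_of_unity R z \<Longrightarrow> ?thesis"
    by (simp add: primitive_root_of_unity_def)
qed

lemma of_nat_poly_fract: "(of_nat m :: ('a :: field) poly fract) = to_fract [:of_nat m:]"
  by (induction m) (auto simp flip: to_fract_add to_fract_1 simp: one_pCons)

locale kummer_base = residue_system n r R for n r R +
  fixes \<zeta>0 :: "'a :: {field,finite}" and F :: "nat \<Rightarrow> 'a poly" and y :: "nat \<Rightarrow> 'a Kbar"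
  assumes prim0: "primitive_root_of_unity R \<zeta>0"
    and R_nz0: "of_nat R \<noteq> (0 :: 'a)"
    and F_nz: "\<And>j. j \<in> {1..n} \<Longrightarrow> F j \<noteq> 0"
    and yF: "\<And>j. j \<in> {1..n} \<Longrightarrow> y j ^ r j = poly_emb (F j)"
begin

definition vF :: "'a poly \<Rightarrow> nat \<Rightarrow> int" where "vF P = (\<lambda>j. int (pmult P (F j)))"

text \<open>The \<open>R\<close>-th power of the monomial \<open>Y v\<close>, see
  \<open>Y_pow_mon\<close>: \<open>y j ^ (v j * R)\<close> is
  \<open>F j ^ (v j * (R div r j))\<close>. The conversion by \<open>nat\<close> is harmless for
  \<open>v\<close> in \<open>B\<close>.\<close>

definition mon :: "(nat \<Rightarrow> int) \<Rightarrow> 'a poly" where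
  "mon v = (\<Prod>j\<in>{1..n}. F j ^ (nat (v j) * (R div r j)))"

lemma mon_nz [simp]: "mon v \<noteq> 0" using F_nz by (auto simp: mon_def)

lemma pmult_mon:
  assumes P: "monic_irred P" and v: "v \<in> B"
  shows "int (pmult P (mon v)) = pr (vF P) v"
proof -
  have "pmult P (mon v) = (\<Sum>j\<in>{1..n}. nat (v j) * (R div r j) * pmult P (F j))"
    unfolding mon_def using F_nz P by (subst pmult_prod) (auto simp: pmult_power)
  moreover have "int (nat (v j)) = v j" if "j \<in> {1..n}" for j
    using v that by (auto simp: residue_box_def PiE_iff)
  ultimately show ?thesis by (simp add: pairing_def vF_def mult_ac)
qed

sublocale radical_box n r R "to_fract [:\<zeta>0:]" y
proof
  show "primitive_root_of_unity R (to_fract [:\<zeta>0:])" by (rule prim_root_to_fract[OF prim0])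
  show "of_nat R \<noteq> (0 :: 'a poly fract)" using R_nz0 by (simp add: of_nat_poly_fract)
  show "y j ^ r j \<in> range to_ac" if "j \<in> {1..n}" for j using yF[OF that] by (simp add: poly_emb_def)
  show "y j \<noteq> 0" if j: "j \<in> {1..n}" for j
  proof
    assume "y j = 0"
    then have "poly_emb (F j) = (0 :: 'a Kbar)" using yF[OF j] r_pos[OF j] by (simp add: power_0_left)
    then show False using F_nz[OF j] by (simp add: poly_emb_simps)
  qed
qed

lemma Y_pow_mon:
  assumes v: "v \<in> B" shows "Y v ^ R = poly_emb (mon v)"
proof -
  have "(y j powi v j) ^ R = poly_emb (F j) ^ (nat (v j) * (R div r j))" if j: "j \<in> {1..n}" for j
  proof -
    have "v j \<ge> 0" using v j by (auto simp: residue_box_def PiE_iff)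
    then have "(y j powi v j) ^ R = y j ^ (nat (v j) * R)" by (simp add: power_int_def power_mult)
    also have "nat (v j) * R = r j * (nat (v j) * (R div r j))" using r_dvd[OF j] by auto
    finally show ?thesis by (simp only: power_mult yF[OF j])
  qed
  then have "Y v ^ R = (\<Prod>j\<in>{1..n}. poly_emb (F j) ^ (nat (v j) * (R div r j)))"
    by (simp add: Y_def prod_power_distrib)
  also have "\<dots> = poly_emb (mon v)" by (simp add: mon_def poly_emb_prod poly_emb_simps)
  finally show ?thesis .
qed

end

section \<open>Normalised monomials and the three coordinate rings\<close>

definition Laurent :: "'a :: field poly fract set" where
  "Laurent = {to_fract p / to_fract [:0, 1:] ^ m | p m. True}"

lemma LaurentI: "k = to_fract p / to_fract [:0, 1:] ^ m \<Longrightarrow> k \<in> Laurent"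
  by (auto simp: Laurent_def)

lemma LaurentE:
  assumes "k \<in> Laurent" obtains p m where "k = to_fract p / to_fract [:0, 1:] ^ m"
  using assms by (auto simp: Laurent_def)

lemma to_fract_in_Laurent [simp]: "to_fract p \<in> Laurent"
  by (rule LaurentI[of _ p 0]) simp

lemma zero_in_Laurent [simp]: "0 \<in> Laurent"
  using to_fract_in_Laurent[of 0] by simp

lemma Laurent_add: "a \<in> Laurent \<Longrightarrow> b \<in> Laurent \<Longrightarrow> a + b \<in> Laurent"
proof -
  assume "a \<in> Laurent" "b \<in> Laurent"
  then obtain p q i j where "a = to_fract p / to_fract [:0, 1:] ^ i" "b = to_fract q / to_fract [:0, 1:] ^ j"
    by (elim LaurentE)
  moreover have "to_fract [:0, 1:] \<noteq> 0" by simp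
  ultimately have "a + b = to_fract (p * [:0, 1:] ^ j + q * [:0, 1:] ^ i) / to_fract [:0, 1:] ^ (i + j)"
    unfolding to_fract_add to_fract_mult to_fract_power by (simp only: field_simps power_add power_not_zero not_False_eq_True simp_thms) (simp add: field_simps)
  then show "a + b \<in> Laurent" by (rule LaurentI)
qed

lemma Laurent_scale: "a \<in> Laurent \<Longrightarrow> to_fract p * a \<in> Laurent"
proof -
  assume "a \<in> Laurent"
  then obtain q i where "a = to_fract q / to_fract [:0, 1:] ^ i" by (elim LaurentE)
  then have "to_fract p * a = to_fract (p * q) / to_fract [:0, 1:] ^ i" by simp
  then show ?thesis by (rule LaurentI)
qed

lemma valuation_ring_torus_Laurent: "valuation_ring torus_vals = Laurent"
  by (simp only: valuation_ring_torus Laurent_def)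

context kummer_base
begin

definition primes_of :: "'a poly set" where
  "primes_of = {P. monic_irred P \<and> P dvd (\<Prod>j\<in>{1..n}. F j)}"

lemma finite_primes_of [simp]: "finite primes_of"
  unfolding primes_of_def by (rule finite_prime_divisors) (use F_nz in auto)

lemma primes_of_irred: "P \<in> primes_of \<Longrightarrow> monic_irred P"
  by (simp add: primes_of_def)

lemma prime_dvd_mon:
  assumes P: "monic_irred P" "P dvd mon v" shows "P \<in> primes_of"
proof -
  have "P dvd (\<Prod>j\<in>{1..n}. F j)"
  proof -
    have "pmult P (F j) = 0" if "\<not> ?thesis" "j \<in> {1..n}" for j
    proof -
      have "pmult P (\<Prod>j\<in>{1..n}. F j) = 0"
        using that(1) F_nz by (subst (asm) dvd_iff_pmult_pos[OF P(1)]) auto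
      then show ?thesis using F_nz that(2) by (subst (asm) pmult_prod[OF P(1)]) auto
    qed
    moreover have "pmult P (mon v) = (\<Sum>j\<in>{1..n}. nat (v j) * (R div r j) * pmult P (F j))"
      unfolding mon_def using F_nz P by (subst pmult_prod) (auto simp: pmult_power)
    ultimately show ?thesis using P dvd_iff_pmult_pos[OF P(1) mon_nz[of v]] by force
  qed
  then show ?thesis using P by (simp add: primes_of_def)
qed

text \<open>The largest monic polynomial whose \<open>R\<close>-th power divides
  \<open>mon v\<close>. Dividing \<open>Y v\<close> by it leaves an element whose
  \<open>R\<close>-th power \<open>free_part v\<close> has all multiplicities below
  \<open>R\<close>; these normalised monomials form a basis of the integral closure of F_q[X], see
  \<open>ring_U0_eq\<close>.\<close>

definition root_part :: "(nat \<Rightarrow> int) \<Rightarrow> 'a poly" where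
  "root_part v = (\<Prod>P\<in>primes_of. P ^ (pmult P (mon v) div R))"

lemma root_part_nz [simp]: "root_part v \<noteq> 0"
  unfolding root_part_def using primes_of_irred monic_irred_props(1) by auto

lemma pmult_root_part:
  assumes Q: "monic_irred Q" shows "pmult Q (root_part v) = pmult Q (mon v) div R"
proof -
  have "pmult Q (root_part v) = (\<Sum>P\<in>primes_of. pmult P (mon v) div R * pmult Q P)"
    unfolding root_part_def using primes_of_irred monic_irred_props(1) Q
    by (subst pmult_prod) (auto simp: pmult_power)
  also have "\<dots> = (\<Sum>P\<in>primes_of. if P = Q then pmult Q (mon v) div R else 0)"
    using primes_of_irred Q by (intro sum.cong) (auto simp: pmult_self pmult_other)
  also have "\<dots> = pmult Q (mon v) div R"
    using prime_dvd_mon[OF Q, of v] dvd_iff_pmult_pos[OF Q mon_nz[of v]] by auto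
  finally show ?thesis .
qed

definition free_part :: "(nat \<Rightarrow> int) \<Rightarrow> 'a poly" where
  "free_part v = mon v div root_part v ^ R"

lemma mon_split: "mon v = root_part v ^ R * free_part v"
proof -
  have "root_part v ^ R dvd mon v"
    by (rule dvd_if_pmult_le) (auto simp: pmult_power pmult_root_part)
  then show ?thesis by (simp add: free_part_def)
qed

lemma free_part_nz [simp]: "free_part v \<noteq> 0"
  using mon_nz[of v] unfolding mon_split[of v] by auto

lemma pmult_free_part:
  assumes "monic_irred P" shows "pmult P (free_part v) = pmult P (mon v) mod R"
proof -
  have "pmult P (mon v) = R * (pmult P (mon v) div R) + pmult P (free_part v)"
    by (subst (1) mon_split) (simp add: pmult_mult assms pmult_power pmult_root_part)
  then show ?thesis by (metis add_left_cancel mult_div_mod_eq)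
qed

lemma degree_free_part:
  assumes v: "v \<in> B"
  shows "int (degree (free_part v)) = (\<Sum>P\<in>primes_of. (pr (vF P) v mod int R) * int (degree P))"
proof -
  have "degree (free_part v) = (\<Sum>P\<in>primes_of. pmult P (free_part v) * degree P)"
  proof (rule degree_eq_sum_pmult)
    fix P assume P: "monic_irred P" "P dvd free_part v"
    then have "P dvd mon v" unfolding mon_split[of v] by simp
    then show "P \<in> primes_of" using P prime_dvd_mon by blast
  qed (auto simp: primes_of_irred)
  also have "int \<dots> = (\<Sum>P\<in>primes_of. (pr (vF P) v mod int R) * int (degree P))"
    by (simp add: pmult_free_part primes_of_irred zmod_int pmult_mon v)
  finally show ?thesis .
qed

end

text \<open>\<open>nd\<close> says that no \<open>mon v\<close> with \<open>v\<close> nonzero is a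
  constant times an \<open>R\<close>-th power. This is more than independence of the radicals: it
  also excludes that \<open>L\<close> contains new constants.\<close>

locale kummer_tuple = kummer_base n r R \<zeta>0 F y
  for n r R and \<zeta>0 :: "'a :: {field,finite}" and F y +
  assumes nd: "\<And>v. v \<in> residue_box n r \<Longrightarrow> v \<noteq> zero_vec n \<Longrightarrow>
    \<exists>P. monic_irred P \<and> \<not> int R dvd pairing n r R (\<lambda>j. int (pmult P (F j))) v"

sublocale kummer_tuple \<subseteq> radical_field n r R "to_fract [:\<zeta>0:]" y
proof -
  have "radical_indep n r R (to_fract [:\<zeta>0:]) y"
  proof (rule radical_indepI[OF radical_box_axioms])
    fix v assume v: "v \<in> B" "v \<noteq> z0"
    show "Y v \<notin> range to_ac"
    proof
      assume "Y v \<in> range to_ac"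
      then obtain k where k: "Y v = to_ac k" by auto
      then have "k \<noteq> 0" by (metis Y_nz to_ac_0)
      obtain P where P: "monic_irred P" "\<not> int R dvd pr (vF P) v"
        using nd[OF v] unfolding vF_def by blast
      have "to_ac (k ^ R) = to_ac (to_fract (mon v))"
        using Y_pow_mon[OF v(1)] by (simp add: k poly_emb_def)
      then have "k ^ R = to_fract (mon v)" by (simp only: to_ac_eq_iff)
      then have "val_at P (k ^ R) = int (pmult P (mon v))" using val_at_poly[OF P(1) mon_nz] by simp
      then have "int R * val_at P k = pr (vF P) v"
        using valuation_power[OF is_valuation_at[OF P(1)] \<open>k \<noteq> 0\<close>] pmult_mon[OF P(1) v(1)] by simp
      then show False using P(2) by (metis dvd_triv_left)
    qed
  qed
  then show "radical_field n r R (to_fract [:\<zeta>0:]) y" by (rule radical_field.intro)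
qed

context kummer_tuple
begin

lemma radicand_mon: "v \<in> B \<Longrightarrow> radicand v = to_fract (mon v)"
proof -
  assume "v \<in> B"
  then have "to_ac (radicand v) = to_ac (to_fract (mon v))"
    using Y_pow_mon by (simp add: radicand poly_emb_def)
  then show ?thesis by (simp only: to_ac_eq_iff)
qed

definition redY :: "(nat \<Rightarrow> int) \<Rightarrow> 'a Kbar" where "redY v = Y v / poly_emb (root_part v)"

definition redcoord :: "'a Kbar \<Rightarrow> (nat \<Rightarrow> int) \<Rightarrow> 'a poly fract" where
  "redcoord z v = coord z v * to_fract (root_part v)"

lemma redY_alt: "to_ac k * redY v = to_ac (k / to_fract (root_part v)) * Y v"
  by (simp add: redY_def poly_emb_def)

lemma redY_in_L [simp]: "to_ac k * redY v \<in> L" by (simp only: redY_alt mono_in_L)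

lemma redcoord_add: "a \<in> L \<Longrightarrow> b \<in> L \<Longrightarrow> v \<in> B \<Longrightarrow> redcoord (a + b) v = redcoord a v + redcoord b v"
  by (simp add: redcoord_def coord_add algebra_simps)

lemma redcoord_scale: "a \<in> L \<Longrightarrow> v \<in> B \<Longrightarrow> redcoord (to_ac k * a) v = k * redcoord a v"
  by (simp add: redcoord_def coord_scale)

lemma redcoord_redY: "v \<in> B \<Longrightarrow> w \<in> B \<Longrightarrow> redcoord (to_ac k * redY w) v = (if v = w then k else 0)"
  by (simp only: redcoord_def redY_alt coord_mono) simp

lemma redcoord_sum:
  "(\<And>i. i \<in> I \<Longrightarrow> f i \<in> L) \<Longrightarrow> v \<in> B \<Longrightarrow> redcoord (sum f I) v = (\<Sum>i\<in>I. redcoord (f i) v)"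
proof (induction I rule: infinite_finite_induct)
  case empty then show ?case using redcoord_scale[of 0 v 0] by simp
next
  case (infinite A) then show ?case using redcoord_scale[of 0 v 0] by simp
qed (auto simp: redcoord_add L_sum)

lemma expand_redY: "z \<in> L \<Longrightarrow> z = (\<Sum>v\<in>B. to_ac (redcoord z v) * redY v)"
  by (simp only: redY_alt redcoord_def) (simp add: comb_coord comb_def[symmetric])

text \<open>All three coordinate rings are integral closures of rings cut out by a set of places, so
  the integrality criterion is instantiated once for all of them.\<close>

lemma closure_cond:
  assumes V: "V = finite_vals \<or> V = torus_vals \<or> V = insert val_inf torus_vals"
  shows "integral_closure_in (to_ac ` valuation_ring V) L =
    {z \<in> L. \<forall>v\<in>B. redcoord z v ^ R * to_fract (free_part v) \<in> valuation_ring V}"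
proof -
  have vals: "(\<exists>P. monic_irred P \<and> v = val_at P) \<or> v = val_inf" if "v \<in> V" for v
    using that V by (auto simp: finite_vals_def torus_vals_def)
  interpret V: valued_radical_field n r R "to_fract [:\<zeta>0:]" y V
  proof
    fix v assume v: "v \<in> V"
    show "is_valuation v" using vals[OF v] is_valuation_at is_valuation_inf by blast
    fix m assume m: "of_nat m \<noteq> (0 :: 'a poly fract)"
    then have m0: "of_nat m \<noteq> (0 :: 'a)" by (auto simp: of_nat_poly_fract)
    then have u: "is_unit [:of_nat m :: 'a:]" by (simp add: is_unit_pCons_iff)
    show "v (of_nat m) = 0"
      using vals[OF v] m0 pmult_unit[OF _ u]
      by (auto simp: of_nat_poly_fract val_at_poly val_inf_poly)
  next
    fix k :: "'a poly fract"
    obtain a b where ab: "b \<noteq> 0" "k = to_fract a / to_fract b" using fract_obtain by blast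
    let ?X = "[:0, 1 :: 'a:]"
    show "\<exists>d. d \<noteq> 0 \<and> d \<in> valuation_ring V \<and> d * k \<in> valuation_ring V"
      using V
    proof (elim disjE)
      assume V: "V = finite_vals"
      show ?thesis using ab by (intro exI[of _ "to_fract b"]) (auto simp: V valuation_ring_finite)
    next
      assume V: "V = torus_vals"
      have "to_fract p \<in> valuation_ring torus_vals" for p :: "'a poly"
        by (simp add: valuation_ring_torus_Laurent)
      then show ?thesis using ab by (intro exI[of _ "to_fract b"]) (auto simp: V)
    next
      assume V: "V = insert val_inf torus_vals"
      \<comment> \<open>Dividing by \<open>X ^ m\<close> with \<open>m\<close> at least both degrees
        puts the numerator and the denominator of \<open>k\<close> into the ring of polynomials in
        1/X.\<close>
      define m where "m = max (degree a) (degree b)"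
      have "to_fract p / to_fract ?X ^ m \<in> valuation_ring V" if "degree p \<le> m" for p
        unfolding V valuation_ring_at_infinity using that by blast
      then have "to_fract b / to_fract ?X ^ m \<in> valuation_ring V" "to_fract a / to_fract ?X ^ m \<in> valuation_ring V"
        by (auto simp: m_def)
      then show ?thesis using ab by (intro exI[of _ "to_fract b / to_fract ?X ^ m"]) auto
    qed
  qed
  have "coord z v ^ R * radicand v = redcoord z v ^ R * to_fract (free_part v)" if "v \<in> B" for z v
  proof -
    have "radicand v = to_fract (root_part v) ^ R * to_fract (free_part v)"
      using radicand_mon[OF that] by (subst (asm) mon_split) simp
    then show ?thesis by (simp add: redcoord_def power_mult_distrib mult_ac)
  qed
  then show ?thesis unfolding V.integral_closure_eq V.integral_elts_def by auto
qed

text \<open>The multiplicity of \<open>P\<close> in \<open>free_part v\<close> lies between 0 and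
  \<open>R - 1\<close>, too small to offset the term \<open>R * val_at P c\<close> when
  \<open>val_at P c\<close> is negative. This is what the normalisation is for.\<close>

lemma val_cond:
  assumes P: "monic_irred P" and c: "c \<noteq> 0"
  shows "0 \<le> val_at P (c ^ R * to_fract (free_part v)) \<longleftrightarrow> 0 \<le> val_at P c"
proof -
  have "val_at P (c ^ R * to_fract (free_part v)) = int R * val_at P c + int (pmult P (free_part v))"
    using c by (simp add: valuation_mult[OF is_valuation_at[OF P]] valuation_power[OF is_valuation_at[OF P]] val_at_poly[OF P])
  moreover have "pmult P (free_part v) < R" using R_pos by (simp add: pmult_free_part P)
  moreover have "int R * val_at P c \<le> int R * (-1)" if "val_at P c < 0"
    using that by (intro mult_left_mono) auto
  moreover have "int R * val_at P c \<ge> 0" if "val_at P c \<ge> 0" using that by simp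
  ultimately show ?thesis by (cases "val_at P c < 0") linarith+
qed

lemma ring_U0_eq: "ring_U0 L = {z \<in> L. \<forall>v\<in>B. redcoord z v \<in> range to_fract}"
proof -
  have "range poly_emb = to_ac ` valuation_ring (finite_vals :: ('a poly fract \<Rightarrow> int) set)"
    by (auto simp: valuation_ring_finite poly_emb_def)
  then have "ring_U0 L = {z \<in> L. \<forall>v\<in>B. redcoord z v ^ R * to_fract (free_part v) \<in> valuation_ring finite_vals}"
    unfolding ring_U0_def by (simp only: closure_cond[of finite_vals, simplified])
  moreover have "c ^ R * to_fract (free_part v) \<in> valuation_ring finite_vals \<longleftrightarrow> c \<in> valuation_ring finite_vals" for c v
    using val_cond[of _ c v] R_pos by (cases "c = 0") (auto simp: valuation_ring_def finite_vals_def power_0_left)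
  ultimately show ?thesis unfolding valuation_ring_finite by simp
qed

lemma torus_cond: "c ^ R * to_fract (free_part v) \<in> Laurent \<longleftrightarrow> c \<in> Laurent"
  unfolding valuation_ring_torus_Laurent[symmetric] using val_cond[of _ c v] R_pos by (cases "c = 0") (auto simp: valuation_ring_def torus_vals_def power_0_left)

lemma ring_U01_eq: "ring_U01 L = {z \<in> L. \<forall>v\<in>B. redcoord z v \<in> Laurent}"
proof -
  have "{poly_emb p / X_elem ^ m | p m. True} = to_ac ` valuation_ring (torus_vals :: ('a poly fract \<Rightarrow> int) set)"
    unfolding valuation_ring_torus by (auto simp del: to_ac_divide simp flip: to_ac_Laurent)
  then have "ring_U01 L = {z \<in> L. \<forall>v\<in>B. redcoord z v ^ R * to_fract (free_part v) \<in> valuation_ring torus_vals}"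
    unfolding ring_U01_def by (simp only: closure_cond[of torus_vals, simplified])
  then show ?thesis unfolding valuation_ring_torus_Laurent torus_cond .
qed

text \<open>At infinity \<open>free_part v\<close> has valuation minus its degree, which is not
  confined to a range of length \<open>R\<close>. So the condition does not simplify as at the
  finite places, and this asymmetry produces the genus.\<close>

lemma ring_U1_eq:
  "ring_U1 L = {z \<in> L. \<forall>v\<in>B. redcoord z v \<in> Laurent \<and>
     (redcoord z v \<noteq> 0 \<longrightarrow> int (degree (free_part v)) \<le> int R * val_inf (redcoord z v))}"
proof -
  have "ring_U1 L = {z \<in> L. \<forall>v\<in>B. redcoord z v ^ R * to_fract (free_part v) \<in> valuation_ring (insert val_inf torus_vals)}"
    unfolding ring_U1_def range_poly_inverse_X valuation_ring_at_infinity[symmetric]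
    by (simp only: closure_cond[of "insert val_inf torus_vals", simplified])
  moreover have "c ^ R * to_fract (free_part v) \<in> valuation_ring (insert val_inf torus_vals) \<longleftrightarrow>
     c \<in> Laurent \<and> (c \<noteq> 0 \<longrightarrow> int (degree (free_part v)) \<le> int R * val_inf c)" for c v
  proof -
    have "c ^ R * to_fract (free_part v) \<in> valuation_ring (insert val_inf torus_vals) \<longleftrightarrow>
      c ^ R * to_fract (free_part v) \<in> valuation_ring torus_vals \<and> c ^ R * to_fract (free_part v) \<in> valuation_ring {val_inf}"
      using valuation_ring_Un[of "{val_inf}" torus_vals] by auto
    moreover have "val_inf (c ^ R * to_fract (free_part v)) = int R * val_inf c - int (degree (free_part v))" if "c \<noteq> 0"
      using that by (simp add: valuation_mult[OF is_valuation_inf] valuation_power[OF is_valuation_inf] val_inf_poly)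
    then have "c ^ R * to_fract (free_part v) \<in> valuation_ring {val_inf} \<longleftrightarrow>
        (c \<noteq> 0 \<longrightarrow> int (degree (free_part v)) \<le> int R * val_inf c)"
      using R_pos by (cases "c = 0") (auto simp: valuation_ring_def power_0_left)
    ultimately show ?thesis unfolding valuation_ring_torus_Laurent torus_cond by simp
  qed
  ultimately show ?thesis by simp
qed

lemma const_emb_eq: "const_emb c = to_ac (to_fract [:c:])"
  by (simp add: const_emb_def poly_emb_def)

lemma ring_U0_subspace:
  "0 \<in> ring_U0 L" "a \<in> ring_U0 L \<Longrightarrow> b \<in> ring_U0 L \<Longrightarrow> a + b \<in> ring_U0 L"
  "a \<in> ring_U0 L \<Longrightarrow> const_emb c * a \<in> ring_U0 L"
proof -
  show "0 \<in> ring_U0 L" unfolding ring_U0_eq using redcoord_scale[of 0 _ 0] by (auto intro: range_eqI[of _ _ 0])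
  show "a \<in> ring_U0 L \<Longrightarrow> b \<in> ring_U0 L \<Longrightarrow> a + b \<in> ring_U0 L"
    unfolding ring_U0_eq by (auto simp: L_add redcoord_add image_def) (metis to_fract_add)
  show "a \<in> ring_U0 L \<Longrightarrow> const_emb c * a \<in> ring_U0 L"
    unfolding ring_U0_eq const_emb_eq by (auto simp: L_mult redcoord_scale image_def) (metis to_fract_mult)
qed

lemma ring_U01_subspace:
  "0 \<in> ring_U01 L" "a \<in> ring_U01 L \<Longrightarrow> b \<in> ring_U01 L \<Longrightarrow> a + b \<in> ring_U01 L"
  "a \<in> ring_U01 L \<Longrightarrow> const_emb c * a \<in> ring_U01 L"
proof -
  show "0 \<in> ring_U01 L" unfolding ring_U01_eq using redcoord_scale[of 0 _ 0] by simp
  show "a \<in> ring_U01 L \<Longrightarrow> b \<in> ring_U01 L \<Longrightarrow> a + b \<in> ring_U01 L"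
    unfolding ring_U01_eq by (simp add: L_add redcoord_add Laurent_add)
  show "a \<in> ring_U01 L \<Longrightarrow> const_emb c * a \<in> ring_U01 L"
    unfolding ring_U01_eq const_emb_eq by (simp add: L_mult redcoord_scale Laurent_scale)
qed

lemma val_inf_const: "c \<noteq> 0 \<Longrightarrow> val_inf (to_fract [:c:]) = 0"
  by (simp add: val_inf_poly)

lemma ring_U1_subspace:
  "0 \<in> ring_U1 L" "a \<in> ring_U1 L \<Longrightarrow> b \<in> ring_U1 L \<Longrightarrow> a + b \<in> ring_U1 L"
  "a \<in> ring_U1 L \<Longrightarrow> const_emb c * a \<in> ring_U1 L"
proof -
  show "0 \<in> ring_U1 L" unfolding ring_U1_eq using redcoord_scale[of 0 _ 0] by simp
  show "a + b \<in> ring_U1 L" if a: "a \<in> ring_U1 L" and b: "b \<in> ring_U1 L"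
  proof -
    have ab: "a \<in> L" "b \<in> L" using a b by (auto simp: ring_U1_eq)
    have "redcoord (a + b) v \<in> Laurent \<and> (redcoord (a + b) v \<noteq> 0 \<longrightarrow> int (degree (free_part v)) \<le> int R * val_inf (redcoord (a + b) v))"
      if v: "v \<in> B" for v
    proof
      have l: "redcoord a v \<in> Laurent" "redcoord b v \<in> Laurent" using a b v by (auto simp: ring_U1_eq)
      show "redcoord (a + b) v \<in> Laurent" using Laurent_add[OF l] by (simp only: redcoord_add[OF ab v])
      have da: "redcoord a v \<noteq> 0 \<longrightarrow> int (degree (free_part v)) \<le> int R * val_inf (redcoord a v)"
        and db: "redcoord b v \<noteq> 0 \<longrightarrow> int (degree (free_part v)) \<le> int R * val_inf (redcoord b v)"
        using a b v by (auto simp: ring_U1_eq)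
      show "redcoord (a + b) v \<noteq> 0 \<longrightarrow> int (degree (free_part v)) \<le> int R * val_inf (redcoord (a + b) v)"
      proof
        assume nz: "redcoord (a + b) v \<noteq> 0"
        show "int (degree (free_part v)) \<le> int R * val_inf (redcoord (a + b) v)"
        proof (cases "redcoord a v = 0 \<or> redcoord b v = 0")
          case True then show ?thesis using da db nz by (auto simp: redcoord_add[OF ab v])
        next
          case False
          have "int R * min (val_inf (redcoord a v)) (val_inf (redcoord b v)) \<le> int R * val_inf (redcoord (a + b) v)"
            using valuation_add[OF is_valuation_inf, of "redcoord a v" "redcoord b v"] False nz
            by (intro mult_left_mono) (auto simp: redcoord_add[OF ab v])
          then show ?thesis using da db False by (auto simp: min_def split: if_splits)
        qed
      qed
    qed
    then show ?thesis unfolding ring_U1_eq using ab L_add by blast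
  qed
  show "const_emb c * a \<in> ring_U1 L" if a: "a \<in> ring_U1 L"
  proof -
    have aL: "a \<in> L" using a by (auto simp: ring_U1_eq)
    have "redcoord (const_emb c * a) v \<in> Laurent \<and> (redcoord (const_emb c * a) v \<noteq> 0 \<longrightarrow> int (degree (free_part v)) \<le> int R * val_inf (redcoord (const_emb c * a) v))"
      if v: "v \<in> B" for v
    proof
      have "redcoord a v \<in> Laurent" using a v by (auto simp: ring_U1_eq)
      then show "redcoord (const_emb c * a) v \<in> Laurent"
        unfolding const_emb_eq redcoord_scale[OF aL v] by (rule Laurent_scale)
      show "redcoord (const_emb c * a) v \<noteq> 0 \<longrightarrow> int (degree (free_part v)) \<le> int R * val_inf (redcoord (const_emb c * a) v)"
      proof
        assume nz: "redcoord (const_emb c * a) v \<noteq> 0"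
        then have c: "c \<noteq> 0" "redcoord a v \<noteq> 0" by (auto simp: const_emb_eq redcoord_scale[OF aL v])
        have "val_inf (redcoord (const_emb c * a) v) = val_inf (redcoord a v)"
          unfolding const_emb_eq redcoord_scale[OF aL v] using c
          by (subst valuation_mult[OF is_valuation_inf]) (auto simp: val_inf_const)
        then show "int (degree (free_part v)) \<le> int R * val_inf (redcoord (const_emb c * a) v)"
          using a v c by (auto simp: ring_U1_eq)
      qed
    qed
    moreover have "const_emb c * a \<in> L" using aL L_mult unfolding const_emb_eq by auto
    ultimately show ?thesis unfolding ring_U1_eq by blast
  qed
qed

lemma ring_U0_subset: "ring_U0 L \<subseteq> ring_U01 L"
proof -
  have "range to_fract \<subseteq> Laurent" by auto
  then show ?thesis unfolding ring_U0_eq ring_U01_eq by blast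
qed

lemma ring_U1_subset: "ring_U1 L \<subseteq> ring_U01 L"
  unfolding ring_U1_eq ring_U01_eq by auto

end

section \<open>The genus\<close>

context kummer_tuple
begin

abbreviation "Xf \<equiv> to_fract [:0, 1 :: 'a:]"

text \<open>
  The rings of \<open>U\<^sub>0\<close>, \<open>U\<^sub>1\<close> and \<open>U\<^sub>0 \<inter> U\<^sub>1\<close> are graded by \<open>B\<close>. In degree \<open>v\<close> the monomials
  \<open>redY v / X ^ i\<close> regular on neither \<open>U\<^sub>0\<close> nor \<open>U\<^sub>1\<close> are those with \<open>1 \<le> i\<close> and
  \<open>R * i < degree (free_part v)\<close>.
\<close>

definition polar_indices :: "((nat \<Rightarrow> int) \<times> nat) set" where
  "polar_indices = (SIGMA v:B. {i. 1 \<le> i \<and> R * i < degree (free_part v)})"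

definition polar_elt :: "(nat \<Rightarrow> int) \<times> nat \<Rightarrow> 'a Kbar" where
  "polar_elt vi = to_ac (1 / Xf ^ snd vi) * redY (fst vi)"

text \<open>\<open>(d - 1) div R\<close> counts the \<open>i\<close> with \<open>1 \<le> i\<close>
  and \<open>R * i < d\<close>. For \<open>d = 0\<close> the truncated subtraction gives 0, as it
  should.\<close>

definition genus :: nat where "genus = (\<Sum>v\<in>B. (degree (free_part v) - 1) div R)"

lemma polar_set_eq: "{i. 1 \<le> i \<and> R * i < d} = {1..(d - 1) div R}"
proof -
  have "R * i < d \<longleftrightarrow> i \<le> (d - 1) div R" if "1 \<le> i" for i
  proof -
    have "R * i \<ge> 1" using that R_pos by simp
    then have "R * i < d \<longleftrightarrow> i * R \<le> d - 1" unfolding mult.commute[of i R] by arith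
    also have "\<dots> \<longleftrightarrow> i \<le> (d - 1) div R" using R_pos by (simp add: less_eq_div_iff_mult_less_eq)
    finally show ?thesis .
  qed
  then show ?thesis by auto
qed

lemma finite_polar_indices [simp]: "finite polar_indices"
  unfolding polar_indices_def polar_set_eq by simp

lemma card_polar_indices: "card polar_indices = genus"
  unfolding polar_indices_def polar_set_eq genus_def by simp

lemma val_inf_X_power: "val_inf (1 / Xf ^ i) = int i"
proof -
  have "val_inf (to_fract 1 / to_fract ([:0, 1 :: 'a:] ^ i)) = int (degree ([:0, 1 :: 'a:] ^ i)) - int (degree (1 :: 'a poly))"
    by (rule val_inf_quot) auto
  then show ?thesis by (simp add: degree_power_eq)
qed

lemma polar_elt_inj: "inj_on polar_elt polar_indices"
proof (rule inj_onI, clarify)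
  fix v i w j assume vi: "(v, i) \<in> polar_indices" and wj: "(w, j) \<in> polar_indices"
    and eq: "polar_elt (v, i) = polar_elt (w, j)"
  have B: "v \<in> B" "w \<in> B" using vi wj by (auto simp: polar_indices_def)
  have "redcoord (polar_elt (v, i)) v = redcoord (polar_elt (w, j)) v" using eq by simp
  then have *: "1 / Xf ^ i = (if v = w then 1 / Xf ^ j else 0)"
    unfolding polar_elt_def fst_conv snd_conv redcoord_redY[OF B(1) B(1)] redcoord_redY[OF B] by simp
  have nz: "1 / Xf ^ i \<noteq> 0" by simp
  then have "v = w" using * by (metis (full_types))
  moreover have "val_inf (1 / Xf ^ i) = val_inf (1 / Xf ^ j)" using * \<open>v = w\<close> by simp
  then have "i = j" unfolding val_inf_X_power by simp
  ultimately show "v = w \<and> i = j" by simp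
qed

lemma has_genus_genus: "has_genus L genus"
  unfolding has_genus_def has_quotient_dim_def
proof (intro exI[of _ "polar_elt ` polar_indices"] conjI allI impI)
  let ?W = "{a + b | a b. a \<in> ring_U0 L \<and> b \<in> ring_U1 L}"
  interpret S: vector_space "\<lambda>(c :: 'a) (v :: 'a Kbar). const_emb c * v"
    by (rule vector_space_const_emb)
  show "finite (polar_elt ` polar_indices)" by simp
  show "card (polar_elt ` polar_indices) = genus"
    by (simp add: card_image polar_elt_inj card_polar_indices)
  show sub: "polar_elt ` polar_indices \<subseteq> ring_U01 L"
  proof clarify
    fix v i assume "(v, i) \<in> polar_indices"
    then have v: "v \<in> B" by (auto simp: polar_indices_def)
    have "1 / Xf ^ i \<in> Laurent" by (rule LaurentI[of _ 1 i]) simp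
    then show "polar_elt (v, i) \<in> ring_U01 L"
      unfolding ring_U01_eq polar_elt_def fst_conv snd_conv by (auto simp: redcoord_redY v simp del: to_ac_divide)
  qed
  have U01_sub: "S.subspace (ring_U01 L)" using ring_U01_subspace by (simp add: S.subspace_def)
  have W_sub: "?W \<subseteq> ring_U01 L" using ring_U0_subset ring_U1_subset ring_U01_subspace(2) by blast
  show "ring_U01 L = S.span (polar_elt ` polar_indices \<union> ?W)"
  proof
    show "S.span (polar_elt ` polar_indices \<union> ?W) \<subseteq> ring_U01 L"
      by (rule S.span_minimal[OF _ U01_sub]) (use sub W_sub in blast)
    show "ring_U01 L \<subseteq> S.span (polar_elt ` polar_indices \<union> ?W)"
    proof
      fix z assume z: "z \<in> ring_U01 L"
      then have zL: "z \<in> L" by (auto simp: ring_U01_eq)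
      \<comment> \<open>A Laurent monomial in degree \<open>v\<close> is regular on
        \<open>U0\<close> if its exponent is nonnegative; if it is \<open>1 / X ^ i\<close>, it is
        regular on \<open>U1\<close> when \<open>degree (free_part v) \<le> R * i\<close>, and a
        basis element otherwise.\<close>
      have mono: "to_ac (Xf ^ j / Xf ^ m) * redY v \<in> S.span (polar_elt ` polar_indices \<union> ?W)"
        if v: "v \<in> B" for v j m
      proof (cases "m \<le> j")
        case True
        have "Xf ^ j = Xf ^ m * Xf ^ (j - m)" using True by (simp flip: power_add)
        then have "Xf ^ j / Xf ^ m = to_fract ([:0, 1:] ^ (j - m))" by simp
        then have c: "Xf ^ j / Xf ^ m \<in> range to_fract" by (rule range_eqI)
        have 0: "0 \<in> range (to_fract :: 'a poly \<Rightarrow> _)" by (metis range_eqI to_fract_0)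
        have "redcoord (to_ac (Xf ^ j / Xf ^ m) * redY v) w \<in> range to_fract" if "w \<in> B" for w
          unfolding redcoord_redY[OF that v] using c 0 by (cases "w = v") (simp_all only: if_True if_False refl)
        then have "to_ac (Xf ^ j / Xf ^ m) * redY v \<in> ring_U0 L"
          unfolding ring_U0_eq using redY_in_L by blast
        then have "to_ac (Xf ^ j / Xf ^ m) * redY v + 0 \<in> ?W" using ring_U1_subspace(1) by blast
        then show ?thesis by (intro S.span_base) simp
      next
        case False
        define i where "i = m - j"
        have "Xf ^ m = Xf ^ j * Xf ^ i" using False by (simp add: i_def flip: power_add)
        then have eq: "Xf ^ j / Xf ^ m = 1 / Xf ^ i" by simp
        show ?thesis
        proof (cases "R * i < degree (free_part v)")
          case True
          then have "(v, i) \<in> polar_indices" using v False by (auto simp: polar_indices_def i_def)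
          then have "polar_elt (v, i) \<in> polar_elt ` polar_indices" by blast
          then show ?thesis unfolding eq by (intro S.span_base) (simp add: polar_elt_def)
        next
          case F: False
          have "1 / Xf ^ i \<in> Laurent" by (rule LaurentI[of _ 1 i]) simp
          moreover have "int (degree (free_part v)) \<le> int R * val_inf (1 / Xf ^ i)"
            using F unfolding val_inf_X_power by (simp flip: of_nat_mult)
          ultimately have "to_ac (1 / Xf ^ i) * redY v \<in> ring_U1 L"
            unfolding ring_U1_eq by (auto simp: redcoord_redY v simp del: to_ac_divide)
          then have "0 + to_ac (1 / Xf ^ i) * redY v \<in> ?W" using ring_U0_subspace(1) by blast
          then show ?thesis unfolding eq by (intro S.span_base) simp
        qed
      qed
      have comp: "to_ac (redcoord z v) * redY v \<in> S.span (polar_elt ` polar_indices \<union> ?W)" if v: "v \<in> B" for v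
      proof -
        obtain p m where pm: "redcoord z v = to_fract p / Xf ^ m"
        proof -
          have "redcoord z v \<in> Laurent" using z v by (simp add: ring_U01_eq)
          then show ?thesis using LaurentE that by blast
        qed
        have "to_ac (redcoord z v) = (\<Sum>i\<le>degree p. const_emb (coeff p i) * X_elem ^ i) / X_elem ^ m"
          unfolding pm to_ac_Laurent by (simp add: poly_emb_eq_sum[OF order.refl])
        also have "\<dots> = (\<Sum>i\<le>degree p. const_emb (coeff p i) * to_ac (Xf ^ i / Xf ^ m))"
          by (simp add: sum_divide_distrib X_elem_def poly_emb_def)
        finally have "to_ac (redcoord z v) * redY v = (\<Sum>i\<le>degree p. const_emb (coeff p i) * (to_ac (Xf ^ i / Xf ^ m) * redY v))"
          by (simp add: sum_distrib_right mult.assoc)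
        also have "\<dots> \<in> S.span (polar_elt ` polar_indices \<union> ?W)"
          by (intro S.span_sum S.span_scale mono v)
        finally show ?thesis .
      qed
      have "z = (\<Sum>v\<in>B. to_ac (redcoord z v) * redY v)" using zL by (rule expand_redY)
      also have "\<dots> \<in> S.span (polar_elt ` polar_indices \<union> ?W)" by (intro S.span_sum comp)
      finally show "z \<in> S.span (polar_elt ` polar_indices \<union> ?W)" .
    qed
  qed
  fix c :: "'a Kbar \<Rightarrow> 'a"
  assume "(\<Sum>b\<in>polar_elt ` polar_indices. const_emb (c b) * b) \<in> ?W"
  then obtain a b where ab: "(\<Sum>b\<in>polar_elt ` polar_indices. const_emb (c b) * b) = a + b"
    "a \<in> ring_U0 L" "b \<in> ring_U1 L" by blast
  have abL: "a \<in> L" "b \<in> L" using ab by (auto simp: ring_U0_eq ring_U1_eq)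
  show "\<forall>b\<in>polar_elt ` polar_indices. c b = 0"
  proof (rule ccontr)
    assume "\<not> ?thesis"
    then obtain w i0 where wi: "(w, i0) \<in> polar_indices" "c (polar_elt (w, i0)) \<noteq> 0" by auto
    then have w: "w \<in> B" and i0: "1 \<le> i0" "R * i0 < degree (free_part w)" by (auto simp: polar_indices_def)
    define d where "d = (\<lambda>i. c (polar_elt (w, i)))"
    define I where "I = {i. 1 \<le> i \<and> R * i < degree (free_part w)}"
    have finI: "finite I" unfolding I_def polar_set_eq by simp
    have "a + b = (\<Sum>vi\<in>polar_indices. const_emb (c (polar_elt vi)) * polar_elt vi)"
      unfolding ab(1)[symmetric] by (rule sum.reindex[OF polar_elt_inj, unfolded o_def])
    also have "\<dots> = (\<Sum>vi\<in>polar_indices. to_ac (to_fract [:c (polar_elt vi):] * (1 / Xf ^ snd vi)) * redY (fst vi))"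
      by (simp add: polar_elt_def const_emb_eq mult.assoc)
    finally have "redcoord (a + b) w = (\<Sum>vi\<in>polar_indices. if w = fst vi then to_fract [:c (polar_elt vi):] * (1 / Xf ^ snd vi) else 0)"
      by (simp only:) (subst redcoord_sum[OF redY_in_L w], intro sum.cong refl redcoord_redY w, auto simp: polar_indices_def)
    also have "\<dots> = (\<Sum>v\<in>B. \<Sum>i | 1 \<le> i \<and> R * i < degree (free_part v).
        if w = v then to_fract [:c (polar_elt (v, i)):] * (1 / Xf ^ i) else 0)"
    proof -
      have fin: "\<forall>v\<in>B. finite {i. 1 \<le> i \<and> R * i < degree (free_part v)}" by (simp only: polar_set_eq finite_atLeastAtMost) simp
      show ?thesis unfolding polar_indices_def by (simp only: sum.Sigma[OF finite_B fin] case_prod_unfold prod.collapse)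
    qed
    also have "\<dots> = (\<Sum>v\<in>B. if w = v then \<Sum>i\<in>I. to_fract [:d i:] * (1 / Xf ^ i) else 0)"
      by (rule sum.cong) (auto simp: I_def d_def)
    also have "\<dots> = (\<Sum>i\<in>I. to_fract [:d i:] * (1 / Xf ^ i))" using w by simp
    finally have eq: "redcoord a w + redcoord b w = (\<Sum>i\<in>I. to_fract [:d i:] * (1 / Xf ^ i))"
      using redcoord_add[OF abL w] by simp
    obtain p where p: "redcoord a w = to_fract p" using ab(2) w by (auto simp: ring_U0_eq)
    define m where "m = degree (free_part w)"
    have Im: "i \<le> m" if "i \<in> I" for i
    proof -
      have "i \<le> R * i" using R_pos by simp
      moreover have "R * i < m" using that by (simp add: I_def m_def)
      ultimately show ?thesis by linarith
    qed
    \<comment> \<open>\<open>Q\<close> is the \<open>w\<close>-coordinate of \<open>b\<close> with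
      its denominator cleared by \<open>X ^ m\<close>. The polynomial part \<open>X ^ m * p\<close>
      affects only coefficients from \<open>m\<close> on, so the coefficient of \<open>Q\<close> at
      \<open>m - i0\<close> is the nonzero \<open>d i0\<close>. Hence this coordinate has valuation
      at most \<open>i0\<close> at infinity, too small for \<open>U1\<close>.\<close>
    define Q where "Q = (\<Sum>i\<in>I. monom (d i) (m - i)) - monom 1 m * p"
    have "to_fract Q = redcoord b w * Xf ^ m"
    proof -
      have m1: "to_fract (monom e j) = to_fract [:e:] * Xf ^ j" for e :: 'a and j
        by (simp add: monom_altdef smult_conv_map_poly[symmetric] flip: to_fract_power to_fract_mult)
      have "to_fract (monom (d i) (m - i)) = to_fract [:d i:] * (1 / Xf ^ i) * Xf ^ m" if "i \<in> I" for i
      proof -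
        have "Xf ^ m = Xf ^ i * Xf ^ (m - i)" using Im[OF that] by (simp flip: power_add)
        then show ?thesis by (simp add: m1)
      qed
      then have "to_fract Q = (\<Sum>i\<in>I. to_fract [:d i:] * (1 / Xf ^ i) * Xf ^ m) - Xf ^ m * to_fract p"
        unfolding Q_def to_fract_diff to_fract_sum to_fract_mult using m1[of 1 m] by (simp flip: one_pCons)
      also have "\<dots> = (redcoord a w + redcoord b w) * Xf ^ m - Xf ^ m * redcoord a w"
        by (simp only: eq sum_distrib_right p[symmetric])
      finally show ?thesis by (simp add: algebra_simps)
    qed
    then have cb: "redcoord b w = to_fract Q / to_fract ([:0, 1:] ^ m)" by simp
    have i0I: "i0 \<in> I" using i0 by (simp add: I_def)
    have "coeff Q (m - i0) = d i0"
    proof -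
      have "coeff Q (m - i0) = (\<Sum>i\<in>I. if m - i = m - i0 then d i else 0) - coeff (monom 1 m * p) (m - i0)"
        by (simp add: Q_def coeff_sum)
      also have "(\<Sum>i\<in>I. if m - i = m - i0 then d i else 0) = (\<Sum>i\<in>I. if i = i0 then d i else 0)"
        using Im i0I by (intro sum.cong refl if_cong) (metis diff_diff_cancel)+
      also have "\<dots> = d i0" using finI i0I by simp
      also have "coeff (monom 1 m * p) (m - i0) = 0"
        using i0(1) Im[OF i0I] by (simp add: coeff_monom_mult)
      finally show ?thesis by simp
    qed
    moreover have "d i0 \<noteq> 0" using wi(2) by (simp add: d_def)
    ultimately have Q0: "Q \<noteq> 0" and dQ: "m - i0 \<le> degree Q" by (auto intro: le_degree)
    have "val_inf (redcoord b w) = int (degree ([:0, 1 :: 'a:] ^ m)) - int (degree Q)"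
      unfolding cb by (rule val_inf_quot) (use Q0 in auto)
    also have "degree ([:0, 1 :: 'a:] ^ m) = m" by (simp add: degree_power_eq)
    finally have "val_inf (redcoord b w) \<le> int i0" using dQ Im[OF i0I] by simp
    then have "int R * val_inf (redcoord b w) \<le> int R * int i0" by (intro mult_left_mono) auto
    moreover have "int (degree (free_part w)) \<le> int R * val_inf (redcoord b w)"
      using ab(3) w Q0 cb by (auto simp: ring_U1_eq)
    ultimately show False using i0(2) by (simp flip: of_nat_mult)
  qed
qed

lemma has_genus_iff: "has_genus L g \<longleftrightarrow> g = genus"
proof
  let ?W = "{a + b | a b. a \<in> ring_U0 L \<and> b \<in> ring_U1 L}"
  assume "has_genus L g"
  then have dims: "has_quotient_dim (ring_U01 L) ?W g" "has_quotient_dim (ring_U01 L) ?W genus"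
    using has_genus_genus by (simp_all add: has_genus_def)
  have W0: "0 \<in> ?W" using ring_U0_subspace(1) ring_U1_subspace(1) by force
  have Wa: "x + x' \<in> ?W" if x: "x \<in> ?W" "x' \<in> ?W" for x x'
  proof -
    obtain a b a' b' where "x = a + b" "x' = a' + b'" "a \<in> ring_U0 L" "a' \<in> ring_U0 L" "b \<in> ring_U1 L" "b' \<in> ring_U1 L"
      using x by auto
    then have "x + x' = (a + a') + (b + b')" "a + a' \<in> ring_U0 L" "b + b' \<in> ring_U1 L"
      using ring_U0_subspace(2) ring_U1_subspace(2) by auto
    then show ?thesis by blast
  qed
  have Ws: "const_emb c * x \<in> ?W" if "x \<in> ?W" for x c
  proof -
    obtain a b where "x = a + b" "a \<in> ring_U0 L" "b \<in> ring_U1 L" using \<open>x \<in> ?W\<close> by auto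
    then have "const_emb c * x = const_emb c * a + const_emb c * b" "const_emb c * a \<in> ring_U0 L" "const_emb c * b \<in> ring_U1 L"
      using ring_U0_subspace(3) ring_U1_subspace(3) by (auto simp: algebra_simps)
    then show ?thesis by blast
  qed
  show "g = genus"
    by (intro order_antisym quotient_dim_le[OF dims W0 Wa Ws] quotient_dim_le[OF dims(2) dims(1) W0 Wa Ws])
qed (simp add: has_genus_genus)

lemma free_part_nonconst:
  assumes v: "v \<in> B" "v \<noteq> z0" shows "degree (free_part v) > 0"
proof -
  obtain P where P: "monic_irred P" "\<not> int R dvd pr (vF P) v"
    using nd[OF v] unfolding vF_def by blast
  have "\<not> int R dvd int (pmult P (mon v))" using P pmult_mon[OF P(1) v(1)] by simp
  then have "pmult P (free_part v) > 0" by (simp add: pmult_free_part P(1) mod_greater_zero_iff_not_dvd)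
  then have "P dvd free_part v" using dvd_iff_pmult_pos[OF P(1)] free_part_nz by blast
  then have "degree P \<le> degree (free_part v)" by (rule dvd_imp_degree_le) simp
  then show ?thesis using monic_irred_props(4)[OF P(1)] by simp
qed

lemma mon_z0 [simp]: "mon z0 = 1" by (simp add: mon_def zero_vec_def)

lemma root_part_z0 [simp]: "root_part z0 = 1"
  unfolding root_part_def mon_z0 by (rule prod.neutral) (simp add: primes_of_irred)

text \<open>An element algebraic over the constants is integral over both affine rings. Its nonzero
  coordinates are then polynomials \<open>f\<close> with
  \<open>degree (free_part v) + R * degree f \<le> 0\<close>, so only the coordinate at
  \<open>z0\<close> can be nonzero, and that one is constant.\<close>

lemma geom_connected_L: "geom_connected L"
  unfolding geom_connected_def
proof (intro ballI allI impI, elim conjE)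
  fix x and p :: "'a poly"
  assume x: "x \<in> L" and p: "p \<noteq> 0" "poly (map_poly const_emb p) x = 0"
  define q where "q = smult (inverse (lead_coeff p)) p"
  have q: "lead_coeff q = 1" "poly (map_poly const_emb q) x = 0"
  proof -
    show "lead_coeff q = 1" using p(1) by (simp add: q_def)
    have "map_poly const_emb q = smult (const_emb (inverse (lead_coeff p))) (map_poly const_emb p)"
      by (rule poly_eqI) (simp add: coeff_map_poly q_def const_emb_simps)
    then show "poly (map_poly const_emb q) x = 0" using p(2) by simp
  qed
  have c0: "const_emb c = 0 \<longleftrightarrow> c = 0" for c :: 'a by (simp add: const_emb_def poly_emb_simps)
  have lq: "lead_coeff (map_poly const_emb q) = 1"
    using q(1) by (simp add: degree_map_poly c0 coeff_map_poly const_emb_simps)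
  have coef: "coeff (map_poly const_emb q) i = const_emb (coeff q i)" for i
    by (simp add: coeff_map_poly const_emb_simps)
  have int: "x \<in> integral_closure_in A L" if "range const_emb \<subseteq> A" for A
    unfolding integral_closure_in_def using x q lq coef that
    by (auto intro!: exI[of _ "map_poly const_emb q"])
  have xU0: "x \<in> ring_U0 L" unfolding ring_U0_def by (rule int) (auto simp: const_emb_def)
  have "const_emb c \<in> range (\<lambda>p :: 'a poly. poly (map_poly const_emb p) (inverse X_elem))" for c
    by (rule range_eqI[of _ _ "[:c:]"]) (simp add: map_poly_pCons const_emb_simps)
  then have xU1: "x \<in> ring_U1 L" unfolding ring_U1_def by (intro int) auto
  have comp: "\<exists>f. redcoord x v = to_fract f \<and> (f \<noteq> 0 \<longrightarrow> degree f = 0 \<and> degree (free_part v) = 0)" if v: "v \<in> B" for v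
  proof -
    obtain f where f: "redcoord x v = to_fract f" using xU0 v by (auto simp: ring_U0_eq)
    have "degree f = 0 \<and> degree (free_part v) = 0" if "f \<noteq> 0"
    proof -
      have "int (degree (free_part v)) \<le> int R * (- int (degree f))"
        using xU1 v f that val_inf_poly[OF that] by (auto simp: ring_U1_eq)
      then have "int (degree (free_part v)) + int R * int (degree f) \<le> 0" by simp
      moreover have "int R * int (degree f) \<ge> 0" by simp
      ultimately have "int (degree (free_part v)) = 0" "int R * int (degree f) = 0" by linarith+
      then show ?thesis using R_pos by simp
    qed
    then show ?thesis using f by blast
  qed
  have "redcoord x v = 0" if v: "v \<in> B" "v \<noteq> z0" for v
    using comp[OF v(1)] free_part_nonconst[OF v] by auto
  then have "(\<Sum>v\<in>B. to_ac (redcoord x v) * redY v) = (\<Sum>v\<in>B. if v = z0 then to_ac (redcoord x z0) * redY z0 else 0)"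
    by (intro sum.cong) auto
  then have x2: "x = to_ac (redcoord x z0) * redY z0" using expand_redY[OF x] by simp
  obtain f where f: "redcoord x z0 = to_fract f" "f \<noteq> 0 \<longrightarrow> degree f = 0" using comp[of z0] by auto
  have "degree f = 0" using f by (cases "f = 0") auto
  then obtain c where "f = [:c:]" by (elim degree_eq_zeroE)
  then have "x = const_emb c" using x2 f by (simp add: redY_def poly_emb_simps const_emb_eq)
  then show "x \<in> range const_emb" by blast
qed

end

section \<open>Curves and Kummer data\<close>

lemma K_hom_on_prod_power:
  fixes y :: "nat \<Rightarrow> ('a :: {field,finite}) Kbar"
  assumes M: "intermediate_field M" and f: "K_hom_on M f" and y: "\<And>j. j \<in> J \<Longrightarrow> y j \<in> M"
  shows "(\<Prod>j\<in>J. y j ^ e j) \<in> M \<and> f (\<Prod>j\<in>J. y j ^ e j) = (\<Prod>j\<in>J. f (y j) ^ e j)"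
proof -
  have 1: "1 \<in> M" "f 1 = 1"
    using M f to_ac_1 unfolding intermediate_field_iff K_hom_on_def by (metis rangeI subsetD)+
  have pow: "a ^ m \<in> M \<and> f (a ^ m) = f a ^ m" if "a \<in> M" for a m
    by (induction m) (use 1 M f that in \<open>auto simp: intermediate_field_iff K_hom_on_def\<close>)
  show ?thesis using y
    by (induction J rule: infinite_finite_induct)
       (use 1 M f pow in \<open>auto simp: intermediate_field_iff K_hom_on_def\<close>)
qed

lemma intermediate_field_scale: "intermediate_field M \<Longrightarrow> a \<in> M \<Longrightarrow> to_ac k * a \<in> M"
  unfolding intermediate_field_iff by blast

lemma pmult_less_power_free:
  "power_free m f \<Longrightarrow> monic_irred P \<Longrightarrow> pmult P f < m"
  using power_dvd_iff_pmult[of P f m] monic_irred_props(2)[of P]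
  by (auto simp: power_free_def not_less[symmetric])

lemma power_free_iff:
  assumes "f \<noteq> 0" "m > 0"
  shows "power_free m f \<longleftrightarrow> (\<forall>P. monic_irred P \<longrightarrow> pmult P f < m)"
proof
  assume r: "\<forall>P. monic_irred P \<longrightarrow> pmult P f < m"
  have "is_unit p" if p: "p ^ m dvd f" for p
  proof (rule ccontr)
    assume nu: "\<not> is_unit p"
    have p0: "p \<noteq> 0" using p assms by (auto simp: power_0_left)
    then have "degree p > 0" using nu by (simp add: is_unit_iff_degree)
    then obtain P where P: "monic_irred P" "P dvd p" using irreducible_factor_exists by blast
    then have "P ^ m dvd f" using p by (meson dvd_power_same dvd_trans)
    then show False using power_dvd_iff_pmult[OF P(1) assms(1)] r P(1) by auto
  qed
  then show "power_free m f" using assms by (simp add: power_free_def)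
qed (use pmult_less_power_free in blast)

locale cover_data =
  fixes n :: nat and r :: "nat \<Rightarrow> nat" and \<zeta>0 :: "'a :: {field,finite}"
  assumes n_pos: "n \<ge> 1"
    and r_pos': "\<forall>j\<in>{1..n}. r j > 0"
    and r_chain: "\<forall>j\<in>{1..<n}. r j dvd r (Suc j)"
    and r_last: "r n > 1"
    and q_cong: "[CARD('a) = 1] (mod r n)"
    and prim_zeta: "primitive_root_of_unity (r n) \<zeta>0"
begin

lemma r_dvd_last: "j \<in> {1..n} \<Longrightarrow> r j dvd r n"
proof -
  assume "j \<in> {1..n}"
  then have j: "j \<ge> 1" "j \<le> n" by auto
  have "r j dvd r m" if "j \<le> m" "m \<le> n" for m
    using that
  proof (induction m rule: dec_induct)
    case (step m)
    then have "r j dvd r m" "r m dvd r (Suc m)" using r_chain j by auto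
    then show ?case by (rule dvd_trans)
  qed simp
  then show ?thesis using j by simp
qed

text \<open>\<open>r n\<close> divides \<open>q - 1\<close>, while the characteristic divides
  \<open>q\<close>.\<close>

lemma of_nat_last_nz: "of_nat (r n) \<noteq> (0 :: 'a)"
proof
  assume 0: "of_nat (r n) = (0 :: 'a)"
  have "CHAR('a) dvd CARD('a)" by (rule CHAR_dvd_CARD)
  then have "of_nat (CARD('a)) = (0 :: 'a)" by (simp add: of_nat_eq_0_iff_char_dvd)
  moreover have "CARD('a) \<ge> 1" by (simp add: Suc_leI)
  then have "r n dvd CARD('a) - 1" using q_cong by (metis cong_altdef_nat)
  then obtain t where "CARD('a) - 1 = r n * t" by auto
  then have "CARD('a) = r n * t + 1" using \<open>CARD('a) \<ge> 1\<close> by linarith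
  then have "of_nat (CARD('a)) = (of_nat (r n * t + 1) :: 'a)" by (rule arg_cong)
  then have "of_nat (CARD('a)) = (1 :: 'a)" by (simp add: 0)
  ultimately show False by simp
qed

sublocale residue_system n r "r n"
  by unfold_locales (use r_pos' r_dvd_last r_last in auto)

definition nondeg :: "(nat \<Rightarrow> 'a poly) \<Rightarrow> bool" where
  "nondeg F \<longleftrightarrow> (\<forall>v\<in>B. v \<noteq> z0 \<longrightarrow> (\<exists>P. monic_irred P \<and> \<not> int (r n) dvd pr (\<lambda>j. int (pmult P (F j))) v))"

lemma kummer_baseI:
  "(\<And>j. j \<in> {1..n} \<Longrightarrow> F j \<noteq> 0) \<Longrightarrow> (\<And>j. j \<in> {1..n} \<Longrightarrow> y j ^ r j = poly_emb (F j)) \<Longrightarrow>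
   kummer_base n r (r n) \<zeta>0 F y"
  using prim_zeta of_nat_last_nz by unfold_locales auto

lemma kummer_tupleI:
  "(\<And>j. j \<in> {1..n} \<Longrightarrow> F j \<noteq> 0) \<Longrightarrow> (\<And>j. j \<in> {1..n} \<Longrightarrow> y j ^ r j = poly_emb (F j)) \<Longrightarrow>
   nondeg F \<Longrightarrow> kummer_tuple n r (r n) \<zeta>0 F y"
  by (intro kummer_tuple.intro kummer_baseI kummer_tuple_axioms.intro) (auto simp: nondeg_def)

text \<open>\<open>kummer_data\<close> with the roots \<open>y\<close> exposed: two sets of data of
  one curve are compared through their roots.\<close>

definition frame :: "'a Gcurve \<Rightarrow> (nat \<Rightarrow> 'a poly) \<Rightarrow> (nat \<Rightarrow> 'a Kbar) \<Rightarrow> bool" where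
  "frame C F y \<longleftrightarrow> (\<forall>j\<in>{1..n}. power_free (r j) (F j)) \<and>
     (\<forall>j\<in>{1..n}. y j ^ r j = poly_emb (F j)) \<and>
     fst C = intermediate_field hull (y ` {1..n}) \<and>
     (\<forall>\<sigma>\<in>B. \<forall>j\<in>{1..n}. snd C \<sigma> (y j) = to_ac (to_fract [:\<zeta>0:] powi (\<sigma> j * int (r n div r j))) * y j)"

lemma const_zeta_power:
  "\<sigma> \<in> B \<Longrightarrow> j \<in> {1..n} \<Longrightarrow>
   const_emb \<zeta>0 ^ (nat (\<sigma> j) * (r n div r j)) = to_ac (to_fract [:\<zeta>0:] powi (\<sigma> j * int (r n div r j)))"
proof -
  assume "\<sigma> \<in> B" "j \<in> {1..n}"
  then have "\<sigma> j \<ge> 0" by (auto simp: residue_box_def PiE_iff)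
  then have "\<sigma> j * int (r n div r j) = int (nat (\<sigma> j) * (r n div r j))" by simp
  then show ?thesis by (simp only: power_int_of_nat to_ac_power const_emb_def poly_emb_def)
qed

lemma kummer_data_iff_frame: "kummer_data n r \<zeta>0 C F \<longleftrightarrow> (\<exists>y. frame C F y)"
proof -
  have "(\<forall>\<sigma>\<in>B. \<forall>j\<in>{1..n}. snd C \<sigma> (y j) = const_emb \<zeta>0 ^ (nat (\<sigma> j) * (r n div r j)) * y j) \<longleftrightarrow>
      (\<forall>\<sigma>\<in>B. \<forall>j\<in>{1..n}. snd C \<sigma> (y j) = to_ac (to_fract [:\<zeta>0:] powi (\<sigma> j * int (r n div r j))) * y j)" for y
    by (intro ball_cong refl) (simp only: const_zeta_power)
  then show ?thesis unfolding kummer_data_def frame_def carrier_abelian_grp by auto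
qed

lemma frame_nz: "frame C F y \<Longrightarrow> j \<in> {1..n} \<Longrightarrow> F j \<noteq> 0"
  by (auto simp: frame_def power_free_def)

text \<open>If all multiplicities in \<open>mon v\<close> are divisible by \<open>r n\<close>, then
  \<open>Y v\<close> divided by \<open>root_part v\<close> has a constant \<open>r n\<close>-th
  power, hence is a constant by geometric connectedness. So \<open>Y v\<close> lies in
  \<open>K\<close> and is fixed by every group element, which makes the character of
  \<open>v\<close> trivial.\<close>

lemma frame_nondeg:
  assumes C: "C \<in> curves_Gg n r g" and fr: "frame C F y"
  shows "nondeg F"
proof (rule ccontr)
  assume "\<not> nondeg F"
  then obtain v where v: "v \<in> B" "v \<noteq> z0"
    "\<And>P. monic_irred P \<Longrightarrow> int (r n) dvd pr (\<lambda>j. int (pmult P (F j))) v"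
    by (auto simp: nondeg_def)
  obtain M f where Mf: "C = (M, f)" by (cases C)
  have M: "intermediate_field M" "geom_connected M" "f \<in> iso (abelian_grp n r) (Gal M)"
    using C by (auto simp: Mf curves_Gg_def galois_over_K_def)
  interpret kb: kummer_base n r "r n" \<zeta>0 F y
    by (rule kummer_baseI) (use fr frame_nz in \<open>auto simp: frame_def\<close>)
  have yM: "y j \<in> M" if "j \<in> {1..n}" for j
    using fr that hull_subset[of "y ` {1..n}" intermediate_field] by (auto simp: frame_def Mf)
  have Yv: "kb.Y v = (\<Prod>j\<in>{1..n}. y j ^ nat (v j))"
    unfolding kb.Y_def by (rule prod.cong) (use v in \<open>auto simp: residue_box_def power_int_def PiE_iff\<close>)
  have "pmult P (kb.free_part v) = 0" if "monic_irred P" for P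
  proof -
    have "int (r n) dvd int (pmult P (kb.mon v))"
      using v(3)[OF that] kb.pmult_mon[OF that v(1)] unfolding kb.vF_def by simp
    then show ?thesis by (simp add: kb.pmult_free_part[OF that])
  qed
  then have "degree (kb.free_part v) = 0"
    using irreducible_factor_exists[of "kb.free_part v"] dvd_iff_pmult_pos[OF _ kb.free_part_nz] by fastforce
  then obtain u where u: "kb.free_part v = [:u:]" by (elim degree_eq_zeroE)
  define t where "t = kb.Y v / poly_emb (kb.root_part v)"
  have rp: "poly_emb (kb.root_part v) \<noteq> (0 :: 'a Kbar)" by (simp add: poly_emb_simps)
  have tR: "t ^ r n = const_emb u"
  proof -
    have "kb.Y v ^ r n = poly_emb (kb.root_part v) ^ r n * const_emb u"
      unfolding kb.Y_pow_mon[OF v(1)] by (subst kb.mon_split) (simp only: poly_emb_simps u const_emb_def)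
    then show ?thesis using rp by (simp add: t_def power_divide)
  qed
  have "kb.Y v \<in> M"
    unfolding Yv by (rule conjunct1[OF K_hom_on_prod_power[OF M(1), of id]]) (use yM in \<open>auto simp: K_hom_on_def\<close>)
  then have "t \<in> M" using M(1) unfolding t_def poly_emb_def divide_inverse by (auto simp: intermediate_field_iff)
  moreover have "poly (map_poly const_emb (monom 1 (r n) - [:u:])) t = 0"
  proof -
    have "map_poly const_emb (monom 1 (r n) - [:u:]) = monom 1 (r n) - [:const_emb u :: 'a Kbar:]"
      by (rule poly_eqI) (auto simp: coeff_map_poly const_emb_simps coeff_pCons split: nat.split)
    then show ?thesis using tR by (simp add: poly_monom)
  qed
  moreover have "monom 1 (r n) - [:u:] \<noteq> 0"
  proof
    assume "monom 1 (r n) - [:u:] = 0"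
    then have "coeff (monom 1 (r n) - [:u:]) (r n) = 0" by simp
    then show False using r_last by (simp add: coeff_pCons split: nat.split_asm)
  qed
  ultimately have "t \<in> range const_emb" using M(2) unfolding geom_connected_def by blast
  then obtain w where w: "t = const_emb w" by auto
  then have Yk: "kb.Y v = to_ac (to_fract ([:w:] * kb.root_part v))"
  proof -
    have "kb.Y v = const_emb w * poly_emb (kb.root_part v)"
      using w unfolding t_def by (rule iffD1[OF nonzero_divide_eq_eq[OF rp]])
    also have "\<dots> = poly_emb ([:w:] * kb.root_part v)" by (simp only: const_emb_def poly_emb_simps)
    finally show ?thesis by (simp only: poly_emb_def)
  qed
  have "int (r n) dvd pr s v" if s: "s \<in> B" for s
  proof -
    have "f s \<in> carrier (Gal M)" using M(3) s carrier_abelian_grp by (auto simp: iso_def hom_def)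
    then have K: "K_hom_on M (f s)" by (simp add: carrier_Gal)
    have "kb.Y v = f s (kb.Y v)" unfolding Yk using K by (simp only: K_hom_on_def)
    also have "\<dots> = (\<Prod>j\<in>{1..n}. f s (y j) ^ nat (v j))"
      unfolding Yv by (rule conjunct2[OF K_hom_on_prod_power[OF M(1) K]]) (rule yM)
    also have "\<dots> = (\<Prod>j\<in>{1..n}. to_ac (to_fract [:\<zeta>0:] powi (s j * v j * int (r n div r j))) * y j ^ nat (v j))"
    proof (rule prod.cong[OF refl])
      fix j assume j: "j \<in> {1..n}"
      have "f s (y j) = to_ac (to_fract [:\<zeta>0:] powi (s j * int (r n div r j))) * y j"
        using fr s j by (auto simp: frame_def Mf)
      moreover have "to_ac (to_fract [:\<zeta>0:] powi (s j * int (r n div r j))) ^ nat (v j) =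
          to_ac (to_fract [:\<zeta>0:] powi (s j * v j * int (r n div r j)))"
      proof -
        have "v j = int (nat (v j))" using v(1) j by (auto simp: residue_box_def PiE_iff)
        then have "s j * v j * int (r n div r j) = (s j * int (r n div r j)) * int (nat (v j))" by simp
        then show ?thesis by (simp only: power_int_mult power_int_of_nat to_ac_power)
      qed
      ultimately show "f s (y j) ^ nat (v j) = to_ac (to_fract [:\<zeta>0:] powi (s j * v j * int (r n div r j))) * y j ^ nat (v j)"
        by (simp only: power_mult_distrib)
    qed
    also have "\<dots> = to_ac (\<Prod>j\<in>{1..n}. to_fract [:\<zeta>0:] powi (s j * v j * int (r n div r j))) * kb.Y v"
      by (simp only: prod.distrib to_ac_prod Yv)
    also have "(\<Prod>j\<in>{1..n}. to_fract [:\<zeta>0:] powi (s j * v j * int (r n div r j))) = to_fract [:\<zeta>0:] powi pr s v"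
    proof -
      have pw: "z powi (\<Sum>j\<in>J. e j) = (\<Prod>j\<in>J. z powi e j)" if "z \<noteq> 0" "finite J" for z :: "'a poly fract" and e :: "nat \<Rightarrow> int" and J
        using that(2) by (induction J rule: finite_induct) (auto simp: power_int_add that(1))
      show ?thesis unfolding pairing_def by (rule pw[OF kb.zeta_nz finite_atLeastAtMost, symmetric])
    qed
    finally have "to_ac (to_fract [:\<zeta>0:] powi pr s v) * kb.Y v = 1 * kb.Y v" by simp
    then have "to_ac (to_fract [:\<zeta>0:] powi pr s v) = (1 :: 'a Kbar)" by (simp only: mult_right_cancel[OF kb.Y_nz])
    then have "to_fract [:\<zeta>0:] powi pr s v = 1" by (simp only: to_ac_eq_1_iff)
    then show ?thesis using powi_prim_root_eq_1_iff[OF kb.prim] by blast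
  qed
  then have "v = z0" by (rule pr_nondegenerate[OF v(1)])
  then show False using v(2) by blast
qed

lemma frame_tuple:
  "C \<in> curves_Gg n r g \<Longrightarrow> frame C F y \<Longrightarrow> kummer_tuple n r (r n) \<zeta>0 F y"
  by (rule kummer_tupleI[OF frame_nz _ frame_nondeg]) (assumption | simp add: frame_def)+

definition std_curve :: "(nat \<Rightarrow> 'a Kbar) \<Rightarrow> 'a Gcurve" where
  "std_curve y = (radical_box.L n r y, radical_field.aut_map n r (r n) (to_fract [:\<zeta>0:]) y)"

text \<open>The roots determine the curve: they generate the field, and an automorphism is
  determined by its values on them.\<close>

lemma frame_std_curve:
  assumes C: "C \<in> curves_Gg n r g" and fr: "frame C F y"
  shows "C = std_curve y"
proof -
  interpret kt: kummer_tuple n r "r n" \<zeta>0 F y by (rule frame_tuple[OF C fr])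
  obtain M f where Mf: "C = (M, f)" by (cases C)
  have f: "f \<in> iso (abelian_grp n r) (Gal M)" "f \<in> extensional B"
    using C by (auto simp: Mf curves_Gg_def carrier_abelian_grp)
  have MeqL: "M = kt.L" using fr kt.L_hull by (simp add: frame_def Mf)
  have "f s = kt.aut_map s" for s
  proof (cases "s \<in> B")
    case True
    have "f s \<in> carrier (Gal kt.L)" using f(1) True carrier_abelian_grp by (auto simp: iso_def hom_def MeqL)
    then have fs: "f s \<in> Bij kt.L" "K_hom_on kt.L (f s)" by (auto simp: carrier_Gal)
    have "f s z = restrict (kt.aut s) kt.L z" for z
    proof (cases "z \<in> kt.L")
      case z: True
      show ?thesis
      proof (rule kt.K_hom_on_determined[OF fs(2) kt.K_hom_on_aut _ z])
        fix j assume j: "j \<in> {1..n}"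
        have "f s (y j) = to_ac (to_fract [:\<zeta>0:] powi (s j * int (r n div r j))) * y j"
          using fr True j by (auto simp: frame_def Mf)
        then show "f s (y j) = restrict (kt.aut s) kt.L (y j)"
          using kt.y_in_L[OF j] kt.aut_y[OF j, of s] by simp
      qed
    next
      case False then show ?thesis using fs(1) by (auto simp: Bij_def extensional_def)
    qed
    then show ?thesis using True by (auto simp: kt.aut_map_def)
  next
    case False then show ?thesis using f(2) by (auto simp: kt.aut_map_def extensional_def)
  qed
  then show ?thesis by (auto simp: std_curve_def Mf MeqL)
qed

lemma std_curve_in_curves:
  assumes kt: "kummer_tuple n r (r n) \<zeta>0 F y"
  shows "std_curve y \<in> curves_Gg n r (kummer_tuple.genus n r (r n) F)"
proof -
  interpret kt: kummer_tuple n r "r n" \<zeta>0 F y by (rule kt)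
  show ?thesis unfolding std_curve_def curves_Gg_def
    using kt.galois_over_K_L kt.geom_connected_L kt.aut_map_iso kt.has_genus_genus
    by (auto simp: kt.aut_map_def carrier_abelian_grp)
qed

lemma std_curve_frame:
  assumes kt: "kummer_tuple n r (r n) \<zeta>0 F y" and pf: "\<And>j. j \<in> {1..n} \<Longrightarrow> power_free (r j) (F j)"
  shows "frame (std_curve y) F y"
proof -
  interpret kt: kummer_tuple n r "r n" \<zeta>0 F y by (rule kt)
  show ?thesis unfolding frame_def std_curve_def
    using pf kt.yF kt.L_hull kt.y_in_L kt.aut_y by (auto simp: kt.aut_map_def)
qed

lemma frame_genus:
  assumes C: "C \<in> curves_Gg n r g" and fr: "frame C F y"
  shows "g = kummer_tuple.genus n r (r n) F"
proof -
  interpret kt: kummer_tuple n r "r n" \<zeta>0 F y by (rule frame_tuple[OF C fr])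
  have "has_genus kt.L g" using C unfolding frame_std_curve[OF C fr] std_curve_def curves_Gg_def by auto
  then show ?thesis using kt.has_genus_iff by blast
qed

text \<open>Used twice: for another choice of roots of the same polynomials, and for polynomials
  scaled by \<open>r j\<close>-th powers of constants.\<close>

lemma frame_rescale:
  assumes C: "C \<in> curves_Gg n r g" and fr: "frame C F y"
    and F': "\<And>j. j \<in> {1..n} \<Longrightarrow> power_free (r j) (F' j)" "\<And>j. j \<in> {1..n} \<Longrightarrow> y' j ^ r j = poly_emb (F' j)"
    and d: "\<And>j. j \<in> {1..n} \<Longrightarrow> d j \<noteq> 0 \<and> y' j = to_ac (d j) * y j"
  shows "frame C F' y'"
proof -
  obtain M f where Mf: "C = (M, f)" by (cases C)
  have M: "intermediate_field M" "f \<in> iso (abelian_grp n r) (Gal M)"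
    using C by (auto simp: Mf curves_Gg_def galois_over_K_def)
  have hull: "M = intermediate_field hull (y ` {1..n})" using fr by (simp add: frame_def Mf)
  have yM: "y j \<in> M" if "j \<in> {1..n}" for j
    unfolding hull using that hull_subset[of "y ` {1..n}" intermediate_field] by auto
  have "intermediate_field hull (y' ` {1..n}) = M"
  proof (rule hull_unique)
    show "y' ` {1..n} \<subseteq> M" using d intermediate_field_scale[OF M(1) yM] by auto
    show "intermediate_field M" by (rule M)
    fix N assume N: "y' ` {1..n} \<subseteq> N" "intermediate_field N"
    have "y j \<in> N" if j: "j \<in> {1..n}" for j
    proof -
      have "y j = to_ac (inverse (d j)) * y' j" using d[OF j] by simp
      also have "\<dots> \<in> N" by (rule intermediate_field_scale[OF N(2)]) (use N(1) j in auto)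
      finally show ?thesis .
    qed
    then show "M \<subseteq> N" unfolding hull by (intro hull_minimal N(2)) auto
  qed
  moreover have "f s (y' j) = to_ac (to_fract [:\<zeta>0:] powi (s j * int (r n div r j))) * y' j"
    if s: "s \<in> B" and j: "j \<in> {1..n}" for s j
  proof -
    have "f s \<in> carrier (Gal M)" using M(2) s carrier_abelian_grp by (auto simp: iso_def hom_def)
    then have K: "K_hom_on M (f s)" by (simp add: carrier_Gal)
    have "to_ac (d j) \<in> M" using M(1) by (auto simp: intermediate_field_iff)
    then have "f s (y' j) = to_ac (d j) * f s (y j)" using K d[OF j] yM[OF j] by (simp add: K_hom_on_def)
    also have "f s (y j) = to_ac (to_fract [:\<zeta>0:] powi (s j * int (r n div r j))) * y j"
      using fr s j by (auto simp: frame_def Mf)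
    finally show ?thesis using d[OF j] by (simp add: mult_ac)
  qed
  ultimately show ?thesis using F' by (simp add: frame_def Mf)
qed

text \<open>Two choices of roots of the same polynomials differ by roots of unity, which lie in
  \<open>K\<close>.\<close>

lemma frame_unique_curve:
  assumes C: "C \<in> curves_Gg n r g" "frame C F y" and C': "C' \<in> curves_Gg n r g'" "frame C' F y'"
  shows "C = C'"
proof -
  interpret kt: kummer_tuple n r "r n" \<zeta>0 F y by (rule frame_tuple[OF C])
  have "\<exists>d. d \<noteq> 0 \<and> y j = to_ac d * y' j" if j: "j \<in> {1..n}" for j
  proof -
    have eq: "y j ^ r j = y' j ^ r j" using C C' j by (simp add: frame_def)
    have y0: "y j \<noteq> 0" using kt.y_nz[OF j] .
    then have y'0: "y' j \<noteq> 0" using eq r_pos[OF j] by (metis power_eq_0_iff)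
    have "(y j / y' j) ^ r j = 1" using eq y'0 y0 by (simp add: power_divide)
    then have "(y j / y' j) ^ r n = 1" using r_dvd_last[OF j] by (metis dvdE power_mult power_one)
    then obtain i where "y j / y' j = to_ac (to_fract [:\<zeta>0:] powi i)" using kt.root_of_unity_powi by blast
    then have "y j = to_ac (to_fract [:\<zeta>0:] powi i) * y' j" using y'0 by (simp add: field_simps)
    then show ?thesis using kt.zeta_nz by (metis power_int_eq_0_iff)
  qed
  then obtain d where d: "\<And>j. j \<in> {1..n} \<Longrightarrow> d j \<noteq> 0 \<and> y j = to_ac (d j) * y' j" by metis
  have "frame C' F y"
    by (rule frame_rescale[OF C' _ _ d]) (use C(2) in \<open>auto simp: frame_def\<close>)
  then show ?thesis using frame_std_curve[OF C] frame_std_curve[OF C'(1)] by metis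
qed

text \<open>The group acts on \<open>y' j\<close> and \<open>y j\<close> by the same scalars, so
  their quotient \<open>k\<close> is fixed and lies in \<open>K\<close>. Then \<open>F' j\<close> is
  \<open>k ^ r j\<close> times \<open>F j\<close>; as both are free of \<open>r j\<close>-th powers,
  \<open>k\<close> has no zero or pole at a finite place, so it is a constant.\<close>

lemma frame_unique_data:
  assumes C: "C \<in> curves_Gg n r g" and fr: "frame C F y" and fr': "frame C F' y'" and j: "j \<in> {1..n}"
  shows "\<exists>c. c \<noteq> 0 \<and> F' j = smult (c ^ r j) (F j)"
proof -
  interpret kt: kummer_tuple n r "r n" \<zeta>0 F y by (rule frame_tuple[OF C fr])
  have CS: "C = std_curve y" by (rule frame_std_curve[OF C fr])
  have yL: "y j \<in> kt.L" "y' j \<in> kt.L"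
  proof -
    show "y j \<in> kt.L" by (rule kt.y_in_L[OF j])
    have "fst C = intermediate_field hull (y' ` {1..n})" using fr' by (simp add: frame_def)
    then show "y' j \<in> kt.L"
      using j hull_subset[of "y' ` {1..n}" intermediate_field] by (auto simp: CS std_curve_def)
  qed
  have y0: "y j \<noteq> 0" using kt.y_nz[OF j] .
  have au: "kt.aut s (y' j / y j) = y' j / y j" if s: "s \<in> B" for s
  proof -
    have "snd C s (y' j) = to_ac (to_fract [:\<zeta>0:] powi (s j * int (r n div r j))) * y' j"
      using fr' s j by (auto simp: frame_def)
    then have 1: "kt.aut s (y' j) = to_ac (to_fract [:\<zeta>0:] powi (s j * int (r n div r j))) * y' j"
      using s yL by (simp add: CS std_curve_def kt.aut_map_def)
    have "kt.aut s (y' j / y j) * kt.aut s (y j) = kt.aut s (y' j)"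
      using y0 yL by (subst kt.aut_mult[symmetric]) (auto intro: kt.L_divide)
    then have "kt.aut s (y' j / y j) * (to_ac (to_fract [:\<zeta>0:] powi (s j * int (r n div r j))) * y j) =
        to_ac (to_fract [:\<zeta>0:] powi (s j * int (r n div r j))) * y' j"
      unfolding 1 kt.aut_y[OF j] .
    moreover have "to_ac (to_fract [:\<zeta>0:] powi (s j * int (r n div r j))) \<noteq> (0 :: 'a Kbar)"
      using kt.zeta_nz by (metis power_int_eq_0_iff to_ac_eq_0_iff)
    moreover have "a = c / b" if "a * (w * b) = w * c" "w \<noteq> 0" "b \<noteq> 0" for a b c w :: "'a Kbar"
      using that by (simp add: field_simps)
    ultimately show ?thesis using y0 by blast
  qed
  obtain k where k: "y' j / y j = to_ac k"
    using kt.fixed_in_K[OF kt.L_divide[OF yL(2,1)] au] by blast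
  then have yk: "y' j = to_ac k * y j" using y0 by (simp add: field_simps)
  have nz: "F j \<noteq> 0" "F' j \<noteq> 0" using frame_nz[OF fr j] frame_nz[OF fr' j] by auto
  have "poly_emb (F' j) = to_ac (k ^ r j) * poly_emb (F j)"
  proof -
    have "poly_emb (F' j) = y' j ^ r j" "poly_emb (F j) = y j ^ r j"
      using fr fr' j by (simp_all add: frame_def)
    then show ?thesis by (simp add: yk power_mult_distrib)
  qed
  then have "to_ac (to_fract (F' j)) = to_ac (k ^ r j * to_fract (F j))" by (simp add: poly_emb_def)
  then have kF: "to_fract (F' j) = k ^ r j * to_fract (F j)" by (simp only: to_ac_eq_iff)
  have k0: "k \<noteq> 0" using kF nz r_pos[OF j] by (auto simp: power_0_left)
  have v0: "val_at P k = 0" if P: "monic_irred P" for P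
  proof -
    have "int (pmult P (F' j)) = int (r j) * val_at P k + int (pmult P (F j))"
      using arg_cong[OF kF, of "val_at P"] nz k0
      by (simp add: val_at_poly[OF P] valuation_mult[OF is_valuation_at[OF P]] valuation_power[OF is_valuation_at[OF P]])
    moreover have "pmult P (F' j) < r j" "pmult P (F j) < r j"
      using fr fr' j P by (auto simp: frame_def intro: pmult_less_power_free)
    ultimately have "\<bar>int (r j) * val_at P k\<bar> < int (r j)" by linarith
    then have "int (r j) * \<bar>val_at P k\<bar> < int (r j) * 1" by (simp add: abs_mult)
    then have "\<bar>val_at P k\<bar> < 1" by (rule mult_left_less_imp_less) simp
    then show ?thesis by simp
  qed
  have "k \<in> valuation_ring finite_vals" using v0 by (auto simp: valuation_ring_def finite_vals_def)
  then obtain p where p: "k = to_fract p" unfolding valuation_ring_finite by auto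
  have p0: "p \<noteq> 0" using k0 p by auto
  have "pmult P p = 0" if "monic_irred P" for P using v0[OF that] p p0 by (simp add: val_at_poly that)
  then have "degree p = 0" using irreducible_factor_exists[of p] dvd_iff_pmult_pos[OF _ p0] by fastforce
  then obtain c where c: "p = [:c:]" by (elim degree_eq_zeroE)
  have "[:c:] ^ m = [:c ^ m:]" for m by (induction m) (auto simp: one_pCons)
  then have "to_fract (F' j) = to_fract (smult (c ^ r j) (F j))"
    using kF by (simp add: p c flip: to_fract_power to_fract_mult)
  then have "F' j = smult (c ^ r j) (F j)" by (simp only: to_fract_eq_iff)
  then show ?thesis using p0 c by (intro exI[of _ c]) auto
qed

end

section \<open>The Riemann-Hurwitz formula\<close>

lemma cis_primitive_root:
  assumes "m > 0" shows "primitive_root_of_unity m (cis (2 * pi / real m))"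
proof -
  have p: "cis (2 * pi / real m) ^ i = cis (2 * pi * real i / real m)" for i
    by (simp add: DeMoivre mult_ac)
  have "cis (2 * pi * real i / real m) \<noteq> 1" if "0 < i" "i < m" for i
  proof
    assume "cis (2 * pi * real i / real m) = 1"
    then have "cis (2 * pi * real i / real m) = cis (2 * pi * real 0 / real m)" by simp
    then show False using bij_betw_roots_unity[OF assms] that assms
      unfolding bij_betw_def inj_on_def by (metis lessThan_iff less_irrefl)
  qed
  then show ?thesis using assms by (auto simp: primitive_root_of_unity_def p)
qed

context residue_system
begin

text \<open>The number of characters of G that are nontrivial on \<open>v\<close>. By
  \<open>ram_weight_real\<close> this is |G| - |G|/e(v), the contribution of a place to the
  Riemann-Hurwitz formula; in the counting form it arises directly from the degrees of the free
  parts.\<close>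

definition ram_weight :: "(nat \<Rightarrow> int) \<Rightarrow> nat" where
  "ram_weight v = card {w \<in> B. \<not> int R dvd pr v w}"

lemma ram_weight_cong:
  assumes "\<And>j. j \<in> {1..n} \<Longrightarrow> [v j = v' j] (mod int (r j))" shows "ram_weight v = ram_weight v'"
proof -
  have "int R dvd pr v w \<longleftrightarrow> int R dvd pr v' w" for w
    using pr_cong_dvd[of v v' w] assms by (simp add: pairing_commute cong_dvd_iff)
  then show ?thesis by (simp add: ram_weight_def)
qed

lemma ram_weight_z0 [simp]: "ram_weight z0 = 0"
  by (simp add: ram_weight_def)

lemma ram_weight_pos: "v \<in> B \<Longrightarrow> v \<noteq> z0 \<Longrightarrow> ram_weight v > 0"
  using pr_nondegenerate[of v] unfolding ram_weight_def card_gt_0_iff by (auto simp: pairing_commute)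

text \<open>Pair \<open>w\<close> with its negative: \<open>a mod R + (- a) mod R\<close> is 0 or
  \<open>R\<close> according to whether \<open>R\<close> divides \<open>a\<close>.\<close>

lemma sum_pr_mod: "2 * (\<Sum>w\<in>B. pr v w mod int R) = int R * int (ram_weight v)"
proof -
  have neg: "pr v (red (\<lambda>j. - w j)) mod int R = (- pr v w) mod int R" for w
    using pr_red_right[of v "\<lambda>j. - w j"] by (simp add: cong_def pairing_uminus_right)
  have "(\<Sum>w\<in>B. pr v w mod int R) = (\<Sum>w\<in>B. pr v (red (\<lambda>j. - w j)) mod int R)"
    by (rule sum.reindex_bij_betw[OF red_uminus_bij, symmetric])
  then have "2 * (\<Sum>w\<in>B. pr v w mod int R) = (\<Sum>w\<in>B. pr v w mod int R + (- pr v w) mod int R)"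
    by (simp add: sum.distrib neg)
  also have "\<dots> = (\<Sum>w\<in>B. if int R dvd pr v w then 0 else int R)"
    using R_pos by (intro sum.cong refl) (auto simp: zmod_zminus1_eq_if mod_eq_0_iff_dvd)
  also have "\<dots> = int R * int (ram_weight v)"
    by (simp add: ram_weight_def sum.If_cases Int_def)
  finally show ?thesis .
qed

lemma all_pr_dvd_iff: "(\<forall>h. int R dvd pr h u) \<longleftrightarrow> (\<forall>j\<in>{1..n}. int (r j) dvd u j)"
proof
  assume a: "\<forall>h. int R dvd pr h u"
  then have "int R dvd pr h (red u)" for h using pr_red_right cong_dvd_iff by blast
  then have r0: "red u = z0" by (intro pr_nondegenerate) auto
  show "\<forall>j\<in>{1..n}. int (r j) dvd u j"
  proof
    fix j assume "j \<in> {1..n}"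
    then show "int (r j) dvd u j" using fun_cong[OF r0, of j] by (simp add: residue_vec_def zero_vec_def mod_eq_0_iff_dvd)
  qed
next
  assume a: "\<forall>j\<in>{1..n}. int (r j) dvd u j"
  show "\<forall>h. int R dvd pr h u"
  proof
    fix h
    have "[pr h u = pr h z0] (mod int R)"
      by (rule pr_cong_dvd) (use a in \<open>auto simp: zero_vec_def cong_0_iff\<close>)
    then show "int R dvd pr h u" by (simp add: cong_0_iff)
  qed
qed

lemma ram_index_dvd_iff: "ram_index n r v dvd t \<longleftrightarrow> (\<forall>j\<in>{1..n}. int (r j) dvd t * v j)"
proof -
  have "int (r j) div gcd (int (r j)) (v j) dvd t \<longleftrightarrow> int (r j) dvd t * v j" if "j \<in> {1..n}" for j
  proof -
    let ?g = "gcd (int (r j)) (v j)"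
    have g: "?g \<noteq> 0" using r_pos[OF that] by simp
    obtain a b where ab: "int (r j) = ?g * a" "v j = ?g * b" "coprime a b"
      using gcd_coprime_exists[OF g] by (metis mult.commute)
    have "int (r j) div ?g = a" using ab(1) g by (metis nonzero_mult_div_cancel_left)
    moreover have "int (r j) dvd t * v j \<longleftrightarrow> ?g * a dvd ?g * (t * b)"
      using ab by (metis mult.left_commute)
    moreover have "\<dots> \<longleftrightarrow> a dvd t * b" using g by (simp only: dvd_mult_cancel_left) simp
    moreover have "\<dots> \<longleftrightarrow> a dvd t" using ab(3) by (simp add: coprime_dvd_mult_left_iff)
    ultimately show ?thesis by simp
  qed
  then show ?thesis unfolding ram_index_def by (simp add: Lcm_dvd_iff)
qed

lemma ram_index_pos: "ram_index n r v > 0" and ram_index_dvd_R: "ram_index n r v dvd int R"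
proof -
  show d: "ram_index n r v dvd int R"
    unfolding ram_index_dvd_iff using r_dvd by auto
  have "ram_index n r v \<ge> 0" by (simp add: ram_index_def)
  moreover have "ram_index n r v \<noteq> 0" using d R_pos by auto
  ultimately show "ram_index n r v > 0" by simp
qed

text \<open>Double count of the sum of \<open>z powi (t * pr v w)\<close> over \<open>t < R\<close>
  and \<open>w\<close> in \<open>B\<close>. Summing over \<open>t\<close> first detects the
  \<open>w\<close> in the kernel, summing over \<open>w\<close> first detects the multiples
  \<open>t\<close> of e(v).\<close>

lemma card_ker_ram_index: "int (card {w \<in> B. int R dvd pr v w}) * ram_index n r v = int (card B)"
proof -
  define z where "z = cis (2 * pi / real R)"
  have z: "primitive_root_of_unity R z" unfolding z_def by (rule cis_primitive_root[OF R_pos])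
  have z0: "z \<noteq> 0" using prim_root_nonzero[OF z] .
  define e where "e = nat (ram_index n r v)"
  have e: "int e = ram_index n r v" using ram_index_pos[of v] by (simp add: e_def)
  have eR: "e dvd R" using ram_index_dvd_R[of v] by (simp flip: e)
  have geo: "(\<Sum>t<R. z powi (int t * a)) = (if int R dvd a then of_nat R else 0)" for a
  proof (cases "int R dvd a")
    case True
    then have "z powi (int t * a) = 1" for t using powi_prim_root_eq_1_iff[OF z] by simp
    then show ?thesis using True by simp
  next
    case False
    define w where "w = z powi a"
    have w: "w \<noteq> 1" using False powi_prim_root_eq_1_iff[OF z] by (simp add: w_def)
    have "z powi (int t * a) = w ^ t" for t by (simp add: w_def power_int_mult mult.commute)
    moreover have "w ^ R = 1"
    proof -
      have "w ^ R = z powi (a * int R)" by (simp add: w_def power_int_mult)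
      then show ?thesis using powi_prim_root_eq_1_iff[OF z] by simp
    qed
    ultimately show ?thesis using False w by (simp add: geometric_sum)
  qed
  have "(of_nat R * of_nat (card {w \<in> B. int R dvd pr v w}) :: complex) =
      (\<Sum>w\<in>B. if int R dvd pr v w then of_nat R else 0)"
    by (simp add: sum.If_cases Int_def)
  also have "\<dots> = (\<Sum>w\<in>B. \<Sum>t<R. z powi (int t * pr v w))" by (simp only: geo)
  also have "\<dots> = (\<Sum>t<R. \<Sum>w\<in>B. z powi pr w (\<lambda>j. int t * v j))"
  proof -
    have "int t * pr v w = pr w (\<lambda>j. int t * v j)" for t w
      by (simp add: pairing_def sum_distrib_left mult_ac)
    then show ?thesis by (subst sum.swap) simp
  qed
  also have "\<dots> = (\<Sum>t<R. if e dvd t then of_nat (card B) else 0)"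
  proof (rule sum.cong[OF refl])
    fix t
    have "(\<forall>h. int R dvd pr h (\<lambda>j. int t * v j)) \<longleftrightarrow> e dvd t"
      unfolding all_pr_dvd_iff ram_index_dvd_iff[symmetric] by (simp flip: e)
    then show "(\<Sum>w\<in>B. z powi pr w (\<lambda>j. int t * v j)) = (if e dvd t then of_nat (card B) else 0)"
      by (simp add: sum_powi_pr[OF z])
  qed
  also have "\<dots> = of_nat (card {t. t < R \<and> e dvd t}) * of_nat (card B)"
    by (simp add: sum.If_cases Int_def)
  also have "card {t. t < R \<and> e dvd t} = R div e"
  proof -
    have e0: "e > 0" using eR R_pos by (auto intro: Nat.gr0I)
    have "{t. t < R \<and> e dvd t} = (\<lambda>i. e * i) ` {..<R div e}"
      using eR e0 by (auto simp: image_iff elim!: dvdE)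
    moreover have "inj_on (\<lambda>i. e * i) {..<R div e}" using e0 by (auto simp: inj_on_def)
    ultimately show ?thesis by (simp add: card_image)
  qed
  finally have "of_nat (R * card {w \<in> B. int R dvd pr v w}) = (of_nat (R div e * card B) :: complex)" by simp
  then have "R * card {w \<in> B. int R dvd pr v w} = R div e * card B" by (simp only: of_nat_eq_iff)
  then have "e * (R div e) * card {w \<in> B. int R dvd pr v w} = R div e * card B" using eR by simp
  moreover have "R div e > 0"
  proof -
    have "e \<le> R" "e > 0" using eR R_pos by (auto intro: dvd_imp_le Nat.gr0I)
    then show ?thesis by (simp add: div_greater_zero_iff)
  qed
  ultimately have "e * card {w \<in> B. int R dvd pr v w} = card B" by simp
  then show ?thesis by (metis e mult.commute of_nat_mult)
qed

lemma ram_weight_real: "real (ram_weight v) = real (card B) - real (card B) / of_int (ram_index n r v)"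
proof -
  let ?K = "{w \<in> B. int R dvd pr v w}"
  have "B = ?K \<union> {w \<in> B. \<not> int R dvd pr v w}" by blast
  then have "card B = card ?K + ram_weight v" unfolding ram_weight_def by (subst card_Un_disjoint[symmetric]) (auto intro: arg_cong[where f = card])
  moreover have "real (card ?K) = real (card B) / of_int (ram_index n r v)"
  proof -
    have "of_int (int (card ?K) * ram_index n r v) = (of_int (int (card B)) :: real)"
      by (simp only: card_ker_ram_index)
    then show ?thesis using ram_index_pos[of v] by (simp add: field_simps)
  qed
  ultimately show ?thesis by simp
qed

end

context kummer_tuple
begin

text \<open>Up to sign the orders of the \<open>F j\<close> at infinity; \<open>pr_degvec\<close> is
  the product formula that ties them to the finite primes.\<close>

definition degvec :: "nat \<Rightarrow> int" where "degvec = (\<lambda>j. int (degree (F j)))"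

lemma degree_F: "j \<in> {1..n} \<Longrightarrow> degree (F j) = (\<Sum>P\<in>primes_of. pmult P (F j) * degree P)"
proof (rule degree_eq_sum_pmult[OF finite_primes_of primes_of_irred F_nz])
  fix P assume "j \<in> {1..n}" "monic_irred P" "P dvd F j"
  moreover from this have "P dvd (\<Prod>j\<in>{1..n}. F j)" by (meson dvd_prodI dvd_trans finite_atLeastAtMost)
  ultimately show "P \<in> primes_of" by (simp add: primes_of_def)
qed

lemma pr_degvec: "pr degvec v = (\<Sum>P\<in>primes_of. pr (vF P) v * int (degree P))"
proof -
  have "pr degvec v = (\<Sum>j\<in>{1..n}. \<Sum>P\<in>primes_of. int (pmult P (F j)) * int (degree P) * v j * int (R div r j))"
    unfolding pairing_def degvec_def by (rule sum.cong) (simp_all add: degree_F sum_distrib_right)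
  also have "\<dots> = (\<Sum>P\<in>primes_of. pr (vF P) v * int (degree P))"
    unfolding pairing_def vF_def
    by (subst sum.swap, intro sum.cong refl, subst sum_distrib_right, intro sum.cong refl) (simp only: mult_ac)
  finally show ?thesis .
qed

text \<open>Sum \<open>one\<close> over \<open>v\<close>. By \<open>sum_pr_mod\<close> the degrees
  of the free parts give the ramification at the finite primes, and the remainders of
  \<open>- pr degvec v\<close> give that at infinity.\<close>

theorem riemann_hurwitz:
  "2 * genus + 2 * card B = (\<Sum>P\<in>primes_of. ram_weight (vF P) * degree P) + ram_weight degvec + 2"
proof -
  \<comment> \<open>For \<open>d > 0\<close> the number \<open>R * ((d - 1) div R)\<close> is
    \<open>d - R\<close> plus the remainder of \<open>- d\<close>. For \<open>v = z0\<close> the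
    degree is 0 and \<open>R\<close> must not be subtracted.\<close>
  have one: "int R * int ((degree (free_part v) - 1) div R) =
      int (degree (free_part v)) - (if v = z0 then 0 else int R) + (- pr degvec v) mod int R"
    if v: "v \<in> B" for v
  proof (cases "v = z0")
    case True
    have "free_part z0 = 1"
      using mon_split[of z0] by simp
    then show ?thesis using True by simp
  next
    case False
    define d where "d = degree (free_part v)"
    have d: "d > 0" unfolding d_def by (rule free_part_nonconst[OF v False])
    have "[int d = pr degvec v] (mod int R)"
      unfolding d_def degree_free_part[OF v] pr_degvec
      by (intro cong_sum cong_mult cong_refl) (simp add: cong_def)
    then have m: "(- pr degvec v) mod int R = (- int d) mod int R"
      by (metis cong_def cong_minus_minus_iff)
    have e1: "int ((d - 1) div R) = (int d - 1) div int R" using d by (simp add: zdiv_int of_nat_diff)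
    have e2: "(int d - 1) mod int R = int R - 1 - (- int d) mod int R"
    proof -
      have "- int d = - (int d - 1) - 1" by simp
      have "(int d - 1) mod int R = (- (- int d + 1)) mod int R" by simp
      moreover have "(- int d) mod int R + ((int d - 1) mod int R) = int R - 1"
      proof -
        let ?a = "(int d - 1) mod int R"
        have a: "0 \<le> ?a" "?a < int R" using R_pos by auto
        have "(- int d) mod int R = (int R - 1 - ?a) mod int R"
          by (simp add: mod_simps)
        also have "\<dots> = int R - 1 - ?a" using a by (intro mod_pos_pos_trivial) auto
        finally show ?thesis by simp
      qed
      ultimately show ?thesis by simp
    qed
    have "int R * ((int d - 1) div int R) = int d - 1 - (int d - 1) mod int R"
      by (simp add: minus_mod_eq_mult_div)
    then show ?thesis using False unfolding d_def[symmetric] e1 m e2 by simp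
  qed
  have "int R * int genus = (\<Sum>v\<in>B. int (degree (free_part v)) - (if v = z0 then 0 else int R) + (- pr degvec v) mod int R)"
    unfolding genus_def by (simp only: of_nat_sum sum_distrib_left) (rule sum.cong[OF refl one])
  also have "\<dots> = (\<Sum>v\<in>B. int (degree (free_part v))) - int R * (int (card B) - 1) + (\<Sum>v\<in>B. (- pr degvec v) mod int R)"
  proof -
    have "(\<Sum>v\<in>B. if v = z0 then 0 else int R) = (\<Sum>v\<in>B - {z0}. int R)"
      by (rule sum.mono_neutral_cong_right) auto
    moreover have "card B \<ge> 1" by (metis One_nat_def Suc_leI card_gt_0_iff empty_iff finite_B z0_in_B)
    ultimately have "(\<Sum>v\<in>B. if v = z0 then 0 else int R) = int R * (int (card B) - 1)"
      by (simp add: of_nat_diff algebra_simps)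
    then show ?thesis by (simp add: sum.distrib sum_subtractf)
  qed
  also have "(\<Sum>v\<in>B. (- pr degvec v) mod int R) = (\<Sum>v\<in>B. pr degvec v mod int R)"
  proof -
    have "pr degvec (red (\<lambda>j. - w j)) mod int R = (- pr degvec w) mod int R" for w
      using pr_red_right[of degvec "\<lambda>j. - w j"] by (simp add: cong_def pairing_uminus_right)
    then show ?thesis using sum.reindex_bij_betw[OF red_uminus_bij, of "\<lambda>v. pr degvec v mod int R"] by simp
  qed
  finally have "2 * (int R * int genus) = 2 * (\<Sum>v\<in>B. int (degree (free_part v))) - 2 * (int R * (int (card B) - 1)) + int R * int (ram_weight degvec)"
    using sum_pr_mod[of degvec] by simp
  also have "2 * (\<Sum>v\<in>B. int (degree (free_part v))) = (\<Sum>P\<in>primes_of. int R * int (ram_weight (vF P)) * int (degree P))"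
  proof -
    have "(\<Sum>v\<in>B. int (degree (free_part v))) = (\<Sum>P\<in>primes_of. (\<Sum>v\<in>B. pr (vF P) v mod int R) * int (degree P))"
      by (simp add: degree_free_part sum_distrib_right) (rule sum.swap)
    then have "2 * (\<Sum>v\<in>B. int (degree (free_part v))) = (\<Sum>P\<in>primes_of. (2 * (\<Sum>v\<in>B. pr (vF P) v mod int R)) * int (degree P))"
      by (simp only:) (subst sum_distrib_left, intro sum.cong refl, simp only: mult.assoc)
    then show ?thesis by (simp only: sum_pr_mod)
  qed
  finally have "int R * (2 * int genus + 2 * int (card B)) =
      int R * ((\<Sum>P\<in>primes_of. int (ram_weight (vF P)) * int (degree P)) + int (ram_weight degvec) + 2)"
    by (simp add: algebra_simps sum_distrib_left)
  then have "2 * int genus + 2 * int (card B) = (\<Sum>P\<in>primes_of. int (ram_weight (vF P)) * int (degree P)) + int (ram_weight degvec) + 2"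
    using R_pos by (simp only: mult_cancel_left) simp
  then have "int (2 * genus + 2 * card B) = int ((\<Sum>P\<in>primes_of. ram_weight (vF P) * degree P) + ram_weight degvec + 2)" by simp
  then show ?thesis by (simp only: of_nat_eq_iff)
qed

end

section \<open>Quasi-polynomials and recurrences\<close>

lemma power_eq_1_nonneg: "x ^ n = 1 \<Longrightarrow> 0 \<le> x \<Longrightarrow> n > 0 \<Longrightarrow> x = (1 :: real)"
  using power_eq_imp_eq_base[of x n 1] by simp

definition periodic :: "nat \<Rightarrow> (int \<Rightarrow> complex) \<Rightarrow> bool" where
  "periodic T f \<longleftrightarrow> (\<forall>x. f (x + int T) = f x)"

text \<open>
  Here \<open>m\<close> is a strict bound for the degree, so that \<open>m = 0\<close> forces \<open>p = 0\<close>.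
\<close>

definition qpT :: "nat \<Rightarrow> nat \<Rightarrow> (int \<Rightarrow> complex) \<Rightarrow> bool" where
  "qpT T m p \<longleftrightarrow> (\<exists>c. (\<forall>i. periodic T (c i)) \<and> (\<forall>x. p x = (\<Sum>i<m. c i x * of_int x ^ i)))"

text \<open>\<open>qpT\<close> fixes one common period, which computing with the coefficient
  functions needs; \<open>qpoly\<close> forgets it. Arguments range over all integers because the
  completed convolutions below evaluate at negative ones.\<close>

definition qpoly :: "nat \<Rightarrow> (int \<Rightarrow> complex) \<Rightarrow> bool" where
  "qpoly m p \<longleftrightarrow> (\<exists>T>0. qpT T m p)"

lemma periodic_const [simp]: "periodic T (\<lambda>_. c)" by (simp add: periodic_def)

lemma periodic_add: "periodic T f \<Longrightarrow> periodic T g \<Longrightarrow> periodic T (\<lambda>x. f x + g x)"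
  and periodic_mult: "periodic T f \<Longrightarrow> periodic T g \<Longrightarrow> periodic T (\<lambda>x. f x * g x)"
  by (simp_all add: periodic_def)

lemma periodic_shift: "periodic T f \<Longrightarrow> periodic T (\<lambda>x. f (x + s))"
proof -
  assume f: "periodic T f"
  have "f (x + int T + s) = f (x + s)" for x
    using f unfolding periodic_def by (metis add.assoc add.commute)
  then show ?thesis by (simp add: periodic_def)
qed

lemma periodic_times: "periodic T f \<Longrightarrow> f (x + int T * z) = f x"
proof -
  assume f: "periodic T f"
  have "f (y + int T * int m) = f y" for m y
  proof (induction m)
    case (Suc m)
    have "y + int T * int (Suc m) = (y + int T * int m) + int T" by (simp add: algebra_simps)
    then show ?case using f Suc unfolding periodic_def by metis
  qed simp
  note 1 = this
  show ?thesis
  proof (cases "z \<ge> 0")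
    case True then show ?thesis using 1[of x "nat z"] by simp
  next
    case False then show ?thesis using 1[of "x + int T * z" "nat (- z)"] by (simp add: algebra_simps)
  qed
qed

lemma periodic_multiple: "periodic T f \<Longrightarrow> periodic (T * k) f"
  using periodic_times[of T f _ "int k"] by (simp add: periodic_def)

lemma periodic_minus: "periodic T f \<Longrightarrow> f (x - int T) = f x"
  using periodic_times[of T f x "-1"] by simp

lemma qpT_multiple: "qpT T m p \<Longrightarrow> qpT (T * k) m p"
  unfolding qpT_def using periodic_multiple by blast

lemma qpT_multiple': "qpT T m p \<Longrightarrow> qpT (k * T) m p"
  using qpT_multiple[of T m p k] by (simp add: mult.commute)

lemma qpT_add: "qpT T m p \<Longrightarrow> qpT T m p' \<Longrightarrow> qpT T m (\<lambda>x. p x + p' x)"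
proof -
  assume "qpT T m p" "qpT T m p'"
  then obtain c c' where "\<forall>i. periodic T (c i)" "\<forall>x. p x = (\<Sum>i<m. c i x * of_int x ^ i)"
    "\<forall>i. periodic T (c' i)" "\<forall>x. p' x = (\<Sum>i<m. c' i x * of_int x ^ i)" unfolding qpT_def by auto
  then show ?thesis unfolding qpT_def
    by (intro exI[of _ "\<lambda>i x. c i x + c' i x"]) (auto simp: periodic_add sum.distrib algebra_simps)
qed

lemma qpT_periodic_mult: "periodic T f \<Longrightarrow> qpT T m p \<Longrightarrow> qpT T m (\<lambda>x. f x * p x)"
proof -
  assume f: "periodic T f" and "qpT T m p"
  then obtain c where "\<forall>i. periodic T (c i)" "\<forall>x. p x = (\<Sum>i<m. c i x * of_int x ^ i)" unfolding qpT_def by auto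
  then show ?thesis unfolding qpT_def using f
    by (intro exI[of _ "\<lambda>i x. f x * c i x"]) (auto simp: periodic_mult sum_distrib_left algebra_simps)
qed

lemma qpT_cmult: "qpT T m p \<Longrightarrow> qpT T m (\<lambda>x. a * p x)"
  by (rule qpT_periodic_mult) auto

lemma qpT_mono: "qpT T m p \<Longrightarrow> m \<le> m' \<Longrightarrow> qpT T m' p"
proof -
  assume "qpT T m p" and m: "m \<le> m'"
  then obtain c where c: "\<forall>i. periodic T (c i)" "\<forall>x. p x = (\<Sum>i<m. c i x * of_int x ^ i)" unfolding qpT_def by auto
  have "(\<Sum>i<m. c i x * of_int x ^ i) = (\<Sum>i<m'. (if i < m then c i x else 0) * of_int x ^ i)" for x
    using m by (intro sum.mono_neutral_cong_left) auto
  moreover have "periodic T (\<lambda>x. if i < m then c i x else 0)" for i using c(1) by (cases "i < m") auto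
  ultimately show ?thesis unfolding qpT_def using c
    by (intro exI[of _ "\<lambda>i x. if i < m then c i x else 0"]) auto
qed

lemma qpT_monom: "i < m \<Longrightarrow> periodic T c \<Longrightarrow> qpT T m (\<lambda>x. c x * of_int x ^ i)"
proof -
  assume i: "i < m" and c: "periodic T c"
  have "periodic T (\<lambda>x. if j = i then c x else 0)" for j using c by (cases "j = i") auto
  moreover have "(\<Sum>j<m. (if j = i then c x else 0) * of_int x ^ j) = c x * of_int x ^ i" for x
  proof -
    have "(\<Sum>j<m. (if j = i then c x else 0) * of_int x ^ j) = (\<Sum>j<m. if j = i then c x * of_int x ^ j else 0)"
      by (rule sum.cong) auto
    then show ?thesis using i by simp
  qed
  ultimately show ?thesis unfolding qpT_def
    by (intro exI[of _ "\<lambda>j x. if j = i then c x else 0"]) auto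
qed

lemma qpT_zero [simp]: "qpT T m (\<lambda>_. 0)"
  unfolding qpT_def by (intro exI[of _ "\<lambda>_ _. 0"]) auto

lemma qpT_0: "qpT T 0 p \<longleftrightarrow> p = (\<lambda>_. 0)"
  by (auto simp: qpT_def intro: exI[of _ "\<lambda>_ _. 0"])

lemma qpT_sum: "(\<And>i. i \<in> I \<Longrightarrow> qpT T m (f i)) \<Longrightarrow> qpT T m (\<lambda>x. \<Sum>i\<in>I. f i x)"
  by (induction I rule: infinite_finite_induct) (auto intro: qpT_add)

lemma qpT_SucE:
  assumes "qpT T (Suc m) p"
  obtains c p' where "periodic T c" "qpT T m p'" "\<And>x. p x = p' x + c x * of_int x ^ m"
proof -
  obtain c where c: "\<forall>i. periodic T (c i)" "\<forall>x. p x = (\<Sum>i<Suc m. c i x * of_int x ^ i)" using assms unfolding qpT_def by auto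
  have "qpT T m (\<lambda>x. \<Sum>i<m. c i x * of_int x ^ i)" unfolding qpT_def using c by blast
  then show ?thesis using that[of "c m" "\<lambda>x. \<Sum>i<m. c i x * of_int x ^ i"] c by simp
qed

lemma power_shift_diff:
  "of_int (x + s) ^ m - of_int x ^ m = (\<Sum>i<m. of_nat (m choose i) * of_int s ^ (m - i) * (of_int x :: complex) ^ i)"
proof -
  have "of_int (x + s) ^ m = (\<Sum>i\<le>m. of_nat (m choose i) * of_int x ^ i * (of_int s :: complex) ^ (m - i))"
    by (simp add: binomial_ring)
  also have "\<dots> = (\<Sum>i<m. of_nat (m choose i) * of_int x ^ i * (of_int s :: complex) ^ (m - i)) + of_int x ^ m"
    by (simp flip: lessThan_Suc_atMost)
  finally show ?thesis by (simp add: mult_ac)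
qed

lemma qpT_power_diff: "qpT T m (\<lambda>x. of_int (x + s) ^ m - of_int x ^ m)"
  unfolding power_shift_diff by (intro qpT_sum qpT_monom) auto

lemma qpT_shift: "qpT T m p \<Longrightarrow> qpT T m (\<lambda>x. p (x + s))"
proof (induction m arbitrary: p)
  case 0 then show ?case by (simp add: qpT_0)
next
  case (Suc m)
  obtain c p' where cp: "periodic T c" "qpT T m p'" "\<And>x. p x = p' x + c x * of_int x ^ m"
    using qpT_SucE[OF Suc.prems] by blast
  have "p (x + s) = p' (x + s) + c (x + s) * (of_int (x + s) ^ m - of_int x ^ m) + c (x + s) * of_int x ^ m" for x
    by (simp add: cp algebra_simps)
  moreover have "qpT T (Suc m) (\<lambda>x. p' (x + s) + c (x + s) * (of_int (x + s) ^ m - of_int x ^ m) + c (x + s) * of_int x ^ m)"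
    by (intro qpT_add qpT_monom periodic_shift cp qpT_mono[OF Suc.IH[OF cp(2)]]
        qpT_mono[OF qpT_periodic_mult[OF periodic_shift[OF cp(1)] qpT_power_diff]]) auto
  ultimately show ?case by simp
qed

text \<open>
  Solving \<open>g x - z * g (x - s) = p x\<close> raises the degree only in the resonant case. This is why the
  degree of the quasi-polynomial attached to a pole radius is less than the number of factors having it.
\<close>

lemma qpT_solve:
  assumes T: "T = s * N" "N > 0" and z: "z ^ N \<noteq> 1" and p: "qpT T m p"
  shows "\<exists>g. qpT T m g \<and> (\<forall>x. g x - z * g (x - int s) = p x)"
  using p
proof (induction m arbitrary: p)
  case 0 then show ?case by (auto simp: qpT_0)
next
  case (Suc m)
  obtain c p' where cp: "periodic T c" "qpT T m p'" "\<And>x. p x = p' x + c x * of_int x ^ m"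
    using qpT_SucE[OF Suc.prems] by blast
  \<comment> \<open>A geometric sum: replacing \<open>x\<close> by \<open>x - s\<close> shifts it by
    one term, and after \<open>N\<close> terms \<open>c\<close> returns to itself because
    \<open>T = s * N\<close>. What is left is the factor \<open>1 - z ^ N\<close>, nonzero by
    assumption.\<close>
  define C where "C = (\<lambda>x. (\<Sum>j<N. z ^ j * c (x - int s * int j)) / (1 - z ^ N))"
  have "c (x + int T - y) = c (x - y)" for x y
    using periodic_shift[OF cp(1), of "- y"] by (simp add: periodic_def)
  then have C: "periodic T C" by (simp add: C_def periodic_def)
  have C_eq: "C x - z * C (x - int s) = c x" for x
  proof -
    have "z * (\<Sum>j<N. z ^ j * c (x - int s - int s * int j)) = (\<Sum>j<N. z ^ Suc j * c (x - int s * int (Suc j)))"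
      by (simp add: sum_distrib_left algebra_simps)
    then have "(\<Sum>j<N. z ^ j * c (x - int s * int j)) - z * (\<Sum>j<N. z ^ j * c (x - int s - int s * int j)) =
      - (\<Sum>j<N. z ^ Suc j * c (x - int s * int (Suc j)) - z ^ j * c (x - int s * int j))"
      by (simp only: sum_subtractf minus_diff_eq)
    also have "\<dots> = c x - z ^ N * c (x - int s * int N)"
      by (subst sum_lessThan_telescope) simp
    also have "c (x - int s * int N) = c x" using periodic_minus[OF cp(1), of x] by (simp add: T)
    finally have "(\<Sum>j<N. z ^ j * c (x - int s * int j)) - z * (\<Sum>j<N. z ^ j * c (x - int s - int s * int j)) = (1 - z ^ N) * c x"
      by (simp add: algebra_simps)
    moreover have "u1 / u3 - z * (u2 / u3) = (u1 - z * u2) / u3" for u1 u2 u3 :: complex by (simp add: diff_divide_distrib)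
    ultimately show ?thesis using z unfolding C_def by simp
  qed
  \<comment> \<open>The remainder of lower degree that shifting \<open>x ^ m\<close> leaves behind;
    it joins \<open>p'\<close> on the right-hand side for the induction hypothesis.\<close>
  define low where "low = (\<lambda>x. z * (C (x - int s) * (of_int (x - int s) ^ m - of_int x ^ m)))"
  have low: "qpT T m low" unfolding low_def
    using periodic_shift[OF C, of "- int s"] qpT_power_diff[of T m "- int s"]
    by (intro qpT_cmult qpT_periodic_mult) auto
  obtain g where g: "qpT T m g" "\<And>x. g x - z * g (x - int s) = p' x + low x"
    using Suc.IH[OF qpT_add[OF cp(2) low]] by auto
  show ?case
  proof (intro exI[of _ "\<lambda>x. g x + C x * of_int x ^ m"] conjI allI)
    show "qpT T (Suc m) (\<lambda>x. g x + C x * of_int x ^ m)"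
      by (intro qpT_add qpT_monom C qpT_mono[OF g(1)]) auto
    fix x
    have "g x + C x * of_int x ^ m - z * (g (x - int s) + C (x - int s) * of_int (x - int s) ^ m)
       = (g x - z * g (x - int s)) + (C x - z * C (x - int s)) * of_int x ^ m - low x"
      by (simp add: low_def algebra_simps)
    then show "g x + C x * of_int x ^ m - z * (g (x - int s) + C (x - int s) * of_int (x - int s) ^ m) = p x"
      by (simp add: g C_eq cp)
  qed
qed

text \<open>The shift is a full period, so periodic coefficients pass through and only powers
  matter: \<open>x ^ (m + 1) - (x - T) ^ (m + 1)\<close> has leading term
  \<open>(m + 1) * T * x ^ m\<close>, whose coefficient is the \<open>K\<close> of the
  proof.\<close>

lemma qpT_antidiff:
  assumes T: "T > 0" and p: "qpT T m p"
  shows "\<exists>g. qpT T (Suc m) g \<and> (\<forall>x. g x - g (x - int T) = p x)"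
  using p
proof (induction m arbitrary: p)
  case 0 then show ?case by (intro exI[of _ "\<lambda>_. 0"]) (auto simp: qpT_0)
next
  case (Suc m)
  obtain c p' where cp: "periodic T c" "qpT T m p'" "\<And>x. p x = p' x + c x * of_int x ^ m"
    using qpT_SucE[OF Suc.prems] by blast
  define K where "K = (of_nat (Suc m) * of_nat T :: complex)"
  have K: "K \<noteq> 0" using T by (simp add: K_def del: of_nat_Suc)
  define C where "C = (\<lambda>x. c x * (1 / K))"
  have C: "periodic T C" unfolding C_def by (intro periodic_mult cp) auto
  define low where "low = (\<lambda>x. C x * (\<Sum>i<m. of_nat (Suc m choose i) * of_int (- int T) ^ (Suc m - i) * (of_int x :: complex) ^ i))"
  have low: "qpT T m low" unfolding low_def
    by (intro qpT_periodic_mult C qpT_sum qpT_monom) auto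
  have d: "of_int (x - int T) ^ Suc m - of_int x ^ Suc m =
      (\<Sum>i<m. of_nat (Suc m choose i) * of_int (- int T) ^ (Suc m - i) * (of_int x :: complex) ^ i) - K * of_int x ^ m" for x
    using power_shift_diff[of x "- int T" "Suc m"] by (simp add: K_def algebra_simps)
  obtain g where g: "qpT T (Suc m) g" "\<And>x. g x - g (x - int T) = p' x + low x"
    using Suc.IH[OF qpT_add[OF cp(2) low]] by auto
  show ?case
  proof (intro exI[of _ "\<lambda>x. g x + C x * of_int x ^ Suc m"] conjI allI)
    show "qpT T (Suc (Suc m)) (\<lambda>x. g x + C x * of_int x ^ Suc m)"
      by (intro qpT_add qpT_monom C qpT_mono[OF g(1)]) auto
    fix x
    have "g x + C x * of_int x ^ Suc m - (g (x - int T) + C (x - int T) * of_int (x - int T) ^ Suc m)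
       = (g x - g (x - int T)) - C x * (of_int (x - int T) ^ Suc m - of_int x ^ Suc m)"
      by (simp only: periodic_minus[OF C]) (simp add: algebra_simps)
    also have "\<dots> = p' x + low x - (low x - C x * K * of_int x ^ m)"
      unfolding d by (simp add: g low_def algebra_simps)
    also have "\<dots> = p x" using K by (simp add: cp C_def)
    finally show "g x + C x * of_int x ^ Suc m - (g (x - int T) + C (x - int T) * of_int (x - int T) ^ Suc m) = p x" .
  qed
qed

lemma qpoly_add: "qpoly m p \<Longrightarrow> qpoly m p' \<Longrightarrow> qpoly m (\<lambda>x. p x + p' x)"
proof -
  assume "qpoly m p" "qpoly m p'"
  then obtain T T' where "T > 0" "qpT T m p" "T' > 0" "qpT T' m p'" by (auto simp: qpoly_def)
  then have "T * T' > 0" "qpT (T * T') m p" "qpT (T * T') m p'" using qpT_multiple qpT_multiple' by auto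
  then show ?thesis unfolding qpoly_def using qpT_add by blast
qed

lemma qpoly_cmult: "qpoly m p \<Longrightarrow> qpoly m (\<lambda>x. a * p x)"
  unfolding qpoly_def using qpT_cmult by blast

lemma qpoly_shift: "qpoly m p \<Longrightarrow> qpoly m (\<lambda>x. p (x + s))"
  unfolding qpoly_def using qpT_shift by blast

lemma qpoly_mono: "qpoly m p \<Longrightarrow> m \<le> m' \<Longrightarrow> qpoly m' p"
  unfolding qpoly_def using qpT_mono by blast

lemma qpoly_zero [simp]: "qpoly m (\<lambda>_. 0)"
  unfolding qpoly_def by (intro exI[of _ 1]) auto

lemma qpoly_sum: "(\<And>i. i \<in> I \<Longrightarrow> qpoly m (f i)) \<Longrightarrow> qpoly m (\<lambda>x. \<Sum>i\<in>I. f i x)"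
  by (induction I rule: infinite_finite_induct) (auto intro: qpoly_add)

lemma qpoly_periodic: "T > 0 \<Longrightarrow> periodic T f \<Longrightarrow> qpoly (Suc m) f"
  using qpT_monom[of 0 "Suc m" T f] by (auto simp: qpoly_def)

section \<open>Linear recurrences and sums of quasi-polynomials times exponentials\<close>

lemma homogeneous_recurrence:
  fixes f :: "nat \<Rightarrow> complex" and mu :: real
  assumes s: "s > 0" and K: "K > 0" "th ^ K = 1" and mu: "mu > 0"
    and rec: "\<And>m. s \<le> m \<Longrightarrow> f m = th * of_real mu ^ s * f (m - s)"
  shows "\<exists>h. periodic (s * K) h \<and> (\<forall>m. f m = h (int m) * of_real mu ^ m)"
proof -
  \<comment> \<open>After division by \<open>mu ^ m\<close> a step of length \<open>s\<close>
    multiplies by the root of unity \<open>th\<close>, so \<open>K\<close> such steps return to the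
    same value.\<close>
  define g where "g = (\<lambda>m. f m / of_real mu ^ m)"
  have g: "g (m + s) = th * g m" for m
    using rec[of "m + s"] mu by (simp add: g_def power_add)
  have gK: "g (m + s * i) = th ^ i * g m" for m i
  proof (induction i)
    case (Suc i)
    have "g (m + s * Suc i) = g ((m + s * i) + s)" by (simp add: algebra_simps)
    then show ?case using g Suc by simp
  qed simp
  have gT: "g (m + s * K * i) = g m" for m i
    using gK[of m "K * i"] K by (simp add: power_mult mult.assoc)
  define h where "h = (\<lambda>x :: int. g (nat (x mod int (s * K))))"
  have "periodic (s * K) h" by (simp add: periodic_def h_def)
  moreover have "f m = h (int m) * of_real mu ^ m" for m
  proof -
    have "h (int m) = g (m mod (s * K))" by (simp add: h_def zmod_int[symmetric] del: of_nat_mult)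
    also have "\<dots> = g m" using gT[of "m mod (s * K)" "m div (s * K)"] by simp
    finally show ?thesis using mu by (simp add: g_def)
  qed
  ultimately show ?thesis by blast
qed

text \<open>The resonant case. With \<open>N\<close> a multiple of the period of \<open>p\<close>
  and of the order of \<open>th\<close>, iterating \<open>N\<close> times replaces the multiplier by
  1 and the step by a period \<open>T\<close>. An antidifference then solves the recurrence at the
  price of one degree, and what remains is periodic.\<close>

lemma recurrence_same:
  fixes a b :: "nat \<Rightarrow> complex" and mu :: real
  assumes s: "s > 0" and K: "K > 0" "th ^ K = 1" and mu: "mu > 0"
    and a: "\<And>m. a m = p (int m) * of_real mu ^ m" and p: "qpoly e p"
    and rec: "\<And>m. b m = a m + (if s \<le> m then th * of_real mu ^ s * b (m - s) else 0)"
  shows "\<exists>p'. qpoly (Suc e) p' \<and> (\<forall>m. b m = p' (int m) * of_real mu ^ m)"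
proof -
  obtain T0 where T0: "T0 > 0" "qpT T0 e p" using p by (auto simp: qpoly_def)
  define N where "N = T0 * K"
  define T where "T = s * N"
  have T: "T > 0" using s T0 K by (simp add: T_def N_def)
  have pT: "qpT T e p" using qpT_multiple'[OF T0(2), of "s * K"] by (simp add: T_def N_def mult_ac)
  have thN: "th ^ N = 1" using K by (simp add: N_def mult.commute[of T0] power_mult)
  define be where "be = (\<lambda>m. b m / of_real mu ^ m)"
  have be: "be m = p (int m) + (if s \<le> m then th * be (m - s) else 0)" for m
  proof -
    have "be m = p (int m) + (if s \<le> m then th * of_real mu ^ s * b (m - s) / of_real mu ^ m else 0)"
      unfolding be_def by (subst rec) (use mu in \<open>simp add: a add_divide_distrib\<close>)
    moreover have "th * of_real mu ^ s * b (m - s) / of_real mu ^ m = th * be (m - s)" if "s \<le> m"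
    proof -
      have "(of_real mu :: complex) ^ m = of_real mu ^ s * of_real mu ^ (m - s)" using that by (simp flip: power_add)
      then show ?thesis using mu by (simp add: be_def)
    qed
    ultimately show ?thesis by simp
  qed
  have it: "be m = (\<Sum>j<i. th ^ j * p (int m - int s * int j)) + th ^ i * be (m - s * i)" if "s * i \<le> m" for m i
    using that
  proof (induction i)
    case (Suc i)
    have le: "s \<le> m - s * i" "s * i \<le> m" using Suc.prems by auto
    have "be (m - s * i) = p (int m - int s * int i) + th * be (m - s * i - s)"
      using be[of "m - s * i"] le by (simp add: of_nat_diff)
    then show ?case using Suc.IH le(2) by (simp add: algebra_simps diff_diff_add)
  qed simp
  define al where "al = (\<lambda>x. \<Sum>j<N. th ^ j * p (x - int s * int j))"
  have "qpT T e al" unfolding al_def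
    using qpT_shift[OF pT, of "- int s * int _"] by (intro qpT_sum qpT_cmult) simp
  then obtain g where g: "qpT T (Suc e) g" "\<And>x. g x - g (x - int T) = al x"
    using qpT_antidiff[OF T] by blast
  define d where "d = (\<lambda>m. be m - g (int m))"
  have "d m = 1 * of_real 1 ^ T * d (m - T)" if "T \<le> m" for m
  proof -
    have "be m = al (int m) + be (m - T)" using it[of N m] that thN by (simp add: al_def T_def)
    then show ?thesis using g(2)[of "int m"] that by (simp add: d_def of_nat_diff algebra_simps)
  qed
  then have "\<exists>h. periodic (T * 1) h \<and> (\<forall>m. d m = h (int m) * of_real 1 ^ m)"
    using T by (intro homogeneous_recurrence[of T 1 1 1 d]) auto
  then obtain h
    where h: "periodic T h" "\<And>m. d m = h (int m)" by auto
  have "qpT T (Suc e) (\<lambda>x. g x + h x)"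
    using qpT_monom[of 0 "Suc e" T h] h(1) by (intro qpT_add g(1)) simp
  then have "qpoly (Suc e) (\<lambda>x. g x + h x)" using T by (auto simp: qpoly_def)
  moreover have "b m = (g (int m) + h (int m)) * of_real mu ^ m" for m
    using h(2)[of m] mu by (simp add: d_def be_def field_simps)
  ultimately show ?thesis by blast
qed

text \<open>No resonance: relative to \<open>la ^ m\<close> the multiplier has absolute value
  different from 1, so the inhomogeneous part keeps its degree. The homogeneous solution adds a
  periodic multiple of \<open>mu ^ m\<close>.\<close>

lemma recurrence_other:
  fixes a b :: "nat \<Rightarrow> complex" and mu la :: real
  assumes s: "s > 0" and K: "K > 0" "th ^ K = 1" and mu: "mu > 0" "la > 0" "mu \<noteq> la"
    and a: "\<And>m. a m = p (int m) * of_real la ^ m" and p: "qpoly e p"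
    and rec: "\<And>m. b m = a m + (if s \<le> m then th * of_real mu ^ s * b (m - s) else 0)"
  shows "\<exists>p' T h. qpoly e p' \<and> T > 0 \<and> periodic T h \<and>
     (\<forall>m. b m = p' (int m) * of_real la ^ m + h (int m) * of_real mu ^ m)"
proof -
  obtain T0 where T0: "T0 > 0" "qpT T0 e p" using p by (auto simp: qpoly_def)
  define T where "T = s * T0"
  have pT: "qpT T e p" using qpT_multiple'[OF T0(2), of s] by (simp add: T_def)
  define z where "z = th * of_real (mu / la) ^ s"
  have "norm th ^ K = 1" using K(2) by (metis norm_one norm_power)
  then have nth: "norm th = 1" by (rule power_eq_1_nonneg[OF _ norm_ge_zero K(1)])
  have "z ^ T0 \<noteq> 1"
  proof
    assume "z ^ T0 = 1"
    then have "norm z ^ T0 = 1" by (metis norm_one norm_power)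
    then have "norm z = 1" by (rule power_eq_1_nonneg[OF _ norm_ge_zero T0(1)])
    then have "(mu / la) ^ s = 1" using nth mu by (simp add: z_def norm_mult norm_power norm_divide)
    then have "mu / la = 1" by (rule power_eq_1_nonneg[OF _ _ s]) (use mu in simp)
    then show False using mu by simp
  qed
  then obtain g where g: "qpT T e g" "\<And>x. g x - z * g (x - int s) = p x"
    using qpT_solve[OF T_def T0(1) _ pT] by blast
  define f where "f = (\<lambda>m. b m - g (int m) * of_real la ^ m)"
  have "f m = th * of_real mu ^ s * f (m - s)" if m: "s \<le> m" for m
  proof -
    have la: "(of_real la :: complex) ^ m = of_real la ^ s * of_real la ^ (m - s)" using m by (simp flip: power_add)
    have e1: "z * of_real la ^ m = th * of_real mu ^ s * of_real la ^ (m - s)"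
      unfolding la using mu by (simp add: z_def power_divide)
    have e2: "p (int m) = g (int m) - z * g (int (m - s))" using g(2)[of "int m"] m by (simp add: of_nat_diff)
    have e3: "b m = p (int m) * of_real la ^ m + th * of_real mu ^ s * b (m - s)" using rec[of m] m a by simp
    have "f m = th * of_real mu ^ s * b (m - s) - g (int (m - s)) * (z * of_real la ^ m)"
      unfolding f_def e3 e2 by (simp add: algebra_simps)
    then show ?thesis unfolding e1 by (simp add: f_def algebra_simps)
  qed
  note rec_f = this
  from homogeneous_recurrence[of s K th mu f, OF s K mu(1) rec_f] obtain h
    where h: "periodic (s * K) h" "\<And>m. f m = h (int m) * of_real mu ^ m" by auto
  have "b m = g (int m) * of_real la ^ m + h (int m) * of_real mu ^ m" for m
    using h(2)[of m] by (simp add: f_def algebra_simps)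
  moreover have "qpoly e g" unfolding qpoly_def using g(1) s T0 by (intro exI[of _ T]) (simp add: T_def)
  ultimately show ?thesis using h(1) s K by (intro exI[of _ g] exI[of _ "s * K"] exI[of _ h]) auto
qed

text \<open>\<open>e i\<close> is a strict bound on the degree at the base \<open>la i\<close>, so
  \<open>e i = 0\<close> means that this base does not occur.\<close>

definition expq :: "'i set \<Rightarrow> ('i \<Rightarrow> real) \<Rightarrow> ('i \<Rightarrow> nat) \<Rightarrow> (nat \<Rightarrow> complex) \<Rightarrow> bool" where
  "expq I la e a \<longleftrightarrow> (\<exists>p. (\<forall>i\<in>I. qpoly (e i) (p i)) \<and> (\<forall>m. a m = (\<Sum>i\<in>I. p i (int m) * of_real (la i) ^ m)))"

text \<open>The recurrence is multiplication by the power series \<open>1 - z * fps_X ^ s\<close>,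
  which is invertible since \<open>s > 0\<close>.\<close>

lemma recurrence_ex:
  "\<exists>b :: nat \<Rightarrow> complex. \<forall>m. b m = a m + (if s \<le> m then z * b (m - s) else 0)" if "s > 0"
proof -
  define B where "B = Abs_fps a * inverse (1 - fps_const z * fps_X ^ s)"
  have nz: "(1 - fps_const z * fps_X ^ s :: complex fps) $ 0 \<noteq> 0" using that by simp
  have "B * (1 - fps_const z * fps_X ^ s) = Abs_fps a"
    by (simp only: B_def mult.assoc inverse_mult_eq_1[OF nz] mult_1_right)
  then have B: "B = Abs_fps a + fps_const z * (fps_X ^ s * B)" by (simp add: algebra_simps)
  have "B $ m = a m + (if s \<le> m then z * B $ (m - s) else 0)" for m
    by (subst B) (simp add: fps_X_power_mult_nth)
  then show ?thesis by blast
qed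

text \<open>By linearity each summand of \<open>a\<close> gets its own recurrence. The one with base
  \<open>la i0\<close> gains a degree; the others keep theirs and contribute a periodic multiple of
  \<open>la i0 ^ m\<close>, which fits under \<open>Suc (e i0)\<close>.\<close>

lemma expq_step:
  assumes I: "finite I" "i0 \<in> I" and la: "\<And>i. i \<in> I \<Longrightarrow> la i > 0" "inj_on la I"
    and s: "s > 0" and K: "K > 0" "th ^ K = 1"
    and a: "expq I la e a"
    and rec: "\<And>m. b m = a m + (if s \<le> m then th * of_real (la i0) ^ s * b (m - s) else 0)"
  shows "expq I la (e(i0 := Suc (e i0))) b"
proof -
  obtain p where p: "\<And>i. i \<in> I \<Longrightarrow> qpoly (e i) (p i)" "\<And>m. a m = (\<Sum>i\<in>I. p i (int m) * of_real (la i) ^ m)"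
    using a unfolding expq_def by blast
  define z where "z = th * of_real (la i0) ^ s"
  have "\<exists>bi :: nat \<Rightarrow> complex. \<forall>m. bi m = p i (int m) * of_real (la i) ^ m + (if s \<le> m then z * bi (m - s) else 0)" for i
    by (rule recurrence_ex[OF s])
  then obtain bi where bi: "\<And>i m. bi i m = p i (int m) * of_real (la i) ^ m + (if s \<le> m then z * bi i (m - s) else 0)"
    by metis
  have b_eq: "b m = (\<Sum>i\<in>I. bi i m)" for m
  proof (induction m rule: less_induct)
    case (less m)
    have "(\<Sum>i\<in>I. bi i m) = a m + (if s \<le> m then z * (\<Sum>i\<in>I. bi i (m - s)) else 0)"
      by (subst bi) (simp add: sum.distrib p(2) sum_distrib_left)
    then show ?case using rec[of m] less[of "m - s"] s by (simp add: z_def)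
  qed
  obtain p0 where p0: "qpoly (Suc (e i0)) p0" "\<And>m. bi i0 m = p0 (int m) * of_real (la i0) ^ m"
  proof -
    have "\<exists>p'. qpoly (Suc (e i0)) p' \<and> (\<forall>m. bi i0 m = p' (int m) * of_real (la i0) ^ m)"
      by (rule recurrence_same[where s = s and K = K and th = th and p = "p i0" and a = "\<lambda>m. p i0 (int m) * of_real (la i0) ^ m"])
        (use s K la(1)[OF I(2)] p(1)[OF I(2)] bi[of i0] in \<open>simp_all add: z_def\<close>)
    then show ?thesis using that by blast
  qed
  have "\<exists>g h. qpoly (e i) g \<and> qpoly (Suc (e i0)) h \<and> (\<forall>m. bi i m = g (int m) * of_real (la i) ^ m + h (int m) * of_real (la i0) ^ m)"
    if i: "i \<in> I - {i0}" for i
  proof -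
    have "la i0 \<noteq> la i" using la(2) I(2) i by (auto simp: inj_on_def)
    have "\<exists>g T h. qpoly (e i) g \<and> T > 0 \<and> periodic T h \<and>
        (\<forall>m. bi i m = g (int m) * of_real (la i) ^ m + h (int m) * of_real (la i0) ^ m)"
      by (rule recurrence_other[where s = s and K = K and th = th and p = "p i" and a = "\<lambda>m. p i (int m) * of_real (la i) ^ m"])
        (use s K la(1)[OF I(2)] la(1)[of i] p(1)[of i] bi[of i] i \<open>la i0 \<noteq> la i\<close> in \<open>simp_all add: z_def\<close>)
    then show ?thesis using qpoly_periodic by blast
  qed
  then obtain g h where gh: "\<And>i. i \<in> I - {i0} \<Longrightarrow> qpoly (e i) (g i) \<and> qpoly (Suc (e i0)) (h i) \<and>
      (\<forall>m. bi i m = g i (int m) * of_real (la i) ^ m + h i (int m) * of_real (la i0) ^ m)" by metis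
  define p' where "p' = (\<lambda>i. if i = i0 then (\<lambda>x. p0 x + (\<Sum>i\<in>I - {i0}. h i x)) else g i)"
  show ?thesis unfolding expq_def
  proof (intro exI[of _ p'] conjI ballI allI)
    show "qpoly ((e(i0 := Suc (e i0))) i) (p' i)" if "i \<in> I" for i
      using that gh p0(1) by (auto simp: p'_def intro!: qpoly_add qpoly_sum)
    fix m
    have "b m = bi i0 m + (\<Sum>i\<in>I - {i0}. bi i m)" unfolding b_eq by (rule sum.remove[OF I])
    also have "(\<Sum>i\<in>I - {i0}. bi i m) = (\<Sum>i\<in>I - {i0}. g i (int m) * of_real (la i) ^ m) + (\<Sum>i\<in>I - {i0}. h i (int m)) * of_real (la i0) ^ m"
      using gh by (simp add: sum.distrib sum_distrib_right)
    also have "bi i0 m + \<dots> = p' i0 (int m) * of_real (la i0) ^ m + (\<Sum>i\<in>I - {i0}. p' i (int m) * of_real (la i) ^ m)"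
      by (simp add: p0(2) p'_def algebra_simps)
    also have "\<dots> = (\<Sum>i\<in>I. p' i (int m) * of_real (la i) ^ m)" by (rule sum.remove[OF I, symmetric])
    finally show "b m = (\<Sum>i\<in>I. p' i (int m) * of_real (la i) ^ m)" .
  qed
qed

text \<open>The constant \<open>C\<close> may depend on \<open>t\<close>: the error is of order
  \<open>t ^ m\<close> for each \<open>t > t0\<close>, with no claim at \<open>t0\<close> itself.
  This becomes the \<open>\<epsilon>\<close> of the theorem.\<close>

definition expq_upto :: "'i set \<Rightarrow> ('i \<Rightarrow> real) \<Rightarrow> real \<Rightarrow> ('i \<Rightarrow> nat) \<Rightarrow> (nat \<Rightarrow> complex) \<Rightarrow> bool" where
  "expq_upto I la t0 e a \<longleftrightarrow> (\<exists>p. (\<forall>i\<in>I. qpoly (e i) (p i)) \<and>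
     (\<forall>t>t0. \<exists>C. \<forall>m. norm (a m - (\<Sum>i\<in>I. p i (int m) * of_real (la i) ^ m)) \<le> C * t ^ m))"

lemma expq_upto_add:
  assumes "expq_upto I la t0 e a" "expq_upto I la t0 e b" shows "expq_upto I la t0 e (\<lambda>m. a m + b m)"
proof -
  obtain p p' where p: "\<forall>i\<in>I. qpoly (e i) (p i)" "\<forall>t>t0. \<exists>C. \<forall>m. norm (a m - (\<Sum>i\<in>I. p i (int m) * of_real (la i) ^ m)) \<le> C * t ^ m"
    and p': "\<forall>i\<in>I. qpoly (e i) (p' i)" "\<forall>t>t0. \<exists>C. \<forall>m. norm (b m - (\<Sum>i\<in>I. p' i (int m) * of_real (la i) ^ m)) \<le> C * t ^ m"
    using assms unfolding expq_upto_def by blast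
  show ?thesis unfolding expq_upto_def
  proof (intro exI[of _ "\<lambda>i x. p i x + p' i x"] conjI ballI allI impI)
    show "qpoly (e i) (\<lambda>x. p i x + p' i x)" if "i \<in> I" for i using p p' that by (intro qpoly_add) auto
    fix t assume "t > t0"
    then obtain C C' where C: "\<And>m. norm (a m - (\<Sum>i\<in>I. p i (int m) * of_real (la i) ^ m)) \<le> C * t ^ m"
      "\<And>m. norm (b m - (\<Sum>i\<in>I. p' i (int m) * of_real (la i) ^ m)) \<le> C' * t ^ m" using p(2) p'(2) by blast
    have "norm (a m + b m - (\<Sum>i\<in>I. (p i (int m) + p' i (int m)) * of_real (la i) ^ m)) \<le> (C + C') * t ^ m" for m
    proof -
      have "a m + b m - (\<Sum>i\<in>I. (p i (int m) + p' i (int m)) * of_real (la i) ^ m) =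
        (a m - (\<Sum>i\<in>I. p i (int m) * of_real (la i) ^ m)) + (b m - (\<Sum>i\<in>I. p' i (int m) * of_real (la i) ^ m))"
        by (simp add: algebra_simps sum.distrib)
      also have "norm \<dots> \<le> C * t ^ m + C' * t ^ m" by (intro norm_triangle_mono C)
      finally show ?thesis by (simp add: algebra_simps)
    qed
    then show "\<exists>C. \<forall>m. norm (a m + b m - (\<Sum>i\<in>I. (p i (int m) + p' i (int m)) * of_real (la i) ^ m)) \<le> C * t ^ m" by blast
  qed
qed

lemma expq_upto_cmult:
  assumes "expq_upto I la t0 e a" shows "expq_upto I la t0 e (\<lambda>m. c * a m)"
proof -
  obtain p where p: "\<forall>i\<in>I. qpoly (e i) (p i)" "\<forall>t>t0. \<exists>C. \<forall>m. norm (a m - (\<Sum>i\<in>I. p i (int m) * of_real (la i) ^ m)) \<le> C * t ^ m"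
    using assms unfolding expq_upto_def by blast
  show ?thesis unfolding expq_upto_def
  proof (intro exI[of _ "\<lambda>i x. c * p i x"] conjI ballI allI impI)
    show "qpoly (e i) (\<lambda>x. c * p i x)" if "i \<in> I" for i using p that by (intro qpoly_cmult) auto
    fix t assume "t > t0"
    then obtain C where C: "\<And>m. norm (a m - (\<Sum>i\<in>I. p i (int m) * of_real (la i) ^ m)) \<le> C * t ^ m" using p(2) by blast
    have "norm (c * a m - (\<Sum>i\<in>I. c * p i (int m) * of_real (la i) ^ m)) \<le> (norm c * C) * t ^ m" for m
    proof -
      have "c * a m - (\<Sum>i\<in>I. c * p i (int m) * of_real (la i) ^ m) = c * (a m - (\<Sum>i\<in>I. p i (int m) * of_real (la i) ^ m))"
        by (simp add: algebra_simps sum_distrib_left)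
      then show ?thesis using mult_left_mono[OF C[of m], of "norm c"] by (simp add: norm_mult mult.assoc)
    qed
    then show "\<exists>C. \<forall>m. norm (c * a m - (\<Sum>i\<in>I. c * p i (int m) * of_real (la i) ^ m)) \<le> C * t ^ m" by blast
  qed
qed

lemma expq_upto_mono:
  assumes "expq_upto I la t0 e a" "\<And>i. i \<in> I \<Longrightarrow> e i \<le> e' i" shows "expq_upto I la t0 e' a"
proof -
  obtain p where p: "\<forall>i\<in>I. qpoly (e i) (p i)"
    "\<forall>t>t0. \<exists>C. \<forall>m. norm (a m - (\<Sum>i\<in>I. p i (int m) * of_real (la i) ^ m)) \<le> C * t ^ m"
    using assms(1) unfolding expq_upto_def by blast
  have "\<forall>i\<in>I. qpoly (e' i) (p i)" using p(1) assms(2) qpoly_mono by blast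
  then show ?thesis unfolding expq_upto_def by (intro exI[of _ p] conjI p(2))
qed

lemma expq_upto_zero: "t0 \<ge> 0 \<Longrightarrow> expq_upto I la t0 e (\<lambda>_. 0)"
  unfolding expq_upto_def by (intro exI[of _ "\<lambda>_ _. 0"] conjI) (auto intro!: exI[of _ 0])

lemma expq_upto_sum: "t0 \<ge> 0 \<Longrightarrow> (\<And>j. j \<in> J \<Longrightarrow> expq_upto I la t0 e (f j)) \<Longrightarrow> expq_upto I la t0 e (\<lambda>m. \<Sum>j\<in>J. f j m)"
  by (induction J rule: infinite_finite_induct) (auto intro: expq_upto_add expq_upto_zero)

lemma expq_upto_diff: "expq_upto I la t0 e a \<Longrightarrow> expq_upto I la t0 e b \<Longrightarrow> expq_upto I la t0 e (\<lambda>m. a m - b m)"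
  using expq_upto_add[of I la t0 e a "\<lambda>m. (-1) * b m"] expq_upto_cmult[of I la t0 e b "-1"] by simp

section \<open>Convolution with a series of larger radius of convergence\<close>

lemma power_times_poly_bounded:
  fixes x :: real
  assumes "0 \<le> x" "x < 1" shows "\<exists>C. \<forall>k. real (Suc k) ^ j * x ^ k \<le> C"
  using assms
proof (induction j arbitrary: x)
  case 0 then show ?case by (intro exI[of _ 1]) (auto intro: power_le_one)
next
  case (Suc j)
  \<comment> \<open>Half of the exponential decay absorbs one factor \<open>Suc k\<close>, the other
    half is left to the induction hypothesis.\<close>
  define z where "z = sqrt x"
  have z: "0 \<le> z" "z < 1" "z * z = x" using Suc.prems by (auto simp: z_def)
  obtain C where C: "\<And>k. real (Suc k) ^ j * z ^ k \<le> C" using Suc.IH z by blast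
  have "(\<lambda>n. of_nat n * z ^ n) \<longlonglongrightarrow> 0" using z by (intro powser_times_n_limit_0) auto
  then have "Bseq (\<lambda>n. of_nat n * z ^ n)" by (intro convergent_imp_Bseq) (auto simp: convergent_def)
  then obtain D where D: "\<And>n. norm (of_nat n * z ^ n) \<le> D" by (auto simp: Bseq_def)
  have "real (Suc k) ^ Suc j * x ^ k \<le> C * (D + 1)" for k
  proof -
    have "real (Suc k) * z ^ k \<le> D + 1"
      using D[of k] z power_le_one[of z k] by (simp add: algebra_simps abs_mult)
    moreover have "real (Suc k) ^ Suc j * x ^ k = (real (Suc k) ^ j * z ^ k) * (real (Suc k) * z ^ k)"
      by (simp add: z(3)[symmetric] power_mult_distrib mult_ac)
    moreover have "0 \<le> C" using C[of 0] z by (metis mult_nonneg_nonneg of_nat_0_le_iff order_trans zero_le_power)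
    ultimately show ?thesis using C[of k] z by (metis mult_mono mult_nonneg_nonneg of_nat_0_le_iff zero_le_power)
  qed
  then show ?case by blast
qed

lemma periodic_bounded: "T > 0 \<Longrightarrow> periodic T f \<Longrightarrow> \<exists>C. \<forall>x. norm (f x) \<le> C"
proof -
  assume T: "T > 0" and f: "periodic T f"
  have "f x = f (x mod int T)" for x
    using periodic_times[OF f, of "x mod int T" "x div int T"] by (simp add: mult.commute)
  moreover have "x mod int T \<in> {0..<int T}" for x using T by simp
  ultimately have "norm (f x) \<le> Max ((\<lambda>x. norm (f x)) ` {0..<int T})" for x
    by (metis Max_ge finite_atLeastLessThan_int finite_imageI imageI)
  then show ?thesis by blast
qed

lemma qpT_bounded:
  assumes T: "T > 0" and p: "qpT T m p"
  shows "\<exists>C\<ge>0. \<forall>x. norm (p x) \<le> C * (1 + \<bar>of_int x\<bar>) ^ m"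
proof -
  obtain c where c: "\<And>i. periodic T (c i)" "\<And>x. p x = (\<Sum>i<m. c i x * of_int x ^ i)" using p unfolding qpT_def by blast
  have "\<forall>i. \<exists>C. \<forall>x. norm (c i x) \<le> C" using periodic_bounded[OF T c(1)] by blast
  then obtain C where C: "\<And>i x. norm (c i x) \<le> C i" by metis
  have C0: "C i \<ge> 0" for i using C[of i 0] norm_ge_zero order_trans by blast
  have "norm (p x) \<le> (\<Sum>i<m. C i) * (1 + \<bar>of_int x\<bar>) ^ m" for x
  proof -
    have "norm (p x) \<le> (\<Sum>i<m. norm (c i x * of_int x ^ i))" unfolding c(2) by (rule norm_sum)
    also have "\<dots> \<le> (\<Sum>i<m. C i * (1 + \<bar>of_int x\<bar>) ^ m)"
    proof (rule sum_mono)
      fix i assume i: "i \<in> {..<m}"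
      have "norm (of_int x ^ i :: complex) = \<bar>of_int x\<bar> ^ i" by (simp add: norm_power)
      also have "\<dots> \<le> (1 + \<bar>of_int x\<bar>) ^ i" by (intro power_mono) auto
      also have "\<dots> \<le> (1 + \<bar>of_int x\<bar>) ^ m" using i by (intro power_increasing) auto
      finally show "norm (c i x * of_int x ^ i) \<le> C i * (1 + \<bar>of_int x\<bar>) ^ m"
        unfolding norm_mult using C[of i x] C0 by (intro mult_mono) auto
    qed
    finally show ?thesis by (simp add: sum_distrib_right)
  qed
  moreover have "(\<Sum>i<m. C i) \<ge> 0" using C0 by (intro sum_nonneg) auto
  ultimately show ?thesis by blast
qed

lemma summable_weighted:
  fixes h :: "nat \<Rightarrow> complex"
  assumes t: "0 < t" "t < la" and h: "summable (\<lambda>k. norm (h k) / t ^ k)"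
  shows "summable (\<lambda>k. norm (h k / of_real la ^ k) * real (Suc k) ^ j)"
proof -
  obtain C where C: "\<And>k. real (Suc k) ^ j * (t / la) ^ k \<le> C"
    using power_times_poly_bounded[of "t / la" j] t by auto
  show ?thesis
  proof (rule summable_comparison_test')
    show "summable (\<lambda>k. C * (norm (h k) / t ^ k))" using h by (rule summable_mult)
    fix k :: nat
    have "norm (norm (h k / of_real la ^ k) * real (Suc k) ^ j) = (norm (h k) / t ^ k) * (real (Suc k) ^ j * (t / la) ^ k)"
      using t by (simp add: norm_divide norm_power power_divide field_simps)
    also have "\<dots> \<le> (norm (h k) / t ^ k) * C" using t by (intro mult_left_mono C) auto
    finally show "norm (norm (h k / of_real la ^ k) * real (Suc k) ^ j) \<le> C * (norm (h k) / t ^ k)" by (simp add: mult.commute)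
  qed
qed

text \<open>Expanding \<open>(x - k) ^ m\<close> separates \<open>x\<close> from \<open>k\<close>;
  the sums over \<open>k\<close> are the periodic functions \<open>D i\<close>, convergent because
  \<open>g\<close> decays faster than every power.\<close>

lemma qpT_convolution:
  fixes g :: "nat \<Rightarrow> complex"
  assumes T: "T > 0" and p: "qpT T m p" and g: "\<And>j. summable (\<lambda>k. norm (g k) * real (Suc k) ^ j)"
  shows "qpT T m (\<lambda>x. suminf (\<lambda>k. g k * p (x - int k)))" "summable (\<lambda>k. norm (g k * p (x - int k)))"
proof -
  have main: "qpT T m (\<lambda>x. suminf (\<lambda>k. g k * p (x - int k))) \<and> (\<forall>x. summable (\<lambda>k. norm (g k * p (x - int k))))"
    using p
  proof (induction m arbitrary: p)
    case 0 then show ?case by (simp add: qpT_0)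
  next
    case (Suc m)
    obtain c p' where cp: "periodic T c" "qpT T m p'" "\<And>x. p x = p' x + c x * of_int x ^ m"
      using qpT_SucE[OF Suc.prems] by blast
    obtain C where C: "\<And>x. norm (c x) \<le> C" using periodic_bounded[OF T cp(1)] by blast
    have C0: "C \<ge> 0" using C[of 0] norm_ge_zero order_trans by blast
    have sm: "summable (\<lambda>k. norm (g k * c (x - int k) * (- of_nat k) ^ i))" for x i
    proof (rule summable_comparison_test')
      show "summable (\<lambda>k. C * (norm (g k) * real (Suc k) ^ i))" by (intro summable_mult g)
      fix k
      have "norm (g k * c (x - int k) * (- of_nat k) ^ i) = norm (g k) * (norm (c (x - int k)) * real k ^ i)"
        by (simp add: norm_mult norm_power mult.assoc)
      also have "\<dots> \<le> norm (g k) * (C * real (Suc k) ^ i)"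
        using C C0 by (intro mult_left_mono mult_mono power_mono) auto
      finally show "norm (norm (g k * c (x - int k) * (- of_nat k) ^ i)) \<le> C * (norm (g k) * real (Suc k) ^ i)"
        by (simp add: mult_ac)
    qed
    define D where "D = (\<lambda>i x. suminf (\<lambda>k. g k * c (x - int k) * (- of_nat k) ^ i))"
    have D: "periodic T (D i)" for i
    proof -
      have "c (x + int T - y) = c (x - y)" for x y using periodic_shift[OF cp(1), of "- y"] by (simp add: periodic_def)
      then show ?thesis by (simp add: D_def periodic_def)
    qed
    have ex: "g k * (c (x - int k) * of_int (x - int k) ^ m) =
        (\<Sum>i\<le>m. of_nat (m choose i) * of_int x ^ i * (g k * c (x - int k) * (- of_nat k) ^ (m - i)))" for x k
    proof -
      have "(of_int (x - int k) :: complex) ^ m = (of_int x + (- of_nat k)) ^ m" by simp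
      also have "\<dots> = (\<Sum>i\<le>m. of_nat (m choose i) * of_int x ^ i * (- of_nat k) ^ (m - i))" by (rule binomial_ring)
      finally show ?thesis by (simp add: sum_distrib_left mult_ac)
    qed
    have smt: "summable (\<lambda>k. norm (g k * (c (x - int k) * of_int (x - int k) ^ m)))" for x
    proof (rule summable_comparison_test')
      show "summable (\<lambda>k. \<Sum>i\<le>m. norm (of_nat (m choose i) * of_int x ^ i :: complex) * norm (g k * c (x - int k) * (- of_nat k) ^ (m - i)))"
        by (intro summable_sum summable_mult sm)
      fix k
      show "norm (norm (g k * (c (x - int k) * of_int (x - int k) ^ m))) \<le>
        (\<Sum>i\<le>m. norm (of_nat (m choose i) * of_int x ^ i :: complex) * norm (g k * c (x - int k) * (- of_nat k) ^ (m - i)))"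
        unfolding ex norm_mult[symmetric] by (simp only: real_norm_def abs_norm_cancel) (rule norm_sum)
    qed
    have lead: "(suminf (\<lambda>k. g k * (c (x - int k) * of_int (x - int k) ^ m))) = (\<Sum>i\<le>m. of_nat (m choose i) * D (m - i) x * of_int x ^ i)" for x
    proof -
      have "(suminf (\<lambda>k. g k * (c (x - int k) * of_int (x - int k) ^ m))) =
        (\<Sum>i\<le>m. suminf (\<lambda>k. of_nat (m choose i) * of_int x ^ i * (g k * c (x - int k) * (- of_nat k) ^ (m - i))))"
        unfolding ex by (intro suminf_sum summable_mult summable_norm_cancel[OF sm])
      also have "\<dots> = (\<Sum>i\<le>m. of_nat (m choose i) * of_int x ^ i * D (m - i) x)"
        unfolding D_def by (intro sum.cong refl suminf_mult summable_norm_cancel[OF sm])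
      finally show ?thesis by (simp add: mult_ac)
    qed
    have IH: "qpT T m (\<lambda>x. suminf (\<lambda>k. g k * p' (x - int k)))" "\<And>x. summable (\<lambda>k. norm (g k * p' (x - int k)))"
      using Suc.IH[OF cp(2)] by auto
    have eq: "(suminf (\<lambda>k. g k * p (x - int k))) = (suminf (\<lambda>k. g k * p' (x - int k))) + (\<Sum>i\<le>m. of_nat (m choose i) * D (m - i) x * of_int x ^ i)" for x
      unfolding lead[symmetric] cp(3) distrib_left
      by (intro suminf_add[symmetric] summable_norm_cancel[OF IH(2)] summable_norm_cancel[OF smt])
    have "qpT T (Suc m) (\<lambda>x. (suminf (\<lambda>k. g k * p' (x - int k))) + (\<Sum>i\<le>m. of_nat (m choose i) * D (m - i) x * of_int x ^ i))"
      by (intro qpT_add qpT_sum qpT_monom periodic_mult D qpT_mono[OF IH(1)]) auto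
    moreover have "summable (\<lambda>k. norm (g k * p (x - int k)))" for x
    proof (rule summable_comparison_test')
      show "summable (\<lambda>k. norm (g k * p' (x - int k)) + norm (g k * (c (x - int k) * of_int (x - int k) ^ m)))"
        by (intro summable_add IH smt)
      show "norm (norm (g k * p (x - int k))) \<le> norm (g k * p' (x - int k)) + norm (g k * (c (x - int k) * of_int (x - int k) ^ m))" for k
        unfolding cp(3) distrib_left by (simp add: norm_triangle_ineq)
    qed
    ultimately show ?case by (simp only: eq) simp
  qed
  then show "qpT T m (\<lambda>x. suminf (\<lambda>k. g k * p (x - int k)))" "summable (\<lambda>k. norm (g k * p (x - int k)))" by auto
qed

text \<open>The finite convolution is completed to an infinite series, which is again a
  quasi-polynomial times \<open>la ^ m\<close>; the completion evaluates \<open>p\<close> at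
  negative integers. The tail from \<open>m + 1\<close> on is the error, bounded by comparing
  \<open>la\<close> with \<open>t\<close>.\<close>

lemma convolution_single:
  fixes h :: "nat \<Rightarrow> complex"
  assumes t0: "t0 > 0" "t0 < la" and h: "\<And>t. t > t0 \<Longrightarrow> summable (\<lambda>k. norm (h k) / t ^ k)" and p: "qpoly e p"
  shows "\<exists>p'. qpoly e p' \<and> (\<forall>t>t0. \<exists>C. \<forall>m.
     norm ((\<Sum>k\<le>m. h k * (p (int (m - k)) * of_real la ^ (m - k))) - p' (int m) * of_real la ^ m) \<le> C * t ^ m)"
proof -
  obtain T where T: "T > 0" "qpT T e p" using p by (auto simp: qpoly_def)
  define g where "g = (\<lambda>k. h k / of_real la ^ k)"
  have la0: "la > 0" using t0 by simp
  have g: "summable (\<lambda>k. norm (g k) * real (Suc k) ^ j)" for j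
    unfolding g_def using t0 by (intro summable_weighted[of "(t0 + la) / 2"] h) auto
  define p' where "p' = (\<lambda>x. suminf (\<lambda>k. g k * p (x - int k)))"
  have p': "qpT T e p'" unfolding p'_def by (rule qpT_convolution(1)[OF T g])
  have sm: "summable (\<lambda>k. norm (g k * p (x - int k)))" for x by (rule qpT_convolution(2)[OF T g])
  have small: "\<exists>C. \<forall>m. norm ((\<Sum>k\<le>m. h k * (p (int (m - k)) * of_real la ^ (m - k))) - p' (int m) * of_real la ^ m) \<le> C * t ^ m"
    if t: "t > t0" "t < la" for t
  proof -
    have tp: "t > 0" using t t0 by simp
    obtain C0 where C0: "C0 \<ge> 0" "\<And>x. norm (p x) \<le> C0 * (1 + \<bar>of_int x\<bar>) ^ e" using qpT_bounded[OF T] by blast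
    obtain C1 where C1: "\<And>k. real (Suc k) ^ e * (t / la) ^ k \<le> C1"
      using power_times_poly_bounded[of "t / la" e] tp t by auto
    define H where "H = (suminf (\<lambda>k. norm (h k) / t ^ k))"
    have "norm ((\<Sum>k\<le>m. h k * (p (int (m - k)) * of_real la ^ (m - k))) - p' (int m) * of_real la ^ m) \<le> (C0 * C1 * H) * t ^ m" for m
    proof -
      have e1: "(\<Sum>k\<le>m. h k * (p (int (m - k)) * of_real la ^ (m - k))) = (\<Sum>k<Suc m. g k * p (int m - int k)) * of_real la ^ m"
      proof -
        have "h k * (p (int (m - k)) * of_real la ^ (m - k)) = g k * p (int m - int k) * of_real la ^ m" if "k \<le> m" for k
        proof -
          have "(of_real la :: complex) ^ m = of_real la ^ k * of_real la ^ (m - k)" using that by (simp flip: power_add)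
          then show ?thesis using la0 that by (simp add: g_def of_nat_diff)
        qed
        then show ?thesis unfolding lessThan_Suc_atMost sum_distrib_right by (intro sum.cong refl) simp
      qed
      have sm': "summable (\<lambda>k. g k * p (int m - int k))" by (rule summable_norm_cancel[OF sm])
      have "p' (int m) = (suminf (\<lambda>k. g (k + Suc m) * p (int m - int (k + Suc m)))) + (\<Sum>k<Suc m. g k * p (int m - int k))"
        unfolding p'_def by (rule suminf_split_initial_segment[OF sm'])
      then have e2: "(\<Sum>k<Suc m. g k * p (int m - int k)) * of_real la ^ m - p' (int m) * of_real la ^ m =
          - ((suminf (\<lambda>k. g (k + Suc m) * p (int m - int (k + Suc m)))) * of_real la ^ m)"
        by (simp add: algebra_simps)
      have hs: "summable (\<lambda>k. norm (h k) / t ^ k)" by (rule h[OF t(1)])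
      have bound: "norm (g (k + Suc m) * p (int m - int (k + Suc m))) * la ^ m \<le> C0 * C1 * t ^ m * (norm (h (k + Suc m)) / t ^ (k + Suc m))" for k
      proof -
        have "norm (p (int m - int (k + Suc m))) \<le> C0 * (1 + \<bar>of_int (int m - int (k + Suc m))\<bar>) ^ e" by (rule C0)
        also have "\<bar>of_int (int m - int (k + Suc m))\<bar> = real (Suc k)" by simp
        finally have pb: "norm (p (int m - int (k + Suc m))) \<le> C0 * real (Suc (Suc k)) ^ e" by (simp add: add.commute)
        have "norm (g (k + Suc m) * p (int m - int (k + Suc m))) * la ^ m
            = norm (h (k + Suc m)) / la ^ Suc k * norm (p (int m - int (k + Suc m)))"
          using la0 by (simp add: g_def norm_mult norm_divide norm_power power_add)
        also have "\<dots> \<le> norm (h (k + Suc m)) / la ^ Suc k * (C0 * real (Suc (Suc k)) ^ e)"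
          using la0 pb by (intro mult_left_mono) auto
        also have "\<dots> = C0 * (real (Suc (Suc k)) ^ e * (t / la) ^ Suc k) * (norm (h (k + Suc m)) / t ^ Suc k)"
          using tp la0 by (simp add: power_divide field_simps)
        also have "\<dots> \<le> C0 * C1 * (norm (h (k + Suc m)) / t ^ Suc k)"
          using C1[of "Suc k"] C0(1) tp by (intro mult_right_mono mult_left_mono) auto
        also have "\<dots> = C0 * C1 * t ^ m * (norm (h (k + Suc m)) / t ^ (k + Suc m))"
          using tp by (simp add: power_add field_simps)
        finally show ?thesis .
      qed
      have "norm ((suminf (\<lambda>k. g (k + Suc m) * p (int m - int (k + Suc m)))) * of_real la ^ m) \<le> C0 * C1 * t ^ m * (suminf (\<lambda>k. norm (h (k + Suc m)) / t ^ (k + Suc m)))"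
      proof -
        have s1: "summable (\<lambda>k. norm (g (k + Suc m) * p (int m - int (k + Suc m))))"
          using sm[of "int m"] by (subst summable_iff_shift)
        have s2: "summable (\<lambda>k. norm (h (k + Suc m)) / t ^ (k + Suc m))" using hs by (subst summable_iff_shift)
        have "norm ((suminf (\<lambda>k. g (k + Suc m) * p (int m - int (k + Suc m)))) * of_real la ^ m) \<le>
            (suminf (\<lambda>k. norm (g (k + Suc m) * p (int m - int (k + Suc m))))) * la ^ m"
          using la0 summable_norm[OF s1] by (simp add: norm_mult norm_power mult_right_mono)
        also have "\<dots> = (suminf (\<lambda>k. norm (g (k + Suc m) * p (int m - int (k + Suc m))) * la ^ m))" by (rule suminf_mult2[OF s1])
        also have "\<dots> \<le> (suminf (\<lambda>k. C0 * C1 * t ^ m * (norm (h (k + Suc m)) / t ^ (k + Suc m))))"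
          by (intro suminf_le bound summable_mult2[OF s1] summable_mult[OF s2])
        also have "\<dots> = C0 * C1 * t ^ m * (suminf (\<lambda>k. norm (h (k + Suc m)) / t ^ (k + Suc m)))" by (rule suminf_mult[OF s2])
        finally show ?thesis .
      qed
      also have "\<dots> \<le> C0 * C1 * t ^ m * H"
      proof (intro mult_left_mono)
        have "H = (suminf (\<lambda>k. norm (h (k + Suc m)) / t ^ (k + Suc m))) + (\<Sum>k<Suc m. norm (h k) / t ^ k)"
          unfolding H_def by (rule suminf_split_initial_segment[OF hs])
        moreover have "(\<Sum>k<Suc m. norm (h k) / t ^ k) \<ge> 0" using tp by (intro sum_nonneg) auto
        ultimately show "(suminf (\<lambda>k. norm (h (k + Suc m)) / t ^ (k + Suc m))) \<le> H" by simp
        have "C1 \<ge> 0" using C1[of 0] by (simp add: order_trans[OF zero_le_one])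
        then show "0 \<le> C0 * C1 * t ^ m" using C0 tp by simp
      qed
      finally show ?thesis unfolding e1 e2 by (simp add: mult_ac)
    qed
    then show ?thesis by blast
  qed
  have "\<exists>C. \<forall>m. norm ((\<Sum>k\<le>m. h k * (p (int (m - k)) * of_real la ^ (m - k))) - p' (int m) * of_real la ^ m) \<le> C * t ^ m"
    if t: "t > t0" for t
  proof -
    \<comment> \<open>The estimate \<open>small\<close> is limited to \<open>t < la\<close>. A point
      \<open>u\<close> between \<open>t0\<close> and \<open>la\<close> that is at most
      \<open>t\<close> gives a bound at least as strong.\<close>
    define u where "u = min t ((t0 + la) / 2)"
    have "t0 < (t0 + la) / 2" "(t0 + la) / 2 < la" using t0 by auto
    then have u: "u > t0" "u < la" "u \<le> t" "u > 0" using t t0 by (auto simp: u_def min_less_iff_disj)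
    obtain C where C: "\<And>m. norm ((\<Sum>k\<le>m. h k * (p (int (m - k)) * of_real la ^ (m - k))) - p' (int m) * of_real la ^ m) \<le> C * u ^ m"
      using small[OF u(1,2)] by blast
    have "C \<ge> 0" using order_trans[OF norm_ge_zero C[of 0]] by simp
    then have "C * u ^ m \<le> C * t ^ m" for m using u by (intro mult_left_mono power_mono) auto
    then show ?thesis using C order_trans by blast
  qed
  then show ?thesis using p' T(1) by (auto simp: qpoly_def)
qed

theorem expq_convolution:
  assumes I: "finite I" and t0: "t0 > 0" "\<And>i. i \<in> I \<Longrightarrow> t0 < la i"
    and h: "\<And>t. t > t0 \<Longrightarrow> summable (\<lambda>k. norm (h k) / t ^ k)" and b: "expq I la e b"
  shows "expq_upto I la t0 e (\<lambda>m. \<Sum>k\<le>m. h k * b (m - k))"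
proof -
  obtain p where p: "\<And>i. i \<in> I \<Longrightarrow> qpoly (e i) (p i)" "\<And>m. b m = (\<Sum>i\<in>I. p i (int m) * of_real (la i) ^ m)"
    using b unfolding expq_def by blast
  have "\<exists>p'. qpoly (e i) p' \<and> (\<forall>t>t0. \<exists>C. \<forall>m.
     norm ((\<Sum>k\<le>m. h k * (p i (int (m - k)) * of_real (la i) ^ (m - k))) - p' (int m) * of_real (la i) ^ m) \<le> C * t ^ m)"
    if "i \<in> I" for i using convolution_single[OF t0(1) t0(2)[OF that] h p(1)[OF that]] .
  then obtain p' where p': "\<And>i. i \<in> I \<Longrightarrow> qpoly (e i) (p' i)"
    "\<And>i t. i \<in> I \<Longrightarrow> t > t0 \<Longrightarrow> \<exists>C. \<forall>m. norm ((\<Sum>k\<le>m. h k * (p i (int (m - k)) * of_real (la i) ^ (m - k))) - p' i (int m) * of_real (la i) ^ m) \<le> C * t ^ m"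
    using bchoice[of I "\<lambda>i p'. qpoly (e i) p' \<and> (\<forall>t>t0. \<exists>C. \<forall>m.
     norm ((\<Sum>k\<le>m. h k * (p i (int (m - k)) * of_real (la i) ^ (m - k))) - p' (int m) * of_real (la i) ^ m) \<le> C * t ^ m)"]
    by blast
  show ?thesis unfolding expq_upto_def
  proof (intro exI[of _ p'] conjI ballI allI impI p'(1))
    fix t assume t: "t > t0"
    then have "\<exists>C. \<forall>m. norm ((\<Sum>k\<le>m. h k * (p i (int (m - k)) * of_real (la i) ^ (m - k))) - p' i (int m) * of_real (la i) ^ m) \<le> C * t ^ m"
      if "i \<in> I" for i using p'(2) that by blast
    then obtain C where C: "\<And>i m. i \<in> I \<Longrightarrow> norm ((\<Sum>k\<le>m. h k * (p i (int (m - k)) * of_real (la i) ^ (m - k))) - p' i (int m) * of_real (la i) ^ m) \<le> C i * t ^ m"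
      by metis
    have "norm ((\<Sum>k\<le>m. h k * b (m - k)) - (\<Sum>i\<in>I. p' i (int m) * of_real (la i) ^ m)) \<le> (\<Sum>i\<in>I. C i) * t ^ m" for m
    proof -
      have "(\<Sum>k\<le>m. h k * b (m - k)) = (\<Sum>i\<in>I. \<Sum>k\<le>m. h k * (p i (int (m - k)) * of_real (la i) ^ (m - k)))"
        unfolding p(2) by (subst sum.swap) (simp add: sum_distrib_left)
      then have "(\<Sum>k\<le>m. h k * b (m - k)) - (\<Sum>i\<in>I. p' i (int m) * of_real (la i) ^ m) =
        (\<Sum>i\<in>I. (\<Sum>k\<le>m. h k * (p i (int (m - k)) * of_real (la i) ^ (m - k))) - p' i (int m) * of_real (la i) ^ m)"
        by (simp add: sum_subtractf)
      also have "norm \<dots> \<le> (\<Sum>i\<in>I. C i * t ^ m)" by (intro sum_norm_le C)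
      finally show ?thesis by (simp add: sum_distrib_right)
    qed
    then show "\<exists>C. \<forall>m. norm ((\<Sum>k\<le>m. h k * b (m - k)) - (\<Sum>i\<in>I. p' i (int m) * of_real (la i) ^ m)) \<le> C * t ^ m" by blast
  qed
qed

section \<open>Curves as tuples of polynomials\<close>

definition irred_upto :: "nat \<Rightarrow> ('a :: {field,finite}) poly set" where
  "irred_upto D = {P. monic_irred P \<and> degree P \<le> D}"

lemma finite_polys_degree_le: "finite {P :: ('a :: {field,finite}) poly. degree P \<le> D}"
proof (rule finite_subset)
  show "{P :: 'a poly. degree P \<le> D} \<subseteq> Poly ` {xs. set xs \<subseteq> UNIV \<and> length xs \<le> Suc D}"
  proof
    fix P :: "'a poly" assume "P \<in> {P. degree P \<le> D}"
    then have "length (coeffs P) \<le> Suc D"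
      by (cases "P = 0") (auto simp: length_coeffs_degree)
    then show "P \<in> Poly ` {xs. set xs \<subseteq> UNIV \<and> length xs \<le> Suc D}"
      by (intro image_eqI[of _ _ "coeffs P"]) auto
  qed
qed (intro finite_imageI finite_lists_length_le, simp)

lemma finite_irred_upto [simp]: "finite (irred_upto D)"
  by (rule finite_subset[OF _ finite_polys_degree_le[of D]]) (auto simp: irred_upto_def)

lemma card_eq_sum_fibers:
  assumes "finite A" shows "card A = (\<Sum>y\<in>f ` A. card {x \<in> A. f x = y})"
  using sum.image_gen[OF assms, of "\<lambda>_. 1 :: nat" f] by simp

locale counting_data = cover_data n r \<zeta>0
  for n r and \<zeta>0 :: "'a :: {field,finite}" +
  fixes \<chi> :: "nat \<Rightarrow> 'a \<Rightarrow> complex" and x :: "nat \<Rightarrow> 'a"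
    and k :: "nat \<Rightarrow> int" and l :: nat and E :: "nat \<Rightarrow> nat \<Rightarrow> complex"
  assumes chi: "\<forall>j\<in>{1..n}. mult_character_of_order (r j) (\<chi> (r j))"
    and E_root: "\<forall>i\<in>{1..l}. \<forall>j\<in>{1..n}. E i j ^ r j = 1"
begin

definition cond :: "(nat \<Rightarrow> 'a poly) \<Rightarrow> bool" where
  "cond F \<longleftrightarrow> (\<forall>j\<in>{1..n}. [int (degree (F j)) = k j] (mod int (r j))) \<and>
     (\<forall>i\<in>{1..l}. \<forall>j\<in>{1..n}. \<chi> (r j) (poly (F j) (x i)) = E i j)"

abbreviation "curves g \<equiv> curves_GgkE n r \<zeta>0 \<chi> x k l E g"

abbreviation "genus_of F \<equiv> kummer_tuple.genus n r (r n) F"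

definition Fset :: "nat \<Rightarrow> (nat \<Rightarrow> 'a poly) set" where
  "Fset g = {F \<in> (\<Pi>\<^sub>E j\<in>{1..n}. UNIV). (\<forall>j\<in>{1..n}. power_free (r j) (F j)) \<and> nondeg F \<and> cond F \<and> genus_of F = g}"

lemma curves_iff: "C \<in> curves g \<longleftrightarrow> C \<in> curves_Gg n r g \<and> (\<exists>F y. frame C F y \<and> cond F)"
  by (auto simp: curves_GgkE_def kummer_data_iff_frame cond_def)

definition roots_of :: "(nat \<Rightarrow> 'a poly) \<Rightarrow> nat \<Rightarrow> 'a Kbar" where
  "roots_of F = (SOME y. \<forall>j\<in>{1..n}. y j ^ r j = poly_emb (F j))"

lemma roots_of: "j \<in> {1..n} \<Longrightarrow> roots_of F j ^ r j = poly_emb (F j)"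
proof -
  have "\<exists>z. z ^ r j = (poly_emb (F j) :: 'a Kbar)" if "j \<in> {1..n}" for j
    by (rule nth_root_exists) (use r_pos[OF that] in auto)
  then have "\<exists>y. \<forall>j\<in>{1..n}. y j ^ r j = (poly_emb (F j) :: 'a Kbar)" by metis
  then show "j \<in> {1..n} \<Longrightarrow> roots_of F j ^ r j = poly_emb (F j)"
    unfolding roots_of_def by (rule someI2_ex) blast
qed

definition curve_of :: "(nat \<Rightarrow> 'a poly) \<Rightarrow> 'a Gcurve" where "curve_of F = std_curve (roots_of F)"

lemma Fset_tuple: "F \<in> Fset g \<Longrightarrow> kummer_tuple n r (r n) \<zeta>0 F (roots_of F)"
  by (intro kummer_tupleI roots_of) (auto simp: Fset_def power_free_def)

lemma curve_of_frame:
  assumes "F \<in> Fset g"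
  shows "curve_of F \<in> curves_Gg n r g" "frame (curve_of F) F (roots_of F)"
  using std_curve_in_curves[OF Fset_tuple[OF assms]] std_curve_frame[OF Fset_tuple[OF assms]] assms
  by (auto simp: curve_of_def Fset_def)

lemma curve_of_in_curves: "F \<in> Fset g \<Longrightarrow> curve_of F \<in> curves g"
  unfolding curves_iff using curve_of_frame by (auto simp: Fset_def)

definition powers :: "nat \<Rightarrow> 'a set" where "powers j = (\<lambda>c. c ^ r j) ` (UNIV - {0})"

definition scale :: "(nat \<Rightarrow> 'a poly) \<Rightarrow> (nat \<Rightarrow> 'a) \<Rightarrow> nat \<Rightarrow> 'a poly" where
  "scale F e = (\<lambda>j\<in>{1..n}. smult (e j) (F j))"

text \<open>The common size of the fibres of \<open>curve_of\<close>, by \<open>card_fiber\<close>: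
  the entries of a tuple are determined by the curve up to \<open>r j\<close>-th powers of
  constants.\<close>

definition num_scalings :: nat where "num_scalings = card (\<Pi>\<^sub>E j\<in>{1..n}. powers j)"

lemma num_scalings_pos: "num_scalings > 0"
proof -
  have "powers j \<noteq> {}" for j unfolding powers_def by (metis DiffI UNIV_I empty_iff image_is_empty one_neq_zero singletonD)
  then show ?thesis unfolding num_scalings_def card_gt_0_iff by (auto simp: PiE_eq_empty_iff intro!: finite_PiE)
qed

lemma chi_powers: "j \<in> {1..n} \<Longrightarrow> e \<in> powers j \<Longrightarrow> \<chi> (r j) (e * a) = \<chi> (r j) a"
proof -
  assume j: "j \<in> {1..n}" and e: "e \<in> powers j"
  have c: "mult_character_of_order (r j) (\<chi> (r j))" using chi j by blast
  obtain d where d: "e = d ^ r j" "d \<noteq> 0" using e by (auto simp: powers_def)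
  have "\<chi> (r j) (d ^ m) = \<chi> (r j) d ^ m" for m
    by (induction m) (use c in \<open>auto simp: mult_character_of_order_def\<close>)
  then have "\<chi> (r j) e = 1" using c d by (simp add: mult_character_of_order_def)
  then show ?thesis using c by (simp add: mult_character_of_order_def)
qed

text \<open>\<open>curves_GgkE\<close> asks for some Kummer data that satisfy the conditions; by
  this lemma all data of the same curve then satisfy them.\<close>

lemma cond_scale:
  assumes "\<And>j. j \<in> {1..n} \<Longrightarrow> e j \<in> powers j \<and> F' j = smult (e j) (F j)"
  shows "cond F' \<longleftrightarrow> cond F"
proof -
  have "e j \<noteq> 0" if "j \<in> {1..n}" for j using assms[OF that] by (auto simp: powers_def)
  then have d: "degree (F' j) = degree (F j)" if "j \<in> {1..n}" for j using assms[OF that] that by simp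
  have c: "\<chi> (r j) (poly (F' j) a) = \<chi> (r j) (poly (F j) a)" if "j \<in> {1..n}" for j a
    using assms[OF that] chi_powers[OF that] by simp
  show ?thesis unfolding cond_def by (intro conj_cong ball_cong refl) (simp_all only: d c)
qed

lemma frame_in_Fset:
  assumes C: "C \<in> curves g" and fr: "frame C F y" and F: "F \<in> (\<Pi>\<^sub>E j\<in>{1..n}. UNIV)"
  shows "F \<in> Fset g" "curve_of F = C"
proof -
  have Cg: "C \<in> curves_Gg n r g" using C by (simp add: curves_iff)
  obtain F0 y0 where F0: "frame C F0 y0" "cond F0" using C by (auto simp: curves_iff)
  have "\<exists>c. c \<noteq> 0 \<and> F j = smult (c ^ r j) (F0 j)" if "j \<in> {1..n}" for j
    by (rule frame_unique_data[OF Cg F0(1) fr that])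
  then obtain c where "\<And>j. j \<in> {1..n} \<Longrightarrow> c j \<noteq> 0 \<and> F j = smult (c j ^ r j) (F0 j)" by metis
  then have "cond F \<longleftrightarrow> cond F0" by (intro cond_scale[of "\<lambda>j. c j ^ r j"]) (auto simp: powers_def)
  then show "F \<in> Fset g"
    using F0 F frame_nondeg[OF Cg fr] frame_genus[OF Cg fr] fr by (auto simp: Fset_def frame_def)
  then have "curve_of F \<in> curves_Gg n r g" "frame (curve_of F) F (roots_of F)" by (rule curve_of_frame)+
  then show "curve_of F = C" using frame_unique_curve Cg fr by blast
qed

lemma frame_restrict: "frame C F y \<Longrightarrow> frame C (restrict F {1..n}) y"
  by (auto simp: frame_def)

lemma curves_eq_image: "curves g = curve_of ` Fset g"
proof
  show "curve_of ` Fset g \<subseteq> curves g" using curve_of_in_curves by blast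
  show "curves g \<subseteq> curve_of ` Fset g"
  proof
    fix C assume C: "C \<in> curves g"
    then obtain F y where F: "frame C F y" by (auto simp: curves_iff)
    have "restrict F {1..n} \<in> Fset g" "curve_of (restrict F {1..n}) = C"
      using frame_in_Fset[OF C frame_restrict[OF F]] by auto
    then show "C \<in> curve_of ` Fset g" by blast
  qed
qed

lemma fiber_eq:
  assumes F: "F \<in> Fset g"
  shows "{F' \<in> Fset g. curve_of F' = curve_of F} = scale F ` (\<Pi>\<^sub>E j\<in>{1..n}. powers j)"
proof
  have fr: "curve_of F \<in> curves_Gg n r g" "frame (curve_of F) F (roots_of F)" using curve_of_frame[OF F] by auto
  show "{F' \<in> Fset g. curve_of F' = curve_of F} \<subseteq> scale F ` (\<Pi>\<^sub>E j\<in>{1..n}. powers j)"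
  proof
    fix F' assume "F' \<in> {F' \<in> Fset g. curve_of F' = curve_of F}"
    then have F': "F' \<in> Fset g" and fr': "frame (curve_of F) F' (roots_of F')" using curve_of_frame(2) by force+
    have "\<exists>c. c \<noteq> 0 \<and> F' j = smult (c ^ r j) (F j)" if "j \<in> {1..n}" for j
      by (rule frame_unique_data[OF fr fr' that])
    then obtain c where c: "\<And>j. j \<in> {1..n} \<Longrightarrow> c j \<noteq> 0 \<and> F' j = smult (c j ^ r j) (F j)" by metis
    have "F' = scale F (\<lambda>j\<in>{1..n}. c j ^ r j)"
      using c F' by (intro ext) (auto simp: scale_def Fset_def PiE_iff extensional_def)
    moreover have "(\<lambda>j\<in>{1..n}. c j ^ r j) \<in> (\<Pi>\<^sub>E j\<in>{1..n}. powers j)" using c by (auto simp: powers_def)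
    ultimately show "F' \<in> scale F ` (\<Pi>\<^sub>E j\<in>{1..n}. powers j)" by blast
  qed
  show "scale F ` (\<Pi>\<^sub>E j\<in>{1..n}. powers j) \<subseteq> {F' \<in> Fset g. curve_of F' = curve_of F}"
  proof clarify
    fix e assume e: "e \<in> (\<Pi>\<^sub>E j\<in>{1..n}. powers j)"
    then have "\<exists>c. c \<noteq> 0 \<and> e j = c ^ r j" if "j \<in> {1..n}" for j
      using that by (auto simp: powers_def PiE_iff)
    then obtain c where c: "\<And>j. j \<in> {1..n} \<Longrightarrow> c j \<noteq> 0 \<and> e j = c j ^ r j" by metis
    define y' where "y' = (\<lambda>j. to_ac (to_fract [:c j:]) * roots_of F j)"
    have cp: "[:a:] ^ m = [:a ^ m:]" for a :: 'a and m by (induction m) (auto simp: one_pCons)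
    have "frame (curve_of F) (scale F e) y'"
    proof (rule frame_rescale[OF fr])
      fix j assume j: "j \<in> {1..n}"
      show "to_fract [:c j:] \<noteq> 0 \<and> y' j = to_ac (to_fract [:c j:]) * roots_of F j"
        using c[OF j] by (simp add: y'_def)
      have "y' j ^ r j = to_ac (to_fract ([:c j:] ^ r j)) * poly_emb (F j)"
        by (simp add: y'_def power_mult_distrib roots_of[OF j])
      also have "\<dots> = poly_emb ([:c j ^ r j:] * F j)" by (simp only: cp poly_emb_def to_fract_mult to_ac_mult)
      finally show "y' j ^ r j = poly_emb (scale F e j)" using j c[OF j] by (simp add: scale_def)
      have pf: "power_free (r j) (F j)" using F j by (auto simp: Fset_def)
      show "power_free (r j) (scale F e j)"
        using pf j c[OF j] by (auto simp: power_free_def scale_def dvd_smult_iff)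
    qed
    moreover have "curve_of F \<in> curves g" by (rule curve_of_in_curves[OF F])
    moreover have "scale F e \<in> (\<Pi>\<^sub>E j\<in>{1..n}. UNIV)" by (auto simp: scale_def)
    ultimately show "scale F e \<in> Fset g \<and> curve_of (scale F e) = curve_of F"
      using frame_in_Fset by blast
  qed
qed

lemma card_fiber:
  assumes F: "F \<in> Fset g"
  shows "card {F' \<in> Fset g. curve_of F' = curve_of F} = num_scalings"
proof -
  have "inj_on (scale F) (\<Pi>\<^sub>E j\<in>{1..n}. powers j)"
  proof (rule inj_onI)
    fix d e assume de: "d \<in> (\<Pi>\<^sub>E j\<in>{1..n}. powers j)" "e \<in> (\<Pi>\<^sub>E j\<in>{1..n}. powers j)" "scale F d = scale F e"
    have "d j = e j" if j: "j \<in> {1..n}" for j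
    proof -
      have "smult (d j) (F j) = smult (e j) (F j)" using fun_cong[OF de(3), of j] j by (simp add: scale_def)
      then have "smult (d j - e j) (F j) = 0" by (simp add: smult_diff_left)
      moreover have "F j \<noteq> 0" using F j by (auto simp: Fset_def power_free_def)
      ultimately show ?thesis by simp
    qed
    then show "d = e" using de by (intro PiE_ext) auto
  qed
  then show ?thesis unfolding fiber_eq[OF F] num_scalings_def by (rule card_image)
qed

text \<open>
  An assignment \<open>m\<close> encodes the monic tuple in which \<open>P\<close> has multiplicity \<open>m P j\<close> in the \<open>j\<close>-th entry. Primes
  of degree greater than \<open>D\<close> cannot occur in a tuple of weight \<open>D\<close>, since \<open>ram_weight\<close> is positive off \<open>z0\<close>.
\<close>

definition assigns :: "nat \<Rightarrow> ('a poly \<Rightarrow> nat \<Rightarrow> int) set" where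
  "assigns D = (\<Pi>\<^sub>E P\<in>irred_upto D. B)"

definition weight :: "nat \<Rightarrow> ('a poly \<Rightarrow> nat \<Rightarrow> int) \<Rightarrow> nat" where
  "weight D m = (\<Sum>P\<in>irred_upto D. ram_weight (m P) * degree P)"

definition monics :: "nat \<Rightarrow> ('a poly \<Rightarrow> nat \<Rightarrow> int) \<Rightarrow> nat \<Rightarrow> 'a poly" where
  "monics D m j = (\<Prod>P\<in>irred_upto D. P ^ nat (m P j))"

definition nondeg_set :: "(nat \<Rightarrow> int) set \<Rightarrow> bool" where
  "nondeg_set S \<longleftrightarrow> (\<forall>v\<in>B. v \<noteq> z0 \<longrightarrow> (\<exists>a\<in>S. \<not> int (r n) dvd pr a v))"

text \<open>
  The finite part of the ramification; \<open>ram_weight k\<close> is the contribution of infinity. The subtraction does not truncate.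
\<close>

definition ram_degree :: "nat \<Rightarrow> nat" where "ram_degree g = 2 * g + 2 * card B - 2 - ram_weight k"

lemma card_B_ge_2: "card B \<ge> 2"
proof -
  have "r n \<le> (\<Prod>j\<in>{1..n}. r j)"
  proof -
    have "(\<Prod>j\<in>{1..n}. r j) = r n * (\<Prod>j\<in>{1..n} - {n}. r j)" using n_pos by (intro prod.remove) auto
    moreover have "(\<Prod>j\<in>{1..n} - {n}. r j) > 0" using r_pos by (intro prod_pos) auto
    moreover from this have "r n * 1 \<le> r n * (\<Prod>j\<in>{1..n} - {n}. r j)"
      by (intro mult_le_mono order_refl) (simp only: One_nat_def Suc_le_eq)
    ultimately show ?thesis by linarith
  qed
  then show ?thesis using r_last by (simp add: residue_box_def card_PiE)
qed

lemma ram_degree: "2 * g + 2 * card B = ram_degree g + ram_weight k + 2"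
proof -
  have "ram_weight k \<le> card B" unfolding ram_weight_def by (rule card_mono) auto
  then show ?thesis using card_B_ge_2 by (simp add: ram_degree_def)
qed

lemma irred_upto_irred: "P \<in> irred_upto D \<Longrightarrow> monic_irred P"
  by (simp add: irred_upto_def)

lemma monics_nz [simp]: "monics D m j \<noteq> 0"
  unfolding monics_def using irred_upto_irred monic_irred_props(1) by auto

lemma lead_coeff_monics: "lead_coeff (monics D m j) = 1"
proof -
  have "lead_coeff (monics D m j) = (\<Prod>P\<in>irred_upto D. lead_coeff (P ^ nat (m P j)))"
    unfolding monics_def by (rule Polynomial.lead_coeff_prod)
  also have "\<dots> = 1"
    by (intro prod.neutral ballI) (simp only: Polynomial.lead_coeff_power monic_irred_props(5)[OF irred_upto_irred] power_one)
  finally show ?thesis .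
qed

lemma pmult_monics:
  assumes Q: "monic_irred Q"
  shows "pmult Q (monics D m j) = (if Q \<in> irred_upto D then nat (m Q j) else 0)"
proof -
  have "pmult Q (monics D m j) = (\<Sum>P\<in>irred_upto D. nat (m P j) * pmult Q P)"
    unfolding monics_def using irred_upto_irred monic_irred_props(1) Q
    by (subst pmult_prod) (auto simp: pmult_power)
  also have "\<dots> = (\<Sum>P\<in>irred_upto D. if P = Q then nat (m Q j) else 0)"
  proof (rule sum.cong[OF refl])
    fix P :: "'a poly" assume "P \<in> irred_upto D"
    then have "monic_irred P" by (rule irred_upto_irred)
    then show "nat (m P j) * pmult Q P = (if P = Q then nat (m Q j) else 0)"
      using pmult_self[OF Q] pmult_other[OF Q, of P] by (cases "P = Q") auto
  qed
  finally show ?thesis by simp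
qed

definition units :: "(nat \<Rightarrow> 'a) set" where "units = (\<Pi>\<^sub>E j\<in>{1..n}. UNIV - {0})"

definition tuple :: "nat \<Rightarrow> (nat \<Rightarrow> 'a) \<Rightarrow> ('a poly \<Rightarrow> nat \<Rightarrow> int) \<Rightarrow> nat \<Rightarrow> 'a poly" where
  "tuple D c m = (\<lambda>j\<in>{1..n}. smult (c j) (monics D m j))"

text \<open>In the third part \<open>cond\<close> fixes the degrees modulo \<open>r j\<close>, hence
  the ramification at infinity.\<close>

lemma tuple_props:
  assumes c: "c \<in> units" and m: "m \<in> assigns D" and nd: "nondeg_set (m ` irred_upto D)"
  shows "\<And>j. j \<in> {1..n} \<Longrightarrow> power_free (r j) (tuple D c m j)" "nondeg (tuple D c m)"
    "cond (tuple D c m) \<Longrightarrow> 2 * genus_of (tuple D c m) + 2 * card B = weight D m + ram_weight k + 2"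
proof -
  have cnz: "c j \<noteq> 0" if "j \<in> {1..n}" for j using c that by (auto simp: units_def)
  have nz: "tuple D c m j \<noteq> 0" if "j \<in> {1..n}" for j using cnz[OF that] that by (simp add: tuple_def)
  have pm: "pmult P (tuple D c m j) = (if P \<in> irred_upto D then nat (m P j) else 0)"
    if "monic_irred P" "j \<in> {1..n}" for P j
    using that cnz[OF that(2)] by (simp add: tuple_def pmult_smult pmult_monics)
  have mB: "m P \<in> B" if "P \<in> irred_upto D" for P using m that by (auto simp: assigns_def)
  have mb: "0 \<le> m P j" "m P j < int (r j)" if "P \<in> irred_upto D" "j \<in> {1..n}" for P j
    using mB[OF that(1)] that(2) by (auto simp: residue_box_def PiE_iff)
  show "\<And>j. j \<in> {1..n} \<Longrightarrow> power_free (r j) (tuple D c m j)"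
    by (subst power_free_iff) (use nz r_pos pm mb in \<open>auto simp: nat_less_iff\<close>)
  have vec: "pr (\<lambda>j. int (pmult P (tuple D c m j))) v = (if P \<in> irred_upto D then pr (m P) v else 0)"
    if P: "monic_irred P" for P v
    unfolding pairing_def using pm[OF P] mb by auto
  show nd': "nondeg (tuple D c m)"
    unfolding nondeg_def
  proof (intro ballI impI)
    fix v assume "v \<in> B" "v \<noteq> z0"
    then obtain P where "P \<in> irred_upto D" "\<not> int (r n) dvd pr (m P) v"
      using nd by (auto simp: nondeg_set_def)
    then show "\<exists>P. monic_irred P \<and> \<not> int (r n) dvd pr (\<lambda>j. int (pmult P (tuple D c m j))) v"
      using vec irred_upto_irred by metis
  qed
  show "2 * genus_of (tuple D c m) + 2 * card B = weight D m + ram_weight k + 2" if cd: "cond (tuple D c m)"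
  proof -
    interpret kt: kummer_tuple n r "r n" \<zeta>0 "tuple D c m" "roots_of (tuple D c m)"
      by (intro kummer_tupleI nz roots_of nd')
    have rw: "ram_weight (kt.vF P) = (if P \<in> irred_upto D then ram_weight (m P) else 0)" if "monic_irred P" for P
      using vec[OF that] by (simp add: ram_weight_def kt.vF_def)
    have "(\<Sum>P\<in>kt.primes_of. ram_weight (kt.vF P) * degree P) = weight D m"
      unfolding weight_def
    proof (rule sum.mono_neutral_cong)
      fix P assume P: "P \<in> irred_upto D - kt.primes_of"
      then have Pi: "monic_irred P" by (simp add: irred_upto_def)
      have "pmult P (tuple D c m j) = 0" if j: "j \<in> {1..n}" for j
      proof (rule ccontr)
        assume "pmult P (tuple D c m j) \<noteq> 0"
        then have "P dvd tuple D c m j" using dvd_iff_pmult_pos[OF Pi nz[OF j]] by simp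
        then have "P dvd (\<Prod>j\<in>{1..n}. tuple D c m j)" using j by (meson dvd_prodI dvd_trans finite_atLeastAtMost)
        then show False using P Pi by (simp add: kt.primes_of_def)
      qed
      then have "ram_weight (kt.vF P) = ram_weight z0" by (intro ram_weight_cong) (simp add: kt.vF_def zero_vec_def)
      then show "ram_weight (m P) * degree P = 0" using rw[OF Pi] P by simp
    next
      fix P assume "P \<in> kt.primes_of - irred_upto D"
      then show "ram_weight (kt.vF P) * degree P = 0" using rw[of P] kt.primes_of_irred[of P] by simp
    next
      fix P assume "P \<in> kt.primes_of \<inter> irred_upto D"
      then show "ram_weight (kt.vF P) * degree P = ram_weight (m P) * degree P"
        using rw[of P] kt.primes_of_irred[of P] by simp
    next
      show "finite kt.primes_of" by (rule kt.finite_primes_of)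
    next
      show "finite (irred_upto D :: 'a poly set)" by (rule finite_irred_upto)
    qed
    moreover have "ram_weight kt.degvec = ram_weight k"
      using cd by (intro ram_weight_cong) (auto simp: kt.degvec_def cond_def)
    ultimately show ?thesis using kt.riemann_hurwitz by simp
  qed
qed

text \<open>Unique factorisation splits a tuple into leading coefficients and multiplicities; by
  Riemann-Hurwitz its genus is \<open>g\<close> exactly if its weight is
  \<open>ram_degree g\<close>.\<close>

lemma Fset_eq:
  "Fset g = (\<lambda>(c, m). tuple (ram_degree g) c m) `
     {(c, m). c \<in> units \<and> m \<in> assigns (ram_degree g) \<and> weight (ram_degree g) m = ram_degree g \<and>
        nondeg_set (m ` irred_upto (ram_degree g)) \<and> cond (tuple (ram_degree g) c m)}" (is "_ = _ ` ?S")
proof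
  let ?D = "ram_degree g"
  show "(\<lambda>(c, m). tuple ?D c m) ` ?S \<subseteq> Fset g"
  proof clarify
    fix c m assume cm: "c \<in> units" "m \<in> assigns ?D" "weight ?D m = ?D"
      "nondeg_set (m ` irred_upto ?D)" "cond (tuple ?D c m)"
    note tp = tuple_props[OF cm(1,2,4)]
    have "genus_of (tuple ?D c m) = g" using tp(3)[OF cm(5)] ram_degree[of g] cm(3) by simp
    then show "tuple ?D c m \<in> Fset g" using tp(1,2) cm(5) by (auto simp: Fset_def tuple_def)
  qed
  show "Fset g \<subseteq> (\<lambda>(c, m). tuple ?D c m) ` ?S"
  proof
    fix F assume F: "F \<in> Fset g"
    interpret kt: kummer_tuple n r "r n" \<zeta>0 F "roots_of F" by (rule Fset_tuple[OF F])
    have pf: "power_free (r j) (F j)" if "j \<in> {1..n}" for j using F that by (auto simp: Fset_def)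
    have Fnz: "F j \<noteq> 0" if "j \<in> {1..n}" for j using pf[OF that] by (simp add: power_free_def)
    have cd: "cond F" "genus_of F = g" using F by (auto simp: Fset_def)
    define c where "c = (\<lambda>j\<in>{1..n}. lead_coeff (F j))"
    define m where "m = (\<lambda>P\<in>irred_upto ?D. \<lambda>j\<in>{1..n}. int (pmult P (F j)))"
    have "ram_weight kt.degvec = ram_weight k" using cd by (intro ram_weight_cong) (auto simp: kt.degvec_def cond_def)
    then have W: "(\<Sum>P\<in>kt.primes_of. ram_weight (kt.vF P) * degree P) = ?D"
      using kt.riemann_hurwitz cd(2) ram_degree[of g] by simp
    have resB: "(\<lambda>j\<in>{1..n}. int (pmult P (F j))) \<in> B" if "monic_irred P" for P
      using pmult_less_power_free[OF pf that] by (auto simp: residue_box_def)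
    have rw: "ram_weight (kt.vF P) = ram_weight (\<lambda>j\<in>{1..n}. int (pmult P (F j)))" for P
      by (rule ram_weight_cong) (simp add: kt.vF_def)
    have pos: "ram_weight (kt.vF P) \<ge> 1" if P: "P \<in> kt.primes_of" for P
    proof -
      have Pi: "monic_irred P" using P by (rule kt.primes_of_irred)
      have "pmult P (\<Prod>j\<in>{1..n}. F j) > 0"
        using P Fnz by (subst dvd_iff_pmult_pos[OF Pi, symmetric]) (auto simp: kt.primes_of_def)
      moreover have "pmult P (\<Prod>j\<in>{1..n}. F j) = (\<Sum>j\<in>{1..n}. pmult P (F j))"
        by (rule pmult_prod[OF Pi Fnz])
      ultimately have "(\<Sum>j\<in>{1..n}. pmult P (F j)) \<noteq> 0" by linarith
      then obtain j where j: "j \<in> {1..n}" "pmult P (F j) \<noteq> 0" by (meson sum.neutral)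
      then have "(\<lambda>j\<in>{1..n}. int (pmult P (F j))) \<noteq> z0"
        by (auto simp: zero_vec_def fun_eq_iff restrict_def intro!: exI[of _ j])
      then show ?thesis using ram_weight_pos[OF resB[OF Pi]] rw[of P] by simp
    qed
    have sub: "kt.primes_of \<subseteq> irred_upto ?D"
    proof
      fix P assume P: "P \<in> kt.primes_of"
      have "1 * degree P \<le> ram_weight (kt.vF P) * degree P" using pos[OF P] by (intro mult_le_mono) auto
      also have "\<dots> \<le> ?D" unfolding W[symmetric] using P by (intro member_le_sum) auto
      finally show "P \<in> irred_upto ?D" using kt.primes_of_irred[OF P] by (simp add: irred_upto_def)
    qed
    have cu: "c \<in> units" using Fnz by (auto simp: c_def units_def)
    have ma: "m \<in> assigns ?D" using resB irred_upto_irred by (auto simp: m_def assigns_def)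
    have pm0: "pmult P (F j) = 0" if "monic_irred P" "P \<notin> kt.primes_of" "j \<in> {1..n}" for P j
    proof (rule ccontr)
      assume "pmult P (F j) \<noteq> 0"
      then have "P dvd F j" using dvd_iff_pmult_pos[OF that(1) Fnz[OF that(3)]] by simp
      then have "P dvd (\<Prod>j\<in>{1..n}. F j)" using that(3) by (meson dvd_prodI dvd_trans finite_atLeastAtMost)
      then show False using that by (simp add: kt.primes_of_def)
    qed
    have wm: "weight ?D m = ?D"
    proof -
      have "weight ?D m = (\<Sum>P\<in>irred_upto ?D. ram_weight (kt.vF P) * degree P)"
        unfolding weight_def m_def by (intro sum.cong refl) (simp add: rw)
      also have "\<dots> = (\<Sum>P\<in>kt.primes_of. ram_weight (kt.vF P) * degree P)"
      proof (rule sum.mono_neutral_right)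
        show "\<forall>P\<in>irred_upto ?D - kt.primes_of. ram_weight (kt.vF P) * degree P = 0"
        proof
          fix P assume P: "P \<in> irred_upto ?D - kt.primes_of"
          have Pi: "monic_irred P" using P irred_upto_irred by blast
          have "ram_weight (kt.vF P) = ram_weight z0"
            using pm0[OF Pi] P by (intro ram_weight_cong) (simp add: kt.vF_def zero_vec_def)
          then show "ram_weight (kt.vF P) * degree P = 0" by simp
        qed
      next
        show "finite (irred_upto ?D :: 'a poly set)" by (rule finite_irred_upto)
      next
        show "kt.primes_of \<subseteq> irred_upto ?D" by (rule sub)
      qed
      finally show ?thesis using W by simp
    qed
    have teq: "tuple ?D c m = F"
    proof (rule ext)
      fix j show "tuple ?D c m j = F j"
      proof (cases "j \<in> {1..n}")
        case True
        define G where "G = smult (inverse (lead_coeff (F j))) (F j)"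
        have lc: "inverse (lead_coeff (F j)) \<noteq> 0" using Fnz[OF True] by simp
        have "G = (\<Prod>P\<in>irred_upto ?D. P ^ pmult P G)"
        proof (rule monic_factorization)
          show "lead_coeff G = 1" using Fnz[OF True] by (simp add: G_def)
          fix P assume P: "monic_irred P" "P dvd G"
          then have "P dvd F j" using lc by (simp add: G_def dvd_smult_iff)
          then have "P dvd (\<Prod>j\<in>{1..n}. F j)" using True by (meson dvd_prodI dvd_trans finite_atLeastAtMost)
          then show "P \<in> irred_upto ?D" using P sub by (auto simp: kt.primes_of_def)
        next
          show "finite (irred_upto ?D :: 'a poly set)" by (rule finite_irred_upto)
        next
          show "\<And>P. P \<in> irred_upto ?D \<Longrightarrow> monic_irred P" by (rule irred_upto_irred)
        qed
        also have "\<dots> = monics ?D m j"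
          unfolding monics_def using True lc Fnz[OF True]
          by (intro prod.cong refl) (simp add: m_def G_def pmult_smult irred_upto_irred)
        finally have "smult (lead_coeff (F j)) G = smult (c j) (monics ?D m j)" using True by (simp add: c_def)
        then show ?thesis using True Fnz[OF True] by (simp add: tuple_def G_def)
      next
        case False then show ?thesis using F by (auto simp: tuple_def Fset_def PiE_iff extensional_def)
      qed
    qed
    have nds: "nondeg_set (m ` irred_upto ?D)"
      unfolding nondeg_set_def
    proof (intro ballI impI)
      fix v assume "v \<in> B" "v \<noteq> z0"
      then obtain P where P: "monic_irred P" "\<not> int (r n) dvd pr (\<lambda>j. int (pmult P (F j))) v"
        using F by (auto simp: Fset_def nondeg_def)
      have "P \<in> kt.primes_of"
      proof (rule ccontr)
        assume "P \<notin> kt.primes_of"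
        then have "pr (\<lambda>j. int (pmult P (F j))) v = 0" unfolding pairing_def using pm0[OF P(1)] by simp
        then show False using P by simp
      qed
      then have PD: "P \<in> irred_upto ?D" using sub by blast
      have "pr (m P) v = pr (\<lambda>j. int (pmult P (F j))) v" by (rule pairing_cong) (simp_all add: m_def PD)
      then show "\<exists>a\<in>m ` irred_upto ?D. \<not> int (r n) dvd pr a v" using P PD by (metis imageI)
    qed
    have "(c, m) \<in> ?S" using cu ma wm nds cd(1) by (simp add: teq)
    then show "F \<in> (\<lambda>(c, m). tuple ?D c m) ` ?S" using teq by (intro image_eqI[of _ _ "(c, m)"]) auto
  qed
qed

lemma tuple_inj: "inj_on (\<lambda>(c, m). tuple D c m) (units \<times> assigns D)"
proof (rule inj_onI, clarify)
  fix c m c' m' assume cm: "c \<in> units" "m \<in> assigns D" "c' \<in> units" "m' \<in> assigns D" "tuple D c m = tuple D c' m'"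
  have eq: "smult (c j) (monics D m j) = smult (c' j) (monics D m' j)" if "j \<in> {1..n}" for j
    using fun_cong[OF cm(5), of j] that by (simp add: tuple_def)
  have cc: "c j = c' j" if "j \<in> {1..n}" for j
  proof -
    have "lead_coeff (smult a (monics D m'' j)) = a" for a m''
      by (metis Polynomial.lead_coeff_smult lead_coeff_monics mult.right_neutral)
    then show ?thesis using eq[OF that] by metis
  qed
  have "c = c'" by (rule PiE_ext[OF cm(1)[unfolded units_def] cm(3)[unfolded units_def]]) (rule cc)
  moreover have "m P = m' P" if P: "P \<in> irred_upto D" for P
  proof (rule PiE_ext)
    show "m P \<in> (\<Pi>\<^sub>E j\<in>{1..n}. {0..<int (r j)})" "m' P \<in> (\<Pi>\<^sub>E j\<in>{1..n}. {0..<int (r j)})"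
      using cm P by (auto simp: assigns_def residue_box_def PiE_iff)
    fix j assume j: "j \<in> {1..n}"
    have c0: "c j \<noteq> 0" using cm(1) j by (auto simp: units_def)
    have "monics D m j = monics D m' j"
      using eq[OF j] cc[OF j] c0 by (metis smult_diff_right smult_eq_0_iff eq_iff_diff_eq_0)
    then have "nat (m P j) = nat (m' P j)"
      using pmult_monics[OF irred_upto_irred[OF P], of D m j] pmult_monics[OF irred_upto_irred[OF P], of D m' j] P by simp
    moreover have "m P j \<ge> 0" "m' P j \<ge> 0" using cm P j by (auto simp: assigns_def residue_box_def PiE_iff)
    ultimately show "m P j = m' P j" by simp
  qed
  then have "m = m'" by (intro PiE_ext[OF cm(2)[unfolded assigns_def] cm(4)[unfolded assigns_def]])
  ultimately show "c = c' \<and> m = m'" by blast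
qed

lemma finite_units [simp]: "finite units" and finite_assigns [simp]: "finite (assigns D)"
  by (auto simp: units_def assigns_def intro!: finite_PiE)

definition good_assigns :: "nat \<Rightarrow> (nat \<Rightarrow> 'a) \<Rightarrow> ('a poly \<Rightarrow> nat \<Rightarrow> int) set" where
  "good_assigns D c = {m \<in> assigns D. weight D m = D \<and> nondeg_set (m ` irred_upto D) \<and> cond (tuple D c m)}"

lemma finite_Fset: "finite (Fset g)"
proof -
  have "Fset g \<subseteq> (\<lambda>(c, m). tuple (ram_degree g) c m) ` (units \<times> assigns (ram_degree g))"
    by (rule ord_eq_le_trans[OF Fset_eq[of g]], rule image_mono) (auto)
  then show ?thesis by (rule finite_subset) (intro finite_imageI finite_cartesian_product finite_units finite_assigns)
qed

theorem finite_curves: "finite (curves g)"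
  unfolding curves_eq_image by (intro finite_imageI finite_Fset)

theorem card_curves: "card (curves g) * num_scalings = (\<Sum>c\<in>units. card (good_assigns (ram_degree g) c))"
proof -
  have "card (Fset g) = (\<Sum>C\<in>curve_of ` Fset g. card {F' \<in> Fset g. curve_of F' = C})"
    by (rule card_eq_sum_fibers[OF finite_Fset])
  also have "\<dots> = (\<Sum>C\<in>curves g. num_scalings)"
    unfolding curves_eq_image using card_fiber by (intro sum.cong refl) auto
  finally have 1: "card (Fset g) = card (curves g) * num_scalings" by simp
  have "Fset g = (\<lambda>(c, m). tuple (ram_degree g) c m) ` (SIGMA c:units. good_assigns (ram_degree g) c)"
    by (rule trans[OF Fset_eq[of g]], rule arg_cong[where f = "image _"]) (auto simp: good_assigns_def)
  then have "card (Fset g) = card (SIGMA c:units. good_assigns (ram_degree g) c)"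
  proof -
    have "inj_on (\<lambda>(c, m). tuple (ram_degree g) c m) (SIGMA c:units. good_assigns (ram_degree g) c)"
      by (rule inj_on_subset[OF tuple_inj]) (auto simp: good_assigns_def)
    from card_image[OF this] show ?thesis using \<open>Fset g = _\<close> by simp
  qed
  also have "\<dots> = (\<Sum>c\<in>units. card (good_assigns (ram_degree g) c))"
    by (rule card_SigmaI) (auto simp: good_assigns_def)
  finally show ?thesis using 1 by simp
qed

end

section \<open>Multiplicative functions of polynomials\<close>

text \<open>Essentially a Dirichlet character modulo the product of all \<open>X - a\<close>,
  twisted by a root of unity to the degree. The explicit form, instead of mere multiplicativity, is
  what \<open>sum_monic_polys\<close> exploits.\<close>

definition mult_fun :: "complex \<Rightarrow> (('a :: {field,finite}) poly \<Rightarrow> complex) \<Rightarrow> bool" where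
  "mult_fun z h \<longleftrightarrow> (\<exists>K>0. z ^ K = 1) \<and>
     (\<exists>\<eta> :: 'a \<Rightarrow> 'a \<Rightarrow> complex. (\<forall>a. \<eta> a 1 = 1 \<and> (\<forall>s t. \<eta> a (s * t) = \<eta> a s * \<eta> a t) \<and> (\<forall>s. norm (\<eta> a s) \<le> 1)) \<and>
        (\<forall>f. h f = z ^ degree f * (\<Prod>a\<in>UNIV. \<eta> a (poly f a))))"

lemma mult_fun_one: "mult_fun 1 (\<lambda>_. 1)"
  unfolding mult_fun_def by (intro conjI exI[of _ 1] exI[of _ "\<lambda>_ _. 1"]) auto

lemma mult_fun_mult:
  assumes "mult_fun z g" "mult_fun w h" shows "mult_fun (z * w) (\<lambda>f. g f * h f)"
proof -
  obtain K \<eta> where 1: "K > 0" "z ^ K = 1" "\<forall>a. \<eta> a 1 = 1 \<and> (\<forall>s t. \<eta> a (s * t) = \<eta> a s * \<eta> a t) \<and> (\<forall>s. norm (\<eta> a s) \<le> 1)"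
    "\<forall>f. g f = z ^ degree f * (\<Prod>a\<in>UNIV. \<eta> a (poly f a))" using assms(1) unfolding mult_fun_def by blast
  obtain K' \<eta>' where 2: "K' > 0" "w ^ K' = 1" "\<forall>a. \<eta>' a 1 = 1 \<and> (\<forall>s t. \<eta>' a (s * t) = \<eta>' a s * \<eta>' a t) \<and> (\<forall>s. norm (\<eta>' a s) \<le> 1)"
    "\<forall>f. h f = w ^ degree f * (\<Prod>a\<in>UNIV. \<eta>' a (poly f a))" using assms(2) unfolding mult_fun_def by blast
  have "(z * w) ^ (K * K') = (z ^ K) ^ K' * (w ^ K') ^ K" by (simp add: power_mult_distrib power_mult[symmetric] mult.commute)
  then have "(z * w) ^ (K * K') = 1" "K * K' > 0" using 1 2 by auto
  then have r: "\<exists>K>0. (z * w) ^ K = 1" by blast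
  have b: "norm (\<eta> a s * \<eta>' a s) \<le> 1" for a s
    unfolding norm_mult using 1 2 by (intro mult_le_one) auto
  show ?thesis unfolding mult_fun_def
    by (intro conjI r exI[of _ "\<lambda>a s. \<eta> a s * \<eta>' a s"])
       (use 1 2 b in \<open>auto simp: power_mult_distrib prod.distrib mult_ac\<close>)
qed

lemma mult_fun_power: "mult_fun z h \<Longrightarrow> mult_fun (z ^ m) (\<lambda>f. h f ^ m)"
  by (induction m) (auto intro: mult_fun_mult mult_fun_one)

lemma mult_fun_prod: "(\<And>i. i \<in> I \<Longrightarrow> mult_fun (z i) (h i)) \<Longrightarrow> mult_fun (\<Prod>i\<in>I. z i) (\<lambda>f. \<Prod>i\<in>I. h i f)"
  by (induction I rule: infinite_finite_induct) (auto intro: mult_fun_mult mult_fun_one)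

lemma mult_fun_multiplicative: "mult_fun z h \<Longrightarrow> f \<noteq> 0 \<Longrightarrow> g \<noteq> 0 \<Longrightarrow> h (f * g) = h f * h g"
  unfolding mult_fun_def by (auto simp: degree_mult_eq power_add prod.distrib mult_ac)

lemma mult_fun_at_1: "mult_fun z h \<Longrightarrow> h 1 = 1"
  unfolding mult_fun_def by auto

lemma mult_fun_norm: "mult_fun z h \<Longrightarrow> norm (h f) \<le> 1"
proof -
  assume m: "mult_fun z h"
  then obtain K \<eta> where 1: "K > 0" "z ^ K = 1" "\<forall>a s. norm (\<eta> a s) \<le> 1"
    "\<forall>f. h f = z ^ degree f * (\<Prod>a\<in>UNIV. \<eta> a (poly f a))" unfolding mult_fun_def by blast
  have "norm z ^ K = 1" using 1(2) by (metis norm_one norm_power)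
  then have "norm z = 1" by (rule power_eq_1_nonneg[OF _ norm_ge_zero 1(1)])
  moreover have "(\<Prod>a\<in>UNIV. norm (\<eta> a (poly f a))) \<le> 1" by (intro prod_le_1) (use 1 in auto)
  ultimately show ?thesis by (simp add: 1(4) norm_mult norm_power flip: prod_norm)
qed

text \<open>The polynomials of degree less than \<open>d\<close>, in a form that also treats the
  zero polynomial and \<open>d = 0\<close> correctly.\<close>

definition low_polys :: "nat \<Rightarrow> ('a :: {field,finite}) poly set" where
  "low_polys d = {g. \<forall>i\<ge>d. coeff g i = 0}"

definition monic_polys :: "nat \<Rightarrow> ('a :: {field,finite}) poly set" where
  "monic_polys d = {f. degree f = d \<and> lead_coeff f = 1}"

lemma finite_monic_polys [simp]: "finite (monic_polys d)"
  by (rule finite_subset[OF _ finite_polys_degree_le[of d]]) (auto simp: monic_polys_def)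

text \<open>In factored form this is \<open>X ^ (d - q) * (X ^ q - X)\<close>.\<close>

definition vanishing :: "nat \<Rightarrow> ('a :: {field,finite}) poly" where
  "vanishing d = monom 1 (d - CARD('a)) * (\<Prod>a\<in>UNIV. [:- a, 1:])"

lemma vanishing:
  assumes "CARD('a) \<le> d"
  shows "poly (vanishing d :: 'a :: {field,finite} poly) a = 0" "degree (vanishing d :: 'a poly) = d"
    "lead_coeff (vanishing d :: 'a poly) = 1"
proof -
  let ?P = "\<Prod>a\<in>(UNIV :: 'a set). [:- a, 1:]"
  have "poly ?P a = (\<Prod>b\<in>UNIV. a - b)" by (simp add: poly_prod)
  also have "\<dots> = 0" by (rule prod_zero) auto
  finally show "poly (vanishing d :: 'a poly) a = 0" by (simp add: vanishing_def)
  have dP: "degree ?P = CARD('a)" by (subst degree_prod_sum_eq) auto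
  have P0: "?P \<noteq> 0" by simp
  show "degree (vanishing d :: 'a poly) = d"
    unfolding vanishing_def using assms by (subst degree_mult_eq) (auto simp: P0 dP degree_monom_eq)
  have "lead_coeff ?P = (\<Prod>a\<in>(UNIV :: 'a set). lead_coeff [:- a, 1:])" by (rule Polynomial.lead_coeff_prod)
  then have "lead_coeff ?P = 1" by simp
  then show "lead_coeff (vanishing d :: 'a poly) = 1"
    unfolding vanishing_def Polynomial.lead_coeff_mult by (simp add: degree_monom_eq)
qed

lemma coeff_vanishing: "CARD('a) \<le> d \<Longrightarrow> coeff (vanishing d :: 'a :: {field,finite} poly) d = 1"
  by (metis vanishing(2,3))

text \<open>
  For \<open>d\<close> at least the size of the field, adding a multiple of \<open>vanishing d\<close> changes no value of a polynomial;
  so both sides are powers of \<open>z\<close> times sums over the polynomials of degree less than \<open>d\<close> resp. \<open>d + 1\<close>.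
\<close>

lemma sum_monic_polys:
  fixes h :: "('a :: {field,finite}) poly \<Rightarrow> complex"
  assumes h: "mult_fun z h" and d: "CARD('a) \<le> d"
  shows "(\<Sum>f\<in>monic_polys (Suc d). h f) = z * of_nat (CARD('a)) * (\<Sum>f\<in>monic_polys d. h f)"
proof -
  obtain \<eta> :: "'a \<Rightarrow> 'a \<Rightarrow> complex" where \<eta>: "\<forall>f. h f = z ^ degree f * (\<Prod>a\<in>UNIV. \<eta> a (poly f a))"
    using h unfolding mult_fun_def by blast
  define V where "V = (\<lambda>f :: 'a poly. \<Prod>a\<in>UNIV. \<eta> a (poly f a))"
  have V: "V (smult t (vanishing e) + g) = V g" if "CARD('a) \<le> e" for t e g
    using vanishing(1)[OF that] by (simp add: V_def)
  have S: "(\<Sum>f\<in>monic_polys e. h f) = z ^ e * (\<Sum>g\<in>low_polys e. V g)" if e: "CARD('a) \<le> e" for e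
  proof -
    have "(\<Sum>f\<in>monic_polys e. h f) = (\<Sum>f\<in>monic_polys e. z ^ e * V f)"
      by (rule sum.cong) (auto simp: \<eta> V_def monic_polys_def)
    also have "\<dots> = (\<Sum>g\<in>low_polys e. z ^ e * V g)"
    proof (rule sum.reindex_bij_witness[where i = "\<lambda>g. vanishing e + g" and j = "\<lambda>f. f - vanishing e"])
      fix f :: "'a poly" assume f: "f \<in> monic_polys e"
      show "vanishing e + (f - vanishing e) = f" by simp
      have "coeff (f - vanishing e) i = 0" if "i \<ge> e" for i
      proof (cases "i = e")
        case True
        have "degree f = e" "lead_coeff f = 1" using f unfolding monic_polys_def by blast+
          then have "coeff f e = 1" by metis
          then show ?thesis using True coeff_vanishing[OF e] by simp
      next
        case False
        then show ?thesis using f vanishing(2)[OF e] that by (simp add: monic_polys_def coeff_eq_0)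
      qed
      then show "f - vanishing e \<in> low_polys e" by (simp add: low_polys_def)
      show "z ^ e * V (f - vanishing e) = z ^ e * V f" using V[OF e, of 1 "f - vanishing e"] by simp
    next
      fix g :: "'a poly" assume g: "g \<in> low_polys e"
      show "vanishing e + g - vanishing e = g" by simp
      have 1: "coeff (vanishing e + g) e = 1" using coeff_vanishing[OF e] g by (simp add: low_polys_def)
      have "degree (vanishing e + g) \<le> e"
        using g vanishing(2)[OF e] by (intro degree_le) (auto simp: low_polys_def coeff_eq_0)
      moreover have "e \<le> degree (vanishing e + g)" using 1 by (intro le_degree) simp
      ultimately have "degree (vanishing e + g) = e" by (rule antisym)
      then show "vanishing e + g \<in> monic_polys e" unfolding monic_polys_def using 1 by simp
    qed
    finally show ?thesis by (simp add: sum_distrib_left)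
  qed
  have L: "(\<Sum>g\<in>low_polys (Suc d). V g) = of_nat (CARD('a)) * (\<Sum>g\<in>low_polys d. V g)"
  proof -
    have "(\<Sum>g\<in>low_polys (Suc d). V g) = (\<Sum>p\<in>(UNIV :: 'a set) \<times> low_polys d. V (snd p))"
    proof (rule sum.reindex_bij_witness[where i = "\<lambda>p. smult (fst p) (vanishing d) + snd p" and j = "\<lambda>f. (coeff f d, f - smult (coeff f d) (vanishing d))"])
      fix f :: "'a poly" assume f: "f \<in> low_polys (Suc d)"
      show "smult (fst (coeff f d, f - smult (coeff f d) (vanishing d))) (vanishing d) + snd (coeff f d, f - smult (coeff f d) (vanishing d)) = f" by simp
      have "coeff (f - smult (coeff f d) (vanishing d)) i = 0" if "i \<ge> d" for i
      proof (cases "i = d")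
        case True then show ?thesis using coeff_vanishing[OF d] by simp
      next
        case False
        then show ?thesis using f vanishing(2)[OF d] that by (simp add: low_polys_def coeff_eq_0)
      qed
      then show "(coeff f d, f - smult (coeff f d) (vanishing d)) \<in> UNIV \<times> low_polys d" unfolding low_polys_def by blast
      show "V (snd (coeff f d, f - smult (coeff f d) (vanishing d))) = V f"
        using V[OF d, of "coeff f d" "f - smult (coeff f d) (vanishing d)"] by simp
    next
      fix p :: "'a \<times> 'a poly" assume "p \<in> UNIV \<times> low_polys d"
      then have g: "snd p \<in> low_polys d" by auto
      have "coeff (smult (fst p) (vanishing d) + snd p) d = fst p" using g coeff_vanishing[OF d] by (simp add: low_polys_def)
      then show "(coeff (smult (fst p) (vanishing d) + snd p) d,
            smult (fst p) (vanishing d) + snd p - smult (coeff (smult (fst p) (vanishing d) + snd p) d) (vanishing d)) = p"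
        by (simp add: prod_eq_iff)
      show "smult (fst p) (vanishing d) + snd p \<in> low_polys (Suc d)"
        using g vanishing(2)[OF d] by (auto simp: low_polys_def coeff_eq_0)
    qed
    also have "\<dots> = (\<Sum>t\<in>(UNIV :: 'a set). \<Sum>g\<in>low_polys d. V g)" by (simp add: sum.cartesian_product')
    finally show ?thesis by simp
  qed
  show ?thesis using S[OF d] S[of "Suc d"] d L by (simp add: mult_ac)
qed

text \<open>
  For \<open>S = {}\<close> this is the zeta function of \<open>h\<close> in the variable \<open>X ^ s\<close>.
\<close>

definition sieved :: "('a :: {field,finite} poly \<Rightarrow> complex) \<Rightarrow> nat \<Rightarrow> 'a poly set \<Rightarrow> complex fps" where
  "sieved h s S = Abs_fps (\<lambda>m. if s dvd m then \<Sum>f\<in>{f \<in> monic_polys (m div s). \<forall>P\<in>S. \<not> P dvd f}. h f else 0)"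

text \<open>Among the polynomials not divisible by any member of \<open>S\<close>, those divisible
  by \<open>P\<close> are the \<open>P * g\<close> with \<open>g\<close> again of this kind;
  complete multiplicativity turns their removal into the factor.\<close>

lemma sieved_insert:
  fixes h :: "('a :: {field,finite}) poly \<Rightarrow> complex"
  assumes s: "s > 0" and h: "mult_fun z h" and S: "\<And>Q. Q \<in> S \<Longrightarrow> monic_irred Q" and P: "monic_irred P" "P \<notin> S"
  shows "sieved h s (insert P S) = (1 - fps_const (h P) * fps_X ^ (s * degree P)) * sieved h s S"
proof (rule fps_ext)
  fix m
  have R: "((1 - fps_const (h P) * fps_X ^ (s * degree P)) * sieved h s S) $ m =
      sieved h s S $ m - (if s * degree P \<le> m then h P * sieved h s S $ (m - s * degree P) else 0)"
  proof -
    have "(1 - fps_const (h P) * fps_X ^ (s * degree P)) * sieved h s S =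
        sieved h s S - fps_const (h P) * (fps_X ^ (s * degree P) * sieved h s S)"
      by (simp add: left_diff_distrib mult.assoc)
    then show ?thesis by (simp only: fps_sub_nth fps_mult_left_const_nth fps_X_power_mult_nth) simp
  qed
  show "sieved h s (insert P S) $ m = ((1 - fps_const (h P) * fps_X ^ (s * degree P)) * sieved h s S) $ m"
  proof (cases "s dvd m")
    case False
    have "\<not> s dvd m - s * degree P" if "s * degree P \<le> m"
      using False that by (metis dvd_diffD dvd_triv_left)
    then show ?thesis unfolding R using False by (simp add: sieved_def)
  next
    case True
    then obtain d where d: "m = s * d" by auto
    define A where "A = {f \<in> monic_polys d. \<forall>Q\<in>S. \<not> Q dvd f}"
    have fA: "finite A" by (simp add: A_def)
    have split: "(\<Sum>f\<in>A. h f) = (\<Sum>f\<in>{f \<in> A. \<not> P dvd f}. h f) + (\<Sum>f\<in>{f \<in> A. P dvd f}. h f)"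
    proof -
      have "A = {f \<in> A. \<not> P dvd f} \<union> {f \<in> A. P dvd f}" by blast
      then show ?thesis using sum.union_disjoint[of "{f \<in> A. \<not> P dvd f}" "{f \<in> A. P dvd f}" h] fA by auto
    qed
    have div: "(\<Sum>f\<in>{f \<in> A. P dvd f}. h f) = (if degree P \<le> d then h P * (\<Sum>f\<in>{f \<in> monic_polys (d - degree P). \<forall>Q\<in>S. \<not> Q dvd f}. h f) else 0)"
    proof (cases "degree P \<le> d")
      case le: True
      have "(\<Sum>f\<in>{f \<in> A. P dvd f}. h f) = (\<Sum>f\<in>{f \<in> monic_polys (d - degree P). \<forall>Q\<in>S. \<not> Q dvd f}. h P * h f)"
      proof (rule sum.reindex_bij_witness[where i = "\<lambda>g. P * g" and j = "\<lambda>f. f div P"])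
        fix f assume f: "f \<in> {f \<in> A. P dvd f}"
        then obtain g where g: "f = P * g" by auto
        have f0: "f \<noteq> 0" using f by (auto simp: A_def monic_polys_def)
        then have nz: "P \<noteq> 0" "g \<noteq> 0" using g by auto
        have fg: "f div P = g" using g nz by simp
        show "P * (f div P) = f" using fg g by simp
        have "degree g = d - degree P" using f g nz by (auto simp: A_def monic_polys_def degree_mult_eq)
        moreover have "lead_coeff g = 1"
        proof -
          have "lead_coeff f = lead_coeff P * lead_coeff g" unfolding g by (rule Polynomial.lead_coeff_mult)
          moreover have "lead_coeff f = 1" using f unfolding A_def monic_polys_def by blast
          ultimately show ?thesis using monic_irred_props(5)[OF P(1)] by simp
        qed
        ultimately show "f div P \<in> {f \<in> monic_polys (d - degree P). \<forall>Q\<in>S. \<not> Q dvd f}"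
          using f unfolding fg A_def g monic_polys_def by (auto dest: dvd_mult)
        show "h P * h (f div P) = h f" unfolding fg unfolding g by (rule mult_fun_multiplicative[OF h nz, symmetric])
      next
        fix g assume g: "g \<in> {f \<in> monic_polys (d - degree P). \<forall>Q\<in>S. \<not> Q dvd f}"
        have nz: "P \<noteq> 0" "g \<noteq> 0" using g monic_irred_props(1)[OF P(1)] by (auto simp: monic_polys_def)
        show "P * g div P = g" using nz by simp
        have "degree (P * g) = d" using g le nz by (simp add: monic_polys_def degree_mult_eq)
        moreover have "lead_coeff (P * g) = 1"
        proof -
          have "lead_coeff (P * g) = lead_coeff P * lead_coeff g" by (rule Polynomial.lead_coeff_mult)
          moreover have "lead_coeff g = 1" using g unfolding monic_polys_def by blast
          ultimately show ?thesis using monic_irred_props(5)[OF P(1)] by simp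
        qed
        moreover have "\<forall>Q\<in>S. \<not> Q dvd P * g"
        proof (intro ballI notI)
          fix Q assume Q: "Q \<in> S" and "Q dvd P * g"
          then have "Q dvd P \<or> Q dvd g" using prime_elem_dvd_mult_iff[OF monic_irred_props(3)[OF S[OF Q]]] by blast
          then show False using g Q P monic_irred_dvd_iff[OF S[OF Q] P(1)] by auto
        qed
        ultimately show "P * g \<in> {f \<in> A. P dvd f}" unfolding A_def monic_polys_def by (auto simp del: Polynomial.lead_coeff_mult)
      qed
      then show ?thesis using le by (simp add: sum_distrib_left)
    next
      case False
      have "{f \<in> A. P dvd f} = {}"
      proof -
        have "\<not> P dvd f" if "f \<in> A" for f
        proof
          assume "P dvd f"
          then have "degree P \<le> degree f" using that by (intro dvd_imp_degree_le) (auto simp: A_def monic_polys_def)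
          then show False using False that by (simp add: A_def monic_polys_def)
        qed
        then show ?thesis by blast
      qed
      then show ?thesis using False by (simp only: sum.empty if_False)
    qed
    have "sieved h s (insert P S) $ m = (\<Sum>f\<in>{f \<in> A. \<not> P dvd f}. h f)"
    proof -
      have "{f \<in> monic_polys d. \<forall>Q\<in>insert P S. \<not> Q dvd f} = {f \<in> A. \<not> P dvd f}" by (auto simp: A_def)
      then show ?thesis using s by (simp add: sieved_def d)
    qed
    moreover have "sieved h s S $ m = (\<Sum>f\<in>A. h f)" unfolding sieved_def A_def d using s by simp
    moreover have "s * degree P \<le> m \<longleftrightarrow> degree P \<le> d" using s d by simp
    moreover have "sieved h s S $ (m - s * degree P) = (\<Sum>f\<in>{f \<in> monic_polys (d - degree P). \<forall>Q\<in>S. \<not> Q dvd f}. h f)"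
    proof -
      have "m - s * degree P = s * (d - degree P)" by (simp add: d right_diff_distrib')
      then show ?thesis using s by (simp add: sieved_def)
    qed
    ultimately show ?thesis unfolding R split div by simp
  qed
qed

lemma sieved_prod:
  fixes h :: "('a :: {field,finite}) poly \<Rightarrow> complex"
  assumes "s > 0" "mult_fun z h" "finite S" "\<And>Q. Q \<in> S \<Longrightarrow> monic_irred Q"
  shows "sieved h s S = (\<Prod>P\<in>S. 1 - fps_const (h P) * fps_X ^ (s * degree P)) * sieved h s {}"
  using assms(3,4)
proof (induction S rule: finite_induct)
  case (insert P S)
  have "sieved h s (insert P S) = (1 - fps_const (h P) * fps_X ^ (s * degree P)) * sieved h s S"
    by (rule sieved_insert[OF assms(1,2)]) (use insert in auto)
  then show ?case using insert by (simp add: mult.assoc)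
qed simp

text \<open>A monic polynomial of positive degree at most \<open>N\<close> has a prime factor of
  degree at most \<open>N\<close>, so the sieve removes it. Together with \<open>sieved_prod\<close>
  this is the Euler product up to \<open>N\<close>, without infinite products.\<close>

lemma sieved_irred_upto:
  fixes h :: "('a :: {field,finite}) poly \<Rightarrow> complex"
  assumes "s > 0" "mult_fun z h" "m \<le> N"
  shows "sieved h s (irred_upto N) $ m = (if m = 0 then 1 else 0)"
proof (cases "m = 0")
  case True
  have "{f \<in> monic_polys 0. \<forall>P\<in>irred_upto N. \<not> P dvd f} = {1 :: 'a poly}"
  proof -
    have "monic_polys 0 = {1 :: 'a poly}"
      by (auto simp: monic_polys_def elim!: degree_eq_zeroE simp flip: one_pCons)
    moreover have "\<not> P dvd 1" if "P \<in> irred_upto N" for P :: "'a poly"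
      using that monic_irred_props(2) by (auto simp: irred_upto_def)
    ultimately show ?thesis by auto
  qed
  then show ?thesis using True mult_fun_at_1[OF assms(2)] by (simp add: sieved_def)
next
  case False
  have "{f \<in> monic_polys (m div s). \<forall>P\<in>irred_upto N. \<not> P dvd f} = ({} :: 'a poly set)" if sm: "s dvd m"
  proof -
    obtain e where e: "m = s * e" using sm by (rule dvdE)
    have "m div s \<le> m" by (rule div_le_dividend)
    moreover have "m div s = e" "e > 0" using e False assms(1) by auto
    ultimately have d: "m div s > 0" "m div s \<le> N" using assms(3) by linarith+
    have "\<exists>P\<in>irred_upto N. P dvd f" if f: "f \<in> monic_polys (m div s)" for f :: "'a poly"
    proof -
      have "degree f > 0" using f d by (simp add: monic_polys_def)
      then obtain P where P: "monic_irred P" "P dvd f" using irreducible_factor_exists by blast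
      have "f \<noteq> 0" using \<open>degree f > 0\<close> by auto
      then have "degree P \<le> m div s" using dvd_imp_degree_le[OF P(2)] f by (simp add: monic_polys_def)
      then show ?thesis using P d by (auto simp: irred_upto_def)
    qed
    then show ?thesis by auto
  qed
  then show ?thesis using False by (simp add: sieved_def del: Collect_empty_eq)
qed

section \<open>Euler products\<close>

text \<open>A weighted sum norm, submultiplicative and finite for every series. A bound independent
  of \<open>K\<close> means absolute convergence at radius \<open>t\<close>.\<close>

definition trunc_norm :: "nat \<Rightarrow> real \<Rightarrow> complex fps \<Rightarrow> real" where
  "trunc_norm K t f = (\<Sum>k\<le>K. norm (f $ k) * t ^ k)"

lemma trunc_norm_nonneg: "t \<ge> 0 \<Longrightarrow> trunc_norm K t f \<ge> 0"
  unfolding trunc_norm_def by (intro sum_nonneg) auto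

lemma trunc_norm_add: "t \<ge> 0 \<Longrightarrow> trunc_norm K t (f + g) \<le> trunc_norm K t f + trunc_norm K t g"
  unfolding trunc_norm_def sum.distrib[symmetric]
  by (intro sum_mono) (simp add: distrib_right[symmetric] mult_right_mono norm_triangle_ineq)

lemma trunc_norm_uminus [simp]: "trunc_norm K t (- f) = trunc_norm K t f"
  by (simp add: trunc_norm_def)

lemma trunc_norm_diff: "t \<ge> 0 \<Longrightarrow> trunc_norm K t (f - g) \<le> trunc_norm K t f + trunc_norm K t g"
  using trunc_norm_add[of t K f "- g"] by simp

lemma trunc_norm_one [simp]: "trunc_norm K t 1 = 1"
proof -
  have "trunc_norm K t 1 = (\<Sum>k\<le>K. if k = 0 then 1 else 0)" unfolding trunc_norm_def by (rule sum.cong) auto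
  then show ?thesis by simp
qed

lemma trunc_norm_mult:
  assumes t: "t \<ge> 0" shows "trunc_norm K t (f * g) \<le> trunc_norm K t f * trunc_norm K t g"
proof -
  have "trunc_norm K t (f * g) \<le> (\<Sum>k\<le>K. \<Sum>i\<le>k. (norm (f $ i) * t ^ i) * (norm (g $ (k - i)) * t ^ (k - i)))"
    unfolding trunc_norm_def
  proof (rule sum_mono)
    fix k
    have "norm ((f * g) $ k) * t ^ k \<le> (\<Sum>i\<le>k. norm (f $ i) * norm (g $ (k - i))) * t ^ k"
      unfolding fps_mult_nth atLeast0AtMost using t
      by (intro mult_right_mono sum_norm_le) (auto simp: norm_mult)
    also have "\<dots> = (\<Sum>i\<le>k. (norm (f $ i) * t ^ i) * (norm (g $ (k - i)) * t ^ (k - i)))"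
      unfolding sum_distrib_right
    proof (rule sum.cong[OF refl])
      fix i assume "i \<in> {..k}"
      then have "t ^ k = t ^ i * t ^ (k - i)" by (simp flip: power_add)
      then show "norm (f $ i) * norm (g $ (k - i)) * t ^ k = (norm (f $ i) * t ^ i) * (norm (g $ (k - i)) * t ^ (k - i))"
        by (simp add: mult_ac)
    qed
    finally show "norm ((f * g) $ k) * t ^ k \<le> (\<Sum>i\<le>k. (norm (f $ i) * t ^ i) * (norm (g $ (k - i)) * t ^ (k - i)))" .
  qed
  also have "\<dots> = (\<Sum>(i, j)\<in>{(i, j). i + j \<le> K}. (norm (f $ i) * t ^ i) * (norm (g $ j) * t ^ j))"
    by (rule sum.triangle_reindex_eq[symmetric])
  also have "\<dots> \<le> (\<Sum>(i, j)\<in>{..K} \<times> {..K}. (norm (f $ i) * t ^ i) * (norm (g $ j) * t ^ j))"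
    using t by (intro sum_mono2) auto
  also have "\<dots> = trunc_norm K t f * trunc_norm K t g"
    unfolding trunc_norm_def sum_product by (rule sum.cartesian_product[symmetric])
  finally show ?thesis .
qed

lemma trunc_norm_prod: "t \<ge> 0 \<Longrightarrow> trunc_norm K t (\<Prod>i\<in>I. f i) \<le> (\<Prod>i\<in>I. trunc_norm K t (f i))"
proof (induction I rule: infinite_finite_induct)
  case (insert i I)
  have "trunc_norm K t (\<Prod>i\<in>insert i I. f i) \<le> trunc_norm K t (f i) * trunc_norm K t (\<Prod>i\<in>I. f i)"
    using insert trunc_norm_mult by simp
  also have "\<dots> \<le> trunc_norm K t (f i) * (\<Prod>i\<in>I. trunc_norm K t (f i))"
    using insert by (intro mult_left_mono trunc_norm_nonneg) auto
  finally show ?case using insert by simp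
qed auto

lemma trunc_norm_sum: "t \<ge> 0 \<Longrightarrow> trunc_norm K t (\<Sum>i\<in>I. f i) \<le> (\<Sum>i\<in>I. trunc_norm K t (f i))"
proof (induction I rule: infinite_finite_induct)
  case (insert i I)
  then show ?case using trunc_norm_add[of t K "f i" "\<Sum>i\<in>I. f i"] by auto
qed (auto simp: trunc_norm_def)

lemma trunc_norm_monom: "t \<ge> 0 \<Longrightarrow> trunc_norm K t (fps_const c * fps_X ^ m) \<le> norm c * t ^ m"
proof -
  assume t: "t \<ge> 0"
  have "trunc_norm K t (fps_const c * fps_X ^ m) = (\<Sum>k\<le>K. if k = m then norm c * t ^ m else 0)"
    unfolding trunc_norm_def by (rule sum.cong) (auto simp: fps_X_power_nth)
  then show ?thesis using t by simp
qed

lemma trunc_norm_finite_support: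
  assumes "t \<ge> 0" "\<And>m. m > M \<Longrightarrow> f $ m = 0" shows "trunc_norm K t f \<le> trunc_norm M t f"
proof -
  have "trunc_norm K t f = (\<Sum>k\<in>{..K} \<inter> {..M}. norm (f $ k) * t ^ k)"
    unfolding trunc_norm_def using assms(2) by (intro sum.mono_neutral_right) (auto simp: not_le)
  also have "\<dots> \<le> trunc_norm M t f" unfolding trunc_norm_def using assms(1) by (intro sum_mono2) auto
  finally show ?thesis .
qed

text \<open>
  The terms of first order cancel, so a bound quadratic in \<open>y\<close> is left.
\<close>

lemma local_factor_bound:
  fixes x :: "'i \<Rightarrow> complex fps"
  assumes T: "finite T" and t: "t \<ge> 0" and y: "0 \<le> y" "y \<le> 1" "\<And>i. i \<in> T \<Longrightarrow> trunc_norm K t (x i) \<le> y"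
  shows "trunc_norm K t ((1 + (\<Sum>i\<in>T. x i)) * (\<Prod>i\<in>T. 1 - x i) - 1) \<le>
    (real (card T) ^ 2 + 4 ^ card T + real (card T) * 4 ^ card T) * y ^ 2"
proof -
  have A: "trunc_norm K t (\<Sum>i\<in>S. x i) \<le> real (card S) * y" if "S \<subseteq> T" for S
  proof -
    have "trunc_norm K t (\<Sum>i\<in>S. x i) \<le> (\<Sum>i\<in>S. trunc_norm K t (x i))" by (rule trunc_norm_sum[OF t])
    also have "\<dots> \<le> (\<Sum>i\<in>S. y)" using y that by (intro sum_mono) auto
    finally show ?thesis by simp
  qed
  \<comment> \<open>The constant 4 is crude: one more factor costs
    \<open>2 * 4 ^ s + s \<le> 4 ^ (s + 1)\<close> with \<open>s = card S\<close>.\<close>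
  have R: "trunc_norm K t ((\<Prod>i\<in>S. 1 - x i) - 1 + (\<Sum>i\<in>S. x i)) \<le> 4 ^ card S * y ^ 2"
    if "finite S" "S \<subseteq> T" for S
    using that
  proof (induction S rule: finite_induct)
    case empty then show ?case using y by (simp add: trunc_norm_def)
  next
    case (insert a S)
    define r where "r = (\<Prod>i\<in>S. 1 - x i) - 1 + (\<Sum>i\<in>S. x i)"
    define b where "b = (\<Sum>i\<in>S. x i)"
    have r: "trunc_norm K t r \<le> 4 ^ card S * y ^ 2" unfolding r_def using insert by auto
    have b: "trunc_norm K t b \<le> real (card S) * y" unfolding b_def using insert by (intro A) auto
    have "(\<Prod>i\<in>insert a S. 1 - x i) - 1 + (\<Sum>i\<in>insert a S. x i) = r - x a * (r - b)"
      using insert by (simp add: r_def b_def algebra_simps)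
    also have "trunc_norm K t \<dots> \<le> trunc_norm K t r + trunc_norm K t (x a) * (trunc_norm K t r + trunc_norm K t b)"
    proof -
      have "trunc_norm K t (x a * (r - b)) \<le> trunc_norm K t (x a) * trunc_norm K t (r - b)" by (rule trunc_norm_mult[OF t])
      also have "\<dots> \<le> trunc_norm K t (x a) * (trunc_norm K t r + trunc_norm K t b)" by (intro mult_left_mono trunc_norm_diff trunc_norm_nonneg t)
      finally show ?thesis using trunc_norm_diff[OF t, of K r "x a * (r - b)"] by linarith
    qed
    also have "\<dots> \<le> 4 ^ card S * y ^ 2 + y * (4 ^ card S * y ^ 2 + real (card S) * y)"
      using r b y insert trunc_norm_nonneg[OF t] by (intro add_mono mult_mono) auto
    also have "\<dots> \<le> 4 ^ card S * y ^ 2 + (4 ^ card S * y ^ 2 + real (card S) * y ^ 2)"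
    proof -
      have "y * (4 ^ card S * y ^ 2) \<le> 1 * (4 ^ card S * y ^ 2)" using y by (intro mult_right_mono) auto
      then show ?thesis by (simp add: algebra_simps power2_eq_square)
    qed
    also have "\<dots> = (2 * 4 ^ card S + real (card S)) * y ^ 2" by (simp add: algebra_simps)
    also have "\<dots> \<le> 4 ^ Suc (card S) * y ^ 2"
    proof (intro mult_right_mono)
      have "card S < 2 ^ card S" by (rule less_exp)
      also have "(2::nat) ^ card S \<le> 4 ^ card S" by (intro power_mono) auto
      finally have "card S \<le> 4 ^ card S" by simp
      then have "real (card S) \<le> 4 ^ card S" by (metis of_nat_le_iff of_nat_numeral of_nat_power)
      then show "2 * 4 ^ card S + real (card S) \<le> 4 ^ Suc (card S)" unfolding power_Suc by linarith
    qed auto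
    finally show ?case using insert by simp
  qed
  define b r where "b = (\<Sum>i\<in>T. x i)" and "r = (\<Prod>i\<in>T. 1 - x i) - 1 + b"
  have b: "trunc_norm K t b \<le> real (card T) * y" unfolding b_def by (rule A) simp
  have r: "trunc_norm K t r \<le> 4 ^ card T * y ^ 2" unfolding r_def b_def using R[OF T] by simp
  have e: "(\<Prod>i\<in>T. 1 - x i) = 1 - b + r" by (simp add: r_def)
  have "(1 + b) * (\<Prod>i\<in>T. 1 - x i) - 1 = r + b * r - b * b" unfolding e by (simp add: algebra_simps)
  also have "trunc_norm K t \<dots> \<le> (trunc_norm K t r + trunc_norm K t b * trunc_norm K t r) + trunc_norm K t b * trunc_norm K t b"
    using trunc_norm_diff[OF t, of K "r + b * r" "b * b"] trunc_norm_add[OF t, of K r "b * r"] trunc_norm_mult[OF t, of K b r] trunc_norm_mult[OF t, of K b b]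
    by linarith
  also have "\<dots> \<le> (4 ^ card T * y ^ 2 + real (card T) * y * (4 ^ card T * y ^ 2)) + (real (card T) * y) * (real (card T) * y)"
    using b r y trunc_norm_nonneg[OF t] by (intro add_mono mult_mono) auto
  also have "\<dots> \<le> (4 ^ card T * y ^ 2 + real (card T) * 1 * (4 ^ card T * y ^ 2)) + (real (card T) * y) * (real (card T) * y)"
    using y by (intro add_mono mult_right_mono mult_left_mono order_refl) auto
  also have "\<dots> = (real (card T) ^ 2 + 4 ^ card T + real (card T) * 4 ^ card T) * y ^ 2"
    by (simp add: power2_eq_square algebra_simps)
  finally show ?thesis by (simp add: b_def)
qed

text \<open>Congruence modulo \<open>fps_X ^ (N + 1)\<close>.\<close>

definition agree_upto :: "nat \<Rightarrow> complex fps \<Rightarrow> complex fps \<Rightarrow> bool" where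
  "agree_upto N f g \<longleftrightarrow> (\<forall>m\<le>N. f $ m = g $ m)"

lemma agree_upto_refl [simp]: "agree_upto N f f" by (simp add: agree_upto_def)

lemma agree_upto_mult: "agree_upto N f f' \<Longrightarrow> agree_upto N g g' \<Longrightarrow> agree_upto N (f * g) (f' * g')"
  unfolding agree_upto_def fps_mult_nth by (auto intro!: sum.cong)

lemma agree_upto_prod: "(\<And>i. i \<in> I \<Longrightarrow> agree_upto N (f i) (g i)) \<Longrightarrow> agree_upto N (\<Prod>i\<in>I. f i) (\<Prod>i\<in>I. g i)"
  by (induction I rule: infinite_finite_induct) (auto intro: agree_upto_mult)

lemma trunc_norm_agree_upto: "agree_upto N f g \<Longrightarrow> trunc_norm N t f = trunc_norm N t g"
  unfolding trunc_norm_def agree_upto_def by (intro sum.cong) auto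

lemma card_monic_polys_le: "card (monic_polys d :: ('a :: {field,finite}) poly set) \<le> CARD('a) ^ d"
proof -
  have "inj_on (\<lambda>f. \<lambda>i\<in>{..<d}. coeff f i) (monic_polys d :: 'a poly set)"
  proof (rule inj_onI, rule poly_eqI)
    fix f g :: "'a poly" and i
    assume fg: "f \<in> monic_polys d" "g \<in> monic_polys d" "(\<lambda>i\<in>{..<d}. coeff f i) = (\<lambda>i\<in>{..<d}. coeff g i)"
    show "coeff f i = coeff g i"
    proof (cases i d rule: linorder_cases)
      case less then show ?thesis using fun_cong[OF fg(3), of i] by simp
    next
      case equal then show ?thesis using fg by (auto simp: monic_polys_def)
    next
      case greater then show ?thesis using fg by (auto simp: monic_polys_def coeff_eq_0)
    qed
  qed
  then have "card (monic_polys d :: 'a poly set) \<le> card (\<Pi>\<^sub>E i\<in>{..<d}. (UNIV :: 'a set))"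
  proof (rule card_inj_on_le)
    show "finite (\<Pi>\<^sub>E i\<in>{..<d}. (UNIV :: 'a set))" by (rule finite_PiE) auto
    show "(\<lambda>f. \<lambda>i\<in>{..<d}. coeff f i) ` monic_polys d \<subseteq> (\<Pi>\<^sub>E i\<in>{..<d}. (UNIV :: 'a set))"
      by (intro image_subsetI restrict_PiE_iff[THEN iffD2]) simp
  qed
  then show ?thesis by (simp add: card_PiE)
qed

text \<open>The primes are bounded crudely by all monic polynomials, which give a geometric
  series.\<close>

lemma sum_irred_upto_le:
  assumes w: "w \<ge> 0" "real CARD('a :: {field,finite}) * w < 1"
  shows "(\<Sum>P\<in>(irred_upto N :: 'a poly set). w ^ degree P) \<le> 1 / (1 - real CARD('a) * w)"
proof -
  have "(\<Sum>P\<in>(irred_upto N :: 'a poly set). w ^ degree P) \<le> (\<Sum>P\<in>(\<Union>d\<le>N. monic_polys d :: 'a poly set). w ^ degree P)"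
  proof (rule sum_mono2)
    show "irred_upto N \<subseteq> (\<Union>d\<le>N. monic_polys d :: 'a poly set)"
      using monic_irred_props(5) unfolding irred_upto_def monic_polys_def by blast
  qed (use w in auto)
  also have "\<dots> = (\<Sum>d\<le>N. \<Sum>P\<in>(monic_polys d :: 'a poly set). w ^ degree P)"
  proof (rule sum.UNION_disjoint)
    show "\<forall>i\<in>{..N}. \<forall>j\<in>{..N}. i \<noteq> j \<longrightarrow> monic_polys i \<inter> monic_polys j = ({} :: 'a poly set)"
      unfolding monic_polys_def by blast
  qed auto
  also have "\<dots> = (\<Sum>d\<le>N. real (card (monic_polys d :: 'a poly set)) * w ^ d)"
    by (intro sum.cong refl) (simp add: monic_polys_def)
  also have "\<dots> \<le> (\<Sum>d\<le>N. real (CARD('a) ^ d) * w ^ d)"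
    using w card_monic_polys_le by (intro sum_mono mult_right_mono) (auto simp only: of_nat_le_iff zero_le_power)
  also have "\<dots> = (\<Sum>d\<le>N. (real CARD('a) * w) ^ d)" by (simp add: power_mult_distrib)
  also have "\<dots> \<le> suminf (\<lambda>d. (real CARD('a) * w) ^ d)"
    using w by (intro sum_le_suminf summable_geometric) auto
  also have "\<dots> = 1 / (1 - real CARD('a) * w)" using w by (intro suminf_geometric) auto
  finally show ?thesis .
qed

section \<open>An Euler product compared with its zeta functions\<close>

locale euler_data =
  fixes T :: "'i set" and \<psi> :: "'i \<Rightarrow> ('a :: {field,finite}) poly \<Rightarrow> complex" and \<theta> :: "'i \<Rightarrow> complex"
    and c :: "'i \<Rightarrow> nat" and cm :: nat
  assumes finT: "finite T" and mf: "\<And>i. i \<in> T \<Longrightarrow> mult_fun (\<theta> i) (\<psi> i)"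
    and cm: "cm > 0" "\<And>i. i \<in> T \<Longrightarrow> cm \<le> c i"
begin

text \<open>
  The Euler product \<open>SN\<close> is compared with the product of the zeta functions \<open>Zf i\<close>, whose only poles are the
  zeros of \<open>Df i\<close>; the truncated inverse of \<open>Zf i\<close> is \<open>EN N i\<close>. The coefficients of \<open>SN N\<close> up to \<open>N\<close> do not
  depend on \<open>N\<close>; the limit \<open>Sinf\<close> times the product of all \<open>Df i\<close> is \<open>Ginf\<close>, analytic in the larger disc.
\<close>

definition SN :: "nat \<Rightarrow> complex fps" where
  "SN N = (\<Prod>P\<in>irred_upto N. 1 + (\<Sum>i\<in>T. fps_const (\<psi> i P) * fps_X ^ (c i * degree P)))"

definition Zf where "Zf i = sieved (\<psi> i) (c i) {}"

definition Df where "Df i = 1 - fps_const (\<theta> i * of_nat CARD('a)) * fps_X ^ c i"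

definition EN where "EN N i = (\<Prod>P\<in>irred_upto N. 1 - fps_const (\<psi> i P) * fps_X ^ (c i * degree P))"

lemma c_pos: "i \<in> T \<Longrightarrow> c i > 0" using cm by fastforce

lemma EN_Zf: "i \<in> T \<Longrightarrow> agree_upto N (EN N i * Zf i) 1"
proof -
  assume i: "i \<in> T"
  have "sieved (\<psi> i) (c i) (irred_upto N) = EN N i * Zf i" unfolding EN_def Zf_def
    by (rule sieved_prod[OF c_pos[OF i] mf[OF i] finite_irred_upto]) (simp add: irred_upto_def)
  then show ?thesis unfolding agree_upto_def using sieved_irred_upto[OF c_pos[OF i] mf[OF i]]
    by (metis fps_one_nth)
qed

text \<open>From the degree \<open>CARD('a)\<close> on, \<open>sum_monic_polys\<close> multiplies
  the coefficients of \<open>Zf i\<close> by the constant in \<open>Df i\<close>, so they cancel in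
  the product: the zeta function is rational with denominator \<open>Df i\<close>.\<close>

lemma Wf_support:
  assumes i: "i \<in> T" and m: "m > c i * (CARD('a) + 1)" shows "(Zf i * Df i) $ m = 0"
proof -
  have e: "(Zf i * Df i) $ m = Zf i $ m - (if c i \<le> m then \<theta> i * of_nat CARD('a) * Zf i $ (m - c i) else 0)"
  proof -
    have "Zf i * Df i = Zf i - fps_const (\<theta> i * of_nat CARD('a)) * (fps_X ^ c i * Zf i)" by (simp add: Df_def algebra_simps)
    then show ?thesis by (simp add: fps_X_power_mult_nth)
  qed
  have ge: "c i \<le> m" using m by (metis add.commute le_trans less_imp_le_nat mult.commute mult_Suc plus_1_eq_Suc le_add1)
  show ?thesis
  proof (cases "c i dvd m")
    case False
    then have "\<not> c i dvd m - c i" using ge by (metis dvd_diffD dvd_refl)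
    then show ?thesis unfolding e using False by (simp add: Zf_def sieved_def)
  next
    case True
    then obtain d where d: "m = c i * d" by auto
    then have "d > CARD('a) + 1" using m c_pos[OF i] by (metis mult_less_cancel1)
    then obtain d' where d': "d = Suc d'" "CARD('a) \<le> d'" by (cases d) auto
    have "m div c i = Suc d'" "(m - c i) div c i = d'" "c i dvd m - c i"
      using d d' c_pos[OF i] by (auto simp: algebra_simps)
    then show ?thesis unfolding e using ge True sum_monic_polys[OF mf[OF i] d'(2)] by (simp add: Zf_def sieved_def)
  qed
qed

definition GN where "GN N = SN N * (\<Prod>i\<in>T. Df i)"

definition HN where "HN N = SN N * (\<Prod>i\<in>T. EN N i)"

text \<open>Separates \<open>GN\<close> into \<open>HN\<close>, whose local factors are close to 1,
  and a polynomial that does not depend on \<open>N\<close>.\<close>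

lemma HN_GN: "agree_upto N (HN N * (\<Prod>i\<in>T. Zf i * Df i)) (GN N)"
proof -
  have "HN N * (\<Prod>i\<in>T. Zf i * Df i) = SN N * ((\<Prod>i\<in>T. EN N i * Zf i) * (\<Prod>i\<in>T. Df i))"
    by (simp add: HN_def prod.distrib mult_ac)
  moreover have "agree_upto N \<dots> (SN N * ((\<Prod>i\<in>T. 1) * (\<Prod>i\<in>T. Df i)))"
    by (intro agree_upto_mult agree_upto_prod EN_Zf agree_upto_refl)
  ultimately show ?thesis by (simp add: GN_def)
qed

text \<open>The local factor of \<open>HN\<close> at \<open>P\<close> is 1 up to
  \<open>C * w ^ degree P\<close> with \<open>w = t ^ (2 * cm)\<close>, by
  \<open>local_factor_bound\<close> and since all weights are at least \<open>cm\<close>. There are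
  at most \<open>q ^ d\<close> primes of degree \<open>d\<close>, so \<open>q * w < 1\<close> bounds
  the product uniformly in \<open>N\<close>.\<close>

lemma GN_bound:
  assumes t: "0 < t" "t \<le> 1" "real CARD('a) * t ^ (2 * cm) < 1"
  shows "\<exists>M. \<forall>N. trunc_norm N t (GN N) \<le> M"
proof -
  define w where "w = t ^ (2 * cm)"
  have w: "0 \<le> w" "real CARD('a) * w < 1" using t by (auto simp: w_def)
  define C where "C = real (card T) ^ 2 + 4 ^ card T + real (card T) * 4 ^ card T"
  have C0: "C \<ge> 0" by (simp add: C_def)
  have H: "trunc_norm N t (HN N) \<le> exp (C * (1 / (1 - real CARD('a) * w)))" for N
  proof -
    define x where "x = (\<lambda>P i. fps_const (\<psi> i P) * fps_X ^ (c i * degree P) :: complex fps)"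
    have HNe: "HN N = (\<Prod>P\<in>irred_upto N. (1 + (\<Sum>i\<in>T. x P i)) * (\<Prod>i\<in>T. 1 - x P i))"
      unfolding HN_def SN_def EN_def x_def prod.distrib by (simp only: prod.swap[of _ T])
    have loc: "trunc_norm N t ((1 + (\<Sum>i\<in>T. x P i)) * (\<Prod>i\<in>T. 1 - x P i)) \<le> exp (C * w ^ degree P)" for P
    proof -
      have "trunc_norm N t ((1 + (\<Sum>i\<in>T. x P i)) * (\<Prod>i\<in>T. 1 - x P i) - 1) \<le> C * (t ^ (cm * degree P)) ^ 2"
        unfolding C_def
      proof (rule local_factor_bound[OF finT])
        fix i assume i: "i \<in> T"
        have "trunc_norm N t (x P i) \<le> norm (\<psi> i P) * t ^ (c i * degree P)" unfolding x_def using t by (intro trunc_norm_monom) auto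
        also have "\<dots> \<le> 1 * t ^ (c i * degree P)" using mult_fun_norm[OF mf[OF i]] t by (intro mult_right_mono) auto
        also have "\<dots> \<le> t ^ (cm * degree P)"
          using t cm(2)[OF i] by (simp add: power_decreasing)
        finally show "trunc_norm N t (x P i) \<le> t ^ (cm * degree P)" .
      qed (use t in \<open>auto intro: power_le_one\<close>)
      also have "(t ^ (cm * degree P)) ^ 2 = w ^ degree P" by (simp add: w_def power_mult[symmetric] mult_ac)
      finally have "trunc_norm N t ((1 + (\<Sum>i\<in>T. x P i)) * (\<Prod>i\<in>T. 1 - x P i) - 1) + trunc_norm N t 1 \<le> 1 + C * w ^ degree P" by simp
      then have "trunc_norm N t ((1 + (\<Sum>i\<in>T. x P i)) * (\<Prod>i\<in>T. 1 - x P i)) \<le> 1 + C * w ^ degree P"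
        using trunc_norm_add[of t N "(1 + (\<Sum>i\<in>T. x P i)) * (\<Prod>i\<in>T. 1 - x P i) - 1" 1] t by simp
      also have "\<dots> \<le> exp (C * w ^ degree P)" by (rule exp_ge_add_one_self)
      finally show ?thesis .
    qed
    have "trunc_norm N t (HN N) \<le> (\<Prod>P\<in>irred_upto N. trunc_norm N t ((1 + (\<Sum>i\<in>T. x P i)) * (\<Prod>i\<in>T. 1 - x P i)))"
      unfolding HNe using t by (intro trunc_norm_prod) auto
    also have "\<dots> \<le> (\<Prod>P\<in>(irred_upto N :: 'a poly set). exp (C * w ^ degree P))"
      using loc t by (intro prod_mono) (auto intro: trunc_norm_nonneg)
    also have "\<dots> = exp (C * (\<Sum>P\<in>(irred_upto N :: 'a poly set). w ^ degree P))"
      by (simp add: exp_sum sum_distrib_left)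
    also have "\<dots> \<le> exp (C * (1 / (1 - real CARD('a) * w)))"
      using sum_irred_upto_le[OF w, of N] C0 by (simp add: mult_left_mono del: times_divide_eq_right)
    finally show ?thesis .
  qed
  define M where "M = (\<Prod>i\<in>T. trunc_norm (c i * (CARD('a) + 1)) t (Zf i * Df i))"
  have "trunc_norm N t (GN N) \<le> exp (C * (1 / (1 - real CARD('a) * w))) * M" for N
  proof -
    have "trunc_norm N t (GN N) = trunc_norm N t (HN N * (\<Prod>i\<in>T. Zf i * Df i))" using trunc_norm_agree_upto[OF HN_GN] by simp
    also have "\<dots> \<le> trunc_norm N t (HN N) * trunc_norm N t (\<Prod>i\<in>T. Zf i * Df i)" using t by (intro trunc_norm_mult) auto
    also have "\<dots> \<le> trunc_norm N t (HN N) * (\<Prod>i\<in>T. trunc_norm N t (Zf i * Df i))"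
      using t by (intro mult_left_mono trunc_norm_prod trunc_norm_nonneg) auto
    also have "\<dots> \<le> trunc_norm N t (HN N) * M"
      unfolding M_def using t Wf_support by (intro mult_left_mono prod_mono conjI trunc_norm_nonneg trunc_norm_finite_support) auto
    also have "\<dots> \<le> exp (C * (1 / (1 - real CARD('a) * w))) * M"
      using H[of N] t unfolding M_def by (intro mult_right_mono prod_nonneg) (auto intro: trunc_norm_nonneg)
    finally show ?thesis .
  qed
  then show ?thesis by blast
qed

lemma SN_stable:
  assumes "k \<le> N" shows "agree_upto k (SN N) (SN k)"
proof -
  define f where "f = (\<lambda>P. 1 + (\<Sum>i\<in>T. fps_const (\<psi> i P) * fps_X ^ (c i * degree P)))"
  have sub: "irred_upto k \<subseteq> (irred_upto N :: 'a poly set)" using assms by (auto simp: irred_upto_def)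
  have "SN N = (\<Prod>P\<in>irred_upto N - irred_upto k. f P) * SN k"
    unfolding SN_def f_def[symmetric] by (rule prod.subset_diff[OF sub]) simp
  moreover have "agree_upto k (f P) 1" if P: "P \<in> irred_upto N - irred_upto k" for P
  proof -
    have d: "degree P > k" using P by (auto simp: irred_upto_def)
    have "(\<Sum>i\<in>T. fps_const (\<psi> i P) * fps_X ^ (c i * degree P)) $ m = 0" if "m \<le> k" for m
    proof -
      have "m \<noteq> c i * degree P" if i: "i \<in> T" for i
      proof -
        have "1 * degree P \<le> c i * degree P" using c_pos[OF i] by (intro mult_le_mono) auto
        then show ?thesis using d \<open>m \<le> k\<close> by linarith
      qed
      then show ?thesis by (auto simp: fps_sum_nth fps_X_power_nth intro!: sum.neutral)
    qed
    then show ?thesis by (simp add: f_def agree_upto_def)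
  qed
  then have "agree_upto k (\<Prod>P\<in>irred_upto N - irred_upto k. f P) (\<Prod>P\<in>irred_upto N - (irred_upto k :: 'a poly set). 1)"
    by (rule agree_upto_prod)
  then have "agree_upto k ((\<Prod>P\<in>irred_upto N - irred_upto k. f P) * SN k) (1 * SN k)"
    by (intro agree_upto_mult agree_upto_refl) simp
  ultimately show ?thesis by simp
qed

definition Sinf where "Sinf = Abs_fps (\<lambda>D. SN D $ D)"

lemma Sinf_SN: "agree_upto N Sinf (SN N)"
  using SN_stable unfolding agree_upto_def Sinf_def by auto

definition Ginf where "Ginf = Sinf * (\<Prod>i\<in>T. Df i)"

text \<open>The condition on \<open>u\<close> amounts to \<open>q < u ^ (2 * cm)\<close>, the
  hypothesis of \<open>GN_bound\<close> at \<open>t = 1 / u\<close>.\<close>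

lemma Ginf_summable:
  assumes u: "u > real CARD('a) powr (1 / (2 * real cm))"
  shows "summable (\<lambda>k. norm (Ginf $ k) / u ^ k)"
proof -
  have q1: "real CARD('a) \<ge> 1" by (simp add: Suc_leI)
  have u1: "u > 1"
  proof -
    have "real CARD('a) powr (1 / (2 * real cm)) \<ge> real CARD('a) powr 0" using q1 by (intro powr_mono) auto
    then show ?thesis using u q1 by simp
  qed
  have "real CARD('a) * (1 / u) ^ (2 * cm) < 1"
  proof -
    have "real CARD('a) = (real CARD('a) powr (1 / (2 * real cm))) ^ (2 * cm)"
      using q1 cm(1) by (simp add: powr_power)
    also have "\<dots> < u ^ (2 * cm)" using u cm(1) by (intro power_strict_mono) auto
    finally show ?thesis using u1 by (simp add: power_divide)
  qed
  then obtain M where M: "\<And>N. trunc_norm N (1 / u) (GN N) \<le> M" using GN_bound[of "1 / u"] u1 by auto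
  have "agree_upto N Ginf (GN N)" for N
    unfolding Ginf_def GN_def by (intro agree_upto_mult Sinf_SN agree_upto_refl)
  then have b: "trunc_norm N (1 / u) Ginf \<le> M" for N using M[of N] trunc_norm_agree_upto by metis
  show ?thesis
  proof (rule summableI_nonneg_bounded)
    show "0 \<le> norm (Ginf $ k) / u ^ k" for k using u1 by simp
    fix N
    have "(\<Sum>k<N. norm (Ginf $ k) / u ^ k) \<le> (\<Sum>k\<le>N. norm (Ginf $ k) / u ^ k)"
      using u1 by (intro sum_mono2) auto
    also have "\<dots> = trunc_norm N (1 / u) Ginf" by (simp add: trunc_norm_def power_divide)
    also have "\<dots> \<le> M" by (rule b)
    finally show "(\<Sum>k<N. norm (Ginf $ k) / u ^ k) \<le> M" .
  qed
qed

text \<open>One factor after the other through \<open>expq_step\<close>. The induction starts at a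
  single factor because the coefficients 1, 0, 0, ... of the empty product are not of the required
  form; for one factor the recurrence is homogeneous from \<open>c a\<close> on.\<close>

lemma expq_inverse_prod:
  assumes I: "finite I" "c ` T \<subseteq> I" "\<And>i. i \<in> I \<Longrightarrow> i > 0" and S: "finite S" "S \<noteq> {}" "S \<subseteq> T"
  shows "expq I (\<lambda>i. real CARD('a) powr (1 / real i)) (\<lambda>i. card {a \<in> S. c a = i}) (\<lambda>m. (\<Prod>a\<in>S. inverse (Df a)) $ m)"
proof -
  define la where "la = (\<lambda>i. real CARD('a) powr (1 / real i))"
  have q2: "real CARD('a) > 1"
  proof -
    have "card {0, 1 :: 'a} \<le> CARD('a)" by (rule card_mono) auto
    then show ?thesis by simp
  qed
  have la_pos: "la i > 0" for i using q2 by (simp add: la_def)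
  have la_inj: "inj_on la I"
    using I(3) q2 by (intro inj_onI) (simp add: la_def powr_inj)
  have la_pow: "of_real (la (c a)) ^ c a = (of_nat CARD('a) :: complex)" if "a \<in> T" for a
  proof -
    have "la (c a) ^ c a = real CARD('a)" using c_pos[OF that] q2 by (simp add: la_def powr_power)
    then show ?thesis by (metis of_real_of_nat_eq of_real_power)
  qed
  have Df0: "Df a $ 0 \<noteq> 0" if "a \<in> T" for a using c_pos[OF that] by (simp add: Df_def)
  have rec: "(inverse (Df a) * f) $ m = f $ m + (if c a \<le> m then \<theta> a * of_real (la (c a)) ^ c a * (inverse (Df a) * f) $ (m - c a) else 0)"
    if a: "a \<in> T" for a f m
  proof -
    have "inverse (Df a) * f - fps_const (\<theta> a * of_nat CARD('a)) * (fps_X ^ c a * (inverse (Df a) * f)) = (inverse (Df a) * Df a) * f"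
      by (simp add: Df_def algebra_simps)
    also have "\<dots> = f" using inverse_mult_eq_1[OF Df0[OF a]] by simp
    finally have "inverse (Df a) * f = f + fps_const (\<theta> a * of_nat CARD('a)) * (fps_X ^ c a * (inverse (Df a) * f))"
      by (simp only: diff_eq_eq)
    then have "(inverse (Df a) * f) $ m = (f + fps_const (\<theta> a * of_nat CARD('a)) * (fps_X ^ c a * (inverse (Df a) * f))) $ m" by (rule arg_cong)
    then show ?thesis unfolding la_pow[OF a] by (simp add: fps_X_power_mult_nth)
  qed
  have rt: "\<exists>K>0. \<theta> a ^ K = 1" if "a \<in> T" for a using mf[OF that] unfolding mult_fun_def by blast
  have "expq I la (\<lambda>i. card {a \<in> S. c a = i}) (\<lambda>m. (\<Prod>a\<in>S. inverse (Df a)) $ m)"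
    using S
  proof (induction S rule: finite_ne_induct)
    case (singleton a)
    then have a: "a \<in> T" by simp
    obtain K where K: "K > 0" "\<theta> a ^ K = 1" using rt[OF a] by blast
    have "(inverse (Df a) * 1) $ m = \<theta> a * of_real (la (c a)) ^ c a * (inverse (Df a) * 1) $ (m - c a)" if "c a \<le> m" for m
      using rec[OF a, of 1 m] that c_pos[OF a] by simp
    then obtain h where h: "periodic (c a * K) h" "\<And>m. (inverse (Df a) * 1) $ m = h (int m) * of_real (la (c a)) ^ m"
      using homogeneous_recurrence[OF c_pos[OF a] K la_pos[of "c a"], of "\<lambda>m. (inverse (Df a) * 1) $ m"] by auto
    have qh: "qpoly (Suc 0) h" using h(1) c_pos[OF a] K by (intro qpoly_periodic) auto
    show ?case unfolding expq_def
    proof (intro exI[of _ "\<lambda>i. if i = c a then h else (\<lambda>_. 0)"] conjI ballI allI)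
      fix i assume "i \<in> I"
      have "{a' \<in> {a}. c a' = i} = (if i = c a then {a} else {})" by auto
      then show "qpoly (card {a' \<in> {a}. c a' = i}) (if i = c a then h else (\<lambda>_. 0))" using qh by simp
    next
      fix m
      have "(\<Sum>i\<in>I. (if i = c a then h else (\<lambda>_. 0)) (int m) * of_real (la i) ^ m) = (\<Sum>i\<in>I. if i = c a then h (int m) * of_real (la (c a)) ^ m else 0)"
        by (rule sum.cong) auto
      also have "\<dots> = h (int m) * of_real (la (c a)) ^ m" using I a by (simp add: image_subset_iff)
      finally show "(\<Prod>a\<in>{a}. inverse (Df a)) $ m = (\<Sum>i\<in>I. (if i = c a then h else (\<lambda>_. 0)) (int m) * of_real (la i) ^ m)"
        using h(2)[of m] by simp
    qed
  next
    case (insert a S)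
    then have a: "a \<in> T" by simp
    obtain K where K: "K > 0" "\<theta> a ^ K = 1" using rt[OF a] by blast
    have cI: "c a \<in> I" using I a by blast
    have "expq I la ((\<lambda>i. card {a \<in> S. c a = i})(c a := Suc (card {a' \<in> S. c a' = c a}))) (\<lambda>m. (inverse (Df a) * (\<Prod>a\<in>S. inverse (Df a))) $ m)"
      by (rule expq_step[OF I(1) cI la_pos la_inj c_pos[OF a] K _ rec[OF a]]) (use insert in auto)
    moreover have "(\<lambda>i. card {a \<in> S. c a = i})(c a := Suc (card {a' \<in> S. c a' = c a})) = (\<lambda>i. card {a' \<in> insert a S. c a' = i})"
    proof
      fix i
      have "{a' \<in> insert a S. c a' = i} = (if i = c a then insert a {a' \<in> S. c a' = i} else {a' \<in> S. c a' = i})" by auto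
      then show "((\<lambda>i. card {a \<in> S. c a = i})(c a := Suc (card {a' \<in> S. c a' = c a}))) i = card {a' \<in> insert a S. c a' = i}"
        using insert by simp
    qed
    ultimately show ?case using insert by simp
  qed
  then show ?thesis by (simp only: la_def)
qed

text \<open>The coefficients are those of \<open>Ginf\<close> times the inverses of all
  \<open>Df i\<close>, a convolution. The bound \<open>i < 2 * cm\<close> makes every base
  \<open>q powr (1 / i)\<close> exceed the base \<open>q powr (1 / (2 * cm))\<close> of the
  error.\<close>

theorem SN_expq_upto:
  assumes I: "finite I" "c ` T \<subseteq> I" "\<And>i. i \<in> I \<Longrightarrow> i > 0" "\<And>i. i \<in> I \<Longrightarrow> i < 2 * cm"
  shows "expq_upto I (\<lambda>i. real CARD('a) powr (1 / real i)) (real CARD('a) powr (1 / (2 * real cm))) (\<lambda>i. card {a \<in> T. c a = i}) (\<lambda>D. SN D $ D)"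
proof (cases "T = {}")
  case True
  have q1: "real CARD('a) \<ge> 1" by (simp add: Suc_leI)
  have SN1: "SN D = 1" for D unfolding SN_def by (simp add: True)
  show ?thesis unfolding expq_upto_def
  proof (intro exI[of _ "\<lambda>_ _. 0"] conjI ballI allI impI)
    fix t assume t: "t > real CARD('a) powr (1 / (2 * real cm))"
    then have "t > 0" using powr_ge_zero[of "real CARD('a)" "1 / (2 * real cm)"] by linarith
    then show "\<exists>C. \<forall>m. norm (SN m $ m - (\<Sum>i\<in>I. 0 * of_real (real CARD('a) powr (1 / real i)) ^ m)) \<le> C * t ^ m"
      by (intro exI[of _ 1]) (auto simp: SN1)
  qed auto
next
  case False
  define Bf where "Bf = (\<Prod>a\<in>T. inverse (Df a))"
  have "(\<Prod>i\<in>T. Df i) * Bf = 1"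
  proof -
    have "Df a * inverse (Df a) = 1" if "a \<in> T" for a
    proof -
      have "Df a $ 0 \<noteq> 0" using c_pos[OF that] by (simp add: Df_def)
      then show ?thesis using inverse_mult_eq_1[of "Df a"] by (simp add: mult.commute)
    qed
    then show ?thesis unfolding Bf_def prod.distrib[symmetric] by simp
  qed
  then have S: "Sinf = Ginf * Bf" by (simp add: Ginf_def mult.assoc)
  have "SN D $ D = (\<Sum>k\<le>D. Ginf $ k * Bf $ (D - k))" for D
  proof -
    have "SN D $ D = Sinf $ D" by (simp add: Sinf_def)
    then show ?thesis unfolding S by (simp add: fps_mult_nth atLeast0AtMost)
  qed
  moreover have q2: "real CARD('a) > 1"
  proof -
    have "card {0, 1 :: 'a} \<le> CARD('a)" by (rule card_mono) auto
    then show ?thesis by simp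
  qed
  have "expq_upto I (\<lambda>i. real CARD('a) powr (1 / real i)) (real CARD('a) powr (1 / (2 * real cm))) (\<lambda>i. card {a \<in> T. c a = i}) (\<lambda>D. \<Sum>k\<le>D. Ginf $ k * Bf $ (D - k))"
  proof (rule expq_convolution[OF I(1)])
    show "0 < real CARD('a) powr (1 / (2 * real cm))" using q2 by simp
    show "real CARD('a) powr (1 / (2 * real cm)) < real CARD('a) powr (1 / real i)" if "i \<in> I" for i
      using I(3,4)[OF that] q2 cm(1) by (intro powr_less_mono divide_strict_left_mono) auto
    show "expq I (\<lambda>i. real CARD('a) powr (1 / real i)) (\<lambda>i. card {a \<in> T. c a = i}) (\<lambda>m. Bf $ m)"
      unfolding Bf_def by (rule expq_inverse_prod[OF I(1,2,3) finT False]) auto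
    show "\<And>t. real CARD('a) powr (1 / (2 * real cm)) < t \<Longrightarrow> summable (\<lambda>k. norm (Ginf $ k) / t ^ k)"
      by (rule Ginf_summable)
  qed
  ultimately show ?thesis by simp
qed

end

lemma mult_fun_apply_power: "mult_fun z h \<Longrightarrow> P \<noteq> 0 \<Longrightarrow> h (P ^ e) = h P ^ e"
  by (induction e) (simp_all add: mult_fun_at_1 mult_fun_multiplicative)

lemma mult_fun_apply_prod:
  assumes "mult_fun z h" "finite A" "\<And>P. P \<in> A \<Longrightarrow> P \<noteq> 0"
  shows "h (\<Prod>P\<in>A. P ^ e P) = (\<Prod>P\<in>A. h P ^ e P)"
  using assms(2,3)
proof (induction A rule: finite_induct)
  case empty
  then show ?case using mult_fun_at_1[OF assms(1)] by simp
next
  case (insert P A)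
  have "(\<Prod>P\<in>A. P ^ e P) \<noteq> 0" "P ^ e P \<noteq> 0" using insert by auto
  then have "h (P ^ e P * (\<Prod>P\<in>A. P ^ e P)) = h (P ^ e P) * h (\<Prod>P\<in>A. P ^ e P)"
    using mult_fun_multiplicative[OF assms(1)] by blast
  then show ?case using insert mult_fun_apply_power[OF assms(1), of P] by simp
qed

section \<open>Counting\<close>

text \<open>Linear combinations of products of multiplicative functions, one for each entry of the
  tuple. Summing such a product over tuples gives coefficients of an Euler product, see
  \<open>euler_product_coeff\<close>.\<close>

inductive_set mult_span :: "nat \<Rightarrow> ((nat \<Rightarrow> ('a :: {field,finite}) poly) \<Rightarrow> complex) set" for n where
  gen: "(\<And>j. j \<in> {1..n} \<Longrightarrow> \<exists>z. mult_fun z (h j)) \<Longrightarrow> (\<lambda>F. a * (\<Prod>j\<in>{1..n}. h j (F j))) \<in> mult_span n"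
| add: "\<phi> \<in> mult_span n \<Longrightarrow> \<psi> \<in> mult_span n \<Longrightarrow> (\<lambda>F. \<phi> F + \<psi> F) \<in> mult_span n"

lemma mult_span_gen_mult:
  assumes "\<And>j. j \<in> {1..n} \<Longrightarrow> \<exists>z. mult_fun z (h j)" "\<psi> \<in> mult_span n"
  shows "(\<lambda>F. (a * (\<Prod>j\<in>{1..n}. h j (F j))) * \<psi> F) \<in> mult_span n"
  using assms(2)
proof (induction rule: mult_span.induct)
  case (gen h' b)
  have "(\<lambda>F. (a * b) * (\<Prod>j\<in>{1..n}. h j (F j) * h' j (F j))) \<in> mult_span n"
  proof (rule mult_span.gen[of n "\<lambda>j f. h j f * h' j f"])
    fix j assume "j \<in> {1..n}"
    then obtain z w where "mult_fun z (h j)" "mult_fun w (h' j)" using assms(1) gen by blast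
    then show "\<exists>z. mult_fun z (\<lambda>f. h j f * h' j f)" using mult_fun_mult by blast
  qed
  then show ?case by (simp add: prod.distrib mult_ac)
next
  case (add \<phi> \<psi>)
  show ?case using mult_span.add[OF add.IH] by (simp only: distrib_left)
qed

lemma mult_span_mult:
  assumes "\<phi> \<in> mult_span n" "\<psi> \<in> mult_span n" shows "(\<lambda>F. \<phi> F * \<psi> F) \<in> mult_span n"
  using assms(1)
proof (induction rule: mult_span.induct)
  case (gen h a)
  show ?case by (rule mult_span_gen_mult[OF gen assms(2)])
next
  case (add \<phi> \<phi>')
  show ?case using mult_span.add[OF add.IH] by (simp only: distrib_right)
qed

lemma mult_span_const: "(\<lambda>_. a) \<in> mult_span n"
  using mult_span.gen[of n "\<lambda>_ _. 1" a] mult_fun_one by auto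

lemma mult_span_sum: "(\<And>i. i \<in> I \<Longrightarrow> \<phi> i \<in> mult_span n) \<Longrightarrow> (\<lambda>F. \<Sum>i\<in>I. \<phi> i F) \<in> mult_span n"
  by (induction I rule: infinite_finite_induct) (auto intro: mult_span_const mult_span.add)

lemma mult_span_prod: "(\<And>i. i \<in> I \<Longrightarrow> \<phi> i \<in> mult_span n) \<Longrightarrow> (\<lambda>F. \<Prod>i\<in>I. \<phi> i F) \<in> mult_span n"
  by (induction I rule: infinite_finite_induct) (auto intro: mult_span_const mult_span_mult)

lemma mult_span_single:
  assumes "j \<in> {1..n}" "mult_fun z h" shows "(\<lambda>F. h (F j)) \<in> mult_span n"
proof -
  define h' where "h' = (\<lambda>i. if i = j then h else (\<lambda>_. 1))"
  have "(\<lambda>F. 1 * (\<Prod>i\<in>{1..n}. h' i (F i))) \<in> mult_span n"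
    by (rule mult_span.gen) (use assms(2) mult_fun_one in \<open>auto simp: h'_def\<close>)
  moreover have "(\<Prod>i\<in>{1..n}. h' i (F i)) = h (F j)" for F
  proof -
    have "(\<Prod>i\<in>{1..n}. h' i (F i)) = (\<Prod>i\<in>{1..n}. if i = j then h (F j) else 1)"
      by (rule prod.cong) (auto simp: h'_def)
    then show ?thesis using assms(1) by simp
  qed
  ultimately show ?thesis by simp
qed

text \<open>
  The exponents start at \<open>1\<close>, so that the value \<open>w = 0\<close> of a character does not contribute.
\<close>

lemma root_of_unity_indicator:
  fixes w :: complex
  assumes m: "m > 0" and w: "w = 0 \<or> w ^ m = 1"
  shows "(\<Sum>b<m. w ^ Suc b) / of_nat m = (if w = 1 then 1 else 0)"
proof (cases "w = 1 \<or> w = 0")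
  case True then show ?thesis using m by auto
next
  case False
  have "(\<Sum>b<m. w ^ Suc b) = w * (\<Sum>b<m. w ^ b)" by (simp add: sum_distrib_left)
  also have "(\<Sum>b<m. w ^ b) = (w ^ m - 1) / (w - 1)" using False by (intro geometric_sum) auto
  also have "\<dots> = 0" using w False by simp
  finally show ?thesis using False by simp
qed

lemma prod_indicator:
  "finite A \<Longrightarrow> (\<Prod>a\<in>A. if P a then 1 else 0 :: complex) = (if \<forall>a\<in>A. P a then 1 else 0)"
  by (induction A rule: finite_induct) auto

text \<open>Passing from the strict bound \<open>m\<close> to \<open>m - 1\<close> is sound for
  \<open>m = 0\<close> too, as \<open>p\<close> is then 0. Real parts suffice since the counts are
  real.\<close>

lemma qpoly_imp_quasi_polynomial:
  assumes "qpoly m p" shows "quasi_polynomial_le (m - 1) (\<lambda>y. Re (p y))"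
proof -
  obtain T c where T: "T > 0" "\<forall>i. periodic T (c i)" "\<forall>y. p y = (\<Sum>i<m. c i y * of_int y ^ i)"
    using assms unfolding qpoly_def qpT_def by blast
  define c' where "c' = (\<lambda>i y. if i < m then Re (c i y) else 0)"
  have "c' i (y + int T) = c' i y" for i y using T(2) by (simp add: c'_def periodic_def)
  moreover have "Re (p y) = (\<Sum>i\<le>m - 1. c' i y * of_int y ^ i)" for y
  proof -
    have R: "Re (a * of_int y ^ i) = Re a * of_int y ^ i" for a i
    proof -
      have eq: "a * of_int y ^ i = a * of_real (of_int y ^ i)" by simp
      show ?thesis unfolding eq times_complex.sel Re_complex_of_real Im_complex_of_real by simp
    qed
    have "Re (p y) = (\<Sum>i<m. Re (c i y) * of_int y ^ i)" using T(3) by (simp add: R)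
    also have "\<dots> = (\<Sum>i<m. c' i y * of_int y ^ i)" by (rule sum.cong) (auto simp: c'_def)
    also have "\<dots> = (\<Sum>i\<le>m - 1. c' i y * of_int y ^ i)"
      by (rule sum.mono_neutral_left) (auto simp: c'_def)
    finally show ?thesis .
  qed
  ultimately show ?thesis unfolding quasi_polynomial_le_def using T(1)
    by (intro exI[of _ c'] conjI allI impI exI[of _ "int T"]) auto
qed

section \<open>The conditions on degrees and values as combinations of multiplicative
  functions\<close>

context counting_data
begin

lemma degree_indicator:
  assumes j: "j \<in> {1..n}"
  shows "(\<lambda>F :: nat \<Rightarrow> 'a poly. if [int (degree (F j)) = k j] (mod int (r j)) then 1 else 0) \<in> mult_span n"
proof -
  define w where "w = cis (2 * pi / real (r j))"
  have w: "primitive_root_of_unity (r j) w" unfolding w_def by (rule cis_primitive_root[OF r_pos[OF j]])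
  have w0: "w \<noteq> 0" by (rule prim_root_nonzero[OF w])
  have wr: "w ^ r j = 1" using w by (simp add: primitive_root_of_unity_def)
  \<comment> \<open>\<open>e d\<close> is an \<open>r j\<close>-th root of unity, equal to 1 exactly
    when \<open>d\<close> is congruent to \<open>k j\<close>; averaging its powers detects
    this.\<close>
  define e where "e = (\<lambda>d. w ^ d * w powi (- k j))"
  have e: "(if [int d = k j] (mod int (r j)) then 1 else 0) = (\<Sum>b<r j. e d ^ Suc b) / of_nat (r j)" for d
  proof -
    have e': "e d = w powi (int d - k j)" using w0 by (simp add: e_def power_int_add[symmetric] flip: power_int_of_nat)
    have "e d ^ r j = 1"
      using powi_prim_root_eq_1_iff[OF w, of "(int d - k j) * int (r j)"] by (simp add: e' power_int_mult power_int_of_nat)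
    moreover have "e d = 1 \<longleftrightarrow> [int d = k j] (mod int (r j))"
      unfolding e' powi_prim_root_eq_1_iff[OF w] by (simp add: cong_iff_dvd_diff)
    ultimately show ?thesis using root_of_unity_indicator[OF r_pos[OF j], of "e d"] by simp
  qed
  have "(\<lambda>F :: nat \<Rightarrow> 'a poly. inverse (of_nat (r j)) * (\<Sum>b<r j. (w powi (- k j)) ^ Suc b * (\<lambda>f. (w ^ Suc b) ^ degree f) (F j))) \<in> mult_span n"
  proof (intro mult_span_mult mult_span_const mult_span_sum mult_span_single[OF j])
    fix b
    have "(w ^ Suc b) ^ r j = (w ^ r j) ^ Suc b" by (simp only: power_mult[symmetric] mult.commute)
    then have "(w ^ Suc b) ^ r j = 1" using wr by simp
    then show "mult_fun (w ^ Suc b) (\<lambda>f. (w ^ Suc b) ^ degree f)"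
      unfolding mult_fun_def using r_pos[OF j] by (intro conjI exI[of _ "r j"] exI[of _ "\<lambda>_ _. 1"]) auto
  qed
  moreover have "inverse (of_nat (r j)) * (\<Sum>b<r j. (w powi (- k j)) ^ Suc b * (\<lambda>f. (w ^ Suc b) ^ degree f) (F j)) =
      (if [int (degree (F j)) = k j] (mod int (r j)) then 1 else 0)" for F :: "nat \<Rightarrow> 'a poly"
  proof -
    have p: "(w ^ d * w powi (- k j)) ^ m = (w powi (- k j)) ^ m * (w ^ m) ^ d" for d m
      by (simp add: power_mult_distrib mult.commute flip: power_mult)
    show ?thesis unfolding e e_def p by (simp only: divide_inverse mult.commute)
  qed
  ultimately show ?thesis by (simp only:)
qed

lemma character_indicator:
  assumes i: "i \<in> {1..l}" and j: "j \<in> {1..n}" and c: "c \<noteq> 0"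
  shows "(\<lambda>F. if \<chi> (r j) (poly (smult c (F j)) (x i)) = E i j then 1 else 0) \<in> mult_span n"
proof -
  define ch where "ch = \<chi> (r j)"
  have ch: "ch 0 = 0" "ch 1 = 1" "\<And>a b. ch (a * b) = ch a * ch b" "\<And>a. a \<noteq> 0 \<Longrightarrow> ch a ^ r j = 1"
    using chi j by (auto simp: ch_def mult_character_of_order_def)
  have E0: "E i j ^ r j = 1" using E_root i j by blast
  then have Enz: "E i j \<noteq> 0" using r_pos[OF j] by (auto simp: power_0_left)
  have ind: "(if ch y = E i j then 1 else 0) = (\<Sum>b<r j. (ch y / E i j) ^ Suc b) / of_nat (r j)" for y
  proof -
    have "ch y / E i j = 0 \<or> (ch y / E i j) ^ r j = 1" using ch(1,4) E0 by (cases "y = 0") (auto simp: power_divide)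
    then show ?thesis using root_of_unity_indicator[OF r_pos[OF j], of "ch y / E i j"] Enz by simp
  qed
  have "(\<lambda>F. inverse (of_nat (r j)) * (\<Sum>b<r j. (ch c / E i j) ^ Suc b * (\<lambda>f. ch (poly f (x i)) ^ Suc b) (F j))) \<in> mult_span n"
  proof (intro mult_span_mult mult_span_const mult_span_sum mult_span_single[OF j])
    fix b
    have "norm (ch a) \<le> 1" for a
    proof (cases "a = 0")
      case False
      then have "norm (ch a) ^ r j = 1" using ch(4) by (metis norm_one norm_power)
      then show ?thesis using power_eq_1_nonneg[OF _ norm_ge_zero r_pos[OF j]] by fastforce
    qed (simp add: ch)
    then have nX: "norm (ch a ^ Suc b) \<le> 1" for a unfolding norm_power by (intro power_le_one) auto
    have "mult_fun 1 (\<lambda>f. (1 :: complex) ^ degree f * (\<Prod>a\<in>UNIV. if a = x i then ch (poly f a) ^ Suc b else 1))"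
      unfolding mult_fun_def using nX ch(2,3)
      by (intro conjI exI[of _ "1 :: nat"] exI[of _ "\<lambda>a s. if a = x i then ch s ^ Suc b else 1"])
         (auto simp: power_mult_distrib simp del: power_Suc)
    then show "mult_fun 1 (\<lambda>f. ch (poly f (x i)) ^ Suc b)" by (simp del: power_Suc)
  qed
  moreover have "inverse (of_nat (r j)) * (\<Sum>b<r j. (ch c / E i j) ^ Suc b * (\<lambda>f. ch (poly f (x i)) ^ Suc b) (F j)) =
      (if ch (poly (smult c (F j)) (x i)) = E i j then 1 else 0)" for F
  proof -
    have p: "(ch (c * y) / E i j) ^ m = (ch c / E i j) ^ m * ch y ^ m" for y m
      by (simp add: ch(3) power_divide power_mult_distrib)
    show ?thesis unfolding ind poly_smult p by (simp only: divide_inverse mult.commute)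
  qed
  ultimately show ?thesis by (simp only: ch_def)
qed

lemma cond_indicator:
  assumes c: "c \<in> units"
  shows "(\<lambda>F. if cond (\<lambda>j. smult (c j) (F j)) then 1 else 0) \<in> mult_span n"
proof -
  have c0: "c j \<noteq> 0" if "j \<in> {1..n}" for j using c that by (auto simp: units_def)
  have "(\<lambda>F. (\<Prod>j\<in>{1..n}. if [int (degree (F j)) = k j] (mod int (r j)) then 1 else 0) *
      (\<Prod>i\<in>{1..l}. \<Prod>j\<in>{1..n}. if \<chi> (r j) (poly (smult (c j) (F j)) (x i)) = E i j then 1 else 0)) \<in> mult_span n"
    by (intro mult_span_mult mult_span_prod degree_indicator character_indicator c0)
  moreover have "(\<Prod>j\<in>{1..n}. if [int (degree (F j)) = k j] (mod int (r j)) then 1 else 0) *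
      (\<Prod>i\<in>{1..l}. \<Prod>j\<in>{1..n}. if \<chi> (r j) (poly (smult (c j) (F j)) (x i)) = E i j then 1 else 0) =
      (if cond (\<lambda>j. smult (c j) (F j)) then 1 else 0 :: complex)" for F
    using c0 by (auto simp: prod_indicator cond_def)
  ultimately show ?thesis by simp
qed

section \<open>Counts of assignments as coefficients of Euler products\<close>

definition supported :: "(nat \<Rightarrow> int) set \<Rightarrow> nat \<Rightarrow> ('a poly \<Rightarrow> nat \<Rightarrow> int) set" where
  "supported T D = {m \<in> (\<Pi>\<^sub>E P\<in>irred_upto D. insert z0 T). weight D m = D}"

text \<open>The set of nonzero values is prescribed exactly, because nondegeneracy of an assignment
  depends on this set alone.\<close>

definition exact :: "(nat \<Rightarrow> int) set \<Rightarrow> nat \<Rightarrow> ('a poly \<Rightarrow> nat \<Rightarrow> int) set" where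
  "exact T D = {m \<in> assigns D. weight D m = D \<and> m ` irred_upto D - {z0} = T}"

text \<open>Expanding the product chooses for each prime the term 1, that is \<open>z0\<close>, or a
  vector in \<open>T\<close>. These choices are the assignments, and the exponent of
  \<open>fps_X\<close> is the weight.\<close>

lemma euler_product_coeff:
  assumes T: "T \<subseteq> B - {z0}" and h: "\<And>j. j \<in> {1..n} \<Longrightarrow> mult_fun (z j) (h j)"
  shows "(\<Sum>m\<in>supported T D. \<Prod>j\<in>{1..n}. h j (monics D m j)) =
    (\<Prod>P\<in>irred_upto D. 1 + (\<Sum>v\<in>T. fps_const (\<Prod>j\<in>{1..n}. h j P ^ nat (v j)) * fps_X ^ (ram_weight v * degree P))) $ D"
proof -
  define \<psi> where "\<psi> = (\<lambda>v P. \<Prod>j\<in>{1..n}. h j P ^ nat (v j))"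
  define U where "U = (\<Pi>\<^sub>E P\<in>(irred_upto D :: 'a poly set). insert z0 T)"
  have fT: "finite (insert z0 T)" using T finite_subset[of T B] by auto
  have fU: "finite U" unfolding U_def by (intro finite_PiE finite_irred_upto fT)
  have eval: "(\<Prod>j\<in>{1..n}. h j (monics D m j)) = (\<Prod>P\<in>irred_upto D. \<psi> (m P) P)" for m
  proof -
    have "h j (monics D m j) = (\<Prod>P\<in>irred_upto D. h j P ^ nat (m P j))" if "j \<in> {1..n}" for j
      unfolding monics_def
      by (rule mult_fun_apply_prod[OF h[OF that]]) (auto dest: irred_upto_irred monic_irred_props(1))
    then show ?thesis unfolding \<psi>_def by (simp add: prod.swap[of _ "irred_upto D"])
  qed
  have "1 + (\<Sum>v\<in>T. fps_const (\<psi> v P) * fps_X ^ (ram_weight v * degree P)) =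
      (\<Sum>v\<in>insert z0 T. fps_const (\<psi> v P) * fps_X ^ (ram_weight v * degree P))" for P
  proof -
    have "\<psi> z0 P = 1" by (simp add: \<psi>_def zero_vec_def)
    then show ?thesis using T fT by (subst sum.insert) auto
  qed
  then have "(\<Prod>P\<in>irred_upto D. 1 + (\<Sum>v\<in>T. fps_const (\<psi> v P) * fps_X ^ (ram_weight v * degree P))) =
      (\<Prod>P\<in>irred_upto D. \<Sum>v\<in>insert z0 T. fps_const (\<psi> v P) * fps_X ^ (ram_weight v * degree P))" by simp
  also have "\<dots> = (\<Sum>m\<in>U. \<Prod>P\<in>irred_upto D. fps_const (\<psi> (m P) P) * fps_X ^ (ram_weight (m P) * degree P))"
    unfolding U_def by (rule prod_sum_PiE) (use fT in auto)
  also have "\<dots> = (\<Sum>m\<in>U. fps_const (\<Prod>P\<in>irred_upto D. \<psi> (m P) P) * fps_X ^ weight D m)"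
  proof (rule sum.cong[OF refl])
    fix m
    have "(\<Prod>P\<in>irred_upto D. fps_const (\<psi> (m P) P)) = fps_const (\<Prod>P\<in>irred_upto D. \<psi> (m P) P)"
      using finite_irred_upto by (induction rule: finite_induct) (auto simp: fps_const_mult[symmetric] simp del: fps_const_mult)
    then show "(\<Prod>P\<in>irred_upto D. fps_const (\<psi> (m P) P) * fps_X ^ (ram_weight (m P) * degree P)) =
        fps_const (\<Prod>P\<in>irred_upto D. \<psi> (m P) P) * fps_X ^ weight D m"
      by (simp add: prod.distrib weight_def power_sum)
  qed
  finally have eq: "(\<Prod>P\<in>irred_upto D. 1 + (\<Sum>v\<in>T. fps_const (\<psi> v P) * fps_X ^ (ram_weight v * degree P))) =
      (\<Sum>m\<in>U. fps_const (\<Prod>P\<in>irred_upto D. \<psi> (m P) P) * fps_X ^ weight D m)" .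
  have "(\<Prod>P\<in>irred_upto D. 1 + (\<Sum>v\<in>T. fps_const (\<psi> v P) * fps_X ^ (ram_weight v * degree P))) $ D =
      (\<Sum>m\<in>U. if weight D m = D then \<Prod>P\<in>irred_upto D. \<psi> (m P) P else 0)"
    unfolding eq fps_sum_nth fps_mult_left_const_nth fps_X_power_nth by (intro sum.cong) auto
  also have "\<dots> = (\<Sum>m\<in>supported T D. \<Prod>P\<in>irred_upto D. \<psi> (m P) P)"
    unfolding supported_def U_def[symmetric] using fU by (simp add: sum.inter_filter)
  finally show ?thesis unfolding eval by (simp only: \<psi>_def)
qed

lemma sum_supported:
  fixes f :: "('a poly \<Rightarrow> nat \<Rightarrow> int) \<Rightarrow> complex"
  assumes T: "T \<subseteq> B - {z0}"
  shows "(\<Sum>m\<in>supported T D. f m) = (\<Sum>S\<in>Pow T. \<Sum>m\<in>exact S D. f m)"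
proof -
  have fT: "finite T" by (rule finite_subset[OF T]) simp
  have fs: "finite (supported T D)"
    unfolding supported_def using fT by (intro finite_Collect_conjI disjI1) (simp add: finite_PiE)
  have "{m \<in> supported T D. m ` irred_upto D - {z0} = S} = exact S D" if S: "S \<in> Pow T" for S
  proof (intro equalityI subsetI)
    fix m assume "m \<in> {m \<in> supported T D. m ` irred_upto D - {z0} = S}"
    then show "m \<in> exact S D" using T z0_in_B by (auto simp: supported_def exact_def assigns_def PiE_iff)
  next
    fix m assume m: "m \<in> exact S D"
    then have "m P \<in> insert z0 T" if "P \<in> irred_upto D" for P using S that by (auto simp: exact_def)
    then show "m \<in> {m \<in> supported T D. m ` irred_upto D - {z0} = S}"
      using m by (auto simp: supported_def exact_def assigns_def PiE_iff)
  qed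
  then have "(\<Sum>S\<in>Pow T. \<Sum>m\<in>exact S D. f m) = (\<Sum>S\<in>Pow T. \<Sum>m\<in>{m \<in> supported T D. m ` irred_upto D - {z0} = S}. f m)"
    by (intro sum.cong) auto
  also have "\<dots> = (\<Sum>m\<in>supported T D. f m)"
    using fT by (intro sum.group[OF fs]) (auto simp: supported_def PiE_iff)
  finally show ?thesis by simp
qed

lemma nondeg_set_remove_z0: "nondeg_set (S - {z0}) \<longleftrightarrow> nondeg_set S"
proof -
  have "pr z0 v = 0" for v by (simp add: pairing_def zero_vec_def)
  then show ?thesis unfolding nondeg_set_def by (metis Diff_iff dvd_0_right empty_iff insert_iff)
qed

lemma card_good_assigns:
  "of_nat (card (good_assigns D c)) =
    (\<Sum>S\<in>{S \<in> Pow (B - {z0}). nondeg_set S}. \<Sum>m\<in>exact S D. if cond (\<lambda>j. smult (c j) (monics D m j)) then 1 else 0 :: complex)"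
proof -
  let ?A = "{m \<in> assigns D. weight D m = D \<and> nondeg_set (m ` irred_upto D)}"
  let ?Q = "{S \<in> Pow (B - {z0}). nondeg_set S}"
  let ?f = "\<lambda>m. if cond (\<lambda>j. smult (c j) (monics D m j)) then 1 else 0 :: complex"
  have ct: "cond (tuple D c m) \<longleftrightarrow> cond (\<lambda>j. smult (c j) (monics D m j))" for m
    by (auto simp: cond_def tuple_def)
  have "good_assigns D c = {m \<in> ?A. cond (\<lambda>j. smult (c j) (monics D m j))}" by (auto simp: good_assigns_def ct)
  then have "of_nat (card (good_assigns D c)) = (\<Sum>m\<in>?A. ?f m)" by (simp add: sum.If_cases Int_def conj_ac)
  also have "\<dots> = (\<Sum>S\<in>?Q. \<Sum>m\<in>{m \<in> ?A. m ` irred_upto D - {z0} = S}. ?f m)"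
  proof (rule sum.group[symmetric])
    show "finite ?A" by (rule finite_subset[OF _ finite_assigns[of D]]) blast
    show "finite ?Q" by (intro finite_Collect_conjI disjI1) simp
    show "(\<lambda>m. m ` irred_upto D - {z0}) ` ?A \<subseteq> ?Q"
    proof (rule image_subsetI)
      fix m assume "m \<in> ?A"
      then have "m ` irred_upto D \<subseteq> B" "nondeg_set (m ` irred_upto D)" by (auto simp: assigns_def)
      then show "m ` irred_upto D - {z0} \<in> ?Q" unfolding mem_Collect_eq nondeg_set_remove_z0 by blast
    qed
  qed
  also have "\<dots> = (\<Sum>S\<in>?Q. \<Sum>m\<in>exact S D. ?f m)"
  proof (rule sum.cong[OF refl])
    fix S assume "S \<in> ?Q"
    then have S: "nondeg_set S" by blast
    have "nondeg_set (m ` irred_upto D)" if "m ` irred_upto D - {z0} = S" for m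
      using S nondeg_set_remove_z0[of "m ` irred_upto D"] that by simp
    then have "{m \<in> ?A. m ` irred_upto D - {z0} = S} = exact S D" unfolding exact_def by blast
    then show "(\<Sum>m\<in>{m \<in> ?A. m ` irred_upto D - {z0} = S}. ?f m) = (\<Sum>m\<in>exact S D. ?f m)" by (simp only:)
  qed
  finally show ?thesis .
qed

text \<open>\<open>I\<close> stands for the set of weights and \<open>cm\<close> for the least of
  them; they are made concrete in \<open>card_curves_asymptotics\<close>. \<open>e\<close> counts
  the vectors of a given weight and bounds the degrees for every subset \<open>T\<close> at
  once.\<close>

context
  fixes I :: "nat set" and cm :: nat and Q :: real and e :: "nat \<Rightarrow> nat"
  assumes Q: "Q = real CARD('a)" and e: "e = (\<lambda>i. card {v \<in> B - {z0}. ram_weight v = i})"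
    and finI: "finite I" and ram_weight_I: "\<And>v. v \<in> B - {z0} \<Longrightarrow> ram_weight v \<in> I"
    and I_bounds: "\<And>i. i \<in> I \<Longrightarrow> 0 < i \<and> i < 2 * cm"
    and cm_pos: "cm > 0" and cm_le: "\<And>v. v \<in> B - {z0} \<Longrightarrow> cm \<le> ram_weight v"
begin

abbreviation "expands \<equiv> expq_upto I (\<lambda>i. Q powr (1 / real i)) (Q powr (1 / (2 * real cm))) e"

lemma expands_supported:
  assumes "\<phi> \<in> mult_span n" and T: "T \<subseteq> B - {z0}"
  shows "expands (\<lambda>D. \<Sum>m\<in>supported T D. \<phi> (monics D m))"
  using assms(1)
proof (induction rule: mult_span.induct)
  case (gen h a)
  then obtain z where z: "\<And>j. j \<in> {1..n} \<Longrightarrow> mult_fun (z j) (h j)" by metis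
  define \<psi> where "\<psi> = (\<lambda>v P. \<Prod>j\<in>{1..n}. h j P ^ nat (v j))"
  interpret ed: euler_data T \<psi> "\<lambda>v. \<Prod>j\<in>{1..n}. z j ^ nat (v j)" ram_weight cm
  proof
    show "finite T" by (rule finite_subset[OF T]) simp
    show "mult_fun (\<Prod>j\<in>{1..n}. z j ^ nat (v j)) (\<psi> v)" if "v \<in> T" for v
      unfolding \<psi>_def by (intro mult_fun_prod mult_fun_power z)
  qed (use cm_pos cm_le T in auto)
  have "expq_upto I (\<lambda>i. Q powr (1 / real i)) (Q powr (1 / (2 * real cm))) (\<lambda>i. card {v \<in> T. ram_weight v = i}) (\<lambda>D. ed.SN D $ D)"
    unfolding Q by (rule ed.SN_expq_upto[OF finI]) (use ram_weight_I T I_bounds in auto)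
  then have "expands (\<lambda>D. ed.SN D $ D)"
    by (rule expq_upto_mono) (use T in \<open>auto simp: e intro!: card_mono\<close>)
  then have "expands (\<lambda>D. a * ed.SN D $ D)" by (rule expq_upto_cmult)
  moreover have "ed.SN D $ D = (\<Sum>m\<in>supported T D. \<Prod>j\<in>{1..n}. h j (monics D m j))" for D
  proof -
    have "ed.SN D $ D = (\<Prod>P\<in>irred_upto D. 1 + (\<Sum>v\<in>T. fps_const (\<psi> v P) * fps_X ^ (ram_weight v * degree P))) $ D"
      by (simp only: ed.SN_def)
    then show ?thesis unfolding \<psi>_def using euler_product_coeff[OF T z, where D = D] by (simp only:)
  qed
  ultimately show ?case by (simp add: sum_distrib_left)
next
  case (add \<phi> \<psi>)
  then show ?case using expq_upto_add[OF add.IH] by (simp add: sum.distrib)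
qed

text \<open>\<open>supported T\<close> is the disjoint union of the sets \<open>exact S\<close> over
  the subsets \<open>S\<close> of \<open>T\<close>, so the sum for \<open>T\<close> itself is
  obtained by subtracting the smaller ones. The exponents \<open>e\<close> are common to all
  \<open>S\<close>, hence the differences keep the form.\<close>

lemma expands_exact:
  assumes \<phi>: "\<phi> \<in> mult_span n" and "finite T" "T \<subseteq> B - {z0}"
  shows "expands (\<lambda>D. \<Sum>m\<in>exact T D. \<phi> (monics D m))"
  using assms(2,3)
proof (induction T rule: finite_psubset_induct)
  case (psubset T)
  have "(\<Sum>m\<in>exact T D. \<phi> (monics D m)) =
      (\<Sum>m\<in>supported T D. \<phi> (monics D m)) - (\<Sum>S\<in>Pow T - {T}. \<Sum>m\<in>exact S D. \<phi> (monics D m))" for D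
    unfolding sum_supported[OF psubset.prems] using psubset.hyps by (subst sum.remove[of "Pow T" T]) auto
  moreover have "expands (\<lambda>D. (\<Sum>m\<in>supported T D. \<phi> (monics D m)) - (\<Sum>S\<in>Pow T - {T}. \<Sum>m\<in>exact S D. \<phi> (monics D m)))"
    by (intro expq_upto_diff expq_upto_sum expands_supported[OF \<phi> psubset.prems] psubset.IH) (use psubset.prems in auto)
  ultimately show ?case by simp
qed

lemma expands_card_curves: "expands (\<lambda>D. of_nat (\<Sum>c\<in>units. card (good_assigns D c)))"
proof -
  have "expands (\<lambda>D. \<Sum>c\<in>units. \<Sum>S\<in>{S \<in> Pow (B - {z0}). nondeg_set S}. \<Sum>m\<in>exact S D.
      if cond (\<lambda>j. smult (c j) (monics D m j)) then 1 else 0)"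
  proof (intro expq_upto_sum)
    fix c S assume "c \<in> units" "S \<in> {S \<in> Pow (B - {z0}). nondeg_set S}"
    then show "expands (\<lambda>D. \<Sum>m\<in>exact S D. if cond (\<lambda>j. smult (c j) (monics D m j)) then 1 else 0)"
      using finite_subset[of S "B - {z0}"] by (intro expands_exact[OF cond_indicator]) auto
  qed auto
  then show ?thesis by (simp only: of_nat_sum card_good_assigns)
qed

end

end

section \<open>Admissible genera, orders of elements and the asymptotics\<close>

context counting_data
begin

text \<open>Both sides are determined by the set of \<open>t\<close> for which \<open>r j\<close>
  divides \<open>t * v j\<close> for all \<open>j\<close>.\<close>

lemma ord_eq_ram_index:
  assumes v: "v \<in> B" shows "int (group.ord (abelian_grp n r) v) = ram_index n r v"
proof -
  interpret G: group "abelian_grp n r" unfolding abelian_grp_def by simp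
  have vG: "v \<in> carrier (abelian_grp n r)" using v by (simp add: carrier_abelian_grp)
  have pow: "v [^]\<^bsub>abelian_grp n r\<^esub> t = (\<lambda>j\<in>{1..n}. (int t * v j) mod int (r j))" for t :: nat
  proof (induction t)
    case 0
    then show ?case by (simp add: abelian_grp_def)
  next
    case (Suc t)
    have "v [^]\<^bsub>abelian_grp n r\<^esub> Suc t = (\<lambda>j\<in>{1..n}. (int t * v j) mod int (r j)) \<otimes>\<^bsub>abelian_grp n r\<^esub> v"
      by (simp only: G.nat_pow_Suc Suc.IH)
    also have "\<dots> = (\<lambda>j\<in>{1..n}. ((int t * v j) mod int (r j) + v j) mod int (r j))"
      unfolding abelian_grp_def mult_product_group by (rule restrict_ext) simp
    also have "\<dots> = (\<lambda>j\<in>{1..n}. (int (Suc t) * v j) mod int (r j))"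
    proof (rule restrict_ext)
      fix j
      have "int (Suc t) * v j = int t * v j + v j" by (simp add: algebra_simps)
      then show "((int t * v j) mod int (r j) + v j) mod int (r j) = (int (Suc t) * v j) mod int (r j)"
        by (simp only: mod_add_left_eq)
    qed
    finally show ?case .
  qed
  have "v [^]\<^bsub>abelian_grp n r\<^esub> t = \<one>\<^bsub>abelian_grp n r\<^esub> \<longleftrightarrow> nat (ram_index n r v) dvd t" for t :: nat
  proof -
    have "v [^]\<^bsub>abelian_grp n r\<^esub> t = \<one>\<^bsub>abelian_grp n r\<^esub> \<longleftrightarrow> (\<forall>j\<in>{1..n}. int (r j) dvd int t * v j)"
    proof -
      have "\<one>\<^bsub>abelian_grp n r\<^esub> = (\<lambda>j\<in>{1..n}. 0)" by (simp add: abelian_grp_def)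
      then show ?thesis unfolding pow dvd_eq_mod_eq_0 by (metis (mono_tags, lifting) restrict_apply' restrict_ext)
    qed
    also have "\<dots> \<longleftrightarrow> ram_index n r v dvd int t" by (rule ram_index_dvd_iff[symmetric])
    also have "\<dots> \<longleftrightarrow> nat (ram_index n r v) dvd t"
      using ram_index_pos[of v] by (metis int_dvd_int_iff nat_0_le less_imp_le)
    finally show ?thesis .
  qed
  then have "G.ord v = nat (ram_index n r v)" using G.ord_unique[OF vG] by blast
  then show ?thesis using ram_index_pos[of v] by simp
qed

lemma order_grp: "Coset.order (abelian_grp n r) = card B"
  by (simp add: Coset.order_def carrier_abelian_grp)

lemma nonzero_residues_eq: "nonzero_residues n r = B - {z0}"
  by (simp add: nonzero_residues_def residue_box_def zero_vec_def)

lemma sum_assign_fibers: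
  fixes f :: "(nat \<Rightarrow> int) \<Rightarrow> int"
  assumes m: "m \<in> assigns D" and f: "f z0 = 0"
  shows "(\<Sum>v\<in>B - {z0}. f v * int (\<Sum>P\<in>{P \<in> irred_upto D. m P = v}. degree P)) = (\<Sum>P\<in>irred_upto D. f (m P) * int (degree P))"
proof -
  have "(\<Sum>v\<in>B - {z0}. f v * int (\<Sum>P\<in>{P \<in> irred_upto D. m P = v}. degree P)) =
      (\<Sum>v\<in>B. f v * int (\<Sum>P\<in>{P \<in> irred_upto D. m P = v}. degree P))"
    by (rule sum.mono_neutral_left) (auto simp: f)
  also have "\<dots> = (\<Sum>v\<in>B. \<Sum>P\<in>{P \<in> irred_upto D. m P = v}. f (m P) * int (degree P))"
    by (rule sum.cong[OF refl]) (simp add: sum_distrib_left)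
  also have "\<dots> = (\<Sum>P\<in>irred_upto D. f (m P) * int (degree P))"
    by (rule sum.group) (use m in \<open>auto simp: assigns_def\<close>)
  finally show ?thesis .
qed

theorem curves_imp_admissible:
  assumes "curves g \<noteq> {}" shows "admissible_genus n r k g"
proof -
  let ?D = "ram_degree g"
  obtain F where "F \<in> Fset g" using assms curves_eq_image by blast
  then obtain c m where cm: "c \<in> units" "m \<in> assigns ?D" "weight ?D m = ?D" "cond (tuple ?D c m)"
    unfolding Fset_eq[of g] by auto
  \<comment> \<open>The total degree of the primes with multiplicity vector \<open>v\<close>.
    Summing over fibres turns the weight into the genus equation and the degrees of the entries into
    the congruences.\<close>
  define d where "d = (\<lambda>v. \<Sum>P\<in>{P \<in> irred_upto ?D. m P = v}. degree P)"
  have W: "(\<Sum>v\<in>B - {z0}. ram_weight v * d v) = ?D"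
  proof -
    have "int (\<Sum>v\<in>B - {z0}. ram_weight v * d v) = int (weight ?D m)"
      using sum_assign_fibers[OF cm(2), of "\<lambda>v. int (ram_weight v)"] by (simp add: d_def weight_def)
    then show ?thesis using cm(3) by (metis of_nat_eq_iff)
  qed
  have "2 * real g + 2 * real (card B) - 2 =
      (\<Sum>v\<in>B - {z0}. (real (card B) - real (card B) / of_int (ram_index n r v)) * real (d v)) +
      real (card B) - real (card B) / of_int (ram_index n r k)"
  proof -
    have "real (2 * g + 2 * card B) = real ((\<Sum>v\<in>B - {z0}. ram_weight v * d v) + ram_weight k + 2)" unfolding W by (simp only: ram_degree)
    then show ?thesis by (simp add: ram_weight_real)
  qed
  moreover have "[(\<Sum>v\<in>B - {z0}. v j * int (d v)) = k j] (mod int (r j))" if j: "j \<in> {1..n}" for j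
  proof -
    have "(\<Sum>v\<in>B - {z0}. v j * int (d v)) = (\<Sum>P\<in>irred_upto ?D. m P j * int (degree P))"
      unfolding d_def by (rule sum_assign_fibers[OF cm(2)]) (use j in \<open>simp add: zero_vec_def\<close>)
    also have "\<dots> = int (\<Sum>P\<in>irred_upto ?D. degree (P ^ nat (m P j)))"
    proof -
      have "m P j * int (degree P) = int (degree (P ^ nat (m P j)))" if P: "P \<in> irred_upto ?D" for P
      proof -
        have "m P \<in> B" using cm(2) P by (auto simp: assigns_def)
        then have "m P j \<ge> 0" using j by (auto simp: residue_box_def)
        then show ?thesis by (simp add: Polynomial.degree_power_eq monic_irred_props(1)[OF irred_upto_irred[OF P]])
      qed
      then show ?thesis by simp
    qed
    also have "(\<Sum>P\<in>irred_upto ?D. degree (P ^ nat (m P j))) = degree (monics ?D m j)"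
      unfolding monics_def by (rule degree_prod_sum_eq[symmetric]) (use monic_irred_props(1)[OF irred_upto_irred] in auto)
    also have "\<dots> = degree (tuple ?D c m j)" using cm(1) j by (auto simp: tuple_def units_def)
    finally show ?thesis using cm(4) j by (simp add: cond_def)
  qed
  ultimately show ?thesis unfolding admissible_genus_def Let_def order_grp nonzero_residues_eq by blast
qed

context
  fixes \<eta> :: nat and s :: "nat \<Rightarrow> nat"
  assumes s_mono: "strict_mono_on {0..\<eta>} s" and s_image: "s ` {0..\<eta>} = {d. d dvd r n}"
begin

definition order_weight :: "nat \<Rightarrow> nat" where "order_weight d = card B - card B div d"

lemma s_facts:
  assumes j: "j \<in> {1..\<eta>}"
  shows "s j dvd r n" "s j \<ge> 2" "s 1 \<ge> 2" "s 1 \<le> s j"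
proof -
  show "s j dvd r n" using j s_image by auto
  have "s 0 dvd r n" using s_image by auto
  then have "s 0 > 0" using r_last by (auto intro: Nat.gr0I)
  moreover have "s 0 < s 1" using j by (intro strict_mono_onD[OF s_mono]) auto
  ultimately show 1: "s 1 \<ge> 2" by linarith
  show "s 1 \<le> s j"
  proof (cases "j = 1")
    case False
    then have "s 1 < s j" using j by (intro strict_mono_onD[OF s_mono]) auto
    then show ?thesis by simp
  qed simp
  then show "s j \<ge> 2" using 1 by linarith
qed

lemma s_1: "1 \<le> \<eta>" "s 1 \<ge> 2"
proof -
  have "1 \<in> s ` {0..\<eta>}" "r n \<in> s ` {0..\<eta>}" using s_image by auto
  then have "\<eta> \<noteq> 0" using r_last by (auto intro!: Nat.gr0I)
  then show "1 \<le> \<eta>" by simp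
  then show "s 1 \<ge> 2" using s_facts(2)[of 1] by simp
qed

lemma s_index:
  assumes "d dvd r n" "d > 1" obtains j where "j \<in> {1..\<eta>}" "d = s j"
proof -
  obtain j where j: "j \<in> {0..\<eta>}" "d = s j" using assms(1) s_image by (metis imageE mem_Collect_eq)
  have "j \<noteq> 0"
  proof
    assume j0: "j = 0"
    have "1 \<in> s ` {0..\<eta>}" using s_image by simp
    then obtain i where i: "i \<in> {0..\<eta>}" "s i = 1" by force
    have "s 0 \<le> s i"
    proof (cases "i = 0")
      case False
      then have "s 0 < s i" using i by (intro strict_mono_onD[OF s_mono]) auto
      then show ?thesis by simp
    qed simp
    then show False using i j j0 assms(2) by simp
  qed
  then have "j \<in> {1..\<eta>}" using j(1) by simp
  then show ?thesis using j(2) by (rule that)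
qed

lemma dvd_card_B: "d dvd r n \<Longrightarrow> d dvd card B"
proof -
  have "r n dvd (\<Prod>j\<in>{1..n}. r j)" using n_pos by (intro dvd_prodI) auto
  moreover have "card B = (\<Prod>j\<in>{1..n}. r j)" by (simp add: residue_box_def card_PiE)
  ultimately show "d dvd r n \<Longrightarrow> d dvd card B" by (metis dvd_trans)
qed

lemma order_weight_real:
  assumes "d dvd r n" shows "real (order_weight d) = real (card B) - real (card B) / real d"
  using dvd_card_B[OF assms] by (simp add: order_weight_def of_nat_diff real_of_nat_div)

text \<open>The second inequality, applied to \<open>s 1\<close>, and
  \<open>order_weight_less\<close> together put all weights below twice the least one.\<close>

lemma order_weight_bounds:
  assumes "d \<ge> 2" shows "0 < order_weight d" "card B \<le> 2 * order_weight d"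
proof -
  have "card B div d \<le> card B div 2" using assms by (intro div_le_mono2) auto
  moreover have "card B div 2 * 2 \<le> card B" by simp
  ultimately show "card B \<le> 2 * order_weight d" unfolding order_weight_def by linarith
  then show "0 < order_weight d" using card_B_ge_2 by linarith
qed

lemma order_weight_less: "d dvd r n \<Longrightarrow> order_weight d < card B"
proof -
  assume "d dvd r n"
  then have "d dvd card B" by (rule dvd_card_B)
  then have "d \<le> card B" "d > 0" using card_B_ge_2 dvd_imp_le[of d "card B"] dvd_pos_nat[of "card B" d] by auto
  then have "card B div d > 0" by (simp add: div_greater_zero_iff)
  then show ?thesis using card_B_ge_2 by (simp add: order_weight_def)
qed

lemma order_weight_mono: "0 < d \<Longrightarrow> d \<le> d' \<Longrightarrow> order_weight d \<le> order_weight d'"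
  unfolding order_weight_def by (intro diff_le_mono2 div_le_mono2)

lemma order_weight_inj:
  assumes "d dvd r n" "d' dvd r n" "order_weight d = order_weight d'" shows "d = d'"
proof -
  have "real (card B) / real d = real (card B) / real d'"
    using order_weight_real[OF assms(1)] order_weight_real[OF assms(2)] arg_cong[OF assms(3), of real] by linarith
  moreover have "d > 0" "d' > 0" "real (card B) > 0" using assms(1,2) r_last card_B_ge_2 by (auto intro!: Nat.gr0I)
  ultimately show ?thesis by (metis divide_cancel_left less_numeral_extra(3) of_nat_eq_iff)
qed

lemma ram_weight_order_weight: "ram_weight v = order_weight (nat (ram_index n r v))"
proof -
  have d: "nat (ram_index n r v) dvd r n"
    using ram_index_dvd_R[of v] ram_index_pos[of v] by (metis int_dvd_int_iff nat_0_le less_imp_le)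
  have "real (ram_weight v) = real (order_weight (nat (ram_index n r v)))"
    unfolding ram_weight_real order_weight_real[OF d] using ram_index_pos[of v] by simp
  then show ?thesis by (simp only: of_nat_eq_iff)
qed

lemma ram_weight_index:
  assumes v: "v \<in> B - {z0}" obtains j where "j \<in> {1..\<eta>}" "nat (ram_index n r v) = s j" "ram_weight v = order_weight (s j)"
proof -
  have d: "nat (ram_index n r v) dvd r n"
    using ram_index_dvd_R[of v] ram_index_pos[of v] by (metis int_dvd_int_iff nat_0_le less_imp_le)
  have "ram_weight v > 0" using ram_weight_pos v by blast
  then have "nat (ram_index n r v) \<noteq> 1" unfolding ram_weight_order_weight by (auto simp: order_weight_def)
  then have "nat (ram_index n r v) > 1" using ram_index_pos[of v] by linarith
  then obtain j where "j \<in> {1..\<eta>}" "nat (ram_index n r v) = s j" using s_index[OF d] by blast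
  then show ?thesis using that ram_weight_order_weight[of v] by simp
qed

text \<open>Elements of different orders have different weights, so the zeta functions with a given
  pole radius are counted by the elements of one order. This is the source of the degrees phi_G(s_j)
  - 1.\<close>

lemma card_ram_weight_eq:
  assumes j: "j \<in> {1..\<eta>}"
  shows "card {v \<in> B - {z0}. ram_weight v = order_weight (s j)} = num_of_order (abelian_grp n r) (s j)"
proof -
  have "v \<in> B - {z0} \<and> ram_weight v = order_weight (s j) \<longleftrightarrow> v \<in> B \<and> group.ord (abelian_grp n r) v = s j" for v
  proof (cases "v \<in> B")
    case True
    have o: "group.ord (abelian_grp n r) v = nat (ram_index n r v)" using ord_eq_ram_index[OF True] by simp
    have d: "nat (ram_index n r v) dvd r n"
      using ram_index_dvd_R[of v] ram_index_pos[of v] by (metis int_dvd_int_iff nat_0_le less_imp_le)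
    have "ram_weight v = order_weight (s j) \<longleftrightarrow> nat (ram_index n r v) = s j"
      unfolding ram_weight_order_weight using order_weight_inj[OF d s_facts(1)[OF j]] by auto
    moreover have "ram_weight v = order_weight (s j) \<Longrightarrow> v \<noteq> z0"
      using order_weight_bounds(1)[OF s_facts(2)[OF j]] by auto
    ultimately show ?thesis using True o by auto
  qed auto
  then show ?thesis unfolding num_of_order_def carrier_abelian_grp by (intro arg_cong[where f = card]) blast
qed

lemma inj_order_weight_s: "inj_on (\<lambda>j. order_weight (s j)) {1..\<eta>}"
proof (rule inj_onI)
  fix i j assume ij: "i \<in> {1..\<eta>}" "j \<in> {1..\<eta>}" "order_weight (s i) = order_weight (s j)"
  then have "s i = s j" using order_weight_inj s_facts(1) by blast
  then show "i = j" using inj_onD[OF strict_mono_on_imp_inj_on[OF s_mono]] ij by auto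
qed

theorem card_curves_asymptotics:
  shows "\<exists>P. (\<forall>j\<in>{1..\<eta>}. quasi_polynomial_le (num_of_order (abelian_grp n r) (s j) - 1) (P j)) \<and>
    (\<forall>\<epsilon>>0. \<exists>C. \<forall>g. \<bar>real (card (curves g)) - (\<Sum>j=1..\<eta>. P j (2 * int g) *
        real CARD('a) powr ((2 * real g + 2 * real (card B) - 2) / (real (card B) - real (card B) / real (s j))))\<bar>
      \<le> C * real CARD('a) powr ((1 + \<epsilon>) * real g / (real (card B) - real (card B) / real (s 1))))"
proof -
  define Q where "Q = real CARD('a)"
  define I where "I = (\<lambda>j. order_weight (s j)) ` {1..\<eta>}"
  define e where "e = (\<lambda>i. card {v \<in> B - {z0}. ram_weight v = i})"
  define cm where "cm = order_weight (s 1)"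
  define A where "A = (\<lambda>D. \<Sum>c\<in>units. card (good_assigns D c))"
  have Q1: "Q > 1"
  proof -
    have "card {0, 1 :: 'a} \<le> CARD('a)" by (rule card_mono) auto
    then show ?thesis by (simp add: Q_def)
  qed
  have s1: "s 1 dvd r n" by (rule s_facts(1)) (use s_1(1) in simp)
  have cm0: "cm > 0" unfolding cm_def by (rule order_weight_bounds(1)[OF s_1(2)])
  have as: "expq_upto I (\<lambda>i. Q powr (1 / real i)) (Q powr (1 / (2 * real cm))) e (\<lambda>D. of_nat (A D))"
    unfolding A_def
  proof (rule expands_card_curves)
    show "Q = real CARD('a)" by (rule Q_def)
    show "e = (\<lambda>i. card {v \<in> B - {z0}. ram_weight v = i})" by (rule e_def)
    show "finite I" by (simp add: I_def)
    show "ram_weight v \<in> I" if v: "v \<in> B - {z0}" for v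
    proof -
      obtain j where "j \<in> {1..\<eta>}" "ram_weight v = order_weight (s j)" by (rule ram_weight_index[OF v])
      then show ?thesis unfolding I_def by blast
    qed
    show "0 < i \<and> i < 2 * cm" if i: "i \<in> I" for i
    proof -
      obtain j where j: "j \<in> {1..\<eta>}" "i = order_weight (s j)" using i by (auto simp: I_def)
      have "i < card B" unfolding j(2) by (rule order_weight_less[OF s_facts(1)[OF j(1)]])
      also have "card B \<le> 2 * cm" unfolding cm_def by (rule order_weight_bounds(2)[OF s_1(2)])
      finally show ?thesis using order_weight_bounds(1)[OF s_facts(2)[OF j(1)]] j(2) by simp
    qed
    show "cm > 0" by (rule cm0)
    show "cm \<le> ram_weight v" if v: "v \<in> B - {z0}" for v
    proof -
      obtain j where j: "j \<in> {1..\<eta>}" "ram_weight v = order_weight (s j)" by (rule ram_weight_index[OF v])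
      show ?thesis unfolding j(2) cm_def using s_facts(3,4)[OF j(1)] by (intro order_weight_mono) auto
    qed
  qed
  then obtain p where p: "\<forall>i\<in>I. qpoly (e i) (p i)"
    and err: "\<forall>t>Q powr (1 / (2 * real cm)). \<exists>C. \<forall>m. norm (of_nat (A m) - (\<Sum>i\<in>I. p i (int m) * of_real (Q powr (1 / real i)) ^ m)) \<le> C * t ^ m"
    unfolding expq_upto_def by blast
  \<comment> \<open>The coefficient index is \<open>2 * g + \<kappa>\<close>, so the
    quasi-polynomials are shifted by \<open>\<kappa>\<close> to become functions of
    \<open>2 * g\<close>.\<close>
  define \<kappa> where "\<kappa> = 2 * int (card B) - 2 - int (ram_weight k)"
  \<comment> \<open>The exponents of the main terms do not contain the contribution
    \<open>ram_weight k\<close> of infinity, which \<open>ram_degree g\<close> subtracts; the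
    constant power of \<open>Q\<close> accounts for it. Division by \<open>num_scalings\<close>
    passes from tuples to curves.\<close>
  define P where "P = (\<lambda>j y. Re (of_real (Q powr (- real (ram_weight k) / real (order_weight (s j))) / real num_scalings) * p (order_weight (s j)) (y + \<kappa>)))"
  have Di: "int (ram_degree g) = 2 * int g + \<kappa>" for g using ram_degree[of g] unfolding \<kappa>_def by linarith
  have Dr: "real (ram_degree g) = 2 * real g + of_int \<kappa>" for g using arg_cong[OF Di[of g], of real_of_int] by simp
  have qP: "quasi_polynomial_le (num_of_order (abelian_grp n r) (s j) - 1) (P j)" if j: "j \<in> {1..\<eta>}" for j
  proof -
    have "qpoly (e (order_weight (s j))) (p (order_weight (s j)))" using p j by (auto simp: I_def)
    then have "qpoly (num_of_order (abelian_grp n r) (s j)) (p (order_weight (s j)))"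
      using card_ram_weight_eq[OF j] by (simp add: e_def)
    then show ?thesis unfolding P_def by (intro qpoly_imp_quasi_polynomial qpoly_cmult qpoly_shift)
  qed
  have main: "(\<Sum>j=1..\<eta>. P j (2 * int g) * Q powr ((2 * real g + 2 * real (card B) - 2) / (real (card B) - real (card B) / real (s j)))) =
      Re (\<Sum>i\<in>I. p i (int (ram_degree g)) * of_real (Q powr (1 / real i)) ^ ram_degree g) / real num_scalings" for g
  proof -
    have "(\<Sum>i\<in>I. p i (int (ram_degree g)) * of_real (Q powr (1 / real i)) ^ ram_degree g) =
        (\<Sum>j\<in>{1..\<eta>}. p (order_weight (s j)) (int (ram_degree g)) * of_real (Q powr (1 / real (order_weight (s j)))) ^ ram_degree g)"
      unfolding I_def by (rule sum.reindex_cong[OF inj_order_weight_s refl]) simp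
    moreover have "P j (2 * int g) * Q powr ((2 * real g + 2 * real (card B) - 2) / (real (card B) - real (card B) / real (s j))) =
        Re (p (order_weight (s j)) (int (ram_degree g)) * of_real (Q powr (1 / real (order_weight (s j)))) ^ ram_degree g) / real num_scalings"
      if j: "j \<in> {1..\<eta>}" for j
    proof -
      define w where "w = real (order_weight (s j))"
      have w: "real (card B) - real (card B) / real (s j) = w"
        unfolding w_def by (rule order_weight_real[OF s_facts(1)[OF j], symmetric])
      have "(Q powr (1 / w)) ^ ram_degree g = Q powr (real (ram_degree g) / w)"
        using Q1 by (simp add: powr_power)
      also have "real (ram_degree g) / w = - real (ram_weight k) / w + (2 * real g + 2 * real (card B) - 2) / w"
        unfolding Dr \<kappa>_def by (simp add: add_divide_distrib diff_divide_distrib)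
      finally have pw: "(Q powr (1 / w)) ^ ram_degree g = Q powr (- real (ram_weight k) / w) * Q powr ((2 * real g + 2 * real (card B) - 2) / w)"
        by (simp only: powr_add)
      have re: "Re (of_real a * b) = a * Re b" "Re (b * of_real a) = a * Re b" for a b by simp_all
      have a: "Re (p (order_weight (s j)) (int (ram_degree g)) * of_real (Q powr (1 / w)) ^ ram_degree g) =
          (Q powr (1 / w)) ^ ram_degree g * Re (p (order_weight (s j)) (int (ram_degree g)))"
        unfolding of_real_power[symmetric] by (rule re(2))
      have b: "P j (2 * int g) = Q powr (- real (ram_weight k) / w) / real num_scalings * Re (p (order_weight (s j)) (int (ram_degree g)))"
        unfolding P_def Di w_def by (rule re(1))
      show ?thesis unfolding w w_def[symmetric] a b pw by (simp only: mult_ac times_divide_eq_left times_divide_eq_right)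
    qed
    ultimately show ?thesis by (simp only: Re_sum sum_divide_distrib cong: sum.cong)
  qed
  have "\<exists>C. \<forall>g. \<bar>real (card (curves g)) - (\<Sum>j=1..\<eta>. P j (2 * int g) *
        Q powr ((2 * real g + 2 * real (card B) - 2) / (real (card B) - real (card B) / real (s j))))\<bar>
      \<le> C * Q powr ((1 + \<epsilon>) * real g / (real (card B) - real (card B) / real (s 1)))" if \<epsilon>: "\<epsilon> > 0" for \<epsilon>
  proof -
    \<comment> \<open>Any exponent above \<open>1 / (2 * cm)\<close> is allowed by
      \<open>err\<close>; this one turns \<open>Q powr (u * ram_degree g)\<close> into a constant
      times \<open>Q powr ((1 + \<epsilon>) * g / cm)\<close>.\<close>
    define u where "u = (1 + \<epsilon>) / (2 * real cm)"
    have "1 / (2 * real cm) < u" unfolding u_def using \<epsilon> cm0 by (intro divide_strict_right_mono) auto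
    then have "Q powr (1 / (2 * real cm)) < Q powr u" using Q1 by (intro powr_less_mono) auto
    then obtain C where C: "\<And>m. norm (of_nat (A m) - (\<Sum>i\<in>I. p i (int m) * of_real (Q powr (1 / real i)) ^ m)) \<le> C * (Q powr u) ^ m"
      using err by blast
    show ?thesis
    proof (intro exI[of _ "C * Q powr (u * of_int \<kappa>) / real num_scalings"] allI)
      fix g
      let ?S = "\<Sum>i\<in>I. p i (int (ram_degree g)) * of_real (Q powr (1 / real i)) ^ ram_degree g"
      have N: "real num_scalings > 0" using num_scalings_pos by simp
      have "real (card (curves g)) * real num_scalings = real (A (ram_degree g))"
        unfolding A_def card_curves[symmetric] by simp
      then have "real (card (curves g)) = real (A (ram_degree g)) / real num_scalings" using N by (simp add: field_simps)
      then have eq: "real (card (curves g)) - Re ?S / real num_scalings = Re (of_nat (A (ram_degree g)) - ?S) / real num_scalings"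
        by (simp only: minus_complex.sel complex_Re_of_nat diff_divide_distrib)
      have "\<bar>real (card (curves g)) - Re ?S / real num_scalings\<bar> = \<bar>Re (of_nat (A (ram_degree g)) - ?S)\<bar> / real num_scalings"
        unfolding eq abs_divide using N by simp
      also have "\<dots> \<le> norm (of_nat (A (ram_degree g)) - ?S) / real num_scalings"
        using N by (intro divide_right_mono abs_Re_le_cmod) auto
      also have "\<dots> \<le> C * (Q powr u) ^ ram_degree g / real num_scalings"
        using N C[of "ram_degree g"] by (intro divide_right_mono) auto
      also have "(Q powr u) ^ ram_degree g = Q powr (u * real (ram_degree g))"
        using Q1 by (simp add: powr_power mult.commute)
      also have "u * real (ram_degree g) = u * of_int \<kappa> + (1 + \<epsilon>) * real g / real cm"
        using cm0 unfolding Dr u_def by (simp add: field_simps)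
      also have "Q powr \<dots> = Q powr (u * of_int \<kappa>) * Q powr ((1 + \<epsilon>) * real g / real cm)" by (rule powr_add)
      finally show "\<bar>real (card (curves g)) - (\<Sum>j=1..\<eta>. P j (2 * int g) *
          Q powr ((2 * real g + 2 * real (card B) - 2) / (real (card B) - real (card B) / real (s j))))\<bar>
        \<le> C * Q powr (u * of_int \<kappa>) / real num_scalings * Q powr ((1 + \<epsilon>) * real g / (real (card B) - real (card B) / real (s 1)))"
        unfolding main cm_def order_weight_real[OF s1] by (simp add: mult_ac)
    qed
  qed
  then show ?thesis using qP unfolding Q_def by blast
qed

end

end

theorem theorem1p6:
  fixes n :: nat and r :: "nat \<Rightarrow> nat"
    and \<eta> :: nat and s :: "nat \<Rightarrow> nat"
    and \<zeta> :: "'a :: {field,finite}"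
    and \<chi> :: "nat \<Rightarrow> 'a \<Rightarrow> complex"
    and x :: "nat \<Rightarrow> 'a"
    and k :: "nat \<Rightarrow> int" and l :: nat and E :: "nat \<Rightarrow> nat \<Rightarrow> complex"
  defines "G \<equiv> abelian_grp n r"
    and "q \<equiv> CARD('a)"
  assumes "n \<ge> 1"
    and "\<forall>j\<in>{1..n}. r j > 0"
    and "\<forall>j\<in>{1..<n}. r j dvd r (Suc j)"
    and "r n > 1"
    and "[q = 1] (mod r n)"
    and "strict_mono_on {0..\<eta>} s"
    and "s ` {0..\<eta>} = {d. d dvd r n}"
    and "primitive_root_of_unity (r n) \<zeta>"
    and "\<forall>j\<in>{1..n}. mult_character_of_order (r j) (\<chi> (r j))"
    and "bij_betw x {1..q} UNIV"
    and "l \<le> q"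
    and "\<forall>i\<in>{1..l}. \<forall>j\<in>{1..n}. E i j ^ r j = 1"
  shows "(\<forall>g. finite (curves_GgkE n r \<zeta> \<chi> x k l E g)) \<and>
    (\<exists>P :: nat \<Rightarrow> int \<Rightarrow> real.
       (\<forall>j\<in>{1..\<eta>}. quasi_polynomial_le (num_of_order G (s j) - 1) (P j)) \<and>
       (\<forall>\<epsilon>>0.
          (\<lambda>g. real (card (curves_GgkE n r \<zeta> \<chi> x k l E g)) -
               (\<Sum>j=1..\<eta>. P j (2 * int g) *
                  real q powr ((2 * real g + 2 * real (Coset.order G) - 2) /
                               (real (Coset.order G) - real (Coset.order G) / real (s j)))))
          \<in> O[inf at_top (principal {g. admissible_genus n r k g})](\<lambda>g.
               real q powr ((1 + \<epsilon>) * real g / (real (Coset.order G) - real (Coset.order G) / real (s 1)))))) \<and>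
    (\<forall>g. \<not> admissible_genus n r k g \<longrightarrow> card (curves_GgkE n r \<zeta> \<chi> x k l E g) = 0)"
proof -
  interpret cd: counting_data n r \<zeta> \<chi> x k l E
    by unfold_locales (use assms in \<open>auto simp: q_def\<close>)
  let ?N = "real (Coset.order G)"
  let ?err = "\<lambda>P g. real (card (curves_GgkE n r \<zeta> \<chi> x k l E g)) -
    (\<Sum>j=1..\<eta>. P j (2 * int g) * real q powr ((2 * real g + 2 * ?N - 2) / (?N - ?N / real (s j))))"
  let ?bd = "\<lambda>\<epsilon> g. real q powr ((1 + \<epsilon>) * real g / (?N - ?N / real (s 1)))"
  have ord: "Coset.order G = card (residue_box n r)" unfolding G_def by (rule cd.order_grp)
  obtain P where P: "\<forall>j\<in>{1..\<eta>}. quasi_polynomial_le (num_of_order G (s j) - 1) (P j)"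
    and C: "\<forall>\<epsilon>>0. \<exists>C. \<forall>g. \<bar>?err P g\<bar> \<le> C * ?bd \<epsilon> g"
    using cd.card_curves_asymptotics[OF \<open>strict_mono_on {0..\<eta>} s\<close> \<open>s ` {0..\<eta>} = {d. d dvd r n}\<close>]
    unfolding ord unfolding G_def q_def by blast
  have "?err P \<in> O[inf at_top (principal {g. admissible_genus n r k g})](?bd \<epsilon>)" if \<epsilon>: "\<epsilon> > 0" for \<epsilon>
  proof -
    obtain C' where "\<And>g. \<bar>?err P g\<bar> \<le> C' * ?bd \<epsilon> g" using C \<epsilon> by blast
    then show ?thesis by (intro bigoI[of _ C'] always_eventually) simp
  qed
  moreover have "card (curves_GgkE n r \<zeta> \<chi> x k l E g) = 0" if "\<not> admissible_genus n r k g" for g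
    using cd.curves_imp_admissible[of g] that by (metis card.empty)
  ultimately show ?thesis using cd.finite_curves P by blast
qed

end
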